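(* Let $(\Sigma,\omega)$ be either the plane $\mathbb{R}^2$ with its standard area form or a closed connected symplectic surface other than the sphere, and let $c:C^\infty([0,1]\times\Sigma)\to\mathbb{R}$ be a formal spectral invariant. Then $c(H)=c(H\circ\psi)$ for all $H\in C^\infty([0,1]\times\Sigma)$ and all $\psi\in\mathrm{Symp}_0$, where $\mathrm{Symp}_0$ is the path component of the identity in $\mathrm{Symp}(\Sigma,\omega)$ and $(H\circ\psi)(t,x)=H(t,\psi(x))$.
   Context: Conventions: $C^{\infty}([0,1]\times\Sigma)$ is the set of smooth compactly supported time-dependent Hamiltonians. The Hamiltonian vector field is defined by $\omega(X_H^t,\cdot)=-dH_t$, with flow $\phi_H^t$. A fixed point $x$ of $\phi_H^1$ is contractible if the loop $t\mapsto\phi_H^t(x)$ is contractible in $\Sigma$; its action is $\mathcal{A}_H(x)=\int_0^1H(t,\phi_H^t(x))\,dt-\int_{\mathbb{D}^2}u^*\omega$ for a capping disk $u$ of this loop. $\mathrm{spec}(H)$ is the set of actions of contractible fixed points. A function $c:C^\infty([0,1]\times\Sigma)\to\mathbb{R}$ is a formal spectral invariant if: (1) (Spectrality) $c(H)\in\mathrm{spec}(H)$ for all $H$; (2) (Non-triviality) there exist a topological disk $D\subset\Sigma$ and $H$ supported in $D$ with $c(H)\ne0$; (3) (Continuity) $c$ is continuous with respect to the $C^\infty$ topology; (4) (Max formula) $c(H_1+\dots+H_N)=\max\{c(H_1),\dots,c(H_N)\}$ whenever the $H_i$ are supported in pairwise disjoint disks. *)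

theory Defs
  imports "HOL-Analysis.Analysis"
begin

section \<open>Smooth functions between Euclidean spaces\<close>

text \<open>Iterated directional derivatives. Derivatives are taken within \<open>S\<close>, so that on sets such as
  \<open>{0..1} \<times> U\<close> with \<open>U\<close> open the time derivative is one-sided at the end points.\<close>

primrec iter_deriv ::
    "'e::real_normed_vector set \<Rightarrow> 'e list \<Rightarrow> ('e \<Rightarrow> 'f::real_normed_vector) \<Rightarrow> 'e \<Rightarrow> 'f" where
  "iter_deriv S [] f = f"
| "iter_deriv S (v # vs) f = (\<lambda>x. frechet_derivative (iter_deriv S vs f) (at x within S) v)"

text \<open>Smoothness on an arbitrary set means local extendability to a smooth function on an open
  set; for open \<open>S\<close> this is ordinary smoothness.\<close>

definition smooth_on :: "'e::euclidean_space set \<Rightarrow> ('e \<Rightarrow> 'f::real_normed_vector) \<Rightarrow> bool" where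
  "smooth_on S f \<longleftrightarrow> (\<forall>x\<in>S. \<exists>U g. open U \<and> x \<in> U \<and>
     (\<forall>vs. iter_deriv UNIV vs g differentiable_on U) \<and> (\<forall>y\<in>U \<inter> S. g y = f y))"


section \<open>Surfaces with an area form\<close>

text \<open>A chart is a pair of an open domain and a coordinate map. The surface is the whole type \<open>'a\<close>;
  in a chart \<open>c\<close> with coordinates \<open>(x\<^sub>1, x\<^sub>2)\<close> the 2-form \<open>\<omega>\<close> is \<open>density \<Sigma> c\<close> times
  \<open>dx\<^sub>1 \<and> dx\<^sub>2\<close>.\<close>

type_synonym 'a chart = "'a set \<times> ('a \<Rightarrow> real^2)"

record 'a surface =
  atlas :: "'a chart set"
  density :: "'a chart \<Rightarrow> 'a \<Rightarrow> real"

definition coord_inv :: "'a chart \<Rightarrow> real^2 \<Rightarrow> 'a" where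
  "coord_inv c = inv_into (fst c) (snd c)"

definition is_chart :: "'a::topological_space chart \<Rightarrow> bool" where
  "is_chart c \<longleftrightarrow> open (fst c) \<and> open (snd c ` fst c) \<and>
     homeomorphism (fst c) (snd c ` fst c) (snd c) (coord_inv c)"

text \<open>Tangent vectors at \<open>p\<close> are represented by their coordinates in the chart \<open>c\<close>.\<close>

definition area_form :: "'a surface \<Rightarrow> 'a chart \<Rightarrow> 'a \<Rightarrow> real^2 \<Rightarrow> real^2 \<Rightarrow> real" where
  "area_form \<Sigma> c p v w = density \<Sigma> c p * (v$1 * w$2 - v$2 * w$1)"

definition local_rep :: "'a chart \<Rightarrow> 'a chart \<Rightarrow> ('a \<Rightarrow> 'a) \<Rightarrow> real^2 \<Rightarrow> real^2" where
  "local_rep c d f = snd d \<circ> f \<circ> coord_inv c"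

definition smooth_self_map :: "'a::topological_space surface \<Rightarrow> ('a \<Rightarrow> 'a) \<Rightarrow> bool" where
  "smooth_self_map \<Sigma> f \<longleftrightarrow> continuous_on UNIV f \<and>
     (\<forall>c\<in>atlas \<Sigma>. \<forall>d\<in>atlas \<Sigma>. smooth_on (snd c ` (fst c \<inter> f -` fst d)) (local_rep c d f))"

definition preserves_area_form :: "'a surface \<Rightarrow> ('a \<Rightarrow> 'a) \<Rightarrow> bool" where
  "preserves_area_form \<Sigma> f \<longleftrightarrow>
     (\<forall>c\<in>atlas \<Sigma>. \<forall>d\<in>atlas \<Sigma>. \<forall>p\<in>fst c \<inter> f -` fst d. \<forall>v w.
        area_form \<Sigma> c p v w =
        area_form \<Sigma> d (f p) (frechet_derivative (local_rep c d f) (at (snd c p)) v)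
                            (frechet_derivative (local_rep c d f) (at (snd c p)) w))"

text \<open>For \<open>f = id\<close> the local representatives are the transition maps: the last two conjuncts say
  that the charts are smoothly compatible and that the local expressions define one global form.
  Closedness of \<open>\<omega>\<close> is automatic in dimension 2.\<close>

definition symplectic_surface :: "'a::topological_space surface \<Rightarrow> bool" where
  "symplectic_surface \<Sigma> \<longleftrightarrow>
     (\<forall>c\<in>atlas \<Sigma>. is_chart c) \<and> (\<Union>c\<in>atlas \<Sigma>. fst c) = UNIV \<and>
     (\<forall>c\<in>atlas \<Sigma>. smooth_on (snd c ` fst c) (density \<Sigma> c \<circ> coord_inv c) \<and>
                   (\<forall>p\<in>fst c. density \<Sigma> c p \<noteq> 0)) \<and>
     smooth_self_map \<Sigma> id \<and> preserves_area_form \<Sigma> id"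

definition plane :: "(real^2) surface" where
  "plane = \<lparr>atlas = {(UNIV, id)}, density = (\<lambda>c p. 1)\<rparr>"

definition closed_disk :: "'a::topological_space set \<Rightarrow> bool" where
  "closed_disk D \<longleftrightarrow> D homeomorphic cball (0::real^2) 1"


section \<open>Hamiltonians, flows and the action spectrum\<close>

definition ham_rep :: "'a chart \<Rightarrow> (real \<Rightarrow> 'a \<Rightarrow> real) \<Rightarrow> real \<times> (real^2) \<Rightarrow> real" where
  "ham_rep c H = (\<lambda>(t, y). H t (coord_inv c y))"

definition ham_support :: "(real \<Rightarrow> 'a::topological_space \<Rightarrow> real) \<Rightarrow> 'a set" where
  "ham_support H = closure {x. \<exists>t\<in>{0..1}. H t x \<noteq> 0}"

text \<open>The set of smooth compactly supported functions on \<open>[0,1] \<times> \<Sigma>\<close>. Such a function is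
  represented by its extension by \<open>0\<close> to times outside \<open>[0,1]\<close>, so that each has exactly one
  representative.\<close>

definition hamiltonians :: "'a::topological_space surface \<Rightarrow> (real \<Rightarrow> 'a \<Rightarrow> real) set" where
  "hamiltonians \<Sigma> = {H. (\<forall>t. t \<notin> {0..1} \<longrightarrow> (\<forall>x. H t x = 0)) \<and> compact (ham_support H) \<and>
     (\<forall>c\<in>atlas \<Sigma>. smooth_on ({0..1} \<times> snd c ` fst c) (ham_rep c H))}"

text \<open>The Hamiltonian vector field at \<open>p\<close> in the chart \<open>c\<close>.\<close>

definition ham_vf ::
    "'a surface \<Rightarrow> (real \<Rightarrow> 'a \<Rightarrow> real) \<Rightarrow> real \<Rightarrow> 'a chart \<Rightarrow> 'a \<Rightarrow> real^2" where
  "ham_vf \<Sigma> H t c p = (THE X. \<forall>v.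
     area_form \<Sigma> c p X v = - frechet_derivative (H t \<circ> coord_inv c) (at (snd c p)) v)"

definition ham_trajectory ::
    "'a::topological_space surface \<Rightarrow> (real \<Rightarrow> 'a \<Rightarrow> real) \<Rightarrow> (real \<Rightarrow> 'a) \<Rightarrow> bool" where
  "ham_trajectory \<Sigma> H \<gamma> \<longleftrightarrow> continuous_on {0..1} \<gamma> \<and>
     (\<forall>t\<in>{0..1}. \<forall>c\<in>atlas \<Sigma>. \<gamma> t \<in> fst c \<longrightarrow>
        (snd c \<circ> \<gamma> has_vector_derivative ham_vf \<Sigma> H t c (\<gamma> t)) (at t within {0..1}))"

definition ham_flow ::
    "'a::topological_space surface \<Rightarrow> (real \<Rightarrow> 'a \<Rightarrow> real) \<Rightarrow> real \<Rightarrow> 'a \<Rightarrow> 'a" where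
  "ham_flow \<Sigma> H t x = (THE y. \<exists>\<gamma>. ham_trajectory \<Sigma> H \<gamma> \<and> \<gamma> 0 = x \<and> \<gamma> t = y)"

definition contractible_fixed_point ::
    "'a::topological_space surface \<Rightarrow> (real \<Rightarrow> 'a \<Rightarrow> real) \<Rightarrow> 'a \<Rightarrow> bool" where
  "contractible_fixed_point \<Sigma> H x \<longleftrightarrow> ham_flow \<Sigma> H 1 x = x \<and>
     (\<exists>a. homotopic_loops UNIV (\<lambda>t. ham_flow \<Sigma> H t x) (\<lambda>t. a))"

text \<open>Since \<open>H\<close> need not be periodic in time, the loop may have a corner at its base point and is
  then not the boundary of any disk that is smooth up to the boundary. Smoothness of a capping disk
  \<open>u\<close> is therefore required in polar coordinates, that is, for the map
  \<open>(s, t) \<mapsto> u (s e\<^bsup>2\<pi>it\<^esup>)\<close> on the closed square.\<close>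

definition polar :: "(complex \<Rightarrow> 'a) \<Rightarrow> real \<times> real \<Rightarrow> 'a" where
  "polar u = (\<lambda>(s, t). u (of_real s * cis (2 * pi * t)))"

definition capping_disk ::
    "'a::topological_space surface \<Rightarrow> (real \<Rightarrow> 'a \<Rightarrow> real) \<Rightarrow> 'a \<Rightarrow> (complex \<Rightarrow> 'a) \<Rightarrow> bool" where
  "capping_disk \<Sigma> H x u \<longleftrightarrow> continuous_on (cball 0 1) u \<and>
     (\<forall>c\<in>atlas \<Sigma>. smooth_on (({0..1} \<times> {0..1}) \<inter> polar u -` fst c) (snd c \<circ> polar u)) \<and>
     (\<forall>t\<in>{0..1}. u (cis (2 * pi * t)) = ham_flow \<Sigma> H t x)"

text \<open>\<open>\<omega>(\<partial>\<^sub>s, \<partial>\<^sub>t)\<close> along the polar parametrisation, evaluated in any chart around the image point.\<close>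

definition pullback_density :: "'a surface \<Rightarrow> (complex \<Rightarrow> 'a) \<Rightarrow> real \<times> real \<Rightarrow> real" where
  "pullback_density \<Sigma> u = (\<lambda>(s, t).
     let c = (SOME c. c \<in> atlas \<Sigma> \<and> polar u (s, t) \<in> fst c) in
     area_form \<Sigma> c (polar u (s, t))
       (vector_derivative (\<lambda>r. snd c (polar u (r, t))) (at s within {0..1}))
       (vector_derivative (\<lambda>r. snd c (polar u (s, r))) (at t within {0..1})))"

definition action ::
    "'a::topological_space surface \<Rightarrow> (real \<Rightarrow> 'a \<Rightarrow> real) \<Rightarrow> 'a \<Rightarrow> (complex \<Rightarrow> 'a) \<Rightarrow> real" where
  "action \<Sigma> H x u = integral {0..1} (\<lambda>t. H t (ham_flow \<Sigma> H t x)) -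
     integral ({0..1} \<times> {0..1}) (pullback_density \<Sigma> u)"

definition action_spectrum :: "'a::topological_space surface \<Rightarrow> (real \<Rightarrow> 'a \<Rightarrow> real) \<Rightarrow> real set" where
  "action_spectrum \<Sigma> H = {action \<Sigma> H x u | x u. contractible_fixed_point \<Sigma> H x \<and> capping_disk \<Sigma> H x u}"


section \<open>The smooth topologies\<close>

text \<open>Uniform convergence of all derivatives on compact subsets of charts.\<close>

definition ham_nbhd ::
    "'a::topological_space surface \<Rightarrow> (real \<Rightarrow> 'a \<Rightarrow> real) \<Rightarrow> 'a chart \<Rightarrow> 'a set \<Rightarrow>
     (real \<times> (real^2)) list \<Rightarrow> real \<Rightarrow> (real \<Rightarrow> 'a \<Rightarrow> real) set" where
  "ham_nbhd \<Sigma> H c L vs \<epsilon> = {G \<in> hamiltonians \<Sigma>. \<forall>t\<in>{0..1}. \<forall>p\<in>L.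
     \<bar>iter_deriv ({0..1} \<times> snd c ` fst c) vs (ham_rep c G) (t, snd c p) -
      iter_deriv ({0..1} \<times> snd c ` fst c) vs (ham_rep c H) (t, snd c p)\<bar> < \<epsilon>}"

definition ham_loc_topology ::
    "'a::topological_space surface \<Rightarrow> (real \<Rightarrow> 'a \<Rightarrow> real) topology" where
  "ham_loc_topology \<Sigma> = topology_generated_by
     {ham_nbhd \<Sigma> H c L vs \<epsilon> | H c L vs \<epsilon>.
        H \<in> hamiltonians \<Sigma> \<and> c \<in> atlas \<Sigma> \<and> compact L \<and> L \<subseteq> fst c \<and> \<epsilon> > 0}"

definition hamiltonians_in ::
    "'a::topological_space surface \<Rightarrow> 'a set \<Rightarrow> (real \<Rightarrow> 'a \<Rightarrow> real) set" where
  "hamiltonians_in \<Sigma> K = {H \<in> hamiltonians \<Sigma>. ham_support H \<subseteq> K}"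

text \<open>The \<open>C\<^sup>\<infinity>\<close> topology on compactly supported Hamiltonians: the finest topology inducing
  (at most) the topology of uniform convergence of all derivatives on the functions supported in
  \<open>K\<close>, for every compact \<open>K\<close>. Continuity thus means continuity on each of these subspaces. On a
  compact surface this is just \<open>ham_loc_topology\<close>.\<close>

definition ham_topology ::
    "'a::topological_space surface \<Rightarrow> (real \<Rightarrow> 'a \<Rightarrow> real) topology" where
  "ham_topology \<Sigma> = topology (\<lambda>V. V \<subseteq> hamiltonians \<Sigma> \<and>
     (\<forall>K. compact K \<longrightarrow> openin (subtopology (ham_loc_topology \<Sigma>) (hamiltonians_in \<Sigma> K))
                                (V \<inter> hamiltonians_in \<Sigma> K)))"

lemma openin_ham_topology:
  "openin (ham_topology \<Sigma>) V \<longleftrightarrow> V \<subseteq> hamiltonians \<Sigma> \<and>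
     (\<forall>K. compact K \<longrightarrow> openin (subtopology (ham_loc_topology \<Sigma>) (hamiltonians_in \<Sigma> K))
                                (V \<inter> hamiltonians_in \<Sigma> K))"
proof -
  have "istopology (\<lambda>V. V \<subseteq> hamiltonians \<Sigma> \<and>
     (\<forall>K. compact K \<longrightarrow> openin (subtopology (ham_loc_topology \<Sigma>) (hamiltonians_in \<Sigma> K))
                                (V \<inter> hamiltonians_in \<Sigma> K)))" (is "istopology ?P")
    unfolding istopology_def
  proof (intro conjI allI impI)
    fix S T assume S: "?P S" and T: "?P T"
    show "S \<inter> T \<subseteq> hamiltonians \<Sigma>" using S by blast
    fix K :: "'a set" assume "compact K"
    then have "openin (subtopology (ham_loc_topology \<Sigma>) (hamiltonians_in \<Sigma> K))
        ((S \<inter> hamiltonians_in \<Sigma> K) \<inter> (T \<inter> hamiltonians_in \<Sigma> K))"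
      using S T by (blast intro: openin_Int)
    moreover have "(S \<inter> hamiltonians_in \<Sigma> K) \<inter> (T \<inter> hamiltonians_in \<Sigma> K)
        = S \<inter> T \<inter> hamiltonians_in \<Sigma> K" by blast
    ultimately show "openin (subtopology (ham_loc_topology \<Sigma>) (hamiltonians_in \<Sigma> K))
        (S \<inter> T \<inter> hamiltonians_in \<Sigma> K)" by simp
  next
    fix \<K> assume *: "\<forall>V\<in>\<K>. ?P V"
    show "\<Union>\<K> \<subseteq> hamiltonians \<Sigma>" using * by blast
    fix K :: "'a set" assume "compact K"
    then have "openin (subtopology (ham_loc_topology \<Sigma>) (hamiltonians_in \<Sigma> K))
        (\<Union>((\<lambda>V. V \<inter> hamiltonians_in \<Sigma> K) ` \<K>))"
      using * by (intro openin_Union) auto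
    moreover have "\<Union>((\<lambda>V. V \<inter> hamiltonians_in \<Sigma> K) ` \<K>) = \<Union>\<K> \<inter> hamiltonians_in \<Sigma> K"
      by blast
    ultimately show "openin (subtopology (ham_loc_topology \<Sigma>) (hamiltonians_in \<Sigma> K))
        (\<Union>\<K> \<inter> hamiltonians_in \<Sigma> K)" by simp
  qed
  then show ?thesis
    unfolding ham_topology_def by (simp add: topology_inverse')
qed

definition symp :: "'a::topological_space surface \<Rightarrow> ('a \<Rightarrow> 'a) set" where
  "symp \<Sigma> = {\<psi>. bij \<psi> \<and> smooth_self_map \<Sigma> \<psi> \<and> smooth_self_map \<Sigma> (inv \<psi>) \<and>
     preserves_area_form \<Sigma> \<psi>}"

definition symp_nbhd ::
    "'a::topological_space surface \<Rightarrow> ('a \<Rightarrow> 'a) \<Rightarrow> 'a chart \<Rightarrow> 'a chart \<Rightarrow> 'a set \<Rightarrow>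
     (real^2) list \<Rightarrow> real \<Rightarrow> ('a \<Rightarrow> 'a) set" where
  "symp_nbhd \<Sigma> \<psi> c d L vs \<epsilon> = {\<phi> \<in> symp \<Sigma>. \<phi> ` L \<subseteq> fst d \<and> (\<forall>p\<in>L.
     norm (iter_deriv UNIV vs (local_rep c d \<phi>) (snd c p) -
           iter_deriv UNIV vs (local_rep c d \<psi>) (snd c p)) < \<epsilon>)}"

text \<open>The (weak, or compact-open) \<open>C\<^sup>\<infinity>\<close> topology on symplectomorphisms.\<close>

definition symp_topology :: "'a::topological_space surface \<Rightarrow> ('a \<Rightarrow> 'a) topology" where
  "symp_topology \<Sigma> = topology_generated_by
     {symp_nbhd \<Sigma> \<psi> c d L vs \<epsilon> | \<psi> c d L vs \<epsilon>.
        \<psi> \<in> symp \<Sigma> \<and> c \<in> atlas \<Sigma> \<and> d \<in> atlas \<Sigma> \<and>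
        compact L \<and> L \<subseteq> fst c \<and> \<psi> ` L \<subseteq> fst d \<and> \<epsilon> > 0}"

definition symp0 :: "'a::topological_space surface \<Rightarrow> ('a \<Rightarrow> 'a) set" where
  "symp0 \<Sigma> = {\<psi>. path_component_of (symp_topology \<Sigma>) id \<psi>}"


section \<open>Formal spectral invariants\<close>

definition formal_spectral_invariant ::
    "'a::topological_space surface \<Rightarrow> ((real \<Rightarrow> 'a \<Rightarrow> real) \<Rightarrow> real) \<Rightarrow> bool" where
  "formal_spectral_invariant \<Sigma> c \<longleftrightarrow>
     (\<forall>H\<in>hamiltonians \<Sigma>. c H \<in> action_spectrum \<Sigma> H) \<and>
     (\<exists>D. closed_disk D \<and> (\<exists>H\<in>hamiltonians \<Sigma>. ham_support H \<subseteq> D \<and> c H \<noteq> 0)) \<and>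
     continuous_map (ham_topology \<Sigma>) euclideanreal c \<and>
     (\<forall>(N::nat) H D. N \<ge> 1 \<and>
        (\<forall>i<N. closed_disk (D i) \<and> H i \<in> hamiltonians \<Sigma> \<and> ham_support (H i) \<subseteq> D i) \<and>
        disjoint_family_on D {..<N} \<longrightarrow>
        c (\<lambda>t x. \<Sum>i<N. H i t x) = Max ((\<lambda>i. c (H i)) ` {..<N}))"

end

theory Submission
  imports Defs
begin

text \<open>Along a path \<open>\<psi>\<^sub>s\<close> from the identity to \<open>\<psi>\<close> the number \<open>c (H \<circ> \<psi>\<^sub>s)\<close> depends continuously on \<open>s\<close>. The flow
  of \<open>H \<circ> \<psi>\<^sub>s\<close> is conjugate to that of \<open>H\<close>, so \<open>c (H \<circ> \<psi>\<^sub>s)\<close> always lies in the spectrum of \<open>H\<close>. The spectrum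
  is a null set, so \<open>c (H \<circ> \<psi>\<^sub>s)\<close> is constant.

  That the spectrum is null does not need the flow to be differentiable. Cover the surface by countably many
  chart disks. There are countably many combinatorial patterns in which a grid on a capping disk can be
  subordinate to this cover. For two capped fixed points \<open>x\<close>, \<open>x'\<close> with the same pattern, Green's theorem
  turns the difference of the two areas into a sum of integrals over thin strips along the boundary, and the
  difference of the actions is at most \<open>C |x - x'|\<^sup>3\<close>. A function on a planar set with this property has
  a null image.\<close>

text \<open>The exponent 3 is tuned to the dimension. Fixed points lie on a surface, so about N^2
  coordinate squares of side 1/N are needed; an oscillation of order N^(-3) on each leaves total
  length of order 1/N, whereas a quadratic estimate would only keep the total bounded. The third
  power arises by interpolating linearly, in a chart, between two trajectories. The derivative of
  \<open>H\<close> along the connecting segment is the area form applied to the segment and the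
  vector field, while the swept area uses the interpolated velocity. These differ by the linear
  interpolation error of a smooth field, quadratic in the distance, and the segment supplies one
  more factor.

  Caps are the obstacle: close fixed points may carry unrelated caps. A common pattern replaces a
  homotopy between the caps.

  On the plane, continuity of \<open>c\<close> is available only among Hamiltonians supported in a
  common compact set, so the supports along the path have to be controlled locally in
  \<open>s\<close>.\<close>

section \<open>Smooth functions and smooth families\<close>

text \<open>\<open>C\<^sup>k\<close> in the second variable, with derivatives that are jointly continuous in both.\<close>

primrec family_C :: "nat \<Rightarrow> ('p::topological_space \<times> 'e::euclidean_space) set \<Rightarrow>
    ('p \<Rightarrow> 'e \<Rightarrow> 'f::real_normed_vector) \<Rightarrow> bool" where
  "family_C 0 A F = continuous_on A (\<lambda>(s,z). F s z)"
| "family_C (Suc k) A F = (continuous_on A (\<lambda>(s,z). F s z) \<and> (\<forall>(s,z)\<in>A. F s differentiable (at z)) \<and>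
     (\<forall>v. family_C k A (\<lambda>s z. frechet_derivative (F s) (at z) v)))"

text \<open>Openness is asked only in the space variable, so that the parameter may run over a set
  such as a closed interval while derivatives in space remain two-sided.\<close>

definition slices_open :: "('p \<times> 'e::topological_space) set \<Rightarrow> bool" where
  "slices_open A \<longleftrightarrow> (\<forall>s. open {z. (s, z) \<in> A})"

lemma slices_open_Times [simp]: "open U \<Longrightarrow> slices_open (P \<times> U)"
proof -
  assume "open U"
  moreover have "{z. (s, z) \<in> P \<times> U} = (if s \<in> P then U else {})" for s by auto
  ultimately show ?thesis unfolding slices_open_def by simp
qed

lemma frechet_derivative_cong_open:
  assumes "open U" "z \<in> U" "\<And>y. y \<in> U \<Longrightarrow> f y = g y"
  shows "frechet_derivative f (at z) = frechet_derivative g (at z)"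
proof -
  have "(f has_derivative D) (at z) \<longleftrightarrow> (g has_derivative D) (at z)" for D
    using has_derivative_transform_within_open[of f D z UNIV U g] has_derivative_transform_within_open[of g D z UNIV U f] assms
    by auto
  then show ?thesis unfolding frechet_derivative_def by simp
qed

lemma family_C_imp_continuous: "family_C k A F \<Longrightarrow> continuous_on A (\<lambda>(s,z). F s z)"
  by (cases k) auto

lemma family_C_SucD: "family_C (Suc k) A F \<Longrightarrow> family_C k A F"
proof (induction k arbitrary: F)
  case 0 then show ?case by simp
next
  case (Suc k)
  have "family_C k A (\<lambda>s z. frechet_derivative (F s) (at z) v)" for v
    using Suc.prems by (intro Suc.IH) auto
  then show ?case using Suc.prems by auto
qed

lemma family_C_cong:
  assumes "slices_open A" "\<And>s z. (s,z) \<in> A \<Longrightarrow> F s z = G s z" "family_C k A F"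
  shows "family_C k A G"
  using assms(2,3)
proof (induction k arbitrary: F G)
  case 0
  then have "continuous_on A (\<lambda>(s,z). F s z) = continuous_on A (\<lambda>(s,z). G s z)"
    by (intro continuous_on_cong) auto
  with 0 show ?case by simp
next
  case (Suc k)
  have eq: "frechet_derivative (F s) (at z) = frechet_derivative (G s) (at z)"
    if "(s,z) \<in> A" for s z
    using assms(1) that Suc.prems(1)
    by (intro frechet_derivative_cong_open[of "{z. (s,z)\<in>A}"]) (auto simp: slices_open_def)
  have "G s differentiable at z" if "(s,z) \<in> A" for s z
  proof -
    have "(F s has_derivative frechet_derivative (F s) (at z)) (at z)"
      using Suc.prems(2) that by (auto simp: frechet_derivative_works[symmetric])
    then have "(G s has_derivative frechet_derivative (F s) (at z)) (at z)"
      by (rule has_derivative_transform_within_open[of _ _ _ _ "{z. (s,z)\<in>A}"])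
         (use assms(1) that Suc.prems(1) in \<open>auto simp: slices_open_def\<close>)
    then show ?thesis by (auto simp: differentiable_def)
  qed
  moreover have "family_C k A (\<lambda>s z. frechet_derivative (G s) (at z) v)" for v
  proof (rule Suc.IH[of "\<lambda>s z. frechet_derivative (F s) (at z) v"])
    show "family_C k A (\<lambda>s z. frechet_derivative (F s) (at z) v)" using Suc.prems(2) by simp
  qed (simp add: eq)
  moreover have "continuous_on A (\<lambda>(s,z). G s z)"
  proof -
    have "continuous_on A (\<lambda>(s,z). F s z) = continuous_on A (\<lambda>(s,z). G s z)"
      using Suc.prems(1) by (intro continuous_on_cong) auto
    with Suc.prems(2) show ?thesis by simp
  qed
  ultimately show ?case by auto
qed

lemma family_C_differentiable:
  "family_C (Suc k) A F \<Longrightarrow> (s,z) \<in> A \<Longrightarrow> (F s has_derivative frechet_derivative (F s) (at z)) (at z)"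
  by (force simp: frechet_derivative_works[symmetric])

text \<open>Introduction rule with an explicit derivative \<open>D\<close>, so that the later
  closure proofs can use the product, chain and quotient rules instead of
  \<open>frechet_derivative\<close>.\<close>

lemma family_C_SucI:
  assumes "slices_open A" "continuous_on A (\<lambda>(s,z). F s z)"
    "\<And>s z. (s,z) \<in> A \<Longrightarrow> (F s has_derivative D s z) (at z)"
    "\<And>v. family_C k A (\<lambda>s z. D s z v)"
  shows "family_C (Suc k) A F"
proof -
  have "family_C k A (\<lambda>s z. frechet_derivative (F s) (at z) v)" for v
  proof (rule family_C_cong[OF assms(1) _ assms(4)[of v]])
    show "D s z v = frechet_derivative (F s) (at z) v" if "(s,z) \<in> A" for s z
      using frechet_derivative_at[OF assms(3)[OF that]] by simp
  qed
  then show ?thesis using assms(2,3) by (auto simp: differentiable_def)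
qed

lemma family_C_const: "slices_open A \<Longrightarrow> continuous_on A (\<lambda>(s,z). c s) \<Longrightarrow> family_C k A (\<lambda>s z. c s)"
proof (induction k arbitrary: c)
  case (Suc k)
  show ?case
    by (rule family_C_SucI[OF Suc.prems, where D="\<lambda>s z v. 0"]) (simp_all add: Suc.IH[of "\<lambda>_. 0"] Suc.prems)
qed simp

lemma family_C_linear:
  assumes "bounded_linear L" "slices_open A"
  shows "family_C k A (\<lambda>s. L)"
proof (cases k)
  case 0
  then show ?thesis
    using bounded_linear.continuous_on[OF assms(1) continuous_on_snd[OF continuous_on_id]]
    by (simp add: case_prod_unfold id_def)
next
  case (Suc n)
  have "continuous_on A (\<lambda>p. L (snd p))"
    using bounded_linear.continuous_on[OF assms(1) continuous_on_snd[OF continuous_on_id], of A] by (simp add: id_def)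
  then have "continuous_on A (\<lambda>(s,z). L z)" by (simp add: case_prod_unfold)
  then show ?thesis unfolding Suc
    by (rule family_C_SucI[OF assms(2), where D="\<lambda>s z. L"])
       (simp_all add: bounded_linear_imp_has_derivative assms family_C_const)
qed

lemma family_C_add:
  assumes "slices_open A" "family_C k A F" "family_C k A G"
  shows "family_C k A (\<lambda>s z. F s z + G s z)"
  using assms(2,3)
proof (induction k arbitrary: F G)
  case 0 then show ?case by (auto simp: case_prod_unfold intro: continuous_intros)
next
  case (Suc k)
  show ?case
  proof (rule family_C_SucI[OF assms(1)])
    show "continuous_on A (\<lambda>(s, z). F s z + G s z)"
      using continuous_on_add[OF family_C_imp_continuous[OF Suc.prems(1)] family_C_imp_continuous[OF Suc.prems(2)]]
      by (simp add: case_prod_unfold)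
    show "((\<lambda>z. F s z + G s z) has_derivative
       (\<lambda>v. frechet_derivative (F s) (at z) v + frechet_derivative (G s) (at z) v)) (at z)" if "(s,z) \<in> A" for s z
      using has_derivative_add[OF family_C_differentiable[OF Suc.prems(1) that] family_C_differentiable[OF Suc.prems(2) that]] .
    show "family_C k A (\<lambda>s z. frechet_derivative (F s) (at z) v + frechet_derivative (G s) (at z) v)" for v
      using Suc.prems by (intro Suc.IH) auto
  qed
qed

lemma family_C_sum:
  assumes "slices_open A" "\<And>i. i \<in> I \<Longrightarrow> family_C k A (F i)"
  shows "family_C k A (\<lambda>s z. \<Sum>i\<in>I. F i s z)"
proof (cases "finite I")
  case True
  from True assms(2) show ?thesis
    by (induction I rule: finite_induct) (auto intro!: family_C_add family_C_const assms(1))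
qed (auto intro!: family_C_const assms(1))

lemma family_C_bilinear:
  assumes "bounded_bilinear P" "slices_open A" "family_C k A F" "family_C k A G"
  shows "family_C k A (\<lambda>s z. P (F s z) (G s z))"
  using assms(3,4)
proof (induction k arbitrary: F G)
  case 0 then show ?case
    using bounded_bilinear.continuous_on[OF assms(1)] by (auto simp: case_prod_unfold)
next
  case (Suc k)
  note F = family_C_SucD[OF Suc.prems(1)] and G = family_C_SucD[OF Suc.prems(2)]
  have D: "((\<lambda>z. P (F s z) (G s z)) has_derivative
      (\<lambda>v. P (F s z) (frechet_derivative (G s) (at z) v) + P (frechet_derivative (F s) (at z) v) (G s z))) (at z)"
    if "(s,z) \<in> A" for s z
    using bounded_bilinear.FDERIV[OF assms(1) family_C_differentiable[OF Suc.prems(1) that]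
        family_C_differentiable[OF Suc.prems(2) that]] .
  show ?case
  proof (rule family_C_SucI[OF assms(2) _ D])
    show "continuous_on A (\<lambda>(s, z). P (F s z) (G s z))"
      using bounded_bilinear.continuous_on[OF assms(1) family_C_imp_continuous[OF F] family_C_imp_continuous[OF G]]
      by (auto simp: case_prod_unfold)
    show "family_C k A (\<lambda>s z. P (F s z) (frechet_derivative (G s) (at z) v) +
             P (frechet_derivative (F s) (at z) v) (G s z))" for v
      using Suc.prems by (intro family_C_add[OF assms(2)] Suc.IH F G) auto
  qed
qed

text \<open>In the chain rule the direction fed to the derivative of \<open>G s\<close> varies with
  the point, whereas \<open>family_C\<close> knows only fixed directions. Expanding it in the basis
  gives a finite sum of scalar functions times derivatives of \<open>G s\<close> in basis
  directions, composed with \<open>F s\<close>; the induction hypothesis, general in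
  \<open>G\<close>, covers these.\<close>

lemma family_C_compose:
  fixes F :: "'p::topological_space \<Rightarrow> 'e::euclidean_space \<Rightarrow> 'g::euclidean_space"
  assumes "slices_open A" "slices_open B" "\<And>s z. (s,z) \<in> A \<Longrightarrow> (s, F s z) \<in> B" "family_C k A F" "family_C k B G"
  shows "family_C k A (\<lambda>s z. G s (F s z))"
  using assms(4,5)
proof (induction k arbitrary: G)
  have cont: "continuous_on A (\<lambda>(s,z). G s (F s z))"
    if "continuous_on A (\<lambda>(s,z). F s z)" "continuous_on B (\<lambda>(s,z). G s z)" for G
  proof -
    have "continuous_on A (\<lambda>p. (fst p, F (fst p) (snd p)))"
      using that(1) by (intro continuous_on_Pair continuous_on_fst continuous_on_id) (simp add: case_prod_unfold)
    moreover have "(\<lambda>p. (fst p, F (fst p) (snd p))) ` A \<subseteq> B" using assms(3) by force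
    ultimately show ?thesis
      using continuous_on_compose2[OF that(2)] by (fastforce simp: case_prod_unfold)
  qed
  {
    case 0 then show ?case using cont by simp
  next
    case (Suc k)
    note F = family_C_SucD[OF Suc.prems(1)] and G = family_C_SucD[OF Suc.prems(2)]
    show ?case
    proof (rule family_C_SucI[OF assms(1) cont[OF family_C_imp_continuous[OF F] family_C_imp_continuous[OF G]]])
      fix s z assume sz: "(s,z) \<in> A"
      let ?D = "frechet_derivative (G s) (at (F s z))" and ?E = "frechet_derivative (F s) (at z)"
      have D: "(G s has_derivative ?D) (at (F s z))"
        using family_C_differentiable[OF Suc.prems(2)] assms(3)[OF sz] by blast
      interpret D: bounded_linear ?D using D by (rule has_derivative_bounded_linear)
      have eq: "(\<Sum>b\<in>Basis. (w \<bullet> b) *\<^sub>R ?D b) = ?D w" for w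
      proof -
        have "?D w = ?D (\<Sum>b\<in>Basis. (w \<bullet> b) *\<^sub>R b)" by (simp add: euclidean_representation)
        then show ?thesis by (simp add: D.sum D.scaleR)
      qed
      have "((\<lambda>z. G s (F s z)) has_derivative (\<lambda>v. ?D (?E v))) (at z)"
        using diff_chain_at[OF family_C_differentiable[OF Suc.prems(1) sz] D] by (simp add: o_def)
      then show "((\<lambda>z. G s (F s z)) has_derivative
         (\<lambda>v. \<Sum>b\<in>Basis. (?E v \<bullet> b) *\<^sub>R ?D b)) (at z)" unfolding eq .
    next
      fix v
      have "family_C k A (\<lambda>s z. frechet_derivative (F s) (at z) v \<bullet> b)" for b
        using Suc.prems by (intro family_C_bilinear[OF bounded_bilinear_inner assms(1), of k "\<lambda>s z. frechet_derivative (F s) (at z) v" "\<lambda>s z. b"]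
            family_C_const[OF assms(1), of "\<lambda>s. b"]) simp_all
      then show "family_C k A (\<lambda>s z. \<Sum>b\<in>Basis. (frechet_derivative (F s) (at z) v \<bullet> b) *\<^sub>R
               frechet_derivative (G s) (at (F s z)) b)"
        using Suc.prems
        by (intro family_C_sum[OF assms(1)] family_C_bilinear[OF bounded_bilinear_scaleR assms(1)] Suc.IH F) auto
    qed
  }
qed

lemma family_C_inverse:
  fixes F :: "'p::topological_space \<Rightarrow> 'e::euclidean_space \<Rightarrow> real"
  assumes "slices_open A" "\<And>s z. (s,z) \<in> A \<Longrightarrow> F s z \<noteq> 0" "family_C k A F"
  shows "family_C k A (\<lambda>s z. inverse (F s z))"
  using assms(3)
proof (induction k)
  case 0
  then show ?case using assms(2) by (auto simp: case_prod_unfold intro!: continuous_intros)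
next
  case (Suc k)
  note F = family_C_SucD[OF Suc.prems]
  show ?case
  proof (rule family_C_SucI[OF assms(1)])
    show "continuous_on A (\<lambda>(s, z). inverse (F s z))"
      using family_C_imp_continuous[OF F] assms(2) by (auto simp: case_prod_unfold intro!: continuous_intros)
    show "((\<lambda>z. inverse (F s z)) has_derivative
        (\<lambda>v. (- 1) * ((inverse (F s z) * frechet_derivative (F s) (at z) v) * inverse (F s z)))) (at z)" if "(s,z)\<in>A" for s z
      using Deriv.has_derivative_inverse[OF assms(2)[OF that] family_C_differentiable[OF Suc.prems that]]
      by simp
    show "family_C k A (\<lambda>s z. (- 1) * ((inverse (F s z) * frechet_derivative (F s) (at z) v) * inverse (F s z)))" for v
      using Suc F by (intro family_C_bilinear[OF bounded_bilinear_mult assms(1)] family_C_const[OF assms(1)]) auto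
  qed
qed

lemma iter_deriv_append:
  "iter_deriv S vs (iter_deriv S ws f) = iter_deriv S (vs @ ws) f"
  by (induction vs) auto

text \<open>\<open>iter_deriv\<close> takes the last direction of the list first, hence induction
  from the end of the list.\<close>

lemma family_C_iter_deriv:
  assumes "\<And>k. family_C k A F"
  shows "family_C k A (\<lambda>s. iter_deriv UNIV vs (F s))"
  using assms
proof (induction vs arbitrary: F k rule: rev_induct)
  case (snoc v vs)
  have "family_C k A (\<lambda>s z. frechet_derivative (F s) (at z) v)" for k
    using snoc.prems[of "Suc k"] by simp
  from snoc.IH[of "\<lambda>s z. frechet_derivative (F s) (at z) v", OF this]
  show ?case
    unfolding iter_deriv_append[symmetric] by simp
qed simp

section \<open>Smooth functions on open sets and on arbitrary sets\<close>

definition smooth_open :: "'e::euclidean_space set \<Rightarrow> ('e \<Rightarrow> 'f::real_normed_vector) \<Rightarrow> bool" where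
  "smooth_open U f \<longleftrightarrow> open U \<and> (\<forall>vs. iter_deriv UNIV vs f differentiable_on U)"

lemma smooth_on_iff: "smooth_on S f \<longleftrightarrow> (\<forall>x\<in>S. \<exists>U g. x \<in> U \<and> smooth_open U g \<and> (\<forall>y\<in>U \<inter> S. g y = f y))"
  unfolding smooth_on_def smooth_open_def by blast

lemma smooth_open_differentiable:
  assumes "smooth_open U f" "z \<in> U"
  shows "(iter_deriv UNIV vs f has_derivative frechet_derivative (iter_deriv UNIV vs f) (at z)) (at z)"
  using assms unfolding smooth_open_def
  by (metis differentiable_on_eq_differentiable_at frechet_derivative_works)

lemma smooth_open_family_C:
  assumes "smooth_open U f" shows "family_C k (P \<times> U) (\<lambda>s. f)"
proof -
  have "family_C k (P \<times> U) (\<lambda>s. iter_deriv UNIV vs f)" for vs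
  proof (induction k arbitrary: vs)
    case (0 vs)
    have "continuous_on U (iter_deriv UNIV vs f)"
      using assms by (auto simp: smooth_open_def intro: differentiable_imp_continuous_on)
    then show ?case
      by (auto simp: case_prod_unfold intro!: continuous_intros elim!: continuous_on_compose2)
  next
    case (Suc k)
    have c: "continuous_on (P \<times> U) (\<lambda>(s,z). iter_deriv UNIV vs f z)"
      using family_C_imp_continuous[OF Suc.IH[of vs]] .
    show ?case
    proof (rule family_C_SucI[OF _ c])
      show "slices_open (P \<times> U)" using assms by (simp add: smooth_open_def)
      show "(iter_deriv UNIV vs f has_derivative (\<lambda>v. iter_deriv UNIV (v # vs) f z)) (at z)"
        if "(s,z) \<in> P \<times> U" for s z
        using smooth_open_differentiable[OF assms, of z vs] that by (simp add: eta_contract_eq)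
      show "family_C k (P \<times> U) (\<lambda>s z. iter_deriv UNIV (v # vs) f z)" for v
        using Suc.IH[of "v # vs"] .
    qed
  qed
  from this[of "[]"] show ?thesis by simp
qed

lemma family_C_smooth_open:
  assumes "open U" "\<And>k. family_C k (UNIV \<times> U) (\<lambda>s::real. f)"
  shows "smooth_open U f"
  unfolding smooth_open_def
proof (intro conjI allI)
  fix vs
  have "family_C (Suc 0) (UNIV \<times> U) (\<lambda>s::real. iter_deriv UNIV vs f)"
    using family_C_iter_deriv[OF assms(2)] .
  then show "iter_deriv UNIV vs f differentiable_on U"
    by (auto intro!: differentiable_at_imp_differentiable_on)
qed (fact assms)

text \<open>A smooth function is a family that is constant in a dummy real parameter; all closure
  properties of smooth functions below are inherited from families through this equivalence.\<close>

lemma smooth_open_iff_family_C: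
  "smooth_open U f \<longleftrightarrow> open U \<and> (\<forall>k. family_C k (UNIV \<times> U) (\<lambda>s::real. f))"
  using family_C_smooth_open smooth_open_family_C by (metis smooth_open_def)

lemma smooth_open_cong: "smooth_open U f \<Longrightarrow> (\<And>x. x \<in> U \<Longrightarrow> f x = g x) \<Longrightarrow> smooth_open U g"
  unfolding smooth_open_iff_family_C
  by (auto intro!: family_C_cong[of "UNIV \<times> U" "\<lambda>s. f" "\<lambda>s. g"])

lemma smooth_open_subset: "smooth_open U f \<Longrightarrow> open V \<Longrightarrow> V \<subseteq> U \<Longrightarrow> smooth_open V f"
  unfolding smooth_open_def by (meson differentiable_on_subset)

lemma smooth_open_compose:
  fixes f :: "'e::euclidean_space \<Rightarrow> 'g::euclidean_space"
  assumes "smooth_open U f" "smooth_open V g" "f ` U \<subseteq> V"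
  shows "smooth_open U (\<lambda>x. g (f x))"
proof -
  have "open U" "open V" using assms by (auto simp: smooth_open_def)
  then show ?thesis unfolding smooth_open_iff_family_C
    using family_C_compose[of "UNIV \<times> U" "UNIV \<times> V" "\<lambda>s. f" _ "\<lambda>s. g", OF _ _ _ smooth_open_family_C[OF assms(1)] smooth_open_family_C[OF assms(2)]]
      assms(3) by auto
qed

lemma smooth_open_linear: "bounded_linear L \<Longrightarrow> open U \<Longrightarrow> smooth_open U L"
  unfolding smooth_open_iff_family_C by (auto intro: family_C_linear)

lemma smooth_open_const: "open U \<Longrightarrow> smooth_open U (\<lambda>x. c)"
  unfolding smooth_open_iff_family_C by (intro conjI allI family_C_const) simp_all

lemma smooth_open_add: "smooth_open U f \<Longrightarrow> smooth_open U g \<Longrightarrow> smooth_open U (\<lambda>x. f x + g x)"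
  unfolding smooth_open_iff_family_C by (auto intro!: family_C_add)

lemma smooth_open_bilinear:
  "bounded_bilinear P \<Longrightarrow> smooth_open U f \<Longrightarrow> smooth_open U g \<Longrightarrow> smooth_open U (\<lambda>x. P (f x) (g x))"
  using family_C_bilinear[of P "(UNIV::real set) \<times> U" _ "\<lambda>s. f" "\<lambda>s. g"] by (simp add: smooth_open_iff_family_C)

lemma smooth_open_inverse:
  fixes f :: "'e::euclidean_space \<Rightarrow> real"
  shows "smooth_open U f \<Longrightarrow> (\<And>x. x \<in> U \<Longrightarrow> f x \<noteq> 0) \<Longrightarrow> smooth_open U (\<lambda>x. inverse (f x))"
  unfolding smooth_open_iff_family_C by (auto intro!: family_C_inverse)

lemma smooth_open_deriv: "smooth_open U f \<Longrightarrow> smooth_open U (\<lambda>z. frechet_derivative f (at z) v)"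
  unfolding smooth_open_def using iter_deriv_append[of UNIV _ "[v]" f] by (auto simp: eta_contract_eq)

lemma smooth_open_has_derivative:
  "smooth_open U f \<Longrightarrow> z \<in> U \<Longrightarrow> (f has_derivative frechet_derivative f (at z)) (at z)"
  using smooth_open_differentiable[of U f z "[]"] by simp

lemma smooth_open_continuous_on: "smooth_open U f \<Longrightarrow> continuous_on U f"
  by (intro continuous_at_imp_continuous_on ballI has_derivative_continuous[OF smooth_open_has_derivative])

lemma smooth_open_imp_smooth_on: "smooth_open U f \<Longrightarrow> S \<subseteq> U \<Longrightarrow> smooth_on S f"
  unfolding smooth_on_iff by blast

lemma smooth_on_open:
  assumes "open U" "smooth_on U f" shows "smooth_open U f"
proof -
  have "iter_deriv UNIV vs f differentiable at x" if x: "x \<in> U" for vs x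
  proof -
    obtain V g where V: "x \<in> V" "smooth_open V g" "\<forall>y\<in>V \<inter> U. g y = f y"
      using assms(2) x unfolding smooth_on_iff by blast
    then have "smooth_open (V \<inter> U) f"
      using smooth_open_cong[OF smooth_open_subset[OF V(2), of "V \<inter> U"]] assms(1)
      by (metis Int_lower1 open_Int smooth_open_def)
    then show ?thesis using V(1) x smooth_open_differentiable[of "V \<inter> U" f x vs]
      by (auto simp: differentiable_def)
  qed
  then show ?thesis using assms(1)
    unfolding smooth_open_def by (auto intro!: differentiable_at_imp_differentiable_on)
qed

lemma smooth_on_compose:
  fixes f :: "'e::euclidean_space \<Rightarrow> 'g::euclidean_space"
  assumes "smooth_on S f" "smooth_on T g" "f ` S \<subseteq> T"
  shows "smooth_on S (\<lambda>x. g (f x))"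
  unfolding smooth_on_iff
proof
  fix x assume x: "x \<in> S"
  obtain U F where U: "x \<in> U" "smooth_open U F" "\<forall>y\<in>U \<inter> S. F y = f y"
    using assms(1) x unfolding smooth_on_iff by blast
  obtain V G where V: "f x \<in> V" "smooth_open V G" "\<forall>y\<in>V \<inter> T. G y = g y"
    using assms(2,3) x unfolding smooth_on_iff by blast
  let ?W = "U \<inter> F -` V"
  have oW: "open ?W"
    using smooth_open_continuous_on[OF U(2)] U(2) V(2)
    by (auto simp: smooth_open_def intro: continuous_open_preimage)
  have "smooth_open ?W (\<lambda>x. G (F x))"
    by (rule smooth_open_compose[OF smooth_open_subset[OF U(2) oW] V(2)]) auto
  moreover have "x \<in> ?W" using U x V by auto
  moreover have "\<forall>y\<in>?W \<inter> S. G (F y) = g (f y)"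
    using U(3) V(3) assms(3) by auto
  ultimately show "\<exists>U h. x \<in> U \<and> smooth_open U h \<and> (\<forall>y\<in>U \<inter> S. h y = g (f y))"
    by (intro exI[of _ ?W] exI[of _ "\<lambda>x. G (F x)"]) simp
qed

lemma smooth_on_cong: "smooth_on S f \<Longrightarrow> (\<And>x. x \<in> S \<Longrightarrow> f x = g x) \<Longrightarrow> smooth_on S g"
  unfolding smooth_on_iff by simp

lemma smooth_on_imp_continuous_on: "smooth_on S f \<Longrightarrow> continuous_on S f"
  unfolding continuous_on_eq_continuous_within
proof
  fix x assume "smooth_on S f" and x: "x \<in> S"
  then obtain U g where U: "x \<in> U" "smooth_open U g" "\<forall>y\<in>U \<inter> S. g y = f y"
    unfolding smooth_on_iff by blast
  have "isCont g x" using U has_derivative_continuous smooth_open_has_derivative by blast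
  then have "continuous (at x within S) g" using continuous_at_imp_continuous_at_within by blast
  show "continuous (at x within S) f"
  proof -
    obtain r where r: "r > 0" "ball x r \<subseteq> U" using U openE unfolding smooth_open_def by blast
    show ?thesis
      by (rule continuous_transform_within[OF \<open>continuous (at x within S) g\<close> r(1) x])
         (use r U(3) in \<open>auto simp: dist_commute subset_iff\<close>)
  qed
qed

text \<open>Every basis direction can be approached from inside \<open>S\<close> by arbitrarily
  small steps. This is the condition under which the derivative within \<open>S\<close> is unique,
  so that \<open>frechet_derivative\<close> within \<open>S\<close> has its intended value.\<close>

definition uniq_deriv :: "'e::euclidean_space set \<Rightarrow> bool" where
  "uniq_deriv S \<longleftrightarrow> (\<forall>x\<in>S. \<forall>i\<in>Basis. \<forall>e>0. \<exists>d. 0 < \<bar>d\<bar> \<and> \<bar>d\<bar> < e \<and> x + d *\<^sub>R i \<in> S)"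

text \<open>The derivatives within \<open>[0,1]\<close> times a chart image, which define the
  topology on Hamiltonians, become ordinary derivatives of a local smooth extension.\<close>

lemma iter_deriv_within:
  assumes "uniq_deriv S" "smooth_open W g" "\<And>y. y \<in> S \<inter> W \<Longrightarrow> f y = g y" "x \<in> S \<inter> W"
  shows "iter_deriv S vs f x = iter_deriv UNIV vs g x"
  using assms(4)
proof (induction vs arbitrary: x)
  case Nil then show ?case using assms(3) by simp
next
  case (Cons v vs)
  have W: "open W" using assms(2) by (simp add: smooth_open_def)
  have 1: "(iter_deriv UNIV vs g has_derivative frechet_derivative (iter_deriv UNIV vs g) (at x)) (at x within S)"
    using smooth_open_differentiable[OF assms(2), of x vs] Cons.prems has_derivative_at_withinI by blast
  obtain r where r: "r > 0" "ball x r \<subseteq> W" using W Cons.prems openE by blast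
  have 2: "(iter_deriv S vs f has_derivative frechet_derivative (iter_deriv UNIV vs g) (at x)) (at x within S)"
    by (rule has_derivative_transform_within[OF 1 r(1)])
       (use Cons r in \<open>auto simp: dist_commute subset_iff\<close>)
  have "frechet_derivative (iter_deriv S vs f) (at x within S) = frechet_derivative (iter_deriv UNIV vs g) (at x)"
  proof (rule frechet_derivative_unique_within[OF _ 2])
    show "(iter_deriv S vs f has_derivative frechet_derivative (iter_deriv S vs f) (at x within S)) (at x within S)"
      using 2 by (auto simp: frechet_derivative_works[symmetric] differentiable_def)
  qed (use assms(1) Cons.prems in \<open>auto simp: uniq_deriv_def\<close>)
  then show ?case by simp
qed

lemma uniq_deriv_prod:
  assumes "open U" shows "uniq_deriv ({0..1::real} \<times> (U :: 'e::euclidean_space set))"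
  unfolding uniq_deriv_def
proof (intro ballI allI impI)
  fix x :: "real \<times> 'e" and i :: "real \<times> 'e" and e :: real
  assume x: "x \<in> {0..1} \<times> U" and i: "i \<in> Basis" and e: "e > 0"
  obtain t y where ty: "x = (t,y)" "0 \<le> t" "t \<le> 1" "y \<in> U" using x by (cases x) auto
  consider "i = (1,0)" | b where "b \<in> Basis" "i = (0,b)"
    using i by (auto simp: Basis_prod_def)
  then show "\<exists>d. 0 < \<bar>d\<bar> \<and> \<bar>d\<bar> < e \<and> x + d *\<^sub>R i \<in> {0..1} \<times> U"
  proof cases
    case 1
    show ?thesis
    \<comment> \<open>Near an end point of the time interval only steps pointing inwards stay in the
      set.\<close>
    proof (cases "t < 1/2")
      case True
      then show ?thesis using 1 ty e by (intro exI[of _ "min (e/2) (1/2)"]) (auto simp: min_def)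
    next
      case False
      then show ?thesis using 1 ty e by (intro exI[of _ "- min (e/2) (1/2)"]) (auto simp: min_def)
    qed
  next
    case 2
    obtain r where r: "r > 0" "ball y r \<subseteq> U" using assms ty openE by blast
    have "y + (min (e/2) (r/2)) *\<^sub>R b \<in> ball y r"
      using r 2 e by (simp add: dist_norm min_def)
    then show ?thesis using 2 ty r e by (intro exI[of _ "min (e/2) (r/2)"]) (auto simp: min_def)
  qed
qed

section \<open>Charts, area forms and Hamiltonian vector fields\<close>

lemma smooth_on_local:
  assumes "\<And>x. x \<in> S \<Longrightarrow> \<exists>W. open W \<and> x \<in> W \<and> smooth_on (S \<inter> W) f"
  shows "smooth_on S f"
  unfolding smooth_on_iff
proof
  fix x assume x: "x \<in> S"
  obtain W where W: "open W" "x \<in> W" "smooth_on (S \<inter> W) f" using assms x by blast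
  obtain U g where U: "x \<in> U" "smooth_open U g" "\<forall>y\<in>U \<inter> (S \<inter> W). g y = f y"
    using W x unfolding smooth_on_iff by blast
  have "smooth_open (U \<inter> W) g"
    using smooth_open_subset[OF U(2), of "U \<inter> W"] U(2) W(1) by (auto simp: smooth_open_def)
  then show "\<exists>U g. x \<in> U \<and> smooth_open U g \<and> (\<forall>y\<in>U \<inter> S. g y = f y)"
    using U W by (intro exI[of _ "U \<inter> W"] exI[of _ g]) auto
qed

lemma smooth_on_linear: "bounded_linear L \<Longrightarrow> smooth_on S L"
  using smooth_open_linear[of L UNIV] smooth_open_imp_smooth_on by blast

lemma smooth_on_const: "smooth_on S (\<lambda>x. c)"
  using smooth_open_const[of UNIV c] smooth_open_imp_smooth_on by blast

lemma smooth_on_combine: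
  fixes f :: "'e::euclidean_space \<Rightarrow> 'f::real_normed_vector" and g :: "'e \<Rightarrow> 'g::real_normed_vector"
  assumes "smooth_on S f" "smooth_on S g"
    and comb: "\<And>U F G. smooth_open (U :: 'e set) F \<Longrightarrow> smooth_open U G \<Longrightarrow> smooth_open U (\<lambda>x. P (F x) (G x))"
  shows "smooth_on S (\<lambda>x. P (f x) (g x))"
  unfolding smooth_on_iff
proof
  fix x assume x: "x \<in> S"
  obtain U F where U: "x \<in> U" "smooth_open U F" "\<forall>y\<in>U \<inter> S. F y = f y"
    using assms(1) x unfolding smooth_on_iff by blast
  obtain V G where V: "x \<in> V" "smooth_open V G" "\<forall>y\<in>V \<inter> S. G y = g y"
    using assms(2) x unfolding smooth_on_iff by blast
  have o: "open (U \<inter> V)" using U V by (auto simp: smooth_open_def)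
  have "smooth_open (U \<inter> V) F" by (rule smooth_open_subset[OF U(2) o]) simp
  moreover have "smooth_open (U \<inter> V) G" by (rule smooth_open_subset[OF V(2) o]) simp
  ultimately have "smooth_open (U \<inter> V) (\<lambda>x. P (F x) (G x))" by (rule comb)
  then show "\<exists>W h. x \<in> W \<and> smooth_open W h \<and> (\<forall>y\<in>W \<inter> S. h y = P (f y) (g y))"
    using U V by (intro exI[of _ "U \<inter> V"] exI[of _ "\<lambda>x. P (F x) (G x)"]) auto
qed

lemma smooth_on_add: "smooth_on S f \<Longrightarrow> smooth_on S g \<Longrightarrow> smooth_on S (\<lambda>x. f x + g x)"
  by (rule smooth_on_combine[where P="(+)"]) (auto intro: smooth_open_add)

lemma smooth_on_linear_compose:
  fixes f :: "'e::euclidean_space \<Rightarrow> 'g::euclidean_space"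
  assumes "bounded_linear L" "smooth_on S f" shows "smooth_on S (\<lambda>x. L (f x))"
  using smooth_on_compose[OF assms(2) smooth_on_linear[OF assms(1), of UNIV]] by simp

lemma smooth_on_Pair:
  fixes f :: "'e::euclidean_space \<Rightarrow> 'g::euclidean_space" and g :: "'e \<Rightarrow> 'h::euclidean_space"
  assumes "smooth_on S f" "smooth_on S g"
  shows "smooth_on S (\<lambda>x. (f x, g x))"
proof -
  have "bounded_linear (\<lambda>y::'g. (y, 0::'h))" "bounded_linear (\<lambda>y::'h. (0::'g, y))"
    by (auto intro: bounded_linear_Pair bounded_linear_ident bounded_linear_zero)
  from smooth_on_add[OF smooth_on_linear_compose[OF this(1) assms(1)] smooth_on_linear_compose[OF this(2) assms(2)]]
  show ?thesis by simp
qed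

definition cross2 :: "real^2 \<Rightarrow> real^2 \<Rightarrow> real" where
  "cross2 v w = v$1 * w$2 - v$2 * w$1"

lemma cross2_simps:
  "cross2 (u + v) w = cross2 u w + cross2 v w" "cross2 w (u + v) = cross2 w u + cross2 w v"
  "cross2 (a *\<^sub>R v) w = a * cross2 v w" "cross2 v (a *\<^sub>R w) = a * cross2 v w" "cross2 v v = 0"
  "cross2 (u - v) w = cross2 u w - cross2 v w" "cross2 w (u - v) = cross2 w u - cross2 w v"
  "cross2 0 w = 0" "cross2 w 0 = 0"
  by (simp_all add: cross2_def algebra_simps)

lemma cross2_le: "\<bar>cross2 v w\<bar> \<le> 2 * (norm v * norm w)"
proof -
  have "\<bar>cross2 v w\<bar> \<le> \<bar>v$1\<bar> * \<bar>w$2\<bar> + \<bar>v$2\<bar> * \<bar>w$1\<bar>"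
    unfolding cross2_def by (metis abs_mult abs_triangle_ineq4)
  also have "\<dots> \<le> norm v * norm w + norm v * norm w"
    by (intro add_mono mult_mono) (auto simp: component_le_norm_cart)
  finally show ?thesis by simp
qed

lemma area_form_cross2: "area_form \<Sigma> c p v w = density \<Sigma> c p * cross2 v w"
  by (simp add: area_form_def cross2_def)

lemma linear_real2: "linear D \<Longrightarrow> D v = v$1 *\<^sub>R D (axis 1 1) + v$2 *\<^sub>R D (axis 2 1)"
  for v :: "real^2"
proof -
  assume D: "linear D"
  have "v = v$1 *\<^sub>R axis 1 1 + v$2 *\<^sub>R axis 2 1"
    by (simp add: vec_eq_iff forall_2 axis_def)
  then have "D v = D (v$1 *\<^sub>R axis 1 1 + v$2 *\<^sub>R axis 2 1)" by simp
  then show ?thesis by (simp only: linear_add[OF D] linear_scale[OF D])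
qed

text \<open>The plane and the closed surfaces are handled together. The Hausdorff property enters
  for instance in the uniqueness of trajectories, second countability in the choice of countably
  many coordinate disks.\<close>

locale area_surface =
  fixes \<Sigma> :: "'a::{t2_space,second_countable_topology} surface"
  assumes surf: "symplectic_surface \<Sigma>"
begin

lemma chart:
  assumes "c \<in> atlas \<Sigma>"
  shows open_dom: "open (fst c)" and open_img: "open (snd c ` fst c)"
    and continuous_chart: "continuous_on (fst c) (snd c)"
    and continuous_coord_inv: "continuous_on (snd c ` fst c) (coord_inv c)"
    and coord_inv_chart: "p \<in> fst c \<Longrightarrow> coord_inv c (snd c p) = p"
    and chart_coord_inv: "y \<in> snd c ` fst c \<Longrightarrow> snd c (coord_inv c y) = y"
    and coord_inv_in: "y \<in> snd c ` fst c \<Longrightarrow> coord_inv c y \<in> fst c"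
proof -
  have "is_chart c" using surf assms by (simp add: symplectic_surface_def)
  then have h: "open (fst c)" "open (snd c ` fst c)"
     "homeomorphism (fst c) (snd c ` fst c) (snd c) (coord_inv c)" by (auto simp: is_chart_def)
  then show "open (fst c)" "open (snd c ` fst c)" "continuous_on (fst c) (snd c)"
     "continuous_on (snd c ` fst c) (coord_inv c)"
     "p \<in> fst c \<Longrightarrow> coord_inv c (snd c p) = p"
     "y \<in> snd c ` fst c \<Longrightarrow> snd c (coord_inv c y) = y"
     "y \<in> snd c ` fst c \<Longrightarrow> coord_inv c y \<in> fst c"
    by (auto simp: homeomorphism_def)
qed

lemma chart_at: obtains c where "c \<in> atlas \<Sigma>" "p \<in> fst c"
  using surf unfolding symplectic_surface_def by blast

lemma open_chart_image:
  assumes "c \<in> atlas \<Sigma>" "open O'" "O' \<subseteq> fst c"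
  shows "open (snd c ` O')"
proof -
  have "snd c ` O' = snd c ` fst c \<inter> coord_inv c -` O'"
  proof (intro equalityI subsetI)
    fix y assume "y \<in> snd c ` O'"
    then show "y \<in> snd c ` fst c \<inter> coord_inv c -` O'" using coord_inv_chart[OF assms(1)] assms(3) by auto
  next
    fix y assume "y \<in> snd c ` fst c \<inter> coord_inv c -` O'"
    then show "y \<in> snd c ` O'" using chart_coord_inv[OF assms(1), of y] by (auto simp: image_iff intro!: bexI[of _ "coord_inv c y"])
  qed
  then show ?thesis
    using continuous_open_preimage[OF continuous_coord_inv[OF assms(1)] open_img[OF assms(1)] assms(2)] by simp
qed

lemma open_coord_image:
  assumes "c \<in> atlas \<Sigma>" "open V" "V \<subseteq> snd c ` fst c"
  shows "open (coord_inv c ` V)"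
proof -
  have "coord_inv c ` V = fst c \<inter> snd c -` V"
  proof (intro equalityI subsetI)
    fix p assume "p \<in> fst c \<inter> snd c -` V"
    then show "p \<in> coord_inv c ` V" using coord_inv_chart[OF assms(1), of p] by (auto simp: image_iff intro!: bexI[of _ "snd c p"])
  next
    fix p assume "p \<in> coord_inv c ` V"
    then obtain y where "y \<in> V" "p = coord_inv c y" by blast
    then show "p \<in> fst c \<inter> snd c -` V"
      using chart_coord_inv[OF assms(1), of y] coord_inv_in[OF assms(1), of y] assms(3) by auto
  qed
  then show ?thesis
    using continuous_open_preimage[OF continuous_chart[OF assms(1)] open_dom[OF assms(1)] assms(2)] by simp
qed

definition dens :: "'a chart \<Rightarrow> real^2 \<Rightarrow> real" where "dens c = density \<Sigma> c \<circ> coord_inv c"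

lemma dens_smooth: "c \<in> atlas \<Sigma> \<Longrightarrow> smooth_open (snd c ` fst c) (dens c)"
  using surf open_img unfolding dens_def symplectic_surface_def by (simp add: smooth_on_open)

lemma dens_nz: "c \<in> atlas \<Sigma> \<Longrightarrow> y \<in> snd c ` fst c \<Longrightarrow> dens c y \<noteq> 0"
  using surf coord_inv_in[of c y] unfolding dens_def symplectic_surface_def by simp

lemma density_nz: "c \<in> atlas \<Sigma> \<Longrightarrow> p \<in> fst c \<Longrightarrow> density \<Sigma> c p \<noteq> 0"
  using surf unfolding symplectic_surface_def by blast

lemma dens_chart: "c \<in> atlas \<Sigma> \<Longrightarrow> p \<in> fst c \<Longrightarrow> dens c (snd c p) = density \<Sigma> c p"
  by (simp add: dens_def coord_inv_chart)

text \<open>Symplectomorphisms and the identity are treated at once: a transformation rule for area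
  maps, applied to the identity, is a change-of-chart rule.\<close>

definition area_map :: "('a \<Rightarrow> 'a) \<Rightarrow> bool" where
  "area_map f \<longleftrightarrow> smooth_self_map \<Sigma> f \<and> preserves_area_form \<Sigma> f"

lemma area_map_id: "area_map id"
  using surf by (simp add: symplectic_surface_def area_map_def)

lemma area_map_symp: "\<psi> \<in> symp \<Sigma> \<Longrightarrow> area_map \<psi>"
  by (simp add: symp_def area_map_def)

lemma local_dom_open:
  assumes "c \<in> atlas \<Sigma>" "d \<in> atlas \<Sigma>" "continuous_on UNIV f"
  shows "open (fst c \<inter> f -` fst d)" "open (snd c ` (fst c \<inter> f -` fst d))"
proof -
  show "open (fst c \<inter> f -` fst d)"
    using assms open_dom by (intro open_Int open_vimage) auto
  then show "open (snd c ` (fst c \<inter> f -` fst d))" using assms by (intro open_chart_image) auto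
qed

lemma local_rep_smooth:
  assumes "smooth_self_map \<Sigma> f" "c \<in> atlas \<Sigma>" "d \<in> atlas \<Sigma>"
  shows "smooth_open (snd c ` (fst c \<inter> f -` fst d)) (local_rep c d f)"
  using assms by (intro smooth_on_open local_dom_open) (auto simp: smooth_self_map_def)

lemma local_rep_chart: "c \<in> atlas \<Sigma> \<Longrightarrow> p \<in> fst c \<Longrightarrow> local_rep c d f (snd c p) = snd d (f p)"
  by (simp add: local_rep_def coord_inv_chart)

lemma local_rep_has_derivative:
  assumes "smooth_self_map \<Sigma> f" "c \<in> atlas \<Sigma>" "d \<in> atlas \<Sigma>" "p \<in> fst c" "f p \<in> fst d"
  shows "(local_rep c d f has_derivative frechet_derivative (local_rep c d f) (at (snd c p))) (at (snd c p))"
  using smooth_open_has_derivative[OF local_rep_smooth[OF assms(1-3)]] assms(4,5) by blast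

lemma area_map_area_form:
  assumes "area_map f" "c \<in> atlas \<Sigma>" "d \<in> atlas \<Sigma>" "p \<in> fst c" "f p \<in> fst d"
  shows "area_form \<Sigma> c p v w =
        area_form \<Sigma> d (f p) (frechet_derivative (local_rep c d f) (at (snd c p)) v)
                            (frechet_derivative (local_rep c d f) (at (snd c p)) w)"
  using assms unfolding area_map_def preserves_area_form_def by blast

section \<open>Hamiltonian vector fields and their behaviour under area-preserving maps\<close>

lemma ham_slice_smooth:
  assumes "H \<in> hamiltonians \<Sigma>" "t \<in> {0..1}" "c \<in> atlas \<Sigma>"
  shows "smooth_open (snd c ` fst c) (H t \<circ> coord_inv c)"
proof -
  have "smooth_on (snd c ` fst c) (\<lambda>y. ham_rep c H (t, y))"
    by (rule smooth_on_compose[where T="{0..1} \<times> snd c ` fst c"])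
       (use assms smooth_on_Pair[OF smooth_on_const smooth_on_linear[OF bounded_linear_ident]] in \<open>auto simp: hamiltonians_def\<close>)
  then show ?thesis
    by (intro smooth_on_open open_img assms) (simp add: ham_rep_def o_def)
qed

text \<open>Since the density does not vanish, the area form is nondegenerate; this is what makes
  the definite description in \<open>ham_vf\<close> meaningful.\<close>

lemma ham_vf_unique:
  assumes "c \<in> atlas \<Sigma>" "p \<in> fst c" "\<And>v. area_form \<Sigma> c p X v = - frechet_derivative (H t \<circ> coord_inv c) (at (snd c p)) v"
  shows "ham_vf \<Sigma> H t c p = X"
  unfolding ham_vf_def
proof (rule the_equality)
  fix Y assume Y: "\<forall>v. area_form \<Sigma> c p Y v = - frechet_derivative (H t \<circ> coord_inv c) (at (snd c p)) v"
  have "cross2 (Y - X) v = 0" for v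
    using Y assms(3)[of v] density_nz[OF assms(1,2)]
    by (simp add: cross2_simps area_form_cross2) (metis mult_cancel_left)
  from this[of "axis 1 1"] this[of "axis 2 1"] show "Y = X"
    by (simp add: cross2_def axis_def vec_eq_iff forall_2)
qed (use assms(3) in blast)

lemma ham_vf_formula:
  assumes "H \<in> hamiltonians \<Sigma>" "t \<in> {0..1}" "c \<in> atlas \<Sigma>" "p \<in> fst c"
  defines "D \<equiv> frechet_derivative (H t \<circ> coord_inv c) (at (snd c p))"
  shows "ham_vf \<Sigma> H t c p = (- D (axis 2 1) / density \<Sigma> c p) *\<^sub>R axis 1 1 + (D (axis 1 1) / density \<Sigma> c p) *\<^sub>R axis 2 1"
    and "area_form \<Sigma> c p (ham_vf \<Sigma> H t c p) v = - D v"
proof -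
  have "((H t \<circ> coord_inv c) has_derivative D) (at (snd c p))"
    unfolding D_def using smooth_open_has_derivative[OF ham_slice_smooth[OF assms(1-3)]] assms(4) by blast
  then have lin: "linear D" using has_derivative_bounded_linear bounded_linear.linear by blast
  let ?X = "(- D (axis 2 1) / density \<Sigma> c p) *\<^sub>R axis 1 1 + (D (axis 1 1) / density \<Sigma> c p) *\<^sub>R axis 2 1 :: real^2"
  have X: "area_form \<Sigma> c p ?X v = - D v" for v
    using density_nz[OF assms(3,4)] linear_real2[OF lin, of v]
    by (simp add: area_form_def axis_def field_simps)
  show eq: "ham_vf \<Sigma> H t c p = ?X" by (rule ham_vf_unique[OF assms(3,4)]) (use X in \<open>simp add: D_def\<close>)
  show "area_form \<Sigma> c p (ham_vf \<Sigma> H t c p) v = - D v" unfolding eq by (rule X)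
qed

text \<open>Preserving a nondegenerate form makes the derivative \<open>?L\<close> injective, hence
  surjective on the plane. Every test vector at \<open>f p\<close> is therefore the image of one at
  \<open>p\<close>, and the defining equation of the vector field at \<open>f p\<close> follows from
  the one at \<open>p\<close> by the chain rule.\<close>

lemma ham_vf_transform:
  assumes f: "area_map f" and H: "H \<in> hamiltonians \<Sigma>" "(\<lambda>t x. H t (f x)) \<in> hamiltonians \<Sigma>" and t: "t \<in> {0..1}"
    and c: "c \<in> atlas \<Sigma>" "p \<in> fst c" and d: "d \<in> atlas \<Sigma>" "f p \<in> fst d"
  shows "ham_vf \<Sigma> H t d (f p) =
     frechet_derivative (local_rep c d f) (at (snd c p)) (ham_vf \<Sigma> (\<lambda>t x. H t (f x)) t c p)"
proof -
  let ?L = "frechet_derivative (local_rep c d f) (at (snd c p))"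
  let ?X = "ham_vf \<Sigma> (\<lambda>t x. H t (f x)) t c p"
  have sm: "smooth_self_map \<Sigma> f" using f by (simp add: area_map_def)
  then have cont: "continuous_on UNIV f" by (simp add: smooth_self_map_def)
  have L: "(local_rep c d f has_derivative ?L) (at (snd c p))"
    using local_rep_has_derivative[OF sm c(1) d(1) c(2) d(2)] .
  then have lin: "linear ?L" using has_derivative_bounded_linear bounded_linear.linear by blast
  have "?L v = 0 \<Longrightarrow> v = 0" for v
  proof -
    assume "?L v = 0"
    then have "area_form \<Sigma> c p v w = 0" for w
      using area_map_area_form[OF f c(1) d(1) c(2) d(2), of v w] by (simp add: area_form_def)
    from this[of "axis 1 1"] this[of "axis 2 1"] show "v = 0"
      using density_nz[OF c] by (simp add: area_form_def axis_def vec_eq_iff forall_2)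
  qed
  then have "inj ?L" using lin by (simp add: linear_injective_0)
  then have "surj ?L" using lin by (simp add: linear_injective_imp_surjective)
  show ?thesis
  proof (rule ham_vf_unique[OF d])
    fix w
    obtain v where v: "w = ?L v" using \<open>surj ?L\<close> by (metis surjD)
    have D2: "((H t \<circ> coord_inv d) has_derivative frechet_derivative (H t \<circ> coord_inv d) (at (snd d (f p)))) (at (snd d (f p)))"
      using smooth_open_has_derivative[OF ham_slice_smooth[OF H(1) t d(1)]] d(2) by blast
    have "(((H t \<circ> coord_inv d) \<circ> local_rep c d f) has_derivative
        (frechet_derivative (H t \<circ> coord_inv d) (at (snd d (f p))) \<circ> ?L)) (at (snd c p))"
      by (rule diff_chain_at[OF L]) (use D2 local_rep_chart[OF c] in simp)
    then have "(((\<lambda>x. H t (f x)) \<circ> coord_inv c) has_derivative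
        (frechet_derivative (H t \<circ> coord_inv d) (at (snd d (f p))) \<circ> ?L)) (at (snd c p))"
    proof (rule has_derivative_transform_within_open)
      show "open (snd c ` (fst c \<inter> f -` fst d))" by (rule local_dom_open[OF c(1) d(1) cont])
      show "snd c p \<in> snd c ` (fst c \<inter> f -` fst d)" using c d by blast
      fix y assume "y \<in> snd c ` (fst c \<inter> f -` fst d)"
      then show "((H t \<circ> coord_inv d) \<circ> local_rep c d f) y = ((\<lambda>x. H t (f x)) \<circ> coord_inv c) y"
        by (auto simp: local_rep_def coord_inv_chart[OF c(1)] coord_inv_chart[OF d(1)])
    qed
    from frechet_derivative_at[OF this]
    have "frechet_derivative ((\<lambda>x. H t (f x)) \<circ> coord_inv c) (at (snd c p)) v
        = frechet_derivative (H t \<circ> coord_inv d) (at (snd d (f p))) (?L v)" by (metis o_apply)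
    then show "area_form \<Sigma> d (f p) (?L ?X) w = - frechet_derivative (H t \<circ> coord_inv d) (at (snd d (f p))) w"
      using area_map_area_form[OF f c(1) d(1) c(2) d(2), of ?X v] ham_vf_formula(2)[OF H(2) t c, of v]
      by (simp add: v)
  qed
qed

lemma ham_compose_in_hamiltonians:
  assumes "\<psi> \<in> symp \<Sigma>" "H \<in> hamiltonians \<Sigma>"
  shows "(\<lambda>t x. H t (\<psi> x)) \<in> hamiltonians \<Sigma>"
    and "ham_support (\<lambda>t x. H t (\<psi> x)) \<subseteq> inv \<psi> ` ham_support H"
proof -
  have bij: "bij \<psi>" and sm: "smooth_self_map \<Sigma> \<psi>" and ci: "continuous_on UNIV (inv \<psi>)" and cp: "continuous_on UNIV \<psi>"
    using assms(1) by (auto simp: symp_def smooth_self_map_def)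
  have K: "compact (ham_support H)" using assms(2) by (simp add: hamiltonians_def)
  have K': "compact (inv \<psi> ` ham_support H)"
    by (rule compact_continuous_image[OF continuous_on_subset[OF ci] K]) simp
  show sup: "ham_support (\<lambda>t x. H t (\<psi> x)) \<subseteq> inv \<psi> ` ham_support H"
    unfolding ham_support_def
  proof (rule closure_minimal)
    show "{x. \<exists>t\<in>{0..1}. H t (\<psi> x) \<noteq> 0} \<subseteq> inv \<psi> ` closure {x. \<exists>t\<in>{0..1}. H t x \<noteq> 0}"
    proof
      fix x assume "x \<in> {x. \<exists>t\<in>{0..1}. H t (\<psi> x) \<noteq> 0}"
      then have "\<psi> x \<in> {x. \<exists>t\<in>{0..1}. H t x \<noteq> 0}" by simp
      then have "\<psi> x \<in> closure {x. \<exists>t\<in>{0..1}. H t x \<noteq> 0}" by (rule subsetD[OF closure_subset])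
      then have "inv \<psi> (\<psi> x) \<in> inv \<psi> ` closure {x. \<exists>t\<in>{0..1}. H t x \<noteq> 0}" by blast
      then show "x \<in> inv \<psi> ` closure {x. \<exists>t\<in>{0..1}. H t x \<noteq> 0}" using bij by (simp add: bij_is_inj)
    qed
    show "closed (inv \<psi> ` closure {x. \<exists>t\<in>{0..1}. H t x \<noteq> 0})"
      using K' unfolding ham_support_def by (rule compact_imp_closed)
  qed
  have "compact (ham_support (\<lambda>t x. H t (\<psi> x)))"
    using closed_Int_compact[OF _ K', of "ham_support (\<lambda>t x. H t (\<psi> x))"] sup
    by (simp add: ham_support_def Int_absorb2)
  moreover have "smooth_on ({0..1} \<times> snd c ` fst c) (ham_rep c (\<lambda>t x. H t (\<psi> x)))" if c: "c \<in> atlas \<Sigma>" for c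
  proof (rule smooth_on_local)
    fix z :: "real \<times> (real^2)" assume z: "z \<in> {0..1} \<times> snd c ` fst c"
    then obtain t p where tp: "z = (t, snd c p)" "p \<in> fst c" "t \<in> {0..1}" by auto
    obtain d where d: "d \<in> atlas \<Sigma>" "\<psi> p \<in> fst d" using chart_at .
    let ?O = "snd c ` (fst c \<inter> \<psi> -` fst d)"
    have O: "open ?O" using local_dom_open[OF c d(1) cp] by simp
    let ?S = "({0..1} \<times> snd c ` fst c) \<inter> (UNIV \<times> ?O)"
    \<comment> \<open>Smoothness is local: near \<open>p\<close> the composite is read off in a
      chart \<open>d\<close> around the image point, with the local representative of
      \<open>\<psi>\<close> in the space variable and the identity in time.\<close>
    have "smooth_on ?S (\<lambda>z. ham_rep d H (fst z, local_rep c d \<psi> (snd z)))"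
    proof (rule smooth_on_compose[where T="{0..1} \<times> snd d ` fst d"])
      show "smooth_on ({0..1} \<times> snd d ` fst d) (ham_rep d H)" using assms(2) d by (simp add: hamiltonians_def)
      have "smooth_on ?S (\<lambda>z. local_rep c d \<psi> (snd z))"
        by (rule smooth_on_compose[where T="?O"])
           (use smooth_open_imp_smooth_on[OF local_rep_smooth[OF sm c d(1)] order_refl] in \<open>auto intro: smooth_on_linear bounded_linear_snd\<close>)
      then show "smooth_on ?S (\<lambda>z. (fst z, local_rep c d \<psi> (snd z)))"
        by (rule smooth_on_Pair[OF smooth_on_linear[OF bounded_linear_fst]])
      show "(\<lambda>z. (fst z, local_rep c d \<psi> (snd z))) ` ?S \<subseteq> {0..1} \<times> snd d ` fst d"
        by (auto simp: local_rep_chart[OF c])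
    qed
    then have "smooth_on ?S (ham_rep c (\<lambda>t x. H t (\<psi> x)))"
      by (rule smooth_on_cong) (auto simp: ham_rep_def local_rep_def coord_inv_chart[OF c] coord_inv_chart[OF d(1)])
    moreover have "z \<in> UNIV \<times> ?O" using tp d by auto
    ultimately show "\<exists>W. open W \<and> z \<in> W \<and> smooth_on ({0..1} \<times> snd c ` fst c \<inter> W) (ham_rep c (\<lambda>t x. H t (\<psi> x)))"
      using O by (intro exI[of _ "UNIV \<times> ?O"]) (auto intro: open_Times)
  qed
  ultimately show "(\<lambda>t x. H t (\<psi> x)) \<in> hamiltonians \<Sigma>"
    using assms(2) unfolding hamiltonians_def by simp
qed

end

section \<open>Estimates for smooth functions and ordinary differential equations\<close>

lemma smooth_open_Lipschitz_cball:
  fixes g :: "'e::euclidean_space \<Rightarrow> 'f::real_normed_vector"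
  assumes "smooth_open U g" "cball z r \<subseteq> U"
  obtains C where "C \<ge> 0" "\<And>x y. x \<in> cball z r \<Longrightarrow> y \<in> cball z r \<Longrightarrow> norm (g x - g y) \<le> C * norm (x - y)"
    "\<And>x v. x \<in> cball z r \<Longrightarrow> norm (frechet_derivative g (at x) v) \<le> C * norm v"
proof -
  have "continuous_on (cball z r) (\<lambda>x. frechet_derivative g (at x) b)" for b
    using smooth_open_continuous_on[OF smooth_open_deriv[OF assms(1)]] assms(2) continuous_on_subset by blast
  then have "bounded ((\<lambda>x. frechet_derivative g (at x) b) ` cball z r)" for b
    by (intro compact_imp_bounded compact_continuous_image) auto
  then have "\<exists>M. \<forall>x\<in>cball z r. norm (frechet_derivative g (at x) b) \<le> M" for b
    by (force simp: bounded_iff)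
  then obtain M where M: "\<And>b x. x \<in> cball z r \<Longrightarrow> norm (frechet_derivative g (at x) b) \<le> M b" by metis
  let ?C = "\<Sum>b\<in>Basis. \<bar>M b\<bar>"
  have C0: "?C \<ge> 0" by (simp add: sum_nonneg)
  have D: "(g has_derivative frechet_derivative g (at x)) (at x)" if "x \<in> cball z r" for x
    using smooth_open_has_derivative[OF assms(1)] that assms(2) by blast
  have bd: "norm (frechet_derivative g (at x) v) \<le> ?C * norm v" if x: "x \<in> cball z r" for x v
  proof -
    interpret D: bounded_linear "frechet_derivative g (at x)" using D[OF x] by (rule has_derivative_bounded_linear)
    have "frechet_derivative g (at x) v = frechet_derivative g (at x) (\<Sum>b\<in>Basis. (v \<bullet> b) *\<^sub>R b)"
      by (simp add: euclidean_representation)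
    also have "\<dots> = (\<Sum>b\<in>Basis. (v \<bullet> b) *\<^sub>R frechet_derivative g (at x) b)"
      by (simp add: D.sum D.scaleR)
    also have "norm \<dots> \<le> (\<Sum>b\<in>Basis. \<bar>M b\<bar> * norm v)"
    proof (rule sum_norm_le)
      fix b :: 'e assume b: "b \<in> Basis"
      have "\<bar>v \<bullet> b\<bar> * norm (frechet_derivative g (at x) b) \<le> norm v * \<bar>M b\<bar>"
        using M[OF x, of b] Basis_le_norm[OF b, of v] by (intro mult_mono) auto
      then show "norm ((v \<bullet> b) *\<^sub>R frechet_derivative g (at x) b) \<le> \<bar>M b\<bar> * norm v"
        by (simp add: mult.commute)
    qed
    finally show ?thesis by (simp add: sum_distrib_right)
  qed
  have "norm (g x - g y) \<le> ?C * norm (x - y)" if "x \<in> cball z r" "y \<in> cball z r" for x y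
  proof (rule differentiable_bound[OF convex_cball[of z r] _ _ that(1) that(2)])
    show "(g has_derivative frechet_derivative g (at x)) (at x within cball z r)" if "x \<in> cball z r" for x
      using D[OF that] by (rule has_derivative_at_withinI)
    show "onorm (frechet_derivative g (at x)) \<le> ?C" if "x \<in> cball z r" for x
      using bd[OF that] by (intro onorm_bound C0)
  qed
  then show thesis using that[OF C0] bd by blast
qed

text \<open>The derivative is Lipschitz on the ball, so both partial increments of \<open>g\<close>
  on the segment from \<open>x\<close> to \<open>y\<close> are given, up to second order, by the
  same linear map, the derivative at \<open>x\<close>. In the convex combination the linear terms
  cancel.\<close>

lemma smooth_open_interpolation_cball:
  fixes g :: "'e::euclidean_space \<Rightarrow> 'f::real_normed_vector"
  assumes "smooth_open U g" "cball z r \<subseteq> U"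
  obtains C where "C \<ge> 0" "\<And>x y \<tau>. x \<in> cball z r \<Longrightarrow> y \<in> cball z r \<Longrightarrow> \<tau> \<in> {0..1} \<Longrightarrow>
     norm (g ((1 - \<tau>) *\<^sub>R x + \<tau> *\<^sub>R y) - ((1 - \<tau>) *\<^sub>R g x + \<tau> *\<^sub>R g y)) \<le> C * (norm (x - y))\<^sup>2"
proof -
  have "\<exists>C\<ge>0. \<forall>x\<in>cball z r. \<forall>y\<in>cball z r.
      norm (frechet_derivative g (at x) b - frechet_derivative g (at y) b) \<le> C * norm (x - y)" for b
    using smooth_open_Lipschitz_cball[OF smooth_open_deriv[OF assms(1)] assms(2), of b] by metis
  then obtain M where M0: "\<And>b. M b \<ge> 0" and
    M: "\<And>b x y. x \<in> cball z r \<Longrightarrow> y \<in> cball z r \<Longrightarrow>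
      norm (frechet_derivative g (at x) b - frechet_derivative g (at y) b) \<le> M b * norm (x - y)"
    by metis
  let ?L = "\<Sum>b\<in>Basis. M b"
  have L0: "?L \<ge> 0" using M0 by (simp add: sum_nonneg)
  have D: "(g has_derivative frechet_derivative g (at x)) (at x)" if "x \<in> cball z r" for x
    using smooth_open_has_derivative[OF assms(1)] that assms(2) by blast
  have bd: "norm (frechet_derivative g (at x) v - frechet_derivative g (at y) v) \<le> ?L * norm (x - y) * norm v"
    if x: "x \<in> cball z r" and y: "y \<in> cball z r" for x y v
  proof -
    let ?E = "\<lambda>v. frechet_derivative g (at x) v - frechet_derivative g (at y) v"
    interpret D: bounded_linear ?E
      using bounded_linear_sub[OF has_derivative_bounded_linear[OF D[OF x]] has_derivative_bounded_linear[OF D[OF y]]] .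
    have "?E v = ?E (\<Sum>b\<in>Basis. (v \<bullet> b) *\<^sub>R b)"
      by (simp add: euclidean_representation)
    also have "\<dots> = (\<Sum>b\<in>Basis. (v \<bullet> b) *\<^sub>R ?E b)"
      by (simp only: D.sum D.scaleR)
    also have "norm \<dots> \<le> (\<Sum>b\<in>Basis. M b * norm (x - y) * norm v)"
    proof (rule sum_norm_le)
      fix b :: 'e assume b: "b \<in> Basis"
      have "\<bar>v \<bullet> b\<bar> * norm (?E b) \<le> norm v * (M b * norm (x - y))"
        using M[OF x y, of b] Basis_le_norm[OF b, of v] by (intro mult_mono) auto
      then show "norm ((v \<bullet> b) *\<^sub>R ?E b) \<le> M b * norm (x - y) * norm v"
        by (simp add: mult.commute)
    qed
    finally show ?thesis by (simp add: sum_distrib_right)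
  qed
  have lin: "norm (g b - g a - frechet_derivative g (at x) (b - a)) \<le> norm (b - a) * (?L * R)"
    if x: "x \<in> cball z r" and S: "S \<subseteq> cball z r" "convex S" "a \<in> S" "b \<in> S" "x \<in> S"
      "\<And>w. w \<in> S \<Longrightarrow> norm (w - x) \<le> R" for x a b R S
  proof (rule differentiable_bound_linearization[where S=S])
    show "a + t *\<^sub>R (b - a) \<in> S" if "t \<in> {0..1}" for t
      using S(2-4) that convexD[OF S(2), of a b "1-t" t] by (simp add: algebra_simps)
    show "(g has_derivative frechet_derivative g (at w)) (at w within S)" if "w \<in> S" for w
      using D S(1) that has_derivative_at_withinI by blast
    show "onorm (frechet_derivative g (at w) - frechet_derivative g (at x)) \<le> ?L * R" if "w \<in> S" for w
      unfolding fun_diff_def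
    proof (rule onorm_bound)
      have "0 \<le> R" using S(6)[OF S(5)] by simp
      then show "0 \<le> ?L * R" using L0 by simp
      show "norm (frechet_derivative g (at w) v - frechet_derivative g (at x) v) \<le> ?L * R * norm v" for v
      proof -
        have "?L * norm (w - x) * norm v \<le> ?L * R * norm v"
          using S(6)[OF that] L0 by (intro mult_right_mono mult_left_mono) auto
        with bd[of w x v] x S(1) that show ?thesis by (meson order_trans subsetD)
      qed
    qed
    show "x \<in> S" by fact
  qed
  show thesis
  proof (rule that[of "2 * ?L"])
    show "0 \<le> 2 * ?L" using L0 by simp
    fix x y \<tau> assume xy: "x \<in> cball z r" "y \<in> cball z r" and t: "\<tau> \<in> {0..1::real}"
    let ?d = "norm (x - y)" and ?A = "frechet_derivative g (at x)"
    let ?S = "closed_segment x y" and ?w = "(1 - \<tau>) *\<^sub>R x + \<tau> *\<^sub>R y"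
    have S: "?S \<subseteq> cball z r" using xy closed_segment_subset by blast
    have w: "?w \<in> ?S" using t by (auto simp: in_segment)
    have R: "norm (v - x) \<le> ?d" if "v \<in> ?S" for v
      using segment_bound1[OF that] by (simp add: norm_minus_commute)
    interpret A: bounded_linear ?A using D[OF xy(1)] by (rule has_derivative_bounded_linear)
    have 1: "norm (g ?w - g x - ?A (?w - x)) \<le> norm (?w - x) * (?L * ?d)"
      by (rule lin[OF xy(1) S]) (use w R in auto)
    have 2: "norm (g y - g ?w - ?A (y - ?w)) \<le> norm (y - ?w) * (?L * ?d)"
      by (rule lin[OF xy(1) S]) (use w R in auto)
    have wx: "?w - x = \<tau> *\<^sub>R (y - x)" "y - ?w = (1 - \<tau>) *\<^sub>R (y - x)" by (simp_all add: algebra_simps)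
    \<comment> \<open>The two linear terms are both \<open>\<tau> * (1 - \<tau>)\<close> times the
      derivative at \<open>x\<close> applied to \<open>y - x\<close>, with opposite signs.\<close>
    have eq: "g ?w - ((1 - \<tau>) *\<^sub>R g x + \<tau> *\<^sub>R g y)
      = (1 - \<tau>) *\<^sub>R (g ?w - g x - ?A (?w - x)) - \<tau> *\<^sub>R (g y - g ?w - ?A (y - ?w))"
      unfolding wx A.scaleR by (simp add: algebra_simps)
    have "norm (g ?w - ((1 - \<tau>) *\<^sub>R g x + \<tau> *\<^sub>R g y))
       \<le> (1 - \<tau>) * norm (g ?w - g x - ?A (?w - x)) + \<tau> * norm (g y - g ?w - ?A (y - ?w))"
      unfolding eq using t by (intro order_trans[OF norm_triangle_ineq4]) simp
    also have "\<dots> \<le> 1 * (?d * (?L * ?d)) + 1 * (?d * (?L * ?d))"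
    proof (intro add_mono mult_mono)
      have "norm (?w - x) * (?L * ?d) \<le> ?d * (?L * ?d)"
        using w R L0 by (intro mult_right_mono) auto
      with 1 show "norm (g ?w - g x - ?A (?w - x)) \<le> ?d * (?L * ?d)" by linarith
      have "norm (y - ?w) \<le> ?d" unfolding wx using t mult_right_mono[of "1-\<tau>" 1 "norm (y-x)"] by (simp add: norm_minus_commute)
      then have "norm (y - ?w) * (?L * ?d) \<le> ?d * (?L * ?d)"
        using L0 by (intro mult_right_mono) auto
      with 2 show "norm (g y - g ?w - ?A (y - ?w)) \<le> ?d * (?L * ?d)" by linarith
    qed (use t in auto)
    finally show "norm (g ?w - ((1 - \<tau>) *\<^sub>R g x + \<tau> *\<^sub>R g y)) \<le> 2 * ?L * ?d\<^sup>2"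
      by (simp add: power2_eq_square algebra_simps)
  qed
qed

text \<open>For points closer than a Lebesgue number, a local smooth extension on a ball gives both
  bounds. For the remaining pairs the left sides are bounded because \<open>f\<close> is, and the
  distance is bounded below. \<open>K\<close> need not be convex, so the interpolated point is
  required to lie in \<open>K\<close>.\<close>

lemma smooth_on_compact_estimates:
  fixes f :: "'e::euclidean_space \<Rightarrow> 'f::real_normed_vector"
  assumes "smooth_on S f" "compact K" "K \<subseteq> S"
  obtains C where "C \<ge> 0" "\<And>x y. x \<in> K \<Longrightarrow> y \<in> K \<Longrightarrow> norm (f x - f y) \<le> C * norm (x - y)"
    "\<And>x y \<tau>. x \<in> K \<Longrightarrow> y \<in> K \<Longrightarrow> \<tau> \<in> {0..1} \<Longrightarrow> (1 - \<tau>) *\<^sub>R x + \<tau> *\<^sub>R y \<in> K \<Longrightarrow>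
     norm (f ((1 - \<tau>) *\<^sub>R x + \<tau> *\<^sub>R y) - ((1 - \<tau>) *\<^sub>R f x + \<tau> *\<^sub>R f y)) \<le> C * (norm (x - y))\<^sup>2"
proof (cases "K = {}")
  case True
  show thesis by (rule that[of 0]) (use True in auto)
next
  case False
  define Q where "Q r C z \<longleftrightarrow> r > 0 \<and> C \<ge> 0 \<and> (\<forall>x\<in>K \<inter> ball z r. \<forall>y\<in>K \<inter> ball z r. norm (f x - f y) \<le> C * norm (x - y) \<and>
     (\<forall>\<tau>\<in>{0..1}. (1 - \<tau>) *\<^sub>R x + \<tau> *\<^sub>R y \<in> K \<longrightarrow>
     norm (f ((1 - \<tau>) *\<^sub>R x + \<tau> *\<^sub>R y) - ((1 - \<tau>) *\<^sub>R f x + \<tau> *\<^sub>R f y)) \<le> C * (norm (x - y))\<^sup>2))" for r C z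
  have "\<exists>r C. Q r C z" if z: "z \<in> K" for z
  proof -
    obtain U g where U: "z \<in> U" "smooth_open U g" "\<forall>y\<in>U \<inter> S. g y = f y"
      using assms(1,3) z unfolding smooth_on_iff by (meson subsetD)
    obtain r where r: "r > 0" "cball z r \<subseteq> U" using U unfolding smooth_open_def by (meson open_contains_cball)
    obtain C1 where C1: "C1 \<ge> 0" "\<And>x y. x \<in> cball z r \<Longrightarrow> y \<in> cball z r \<Longrightarrow> norm (g x - g y) \<le> C1 * norm (x - y)"
      using smooth_open_Lipschitz_cball[OF U(2) r(2)] by metis
    obtain C2 where C2: "C2 \<ge> 0" "\<And>x y \<tau>. x \<in> cball z r \<Longrightarrow> y \<in> cball z r \<Longrightarrow> \<tau> \<in> {0..1} \<Longrightarrow>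
     norm (g ((1 - \<tau>) *\<^sub>R x + \<tau> *\<^sub>R y) - ((1 - \<tau>) *\<^sub>R g x + \<tau> *\<^sub>R g y)) \<le> C2 * (norm (x - y))\<^sup>2"
      using smooth_open_interpolation_cball[OF U(2) r(2)] by metis
    have gf: "g x = f x" if "x \<in> K" "x \<in> cball z r" for x
      using U(3) r(2) assms(3) that by blast
    have "Q r (C1 + C2) z"
      unfolding Q_def
    proof (intro conjI ballI impI)
      show "r > 0" "0 \<le> C1 + C2" using r C1 C2 by auto
      fix x y assume x: "x \<in> K \<inter> ball z r" and y: "y \<in> K \<inter> ball z r"
      then have xc: "x \<in> cball z r" "y \<in> cball z r" by auto
      have "norm (f x - f y) \<le> C1 * norm (x - y)"
        using C1(2)[OF xc] gf x y xc by simp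
      also have "\<dots> \<le> (C1 + C2) * norm (x - y)" using C2 by (intro mult_right_mono) auto
      finally show "norm (f x - f y) \<le> (C1 + C2) * norm (x - y)" .
      fix \<tau> :: real assume t: "\<tau> \<in> {0..1}" and k: "(1 - \<tau>) *\<^sub>R x + \<tau> *\<^sub>R y \<in> K"
      have "(1 - \<tau>) *\<^sub>R x + \<tau> *\<^sub>R y \<in> cball z r"
        using convexD[OF convex_cball xc, of "1-\<tau>" \<tau>] t by simp
      then have "norm (f ((1 - \<tau>) *\<^sub>R x + \<tau> *\<^sub>R y) - ((1 - \<tau>) *\<^sub>R f x + \<tau> *\<^sub>R f y)) \<le> C2 * (norm (x - y))\<^sup>2"
        using C2(2)[OF xc t] gf x y xc k by simp
      also have "\<dots> \<le> (C1 + C2) * (norm (x - y))\<^sup>2" using C1 by (intro mult_right_mono) auto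
      finally show "norm (f ((1 - \<tau>) *\<^sub>R x + \<tau> *\<^sub>R y) - ((1 - \<tau>) *\<^sub>R f x + \<tau> *\<^sub>R f y)) \<le> (C1 + C2) * (norm (x - y))\<^sup>2" .
    qed
    then show ?thesis by blast
  qed
  then obtain r C where Q: "\<And>z. z \<in> K \<Longrightarrow> Q (r z) (C z) z" by metis
  have cover: "K \<subseteq> (\<Union>z\<in>K. ball z (r z))" using Q by (force simp: Q_def)
  obtain F where F': "F \<subseteq> K" "finite F" "K \<subseteq> (\<Union>z\<in>F. ball z (r z))"
    by (rule compactE_image[OF assms(2) _ cover]) auto
  note F = F'(2,1,3)
  have "(\<lambda>z. ball z (r z)) ` F \<noteq> {}" using F(3) False by auto
  then obtain \<delta> where \<delta>: "\<delta> > 0" "\<And>T. T \<subseteq> K \<Longrightarrow> diameter T < \<delta> \<Longrightarrow> \<exists>B\<in>(\<lambda>z. ball z (r z)) ` F. T \<subseteq> B"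
    by (rule Lebesgue_number_lemma[OF assms(2) _ F(3)]) auto
  have "bounded (f ` K)"
    by (intro compact_imp_bounded compact_continuous_image assms(2) continuous_on_subset[OF smooth_on_imp_continuous_on[OF assms(1)] assms(3)])
  then obtain M where M: "\<And>x. x \<in> K \<Longrightarrow> norm (f x) \<le> M" by (auto simp: bounded_iff)
  obtain z0 where "z0 \<in> K" using False by blast
  then have M0: "M \<ge> 0" using M[of z0] norm_ge_zero order_trans by blast
  \<comment> \<open>The sum dominates every local constant; the other two terms serve the pairs at
    distance at least \<open>\<delta>\<close> in the first and in the second estimate.\<close>
  define CC where "CC = (\<Sum>z\<in>F. C z) + 2 * M / \<delta> + 2 * M / \<delta>\<^sup>2"
  have CF: "C z \<le> CC" if "z \<in> F" for z
  proof -
    have "C z \<le> (\<Sum>z\<in>F. C z)" using F Q that by (intro member_le_sum) (auto simp: Q_def)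
    then show ?thesis using M0 \<delta>(1) unfolding CC_def by (simp add: add_increasing2)
  qed
  have SF: "(\<Sum>z\<in>F. C z) \<ge> 0" using F Q by (intro sum_nonneg) (auto simp: Q_def)
  have CC1: "2 * M / \<delta> \<le> CC" "2 * M / \<delta>\<^sup>2 \<le> CC" "CC \<ge> 0"
    using SF M0 \<delta>(1) unfolding CC_def by (auto simp: add_increasing add_increasing2)
  have near: "\<exists>z\<in>F. x \<in> K \<inter> ball z (r z) \<and> y \<in> K \<inter> ball z (r z)" if "x \<in> K" "y \<in> K" "norm (x - y) < \<delta>" for x y
  proof -
    have "diameter {x,y} \<le> norm (x - y)" by (rule diameter_le) (auto simp: norm_minus_commute)
    then show ?thesis using \<delta>(2)[of "{x,y}"] that by auto
  qed
  show thesis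
  proof (rule that[OF CC1(3)])
    fix x y assume x: "x \<in> K" and y: "y \<in> K"
    show "norm (f x - f y) \<le> CC * norm (x - y)"
    proof (cases "norm (x - y) < \<delta>")
      case True
      obtain z where z: "z \<in> F" "x \<in> K \<inter> ball z (r z)" "y \<in> K \<inter> ball z (r z)" using near[OF x y True] by blast
      then have "norm (f x - f y) \<le> C z * norm (x - y)" using Q[of z] F(2) unfolding Q_def by blast
      also have "\<dots> \<le> CC * norm (x - y)" using CF[OF z(1)] by (intro mult_right_mono) auto
      finally show ?thesis .
    next
      case False
      have "norm (f x - f y) \<le> 2 * M" using norm_triangle_ineq4[of "f x" "f y"] M[OF x] M[OF y] by linarith
      also have "\<dots> = 2 * M / \<delta> * \<delta>" using \<delta>(1) by simp
      also have "\<dots> \<le> CC * norm (x - y)" using False CC1 \<delta>(1) by (intro mult_mono) auto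
      finally show ?thesis .
    qed
    fix \<tau> :: real assume t: "\<tau> \<in> {0..1}" and k: "(1 - \<tau>) *\<^sub>R x + \<tau> *\<^sub>R y \<in> K"
    show "norm (f ((1 - \<tau>) *\<^sub>R x + \<tau> *\<^sub>R y) - ((1 - \<tau>) *\<^sub>R f x + \<tau> *\<^sub>R f y)) \<le> CC * (norm (x - y))\<^sup>2"
    proof (cases "norm (x - y) < \<delta>")
      case True
      obtain z where z: "z \<in> F" "x \<in> K \<inter> ball z (r z)" "y \<in> K \<inter> ball z (r z)" using near[OF x y True] by blast
      then have "norm (f ((1 - \<tau>) *\<^sub>R x + \<tau> *\<^sub>R y) - ((1 - \<tau>) *\<^sub>R f x + \<tau> *\<^sub>R f y)) \<le> C z * (norm (x - y))\<^sup>2"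
        using Q[of z] F(2) t k unfolding Q_def by blast
      also have "\<dots> \<le> CC * (norm (x - y))\<^sup>2" using CF[OF z(1)] by (intro mult_right_mono) auto
      finally show ?thesis .
    next
      case False
      have "norm ((1 - \<tau>) *\<^sub>R f x + \<tau> *\<^sub>R f y) \<le> (1 - \<tau>) * norm (f x) + \<tau> * norm (f y)"
        using norm_triangle_ineq[of "(1 - \<tau>) *\<^sub>R f x" "\<tau> *\<^sub>R f y"] t by simp
      also have "\<dots> \<le> (1 - \<tau>) * M + \<tau> * M" using M[OF x] M[OF y] t by (intro add_mono mult_left_mono) auto
      finally have "norm (f ((1 - \<tau>) *\<^sub>R x + \<tau> *\<^sub>R y) - ((1 - \<tau>) *\<^sub>R f x + \<tau> *\<^sub>R f y)) \<le> 2 * M"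
        using M[OF k] norm_triangle_ineq4[of "f ((1 - \<tau>) *\<^sub>R x + \<tau> *\<^sub>R y)" "(1 - \<tau>) *\<^sub>R f x + \<tau> *\<^sub>R f y"]
        by (simp add: algebra_simps)
      also have "\<dots> = 2 * M / \<delta>\<^sup>2 * \<delta>\<^sup>2" using \<delta>(1) by simp
      also have "\<dots> \<le> CC * (norm (x - y))\<^sup>2" using False CC1 \<delta>(1) by (intro mult_mono power_mono) auto
      finally show ?thesis .
    qed
  qed
qed

section \<open>Ordinary differential equations\<close>

lemma gronwall:
  fixes y y' :: "real \<Rightarrow> 'e::real_inner"
  assumes d: "\<And>t. t \<in> {a..b} \<Longrightarrow> (y has_vector_derivative v t) (at t within {a..b})"
    "\<And>t. t \<in> {a..b} \<Longrightarrow> (y' has_vector_derivative v' t) (at t within {a..b})"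
    and L: "\<And>t. t \<in> {a..b} \<Longrightarrow> norm (v t - v' t) \<le> L * norm (y t - y' t)" "L \<ge> 0"
    and t: "t1 \<in> {a..b}" "t2 \<in> {a..b}"
  shows "norm (y t2 - y' t2) \<le> exp (L * (b - a)) * norm (y t1 - y' t1)"
proof -
  \<comment> \<open>The squared distance is differentiable also where the curves meet, unlike the
    distance itself.\<close>
  define \<phi> where "\<phi> t = (y t - y' t) \<bullet> (y t - y' t)" for t
  have \<phi>d: "((\<lambda>t. exp (k * t) * \<phi> t) has_derivative
      (\<lambda>h. h * (exp (k * t) * (k * \<phi> t + 2 * ((y t - y' t) \<bullet> (v t - v' t)))))) (at t within {a..b})"
    if "t \<in> {a..b}" for t k
    unfolding \<phi>_def
    by (rule has_derivative_eq_rhs, rule derivative_intros d(1,2)[OF that, unfolded has_vector_derivative_def] | rule refl)+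
       (auto simp: fun_eq_iff algebra_simps inner_commute)
  have bnd: "\<bar>2 * ((y t - y' t) \<bullet> (v t - v' t))\<bar> \<le> 2 * L * \<phi> t" if "t \<in> {a..b}" for t
  proof -
    have "\<bar>(y t - y' t) \<bullet> (v t - v' t)\<bar> \<le> norm (y t - y' t) * norm (v t - v' t)" by (rule Cauchy_Schwarz_ineq2)
    also have "\<dots> \<le> norm (y t - y' t) * (L * norm (y t - y' t))" using L(1)[OF that] by (intro mult_left_mono) auto
    also have "\<dots> = L * \<phi> t" by (simp add: \<phi>_def dot_square_norm power2_eq_square)
    finally show ?thesis by (simp add: abs_mult)
  qed
  \<comment> \<open>By \<open>bnd\<close>, \<open>exp (- 2 * L * t) * \<phi> t\<close> decreases and
    \<open>exp (2 * L * t) * \<phi> t\<close> increases in \<open>t\<close>. The first gives the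
    bound forwards in time, the second backwards, so \<open>t1\<close> and \<open>t2\<close> may
    come in either order.\<close>
  have mono: "exp (k * s') * \<phi> s' \<le> exp (k * s) * \<phi> s" if "(k = - 2 * L \<and> s \<le> s') \<or> (k = 2 * L \<and> s' \<le> s)" and sab: "s \<in> {a..b}" "s' \<in> {a..b}" for k s s'
  proof -
    have *: "\<exists>x\<in>{p..q}. exp (k * q) * \<phi> q - exp (k * p) * \<phi> p = (q - p) * (exp (k * x) * (k * \<phi> x + 2 * ((y x - y' x) \<bullet> (v x - v' x))))"
      if "p \<le> q" "p \<in> {a..b}" "q \<in> {a..b}" for p q
    proof (rule mvt_very_simple[OF that(1)])
      fix x assume "p \<le> x" "x \<le> q"
      then show "((\<lambda>t. exp (k * t) * \<phi> t) has_derivative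
      (\<lambda>h. h * (exp (k * x) * (k * \<phi> x + 2 * ((y x - y' x) \<bullet> (v x - v' x)))))) (at x within {p..q})"
        using that by (intro has_derivative_subset[OF \<phi>d]) auto
    qed
    show ?thesis
    proof (cases "s \<le> s'")
      case True
      then obtain x where x: "x \<in> {s..s'}" "exp (k * s') * \<phi> s' - exp (k * s) * \<phi> s = (s' - s) * (exp (k * x) * (k * \<phi> x + 2 * ((y x - y' x) \<bullet> (v x - v' x))))"
        using *[OF True sab] by blast
      have "s = s' \<or> k * \<phi> x + 2 * ((y x - y' x) \<bullet> (v x - v' x)) \<le> 0"
        using that sab x(1) True bnd[of x] by auto
      then have "(s' - s) * (exp (k * x) * (k * \<phi> x + 2 * ((y x - y' x) \<bullet> (v x - v' x)))) \<le> 0"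
        using True by (auto simp: mult_nonneg_nonpos)
      with x(2) show ?thesis by linarith
    next
      case False
      then have le: "s' \<le> s" and k: "k = 2 * L" using that by auto
      then obtain x where x: "x \<in> {s'..s}" "exp (k * s) * \<phi> s - exp (k * s') * \<phi> s' = (s - s') * (exp (k * x) * (k * \<phi> x + 2 * ((y x - y' x) \<bullet> (v x - v' x))))"
        using *[OF le sab(2,1)] by blast
      have "k * \<phi> x + 2 * ((y x - y' x) \<bullet> (v x - v' x)) \<ge> 0"
        using sab x(1) bnd[of x] k by auto
      then have "(s - s') * (exp (k * x) * (k * \<phi> x + 2 * ((y x - y' x) \<bullet> (v x - v' x)))) \<ge> 0"
        using le by simp
      with x(2) show ?thesis by linarith
    qed
  qed
  have "\<phi> t2 \<le> exp (2 * L * \<bar>t2 - t1\<bar>) * \<phi> t1"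
  proof (cases "t1 \<le> t2")
    case True
    have "exp (- 2 * L * t2) * \<phi> t2 \<le> exp (- 2 * L * t1) * \<phi> t1" by (rule mono) (use True t in auto)
    then have "exp (2 * L * t2) * (exp (- 2 * L * t2) * \<phi> t2) \<le> exp (2 * L * t2) * (exp (- 2 * L * t1) * \<phi> t1)" by simp
    moreover have "exp (2 * L * t2) * exp (- 2 * L * t2) = 1" "exp (2 * L * t2) * exp (- 2 * L * t1) = exp (2 * L * (t2 - t1))"
      unfolding exp_add[symmetric] by (simp_all add: right_diff_distrib)
    ultimately show ?thesis using True unfolding mult.assoc[symmetric] by (simp only: mult_1 abs_of_nonneg diff_ge_0_iff_ge)
  next
    case False
    have "exp (2 * L * t2) * \<phi> t2 \<le> exp (2 * L * t1) * \<phi> t1" by (rule mono) (use False t in auto)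
    then have "exp (- 2 * L * t2) * (exp (2 * L * t2) * \<phi> t2) \<le> exp (- 2 * L * t2) * (exp (2 * L * t1) * \<phi> t1)" by simp
    moreover have "exp (- 2 * L * t2) * exp (2 * L * t2) = 1" "exp (- 2 * L * t2) * exp (2 * L * t1) = exp (2 * L * (t1 - t2))"
      unfolding exp_add[symmetric] by (simp_all add: right_diff_distrib)
    moreover have "\<bar>t2 - t1\<bar> = t1 - t2" using False by simp
    ultimately show ?thesis unfolding mult.assoc[symmetric] by (simp only: mult_1)
  qed
  also have "\<dots> \<le> exp (2 * L * (b - a)) * \<phi> t1"
    using t L(2) by (intro mult_right_mono) (auto simp: \<phi>_def intro!: mult_left_mono)
  also have "\<dots> = (exp (L * (b - a)) * norm (y t1 - y' t1))\<^sup>2"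
    by (simp add: \<phi>_def dot_square_norm power_mult_distrib exp_double[symmetric] mult.assoc)
  finally have "(norm (y t2 - y' t2))\<^sup>2 \<le> (exp (L * (b - a)) * norm (y t1 - y' t1))\<^sup>2"
    by (simp add: \<phi>_def dot_square_norm)
  then show ?thesis by (rule power2_le_imp_le) simp
qed

text \<open>The field is extended to all times and all points by clamping the time and projecting to
  the ball. The integral operator then acts on the whole space of bounded continuous functions,
  where Banach's theorem applies directly. Since \<open>y0\<close> is within \<open>r/2\<close> of
  the centre and \<open>h * M \<le> r/2\<close>, the fixed point stays in the ball, where the
  extension equals \<open>X\<close>.\<close>

lemma picard_lindelof:
  fixes X :: "real \<Rightarrow> 'e::euclidean_space \<Rightarrow> 'e"
  assumes cont: "continuous_on ({t0..t0+h} \<times> cball q r) (\<lambda>(t,y). X t y)"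
    and Lip: "\<And>t y y'. t \<in> {t0..t0+h} \<Longrightarrow> y \<in> cball q r \<Longrightarrow> y' \<in> cball q r \<Longrightarrow>
      norm (X t y - X t y') \<le> L * norm (y - y')"
    and bd: "\<And>t y. t \<in> {t0..t0+h} \<Longrightarrow> y \<in> cball q r \<Longrightarrow> norm (X t y) \<le> M"
    and h: "h \<ge> 0" "h * L \<le> 1/2" "h * M \<le> r/2" and L: "L \<ge> 0" and r: "r > 0" and y0: "dist q y0 \<le> r/2"
  obtains y where "y t0 = y0" "\<And>t. t \<in> {t0..t0+h} \<Longrightarrow> y t \<in> cball q r"
    "\<And>t. t \<in> {t0..t0+h} \<Longrightarrow> (y has_vector_derivative X t (y t)) (at t within {t0..t0+h})"
proof -
  define cl where "cl t = max t0 (min (t0 + h) t)" for t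
  define pr where "pr = closest_point (cball q r)"
  define Z where "Z s y = X (cl s) (pr y)" for s y
  have cl: "cl t \<in> {t0..t0+h}" for t using h(1) by (auto simp: cl_def)
  have cl_id: "cl t = t" if "t \<in> {t0..t0+h}" for t using that by (auto simp: cl_def)
  have ne: "cball q r \<noteq> {}" using r by auto
  have pr: "pr y \<in> cball q r" for y unfolding pr_def by (rule closest_point_in_set) (use r in auto)
  have pr_id: "pr y = y" if "y \<in> cball q r" for y unfolding pr_def using that by (rule closest_point_self)
  have prL: "dist (pr y) (pr z) \<le> dist y z" for y z
    unfolding pr_def by (rule closest_point_lipschitz) (use ne in auto)
  have ccl: "continuous_on UNIV cl" unfolding cl_def by (intro continuous_intros)
  have cpr: "continuous_on UNIV pr" unfolding pr_def by (rule continuous_on_closest_point) (use ne in auto)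
  have ZL: "norm (Z s y - Z s z) \<le> L * norm (y - z)" for s y z
    using Lip[OF cl[of s] pr[of y] pr[of z]] mult_left_mono[OF prL[of y z] L] unfolding Z_def dist_norm by linarith
  have Zb: "norm (Z s y) \<le> M" for s y unfolding Z_def using bd[OF cl pr] .
  have M0: "M \<ge> 0" using Zb norm_ge_zero order_trans by blast
  have Zc: "continuous_on A (\<lambda>s. Z s (y s))" if "continuous_on UNIV y" for A y
  proof -
    have "continuous_on UNIV (\<lambda>s. (cl s, pr (y s)))"
      by (intro continuous_on_Pair ccl continuous_on_compose2[OF cpr that]) auto
    moreover have "(\<lambda>s. (cl s, pr (y s))) ` UNIV \<subseteq> {t0..t0+h} \<times> cball q r" using cl pr by blast
    ultimately have "continuous_on UNIV (\<lambda>s. Z s (y s))"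
      using continuous_on_compose2[OF cont, of UNIV "\<lambda>s. (cl s, pr (y s))"] unfolding Z_def by simp
    then show ?thesis by (rule continuous_on_subset) simp
  qed
  define T where "T y t = y0 + integral {t0..cl t} (\<lambda>s. Z s (y s))" for y t
  have Tbd: "norm (T y t - y0) \<le> h * M" if "continuous_on UNIV y" for y t
  proof -
    have "norm (integral {t0..cl t} (\<lambda>s. Z s (y s))) \<le> M * (cl t - t0)"
      by (rule integral_bound) (use cl[of t] Zc[OF that] Zb in auto)
    also have "\<dots> \<le> M * h" using cl[of t] M0 by (intro mult_left_mono) auto
    finally show ?thesis by (simp add: T_def mult.commute)
  qed
  have Tcont: "continuous_on UNIV (T y)" if "continuous_on UNIV y" for y
  proof -
    have "continuous_on {t0..t0+h} (\<lambda>u. integral {t0..u} (\<lambda>s. Z s (y s)))"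
      by (rule indefinite_integral_continuous_1[OF integrable_continuous_real[OF Zc[OF that]]])
    then have "continuous_on UNIV (\<lambda>t. integral {t0..cl t} (\<lambda>s. Z s (y s)))"
      by (rule continuous_on_compose2[OF _ ccl]) (use cl in blast)
    then show ?thesis unfolding T_def by (intro continuous_intros)
  qed
  have Tb: "T y \<in> bcontfun" if "continuous_on UNIV y" for y
  proof (rule bcontfun_normI[OF Tcont[OF that]])
    show "norm (T y t) \<le> norm y0 + h * M" for t
      using Tbd[OF that, of t] norm_triangle_ineq2[of "T y t" y0] by linarith
  qed
  define TT where "TT y = Bcontfun (T (apply_bcontfun y))" for y :: "real \<Rightarrow>\<^sub>C 'e"
  have TT: "apply_bcontfun (TT y) = T (apply_bcontfun y)" for y
    unfolding TT_def by (rule Bcontfun_inverse) (rule Tb, simp)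
  \<comment> \<open>The contraction constant is the bound on \<open>h * L\<close>.\<close>
  have "dist (TT y) (TT z) \<le> 1/2 * dist y z" for y z
  proof (rule dist_bound)
    fix t
    have "integral {t0..cl t} (\<lambda>s. Z s (y s)) - integral {t0..cl t} (\<lambda>s. Z s (z s)) =
       integral {t0..cl t} (\<lambda>s. Z s (y s) - Z s (z s))"
      by (rule integral_diff[symmetric]; rule integrable_continuous_real; rule Zc) simp_all
    moreover have "norm (integral {t0..cl t} (\<lambda>s. Z s (y s) - Z s (z s))) \<le> (L * dist y z) * (cl t - t0)"
    proof (rule integral_bound)
      show "t0 \<le> cl t" using cl[of t] by simp
      show "continuous_on {t0..cl t} (\<lambda>s. Z s (y s) - Z s (z s))"
        by (intro continuous_on_diff Zc) simp_all
      show "norm (Z s (y s) - Z s (z s)) \<le> L * dist y z" for s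
        using ZL[of s "y s" "z s"] mult_left_mono[OF dist_bounded[of y s z] L] unfolding dist_norm by linarith
    qed
    moreover have "(L * dist y z) * (cl t - t0) \<le> (L * dist y z) * h"
      using cl[of t] L by (intro mult_left_mono) auto
    moreover have "(L * dist y z) * h \<le> 1/2 * dist y z"
      using mult_right_mono[OF h(2), of "dist y z"] by (simp add: mult.commute mult.left_commute)
    ultimately show "dist (apply_bcontfun (TT y) t) (apply_bcontfun (TT z) t) \<le> 1/2 * dist y z"
      unfolding TT T_def dist_norm by simp
  qed
  then obtain y where "TT y = y" using banach_fix_type[of "1/2" TT] by auto
  then have y: "apply_bcontfun y t = T (apply_bcontfun y) t" for t using TT by metis
  have yc: "continuous_on UNIV (apply_bcontfun y)" by simp
  have in_ball: "apply_bcontfun y t \<in> cball q r" for t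
  proof -
    have "dist y0 (apply_bcontfun y t) \<le> r/2"
      using Tbd[OF yc, of t] h(3) unfolding y[of t] dist_norm norm_minus_commute[of y0] by linarith
    then show ?thesis using y0 dist_triangle[of q "apply_bcontfun y t" y0] by simp
  qed
  show thesis
  proof (rule that[of "apply_bcontfun y"])
    show "apply_bcontfun y t0 = y0" unfolding y[of t0] T_def using cl_id[of t0] h(1) by simp
    show "apply_bcontfun y t \<in> cball q r" for t by (rule in_ball)
    fix t assume t: "t \<in> {t0..t0+h}"
    have "((\<lambda>u. y0 + integral {t0..u} (\<lambda>s. Z s (y s))) has_vector_derivative Z t (y t)) (at t within {t0..t0+h})"
      using has_vector_derivative_add[OF has_vector_derivative_const integral_has_vector_derivative[OF Zc[OF yc] t], of y0] by simp
    then have "(apply_bcontfun y has_vector_derivative Z t (y t)) (at t within {t0..t0+h})"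
    proof (rule has_vector_derivative_transform[OF t, rotated])
      fix x assume x: "x \<in> {t0..t0+h}"
      show "apply_bcontfun y x = y0 + integral {t0..x} (\<lambda>s. Z s (y s))"
        unfolding y[of x] T_def cl_id[OF x] ..
    qed
    then show "(apply_bcontfun y has_vector_derivative X t (y t)) (at t within {t0..t0+h})"
      by (simp add: Z_def cl_id[OF t] pr_id[OF in_ball])
  qed
qed

section \<open>Hamiltonian trajectories\<close>

lemma continuous_on_near:
  fixes f :: "'m::metric_space \<Rightarrow> 'b::topological_space"
  assumes "continuous_on S f" "t \<in> S" "open B" "f t \<in> B"
  obtains \<delta> where "\<delta> > 0" "\<And>t'. t' \<in> S \<Longrightarrow> dist t' t < \<delta> \<Longrightarrow> f t' \<in> B"
proof -
  obtain A where A: "open A" "t \<in> A" "\<forall>y\<in>S. y \<in> A \<longrightarrow> f y \<in> B"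
    using assms unfolding continuous_on_topological by meson
  then obtain e where "e > 0" "ball t e \<subseteq> A" using openE by blast
  then show thesis using that[of e] A(3) by (auto simp: subset_iff dist_commute)
qed

lemma has_derivative_within_Un:
  assumes "(f has_derivative D) (at x within S)" "(f has_derivative D) (at x within T)"
  shows "(f has_derivative D) (at x within (S \<union> T))"
  using assms unfolding has_derivative_within by (simp add: Lim_within_Un)

text \<open>Away from a closed set the filter within it is trivial. When two trajectories are glued,
  this disposes of the half interval that does not contain the time considered.\<close>

lemma has_derivative_within_trivial:
  assumes "bounded_linear D" "closed S" "x \<notin> S"
  shows "(f has_derivative D) (at x within S)"
proof -
  have "at x within S = bot" using assms(2,3) by (simp add: at_within_eq_bot_iff)
  then show ?thesis using assms(1) by (simp add: has_derivative_def)
qed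

context area_surface begin

definition vf :: "'a chart \<Rightarrow> (real \<Rightarrow> 'a \<Rightarrow> real) \<Rightarrow> real \<times> (real^2) \<Rightarrow> real^2" where
  "vf c H = (\<lambda>(t,y). ham_vf \<Sigma> H t c (coord_inv c y))"

lemma vf_chart: "c \<in> atlas \<Sigma> \<Longrightarrow> p \<in> fst c \<Longrightarrow> vf c H (t, snd c p) = ham_vf \<Sigma> H t c p"
  by (simp add: vf_def coord_inv_chart)

text \<open>A local smooth extension \<open>g\<close> of the Hamiltonian in time and coordinates
  yields one of the vector field: solving the linear equation expresses the field through the space
  derivatives of \<open>g\<close> divided by the density.\<close>

lemma vf_smooth:
  assumes H: "H \<in> hamiltonians \<Sigma>" and c: "c \<in> atlas \<Sigma>"
  shows "smooth_on ({0..1} \<times> snd c ` fst c) (vf c H)"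
  unfolding smooth_on_iff
proof
  let ?I = "snd c ` fst c"
  fix z assume z: "z \<in> {0..1::real} \<times> ?I"
  have "smooth_on ({0..1} \<times> ?I) (ham_rep c H)" using H c by (simp add: hamiltonians_def)
  then obtain U g where U: "z \<in> U" "smooth_open U g" "\<forall>y\<in>U \<inter> ({0..1} \<times> ?I). g y = ham_rep c H y"
    using z unfolding smooth_on_iff by blast
  let ?V = "U \<inter> (UNIV \<times> ?I)"
  have oV: "open ?V" using U open_img[OF c] by (auto simp: smooth_open_def intro: open_Times)
  have gV: "smooth_open ?V g" by (rule smooth_open_subset[OF U(2) oV]) simp
  have rV: "smooth_open ?V (\<lambda>z. dens c (snd z))"
    by (rule smooth_open_compose[OF smooth_open_linear[OF bounded_linear_snd oV] dens_smooth[OF c]]) auto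
  have iV: "smooth_open ?V (\<lambda>z. inverse (dens c (snd z)))"
    by (rule smooth_open_inverse[OF rV]) (use dens_nz[OF c] in auto)
  \<comment> \<open>The direction \<open>(0, v)\<close> differentiates in space only.\<close>
  let ?G = "\<lambda>v z. frechet_derivative g (at z) (0, v)"
  have "smooth_open ?V (\<lambda>z. (?G v z * inverse (dens c (snd z))) *\<^sub>R w)" for v and w :: "real^2"
    by (rule smooth_open_bilinear[OF bounded_bilinear_scaleR smooth_open_bilinear[OF bounded_bilinear_mult smooth_open_deriv[OF gV] iV]
          smooth_open_const[OF oV]])
  from smooth_open_add[OF this this]
  have sm: "smooth_open ?V (\<lambda>z. (?G (axis 2 1) z * inverse (dens c (snd z))) *\<^sub>R (- axis 1 1) +
      (?G (axis 1 1) z * inverse (dens c (snd z))) *\<^sub>R axis 2 1 :: real^2)" (is "smooth_open ?V ?h") .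
  have "?h x = vf c H x" if x: "x \<in> ?V \<inter> ({0..1} \<times> ?I)" for x
  proof -
    obtain t y where ty: "x = (t,y)" "t \<in> {0..1}" "y \<in> ?I" "(t,y) \<in> U" using x by auto
    let ?D = "frechet_derivative (H t \<circ> coord_inv c) (at y)"
    have "((\<lambda>y. (t, y)) has_derivative (\<lambda>v. (0, v))) (at y)" by (auto intro!: derivative_eq_intros)
    from diff_chain_at[OF this, of g] smooth_open_has_derivative[OF U(2) ty(4)]
    have "(g \<circ> (\<lambda>y. (t, y)) has_derivative (frechet_derivative g (at (t,y)) \<circ> (\<lambda>v. (0, v)))) (at y)" by simp
    then have "((H t \<circ> coord_inv c) has_derivative (frechet_derivative g (at (t,y)) \<circ> (\<lambda>v. (0, v)))) (at y)"
    proof (rule has_derivative_transform_within_open)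
      have "continuous_on UNIV (\<lambda>y. (t, y))" by (intro continuous_intros)
      then show "open (?I \<inter> (\<lambda>y. (t, y)) -` U)"
        using open_img[OF c] U(2) by (intro open_Int open_vimage) (auto simp: smooth_open_def)
      show "y \<in> ?I \<inter> (\<lambda>y. (t, y)) -` U" using ty by simp
      show "(g \<circ> (\<lambda>y. (t, y))) y' = (H t \<circ> coord_inv c) y'" if "y' \<in> ?I \<inter> (\<lambda>y. (t, y)) -` U" for y'
        using U(3) that ty(2) by (simp add: ham_rep_def)
    qed
    then have D: "?D v = ?G v x" for v using frechet_derivative_at[of "H t \<circ> coord_inv c" _ y] ty(1) by (metis o_apply)
    have "vf c H x = (- ?D (axis 2 1) / density \<Sigma> c (coord_inv c y)) *\<^sub>R axis 1 1 + (?D (axis 1 1) / density \<Sigma> c (coord_inv c y)) *\<^sub>R axis 2 1"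
      using ham_vf_formula(1)[OF H ty(2) c coord_inv_in[OF c ty(3)]] chart_coord_inv[OF c ty(3)] by (simp add: vf_def ty(1))
    then show ?thesis by (simp add: D ty(1) dens_def divide_inverse)
  qed
  then show "\<exists>U g. z \<in> U \<and> smooth_open U g \<and> (\<forall>y\<in>U \<inter> ({0..1} \<times> ?I). g y = vf c H y)"
    using sm z U(1) by (intro exI[of _ ?V] exI[of _ ?h]) auto
qed

text \<open>Trajectories over arbitrary subintervals, so that short solutions can be glued.\<close>

definition traj_on :: "(real \<Rightarrow> 'a \<Rightarrow> real) \<Rightarrow> real \<Rightarrow> real \<Rightarrow> (real \<Rightarrow> 'a) \<Rightarrow> bool" where
  "traj_on H a b \<gamma> \<longleftrightarrow> continuous_on {a..b} \<gamma> \<and>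
     (\<forall>t\<in>{a..b}. \<forall>c\<in>atlas \<Sigma>. \<gamma> t \<in> fst c \<longrightarrow>
        (snd c \<circ> \<gamma> has_vector_derivative ham_vf \<Sigma> H t c (\<gamma> t)) (at t within {a..b}))"

lemma ham_trajectory_traj_on: "ham_trajectory \<Sigma> H \<gamma> \<longleftrightarrow> traj_on H 0 1 \<gamma>"
  by (simp add: ham_trajectory_def traj_on_def)

text \<open>Used twice: with the identity it shows that the equation of motion in one chart implies
  it in every chart, and with a symplectomorphism that trajectories are mapped to
  trajectories.\<close>

lemma velocity_transform:
  assumes f: "area_map f" and H: "H \<in> hamiltonians \<Sigma>" "(\<lambda>t x. H t (f x)) \<in> hamiltonians \<Sigma>" and t: "t \<in> {0..1}" "t \<in> S"
    and c: "c \<in> atlas \<Sigma>" "\<gamma> t \<in> fst c" and d: "d \<in> atlas \<Sigma>" "f (\<gamma> t) \<in> fst d"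
    and cont: "continuous_on S \<gamma>"
    and der: "(snd c \<circ> \<gamma> has_vector_derivative ham_vf \<Sigma> (\<lambda>t x. H t (f x)) t c (\<gamma> t)) (at t within S)"
  shows "(snd d \<circ> (f \<circ> \<gamma>) has_vector_derivative ham_vf \<Sigma> H t d (f (\<gamma> t))) (at t within S)"
proof -
  have sm: "smooth_self_map \<Sigma> f" using f by (simp add: area_map_def)
  then have cf: "continuous_on UNIV f" by (simp add: smooth_self_map_def)
  have "(local_rep c d f has_derivative frechet_derivative (local_rep c d f) (at (snd c (\<gamma> t)))) (at ((snd c \<circ> \<gamma>) t) within (snd c \<circ> \<gamma>) ` S)"
    using has_derivative_at_withinI[OF local_rep_has_derivative[OF sm c(1) d(1) c(2) d(2)]] by simp
  from vector_derivative_diff_chain_within[OF der this]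
  have A: "(local_rep c d f \<circ> (snd c \<circ> \<gamma>) has_vector_derivative ham_vf \<Sigma> H t d (f (\<gamma> t))) (at t within S)"
    unfolding ham_vf_transform[OF f H t(1) c d] .
  obtain \<delta> where \<delta>: "\<delta> > 0" "\<And>t'. t' \<in> S \<Longrightarrow> dist t' t < \<delta> \<Longrightarrow> \<gamma> t' \<in> fst c \<inter> f -` fst d"
    using continuous_on_near[OF cont t(2) local_dom_open(1)[OF c(1) d(1) cf]] c(2) d(2) by auto
  show ?thesis
  proof (rule has_vector_derivative_transform_within[OF A \<delta>(1) t(2)])
    fix t' assume "t' \<in> S" "dist t' t < \<delta>"
    then show "(local_rep c d f \<circ> (snd c \<circ> \<gamma>)) t' = (snd d \<circ> (f \<circ> \<gamma>)) t'"
      using \<delta>(2)[of t'] local_rep_chart[OF c(1)] by simp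
  qed
qed

lemma traj_onI:
  assumes H: "H \<in> hamiltonians \<Sigma>" and ab: "0 \<le> a" "b \<le> 1" and cont: "continuous_on {a..b} \<gamma>"
    and der: "\<And>t. t \<in> {a..b} \<Longrightarrow> \<exists>c\<in>atlas \<Sigma>. \<gamma> t \<in> fst c \<and>
        (snd c \<circ> \<gamma> has_vector_derivative ham_vf \<Sigma> H t c (\<gamma> t)) (at t within {a..b})"
  shows "traj_on H a b \<gamma>"
  unfolding traj_on_def
proof (intro conjI ballI impI cont)
  fix t d assume t: "t \<in> {a..b}" and d: "d \<in> atlas \<Sigma>" "\<gamma> t \<in> fst d"
  obtain c where c: "c\<in>atlas \<Sigma>" "\<gamma> t \<in> fst c"
     "(snd c \<circ> \<gamma> has_vector_derivative ham_vf \<Sigma> H t c (\<gamma> t)) (at t within {a..b})" using der[OF t] by blast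
  have "(snd d \<circ> (id \<circ> \<gamma>) has_vector_derivative ham_vf \<Sigma> H t d (id (\<gamma> t))) (at t within {a..b})"
    by (rule velocity_transform[OF area_map_id H _ _ t c(1,2) d(1) _ cont]) (use H c d t ab in auto)
  then show "(snd d \<circ> \<gamma> has_vector_derivative ham_vf \<Sigma> H t d (\<gamma> t)) (at t within {a..b})" by simp
qed

lemma chart_ball:
  assumes "c \<in> atlas \<Sigma>" "p \<in> fst c"
  obtains r where "r > 0" "cball (snd c p) r \<subseteq> snd c ` fst c"
  using open_img[OF assms(1)] assms(2) by (meson imageI open_contains_cball)

lemma vf_estimates:
  assumes "H \<in> hamiltonians \<Sigma>" "c \<in> atlas \<Sigma>" "cball q r \<subseteq> snd c ` fst c"
  obtains C where "C \<ge> 0"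
    "\<And>t y y'. t \<in> {0..1} \<Longrightarrow> y \<in> cball q r \<Longrightarrow> y' \<in> cball q r \<Longrightarrow> norm (vf c H (t,y) - vf c H (t,y')) \<le> C * norm (y - y')"
    "\<And>t y y' \<tau>. t \<in> {0..1} \<Longrightarrow> y \<in> cball q r \<Longrightarrow> y' \<in> cball q r \<Longrightarrow> \<tau> \<in> {0..1} \<Longrightarrow>
       norm (vf c H (t, (1 - \<tau>) *\<^sub>R y + \<tau> *\<^sub>R y') - ((1 - \<tau>) *\<^sub>R vf c H (t,y) + \<tau> *\<^sub>R vf c H (t,y'))) \<le> C * (norm (y - y'))\<^sup>2"
proof -
  let ?K = "{0..1::real} \<times> cball q r"
  have "compact ?K" "?K \<subseteq> {0..1} \<times> snd c ` fst c" using assms(3) by (auto intro: compact_Times)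
  from smooth_on_compact_estimates[OF vf_smooth[OF assms(1,2)] this]
  obtain C where C: "C \<ge> 0" "\<And>x y. x \<in> ?K \<Longrightarrow> y \<in> ?K \<Longrightarrow> norm (vf c H x - vf c H y) \<le> C * norm (x - y)"
    "\<And>x y \<tau>. x \<in> ?K \<Longrightarrow> y \<in> ?K \<Longrightarrow> \<tau> \<in> {0..1} \<Longrightarrow> (1 - \<tau>) *\<^sub>R x + \<tau> *\<^sub>R y \<in> ?K \<Longrightarrow>
     norm (vf c H ((1 - \<tau>) *\<^sub>R x + \<tau> *\<^sub>R y) - ((1 - \<tau>) *\<^sub>R vf c H x + \<tau> *\<^sub>R vf c H y)) \<le> C * (norm (x - y))\<^sup>2"
    by metis
  \<comment> \<open>The two points compared have the same time coordinate, so the estimates on the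
    product become purely spatial and uniform in \<open>t\<close>.\<close>
  have n: "norm ((t::real, y) - (t, y')) = norm (y - y')" for t and y y' :: "real^2" by (simp add: norm_Pair)
  show thesis
  proof (rule that[OF C(1)])
    fix t :: real and y y' :: "real^2" assume a: "t \<in> {0..1}" "y \<in> cball q r" "y' \<in> cball q r"
    show "norm (vf c H (t,y) - vf c H (t,y')) \<le> C * norm (y - y')" using C(2)[of "(t,y)" "(t,y')"] a unfolding n by blast
    fix \<tau> :: real assume \<tau>: "\<tau> \<in> {0..1}"
    have eq: "(1 - \<tau>) *\<^sub>R (t, y) + \<tau> *\<^sub>R (t, y') = (t, (1 - \<tau>) *\<^sub>R y + \<tau> *\<^sub>R y')" by (simp add: algebra_simps)
    have "(1 - \<tau>) *\<^sub>R y + \<tau> *\<^sub>R y' \<in> cball q r" using convexD[OF convex_cball a(2,3), of "1-\<tau>" \<tau>] \<tau> by simp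
    then show "norm (vf c H (t, (1 - \<tau>) *\<^sub>R y + \<tau> *\<^sub>R y') - ((1 - \<tau>) *\<^sub>R vf c H (t,y) + \<tau> *\<^sub>R vf c H (t,y'))) \<le> C * (norm (y - y'))\<^sup>2"
      using C(3)[of "(t,y)" "(t,y')" \<tau>] a \<tau> unfolding n eq by blast
  qed
qed

lemma traj_on_chart:
  assumes "traj_on H a b \<gamma>" "t \<in> {a..b}" "c \<in> atlas \<Sigma>" "\<gamma> t \<in> fst c"
  shows "((\<lambda>t. snd c (\<gamma> t)) has_vector_derivative vf c H (t, snd c (\<gamma> t))) (at t within {a..b})"
  using assms unfolding traj_on_def by (auto simp: vf_chart o_def)

text \<open>Whether the trajectories agree is a locally constant property of time: where they
  differ, disjoint neighbourhoods keep them apart; where they meet, they stay in one chart for a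
  while and Gronwall's inequality forces agreement. The interval is connected.\<close>

lemma traj_on_unique:
  assumes H: "H \<in> hamiltonians \<Sigma>" and \<gamma>: "traj_on H a b \<gamma>" "traj_on H a b \<gamma>'" and ab: "0 \<le> a" "b \<le> 1"
    and eq: "\<gamma> s = \<gamma>' s" and s: "s \<in> {a..b}" and t: "t \<in> {a..b}"
  shows "\<gamma> t = \<gamma>' t"
proof -
  have cont: "continuous_on {a..b} \<gamma>" "continuous_on {a..b} \<gamma>'" using \<gamma> by (auto simp: traj_on_def)
  have "(\<gamma> s = \<gamma>' s) = (\<gamma> t = \<gamma>' t)"
  proof (rule connected_local_const[of "{a..b}" s t "\<lambda>t. \<gamma> t = \<gamma>' t"])
    show "\<forall>u\<in>{a..b}. \<forall>\<^sub>F v in at u within {a..b}. (\<gamma> u = \<gamma>' u) = (\<gamma> v = \<gamma>' v)"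
    proof
      fix u assume u: "u \<in> {a..b}"
      have "\<exists>\<delta>>0. \<forall>v\<in>{a..b}. dist v u < \<delta> \<longrightarrow> (\<gamma> u = \<gamma>' u) = (\<gamma> v = \<gamma>' v)"
      proof (cases "\<gamma> u = \<gamma>' u")
        case False
        then obtain A B where AB: "open A" "open B" "\<gamma> u \<in> A" "\<gamma>' u \<in> B" "A \<inter> B = {}" using hausdorff by metis
        obtain d1 where d1: "d1 > 0" "\<And>t'. t' \<in> {a..b} \<Longrightarrow> dist t' u < d1 \<Longrightarrow> \<gamma> t' \<in> A"
          using continuous_on_near[OF cont(1) u AB(1,3)] by metis
        obtain d2 where d2: "d2 > 0" "\<And>t'. t' \<in> {a..b} \<Longrightarrow> dist t' u < d2 \<Longrightarrow> \<gamma>' t' \<in> B"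
          using continuous_on_near[OF cont(2) u AB(2,4)] by metis
        have "\<gamma> v \<noteq> \<gamma>' v" if "v \<in> {a..b}" "dist v u < min d1 d2" for v
          using d1(2)[of v] d2(2)[of v] that AB(5) by auto
        then show ?thesis using False d1(1) d2(1) by (intro exI[of _ "min d1 d2"]) auto
      next
        case True
        obtain c where c: "c \<in> atlas \<Sigma>" "\<gamma> u \<in> fst c" using chart_at .
        obtain r where r: "r > 0" "cball (snd c (\<gamma> u)) r \<subseteq> snd c ` fst c" using chart_ball[OF c] .
        let ?B = "coord_inv c ` ball (snd c (\<gamma> u)) r"
        have oB: "open ?B" using r(2) ball_subset_cball by (intro open_coord_image[OF c(1)]) auto
        have inB: "\<gamma> u \<in> ?B" using coord_inv_chart[OF c] r(1) by (metis centre_in_ball image_eqI)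
        have B: "snd c p \<in> cball (snd c (\<gamma> u)) r" "p \<in> fst c" if p: "p \<in> ?B" for p
        proof -
          obtain y where y: "y \<in> ball (snd c (\<gamma> u)) r" "p = coord_inv c y" using p by blast
          then have "y \<in> snd c ` fst c" using r(2) ball_subset_cball by blast
          then show "snd c p \<in> cball (snd c (\<gamma> u)) r" "p \<in> fst c"
            using y chart_coord_inv[OF c(1)] coord_inv_in[OF c(1)] by auto
        qed
        obtain d1 where d1: "d1 > 0" "\<And>t'. t' \<in> {a..b} \<Longrightarrow> dist t' u < d1 \<Longrightarrow> \<gamma> t' \<in> ?B"
          using continuous_on_near[OF cont(1) u oB inB] by metis
        obtain d2 where d2: "d2 > 0" "\<And>t'. t' \<in> {a..b} \<Longrightarrow> dist t' u < d2 \<Longrightarrow> \<gamma>' t' \<in> ?B"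
          using continuous_on_near[OF cont(2) u oB] inB True by metis
        obtain L where L: "L \<ge> 0" "\<And>t y y'. t \<in> {0..1} \<Longrightarrow> y \<in> cball (snd c (\<gamma> u)) r \<Longrightarrow> y' \<in> cball (snd c (\<gamma> u)) r \<Longrightarrow>
            norm (vf c H (t,y) - vf c H (t,y')) \<le> L * norm (y - y')"
          using vf_estimates[OF H c(1) r(2)] by metis
        \<comment> \<open>Halved so that the closed interval of radius \<open>?e\<close> lies
          strictly within both distances.\<close>
        let ?e = "min d1 d2 / 2"
        let ?a = "max a (u - ?e)" and ?b = "min b (u + ?e)"
        have sub: "{?a..?b} \<subseteq> {a..b}" by auto
        have near: "\<gamma> v \<in> ?B" "\<gamma>' v \<in> ?B" if "v \<in> {?a..?b}" for v
          using d1 d2 that by (auto simp: dist_real_def)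
        have "\<gamma> v = \<gamma>' v" if v: "v \<in> {?a..?b}" for v
        proof -
          have "norm (snd c (\<gamma> v) - snd c (\<gamma>' v)) \<le> exp (L * (?b - ?a)) * norm (snd c (\<gamma> u) - snd c (\<gamma>' u))"
          proof (rule gronwall[OF _ _ _ L(1)])
            fix w assume w: "w \<in> {?a..?b}"
            then have w': "w \<in> {a..b}" by auto
            show "((\<lambda>t. snd c (\<gamma> t)) has_vector_derivative vf c H (w, snd c (\<gamma> w))) (at w within {?a..?b})"
              by (rule has_vector_derivative_within_subset[OF traj_on_chart[OF \<gamma>(1) w' c(1) B(2)[OF near(1)[OF w]]] sub])
            show "((\<lambda>t. snd c (\<gamma>' t)) has_vector_derivative vf c H (w, snd c (\<gamma>' w))) (at w within {?a..?b})"
              by (rule has_vector_derivative_within_subset[OF traj_on_chart[OF \<gamma>(2) w' c(1) B(2)[OF near(2)[OF w]]] sub])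
            show "norm (vf c H (w, snd c (\<gamma> w)) - vf c H (w, snd c (\<gamma>' w))) \<le> L * norm (snd c (\<gamma> w) - snd c (\<gamma>' w))"
              using w' ab by (intro L(2) B(1) near w) auto
          next
            show "u \<in> {?a..?b}" using u d1 d2 by auto
          qed (fact v)
          then have "snd c (\<gamma> v) = snd c (\<gamma>' v)" using True by simp
          then show ?thesis
            using coord_inv_chart[OF c(1) B(2)[OF near(1)[OF v]]] coord_inv_chart[OF c(1) B(2)[OF near(2)[OF v]]] by metis
        qed
        then have "\<gamma> v = \<gamma>' v" if v: "v \<in> {a..b}" "dist v u < ?e" for v
        proof -
          have "u - ?e \<le> v" "v \<le> u + ?e" using v(2) unfolding dist_real_def by linarith+
          then show ?thesis using v(1) by (intro \<open>\<And>v. v \<in> {?a..?b} \<Longrightarrow> \<gamma> v = \<gamma>' v\<close>) simp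
        qed
        then show ?thesis using True d1(1) d2(1) by (intro exI[of _ "?e"]) simp
      qed
      then show "\<forall>\<^sub>F v in at u within {a..b}. (\<gamma> u = \<gamma>' u) = (\<gamma> v = \<gamma>' v)"
        unfolding eventually_at by blast
    qed
  qed (use s t in auto)
  then show ?thesis using eq by simp
qed

text \<open>The existence time \<open>h\<close> serves all starting points near \<open>p\<close> and
  all starting times. A duration \<open>k\<close> below \<open>h\<close> is allowed so that a
  trajectory can stop exactly at time 1.\<close>

lemma local_trajectories:
  assumes H: "H \<in> hamiltonians \<Sigma>"
  obtains B h where "open B" "p \<in> B" "h > 0"
    "\<And>q a k. q \<in> B \<Longrightarrow> 0 \<le> a \<Longrightarrow> 0 \<le> k \<Longrightarrow> k \<le> h \<Longrightarrow> a + k \<le> 1 \<Longrightarrow> \<exists>\<gamma>. traj_on H a (a + k) \<gamma> \<and> \<gamma> a = q"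
proof -
  obtain c where c: "c \<in> atlas \<Sigma>" "p \<in> fst c" using chart_at .
  obtain r where r: "r > 0" "cball (snd c p) r \<subseteq> snd c ` fst c" using chart_ball[OF c] .
  let ?D = "cball (snd c p) r"
  obtain L where L: "L \<ge> 0" "\<And>t y y'. t \<in> {0..1} \<Longrightarrow> y \<in> ?D \<Longrightarrow> y' \<in> ?D \<Longrightarrow>
      norm (vf c H (t,y) - vf c H (t,y')) \<le> L * norm (y - y')"
    using vf_estimates[OF H c(1) r(2)] by metis
  have cont: "continuous_on ({0..1} \<times> ?D) (vf c H)"
    by (rule continuous_on_subset[OF smooth_on_imp_continuous_on[OF vf_smooth[OF H c(1)]]]) (use r(2) in auto)
  have "bounded (vf c H ` ({0..1} \<times> ?D))"
    by (intro compact_imp_bounded compact_continuous_image cont compact_Times) auto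
  then obtain M where M: "\<And>z. z \<in> {0..1} \<times> ?D \<Longrightarrow> norm (vf c H z) \<le> M" by (auto simp: bounded_iff)
  have "norm (vf c H (0, snd c p)) \<le> M" using r(1) by (intro M) auto
  then have M0: "M \<ge> 0" using norm_ge_zero order_trans by blast
  \<comment> \<open>Chosen for the two smallness conditions \<open>h * L \<le> 1/2\<close> and
    \<open>h * M \<le> r/2\<close>; adding 1 avoids dividing by zero.\<close>
  define h where "h = min (1 / (2 * (L + 1))) (r / (2 * (M + 1)))"
  have h: "h > 0" using L(1) M0 r(1) by (simp add: h_def)
  have hL: "h * L \<le> 1/2"
  proof -
    have "h \<le> 1 / (2 * (L + 1))" by (simp add: h_def)
    then have "h * (2 * (L + 1)) \<le> 1" using L(1) pos_le_divide_eq[of "2 * (L + 1)" h 1] by simp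
    then show ?thesis using h by (simp add: algebra_simps)
  qed
  have hM: "h * M \<le> r/2"
  proof -
    have "h * M \<le> r / (2 * (M + 1)) * (M + 1)" using M0 r(1) by (intro mult_mono) (auto simp: h_def)
    also have "\<dots> = r/2" using M0 by (simp add: field_simps)
    finally show ?thesis .
  qed
  let ?B = "coord_inv c ` ball (snd c p) (r/2)"
  have sub: "ball (snd c p) (r/2) \<subseteq> ?D" using r(1) by (intro order_trans[OF ball_subset_cball]) (simp add: cball_subset_cball_iff)
  show thesis
  proof (rule that[of ?B h])
    show "open ?B" using sub r(2) by (intro open_coord_image[OF c(1)]) auto
    show "p \<in> ?B" using coord_inv_chart[OF c] r(1) by (metis centre_in_ball half_gt_zero image_eqI)
    show "h > 0" by fact
    fix q and a k :: real assume q: "q \<in> ?B" and a: "0 \<le> a" "0 \<le> k" "k \<le> h" "a + k \<le> 1"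
    obtain y0 where y0: "y0 \<in> ball (snd c p) (r/2)" "q = coord_inv c y0" using q by blast
    have I: "{a..a+k} \<subseteq> {0..1}" using a by auto
    obtain y where y: "y a = y0" "\<And>t. t \<in> {a..a+k} \<Longrightarrow> y t \<in> ?D"
      "\<And>t. t \<in> {a..a+k} \<Longrightarrow> (y has_vector_derivative vf c H (t, y t)) (at t within {a..a+k})"
    proof (rule picard_lindelof[of a k "snd c p" r "\<lambda>t y. vf c H (t,y)" L M y0])
      show "continuous_on ({a..a + k} \<times> ?D) (\<lambda>(t, y). vf c H (t, y))"
        using continuous_on_subset[OF cont, of "{a..a + k} \<times> ?D"] I by (simp add: case_prod_eta Sigma_mono)
      show "norm (vf c H (t, y) - vf c H (t, y')) \<le> L * norm (y - y')"
        if "t \<in> {a..a + k}" "y \<in> ?D" "y' \<in> ?D" for t y y'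
        using L(2)[OF _ that(2,3)] that(1) I by blast
      show "norm (vf c H (t, y)) \<le> M" if "t \<in> {a..a + k}" "y \<in> ?D" for t y using M that I by blast
      show "k * L \<le> 1 / 2" using mult_right_mono[OF a(3) L(1)] hL by linarith
      show "k * M \<le> r / 2" using mult_right_mono[OF a(3) M0] hM by linarith
      show "dist (snd c p) y0 \<le> r / 2" using y0 by simp
    qed (use a L r in auto)
    have yI: "y t \<in> snd c ` fst c" if "t \<in> {a..a+k}" for t using y(2)[OF that] r(2) by blast
    have cy: "continuous_on {a..a+k} y"
      using y(3) by (meson continuous_on_eq_continuous_within has_vector_derivative_continuous)
    have "traj_on H a (a + k) (coord_inv c \<circ> y)"
    proof (rule traj_onI[OF H a(1) a(4)])
      show "continuous_on {a..a + k} (coord_inv c \<circ> y)"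
        by (intro continuous_on_compose cy continuous_on_subset[OF continuous_coord_inv[OF c(1)]]) (use yI in auto)
      fix t assume t: "t \<in> {a..a+k}"
      have "(snd c \<circ> (coord_inv c \<circ> y) has_vector_derivative vf c H (t, y t)) (at t within {a..a+k})"
        by (rule has_vector_derivative_transform[OF t _ y(3)[OF t]]) (use yI chart_coord_inv[OF c(1)] in auto)
      moreover have "(coord_inv c \<circ> y) t \<in> fst c" using coord_inv_in[OF c(1) yI[OF t]] by simp
      ultimately show "\<exists>d\<in>atlas \<Sigma>. (coord_inv c \<circ> y) t \<in> fst d \<and>
        (snd d \<circ> (coord_inv c \<circ> y) has_vector_derivative ham_vf \<Sigma> H t d ((coord_inv c \<circ> y) t)) (at t within {a..a+k})"
        using c(1) by (intro bexI[of _ c]) (auto simp: vf_def)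
    qed
    then show "\<exists>\<gamma>. traj_on H a (a + k) \<gamma> \<and> \<gamma> a = q" using y(1) y0 by (intro exI[of _ "coord_inv c \<circ> y"]) simp
  qed
qed

lemma constant_trajectory:
  assumes H: "H \<in> hamiltonians \<Sigma>" and p: "p \<notin> ham_support H" and ab: "0 \<le> a" "b \<le> 1"
  shows "traj_on H a b (\<lambda>t. p)"
proof (rule traj_onI[OF H ab])
  fix t assume t: "t \<in> {a..b}"
  then have t1: "t \<in> {0..1}" using ab by auto
  obtain c where c: "c \<in> atlas \<Sigma>" "p \<in> fst c" using chart_at .
  let ?O = "snd c ` (fst c - ham_support H)"
  have O: "open ?O" by (intro open_chart_image[OF c(1)] open_Diff open_dom[OF c(1)]) (auto simp: ham_support_def)
  have "((\<lambda>y. 0) has_derivative (\<lambda>v. 0)) (at (snd c p))" by simp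
  then have "((H t \<circ> coord_inv c) has_derivative (\<lambda>v. 0)) (at (snd c p))"
  proof (rule has_derivative_transform_within_open[OF _ O])
    show "snd c p \<in> ?O" using c p by blast
    fix y assume "y \<in> ?O"
    then obtain q where q: "q \<in> fst c" "q \<notin> ham_support H" "y = snd c q" by blast
    have "q \<notin> {x. \<exists>t\<in>{0..1}. H t x \<noteq> 0}" using q(2) subsetD[OF closure_subset] unfolding ham_support_def by meson
    then show "0 = (H t \<circ> coord_inv c) y" using q coord_inv_chart[OF c(1) q(1)] t1 by auto
  qed
  then have "frechet_derivative (H t \<circ> coord_inv c) (at (snd c p)) = (\<lambda>v. 0)"
    using frechet_derivative_at by metis
  then have "ham_vf \<Sigma> H t c p = 0" using ham_vf_formula(1)[OF H t1 c] by simp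
  then show "\<exists>c\<in>atlas \<Sigma>. p \<in> fst c \<and> (snd c \<circ> (\<lambda>t. p) has_vector_derivative ham_vf \<Sigma> H t c p) (at t within {a..b})"
    using c by (intro bexI[of _ c]) (auto simp: o_def)
qed simp

text \<open>Compactness of the support gives one existence time for all its points, and off the
  support trajectories are constant. No completeness of the surface has to be discussed.\<close>

lemma uniform_trajectories:
  assumes H: "H \<in> hamiltonians \<Sigma>"
  obtains h where "h > 0"
    "\<And>q a k. 0 \<le> a \<Longrightarrow> 0 \<le> k \<Longrightarrow> k \<le> h \<Longrightarrow> a + k \<le> 1 \<Longrightarrow> \<exists>\<gamma>. traj_on H a (a + k) \<gamma> \<and> \<gamma> a = q"
proof -
  have "\<forall>p. \<exists>B h. open B \<and> p \<in> B \<and> h > 0 \<and>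
    (\<forall>q a k. q \<in> B \<longrightarrow> 0 \<le> a \<longrightarrow> 0 \<le> k \<longrightarrow> k \<le> h \<longrightarrow> a + k \<le> 1 \<longrightarrow> (\<exists>\<gamma>. traj_on H a (a + k) \<gamma> \<and> \<gamma> a = q))"
    (is "\<forall>p. \<exists>B h. ?P p B h")
    using local_trajectories[OF H] by metis
  then obtain B h where P: "\<And>p. ?P p (B p) (h p)" by metis
  have K: "compact (ham_support H)" using H by (simp add: hamiltonians_def)
  have cov: "ham_support H \<subseteq> (\<Union>p\<in>ham_support H. B p)" using P by blast
  obtain F where F: "F \<subseteq> ham_support H" "finite F" "ham_support H \<subseteq> (\<Union>p\<in>F. B p)"
    by (rule compactE_image[OF K _ cov]) (use P in auto)
  let ?h = "Min (insert 1 (h ` F))"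
  show thesis
  proof (rule that[of ?h])
    show "?h > 0"
    proof -
      have "\<forall>x\<in>insert 1 (h ` F). x > 0" using P by fastforce
      then show ?thesis using F(2) Min_in[of "insert 1 (h ` F)"] by blast
    qed
    fix q and a k :: real assume a: "0 \<le> a" "0 \<le> k" "k \<le> ?h" "a + k \<le> 1"
    show "\<exists>\<gamma>. traj_on H a (a + k) \<gamma> \<and> \<gamma> a = q"
    proof (cases "q \<in> ham_support H")
      case True
      then obtain p where p: "p \<in> F" "q \<in> B p" using F(3) by blast
      have "?h \<le> h p" using F(2) p(1) by (intro Min_le) auto
      then have "k \<le> h p" using a(3) by linarith
      then show ?thesis using P[of p] p(2) a by blast
    next
      case False
      then show ?thesis using constant_trajectory[OF H False a(1) a(4)] by blast
    qed
  qed
qed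

text \<open>At the junction both one-sided derivatives equal the vector field at the common point,
  so the glued curve is differentiable there.\<close>

lemma traj_on_concat:
  assumes "traj_on H a b \<gamma>" "traj_on H b e \<gamma>'" "\<gamma> b = \<gamma>' b" "a \<le> b" "b \<le> e"
  shows "traj_on H a e (\<lambda>t. if t \<le> b then \<gamma> t else \<gamma>' t)"
proof -
  let ?g = "\<lambda>t. if t \<le> b then \<gamma> t else \<gamma>' t"
  have ae: "{a..e} = {a..b} \<union> {b..e}" using assms by auto
  have g1: "?g t = \<gamma> t" if "t \<in> {a..b}" for t using that by auto
  have g2: "?g t = \<gamma>' t" if "t \<in> {b..e}" for t using that assms(3) by (cases "t = b") auto
  have "continuous_on {a..e} ?g" unfolding ae
    by (rule continuous_on_If) (use assms in \<open>auto simp: traj_on_def\<close>)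
  moreover have "(snd c \<circ> ?g has_vector_derivative ham_vf \<Sigma> H t c (?g t)) (at t within {a..e})"
    if t: "t \<in> {a..e}" and c: "c \<in> atlas \<Sigma>" "?g t \<in> fst c" for t c
    unfolding ae has_vector_derivative_def
  proof (rule has_derivative_within_Un)
    let ?X = "ham_vf \<Sigma> H t c (?g t)"
    show "(snd c \<circ> ?g has_derivative (\<lambda>x. x *\<^sub>R ?X)) (at t within {a..b})"
    proof (cases "t \<in> {a..b}")
      case True
      then have "(snd c \<circ> \<gamma> has_vector_derivative ?X) (at t within {a..b})"
        using assms(1) c g1[OF True] unfolding traj_on_def by simp
      then have "(snd c \<circ> ?g has_vector_derivative ?X) (at t within {a..b})"
        by (rule has_vector_derivative_transform[OF True, rotated]) (use g1 in auto)
      then show ?thesis by (simp add: has_vector_derivative_def)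
    qed (auto intro!: has_derivative_within_trivial bounded_linear_scaleR_left)
    show "(snd c \<circ> ?g has_derivative (\<lambda>x. x *\<^sub>R ?X)) (at t within {b..e})"
    proof (cases "t \<in> {b..e}")
      case True
      then have "(snd c \<circ> \<gamma>' has_vector_derivative ?X) (at t within {b..e})"
        using assms(2) c g2[OF True] unfolding traj_on_def by simp
      then have "(snd c \<circ> ?g has_vector_derivative ?X) (at t within {b..e})"
        by (rule has_vector_derivative_transform[OF True, rotated]) (use g2 in auto)
      then show ?thesis by (simp add: has_vector_derivative_def)
    qed (auto intro!: has_derivative_within_trivial bounded_linear_scaleR_left)
  qed
  ultimately show ?thesis unfolding traj_on_def by blast
qed

lemma trajectory_exists:
  assumes H: "H \<in> hamiltonians \<Sigma>"
  obtains \<gamma> where "traj_on H 0 1 \<gamma>" "\<gamma> 0 = x"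
proof -
  obtain h where h: "h > 0" "\<And>q a k. 0 \<le> a \<Longrightarrow> 0 \<le> k \<Longrightarrow> k \<le> h \<Longrightarrow> a + k \<le> 1 \<Longrightarrow> \<exists>\<gamma>. traj_on H a (a + k) \<gamma> \<and> \<gamma> a = q"
    using uniform_trajectories[OF H] by metis
  have step: "\<exists>\<gamma>. traj_on H 0 (min 1 (real n * h)) \<gamma> \<and> \<gamma> 0 = x" for n
  proof (induction n)
    case 0 then show ?case using h(2)[of 0 0 x] h(1) by simp
  next
    case (Suc n)
    then obtain \<gamma> where g: "traj_on H 0 (min 1 (real n * h)) \<gamma>" "\<gamma> 0 = x" by blast
    \<comment> \<open>Steps of length \<open>h\<close>, the last one cut off at time 1.\<close>
    define a where "a = min 1 (real n * h)"
    define k where "k = min 1 (real (Suc n) * h) - a"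
    have ak: "0 \<le> a" "0 \<le> k" "k \<le> h" "a + k \<le> 1" using h(1) by (auto simp: a_def k_def algebra_simps min_def)
    obtain \<gamma>' where g': "traj_on H a (a + k) \<gamma>'" "\<gamma>' a = \<gamma> a" using h(2)[OF ak] by blast
    have "traj_on H 0 (a + k) (\<lambda>t. if t \<le> a then \<gamma> t else \<gamma>' t)"
      by (rule traj_on_concat) (use g g' ak in \<open>auto simp: a_def\<close>)
    moreover have "a + k = min 1 (real (Suc n) * h)" by (simp add: k_def)
    ultimately show ?case using g(2) ak(1) by (intro exI[of _ "\<lambda>t. if t \<le> a then \<gamma> t else \<gamma>' t"]) auto
  qed
  obtain n where "1 / h < real n" using reals_Archimedean2 by blast
  then have "min 1 (real n * h) = 1" using h(1) by (simp add: field_simps)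
  then show thesis using step[of n] that by auto
qed

section \<open>The Hamiltonian flow and its conjugation\<close>

lemma ham_flow_eq:
  assumes H: "H \<in> hamiltonians \<Sigma>" and \<gamma>: "traj_on H 0 1 \<gamma>" "\<gamma> 0 = x" and t: "t \<in> {0..1}"
  shows "ham_flow \<Sigma> H t x = \<gamma> t"
  unfolding ham_flow_def
proof (rule the_equality)
  show "\<exists>\<gamma>'. ham_trajectory \<Sigma> H \<gamma>' \<and> \<gamma>' 0 = x \<and> \<gamma>' t = \<gamma> t" using \<gamma> by (auto simp: ham_trajectory_traj_on)
next
  fix y assume "\<exists>\<gamma>'. ham_trajectory \<Sigma> H \<gamma>' \<and> \<gamma>' 0 = x \<and> \<gamma>' t = y"
  then obtain \<gamma>' where g: "traj_on H 0 1 \<gamma>'" "\<gamma>' 0 = x" "\<gamma>' t = y" by (auto simp: ham_trajectory_traj_on)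
  have "\<gamma>' t = \<gamma> t"
    by (rule traj_on_unique[OF H g(1) \<gamma>(1), of 0]) (use g \<gamma> t in auto)
  then show "y = \<gamma> t" using g by simp
qed

lemma traj_on_cong:
  assumes "traj_on H a b \<gamma>" "\<And>t. t \<in> {a..b} \<Longrightarrow> \<gamma>' t = \<gamma> t"
  shows "traj_on H a b \<gamma>'"
  unfolding traj_on_def
proof (intro conjI ballI impI)
  show "continuous_on {a..b} \<gamma>'" using assms continuous_on_cong[of "{a..b}" "{a..b}" \<gamma>' \<gamma>] by (simp add: traj_on_def)
  fix t c assume t: "t \<in> {a..b}" and c: "c \<in> atlas \<Sigma>" "\<gamma>' t \<in> fst c"
  have "(snd c \<circ> \<gamma> has_vector_derivative ham_vf \<Sigma> H t c (\<gamma>' t)) (at t within {a..b})"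
    using assms(1) t c assms(2)[OF t] by (simp add: traj_on_def)
  then show "(snd c \<circ> \<gamma>' has_vector_derivative ham_vf \<Sigma> H t c (\<gamma>' t)) (at t within {a..b})"
    by (rule has_vector_derivative_transform[OF t, rotated]) (simp add: assms(2))
qed

lemma ham_flow_traj_on:
  assumes H: "H \<in> hamiltonians \<Sigma>"
  shows "traj_on H 0 1 (\<lambda>t. ham_flow \<Sigma> H t x)" "ham_flow \<Sigma> H 0 x = x"
proof -
  obtain \<gamma> where \<gamma>: "traj_on H 0 1 \<gamma>" "\<gamma> 0 = x" using trajectory_exists[OF H] .
  show "traj_on H 0 1 (\<lambda>t. ham_flow \<Sigma> H t x)"
    by (rule traj_on_cong[OF \<gamma>(1)]) (rule ham_flow_eq[OF H \<gamma>])
  show "ham_flow \<Sigma> H 0 x = x" using ham_flow_eq[OF H \<gamma>, of 0] \<gamma>(2) by simp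
qed

text \<open>\<open>\<psi>\<close> carries the trajectory of the composed Hamiltonian from
  \<open>x\<close> to a trajectory of \<open>H\<close> from \<open>\<psi> x\<close>; uniqueness
  identifies the latter with the flow line.\<close>

lemma ham_flow_conjugate:
  assumes \<psi>: "\<psi> \<in> symp \<Sigma>" and H: "H \<in> hamiltonians \<Sigma>" and t: "t \<in> {0..1}"
  shows "ham_flow \<Sigma> H t (\<psi> x) = \<psi> (ham_flow \<Sigma> (\<lambda>t x. H t (\<psi> x)) t x)"
proof -
  let ?H = "\<lambda>t x. H t (\<psi> x)"
  have H': "?H \<in> hamiltonians \<Sigma>" by (rule ham_compose_in_hamiltonians[OF \<psi> H])
  let ?g = "\<lambda>t. ham_flow \<Sigma> ?H t x"
  have g: "traj_on ?H 0 1 ?g" "?g 0 = x" by (rule ham_flow_traj_on[OF H'])+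
  have c\<psi>: "continuous_on UNIV \<psi>" using \<psi> by (simp add: symp_def smooth_self_map_def)
  have cg: "continuous_on {0..1} ?g" using g(1) by (simp add: traj_on_def)
  have "traj_on H 0 1 (\<psi> \<circ> ?g)"
    unfolding traj_on_def
  proof (intro conjI ballI impI)
    show "continuous_on {0..1} (\<psi> \<circ> ?g)" by (intro continuous_on_compose cg continuous_on_subset[OF c\<psi>]) auto
    fix t d assume t: "t \<in> {0..1}" and d: "d \<in> atlas \<Sigma>" "(\<psi> \<circ> ?g) t \<in> fst d"
    obtain c where c: "c \<in> atlas \<Sigma>" "?g t \<in> fst c" using chart_at .
    show "(snd d \<circ> (\<psi> \<circ> ?g) has_vector_derivative ham_vf \<Sigma> H t d ((\<psi> \<circ> ?g) t)) (at t within {0..1})"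
      using velocity_transform[OF area_map_symp[OF \<psi>] H H' t t c d(1) _ cg] d(2) g(1) c t
      by (simp add: traj_on_def)
  qed
  then show ?thesis using ham_flow_eq[OF H, of "\<psi> \<circ> ?g" "\<psi> x" t] g(2) t by simp
qed

end

section \<open>Conjugation invariance of the action spectrum\<close>

abbreviation unit_square :: "(real \<times> real) set" where "unit_square \<equiv> {0..1} \<times> {0..1}"

context area_surface begin

text \<open>The regularity that a capping disk has in polar coordinates, as a property of maps on
  the square alone; it is what survives composition with an area map.\<close>

definition square_smooth :: "(real \<times> real \<Rightarrow> 'a) \<Rightarrow> bool" where
  "square_smooth w \<longleftrightarrow> continuous_on unit_square w \<and>
     (\<forall>c\<in>atlas \<Sigma>. smooth_on (unit_square \<inter> w -` fst c) (snd c \<circ> w))"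

definition d1 :: "'a chart \<Rightarrow> (real \<times> real \<Rightarrow> 'a) \<Rightarrow> real \<times> real \<Rightarrow> real^2" where
  "d1 c w = (\<lambda>(s,t). vector_derivative (\<lambda>r. snd c (w (r, t))) (at s within {0..1}))"

definition d2 :: "'a chart \<Rightarrow> (real \<times> real \<Rightarrow> 'a) \<Rightarrow> real \<times> real \<Rightarrow> real^2" where
  "d2 c w = (\<lambda>(s,t). vector_derivative (\<lambda>r. snd c (w (s, r))) (at t within {0..1}))"

lemma square_smooth_local:
  assumes w: "square_smooth w" and c: "c \<in> atlas \<Sigma>" and z: "z \<in> unit_square" "w z \<in> fst c"
  obtains U g where "z \<in> U" "smooth_open U g" "\<And>y. y \<in> U \<Longrightarrow> y \<in> unit_square \<Longrightarrow> w y \<in> fst c \<and> g y = snd c (w y)"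
proof -
  have "smooth_on (unit_square \<inter> w -` fst c) (snd c \<circ> w)" using w c by (simp add: square_smooth_def)
  then obtain U g where U: "z \<in> U" "smooth_open U g" "\<forall>y\<in>U \<inter> (unit_square \<inter> w -` fst c). g y = (snd c \<circ> w) y"
    using z unfolding smooth_on_iff by blast
  obtain \<delta> where \<delta>: "\<delta> > 0" "\<And>y. y \<in> unit_square \<Longrightarrow> dist y z < \<delta> \<Longrightarrow> w y \<in> fst c"
    using continuous_on_near[of unit_square w z "fst c"] w z open_dom[OF c] unfolding square_smooth_def by metis
  let ?V = "U \<inter> ball z \<delta>"
  have "smooth_open ?V g" using U(2) by (intro smooth_open_subset[OF U(2)]) (auto simp: smooth_open_def)
  moreover have "z \<in> ?V" using U \<delta> by simp
  moreover have "w y \<in> fst c \<and> g y = snd c (w y)" if "y \<in> ?V" "y \<in> unit_square" for y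
    using U(3) \<delta>(2)[of y] that by (auto simp: dist_commute)
  ultimately show thesis using that by blast
qed

lemma local_partial_derivatives:
  assumes U: "smooth_open U g" "\<And>y. y \<in> U \<Longrightarrow> y \<in> unit_square \<Longrightarrow> w y \<in> fst c \<and> g y = snd c (w y)"
    and z: "(s,t) \<in> U" "(s,t) \<in> unit_square"
  shows "((\<lambda>r. snd c (w (r, t))) has_vector_derivative frechet_derivative g (at (s,t)) (1,0)) (at s within {0..1})"
    and "((\<lambda>r. snd c (w (s, r))) has_vector_derivative frechet_derivative g (at (s,t)) (0,1)) (at t within {0..1})"
proof -
  obtain r where r: "r > 0" "ball (s,t) r \<subseteq> U" using U(1) z(1) unfolding smooth_open_def by (meson openE)
  have D: "(g has_derivative frechet_derivative g (at (s,t))) (at (s,t))" by (rule smooth_open_has_derivative[OF U(1) z(1)])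
  interpret D: bounded_linear "frechet_derivative g (at (s,t))" using D by (rule has_derivative_bounded_linear)
  have 1: "((\<lambda>r. (r, t)) has_vector_derivative (1,0)) (at s within {0..1})"
    unfolding has_vector_derivative_def by (auto intro!: derivative_eq_intros)
  have 2: "((\<lambda>r. (s, r)) has_vector_derivative (0,1)) (at t within {0..1})"
    unfolding has_vector_derivative_def by (auto intro!: derivative_eq_intros)
  have "((g \<circ> (\<lambda>r. (r, t))) has_vector_derivative frechet_derivative g (at (s,t)) (1,0)) (at s within {0..1})"
    by (rule vector_derivative_diff_chain_within[OF 1 has_derivative_at_withinI[OF D]])
  then show "((\<lambda>r. snd c (w (r, t))) has_vector_derivative frechet_derivative g (at (s,t)) (1,0)) (at s within {0..1})"
    by (rule has_vector_derivative_transform_within[OF _ r(1)])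
       (use z r U(2) in \<open>auto simp: subset_iff dist_Pair_Pair dist_commute\<close>)
  have "((g \<circ> (\<lambda>r. (s, r))) has_vector_derivative frechet_derivative g (at (s,t)) (0,1)) (at t within {0..1})"
    by (rule vector_derivative_diff_chain_within[OF 2 has_derivative_at_withinI[OF D]])
  then show "((\<lambda>r. snd c (w (s, r))) has_vector_derivative frechet_derivative g (at (s,t)) (0,1)) (at t within {0..1})"
    by (rule has_vector_derivative_transform_within[OF _ r(1)])
       (use z r U(2) in \<open>auto simp: subset_iff dist_Pair_Pair dist_commute\<close>)
qed

text \<open>The one-sided partial derivatives on the square are those of any local smooth extension,
  also at the edges and corners.\<close>

lemma local_d1_d2:
  assumes "smooth_open U g" "\<And>y. y \<in> U \<Longrightarrow> y \<in> unit_square \<Longrightarrow> w y \<in> fst c \<and> g y = snd c (w y)"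
    and "z \<in> U" "z \<in> unit_square"
  shows "d1 c w z = frechet_derivative g (at z) (1,0)" "d2 c w z = frechet_derivative g (at z) (0,1)"
proof -
  obtain s t where z: "z = (s,t)" by (cases z)
  have st: "s \<in> {0..1}" "t \<in> {0..1}" using assms(4) z by auto
  note D = local_partial_derivatives[OF assms(1,2) assms(3,4)[unfolded z]]
  show "d1 c w z = frechet_derivative g (at z) (1,0)" "d2 c w z = frechet_derivative g (at z) (0,1)"
    using vector_derivative_within_closed_interval[OF zero_less_one st(1) D(1)]
      vector_derivative_within_closed_interval[OF zero_less_one st(2) D(2)]
    by (simp_all add: d1_def d2_def z)
qed

lemma has_d1_d2:
  assumes w: "square_smooth w" and c: "c \<in> atlas \<Sigma>" and z: "(s,t) \<in> unit_square" "w (s,t) \<in> fst c"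
  shows "((\<lambda>r. snd c (w (r, t))) has_vector_derivative d1 c w (s,t)) (at s within {0..1})"
    and "((\<lambda>r. snd c (w (s, r))) has_vector_derivative d2 c w (s,t)) (at t within {0..1})"
proof -
  obtain U g where U: "(s,t) \<in> U" "smooth_open U g" "\<And>y. y \<in> U \<Longrightarrow> y \<in> unit_square \<Longrightarrow> w y \<in> fst c \<and> g y = snd c (w y)"
    using square_smooth_local[OF w c z] by metis
  show "((\<lambda>r. snd c (w (r, t))) has_vector_derivative d1 c w (s,t)) (at s within {0..1})"
     "((\<lambda>r. snd c (w (s, r))) has_vector_derivative d2 c w (s,t)) (at t within {0..1})"
    using local_partial_derivatives[OF U(2,3) U(1) z(1)] local_d1_d2[OF U(2,3) U(1) z(1)] by simp_all
qed

definition sq_density :: "'a chart \<Rightarrow> (real \<times> real \<Rightarrow> 'a) \<Rightarrow> real \<times> real \<Rightarrow> real" where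
  "sq_density c w z = area_form \<Sigma> c (w z) (d1 c w z) (d2 c w z)"

lemma square_smooth_compose:
  assumes f: "area_map f" and w: "square_smooth w"
  shows "square_smooth (f \<circ> w)"
  unfolding square_smooth_def
proof (intro conjI ballI)
  have sm: "smooth_self_map \<Sigma> f" using f by (simp add: area_map_def)
  then have cf: "continuous_on UNIV f" by (simp add: smooth_self_map_def)
  have cw: "continuous_on unit_square w" using w by (simp add: square_smooth_def)
  show "continuous_on unit_square (f \<circ> w)" by (intro continuous_on_compose cw continuous_on_subset[OF cf]) auto
  fix d assume d: "d \<in> atlas \<Sigma>"
  let ?S = "unit_square \<inter> (f \<circ> w) -` fst d"
  show "smooth_on ?S (snd d \<circ> (f \<circ> w))"
  proof (rule smooth_on_local)
    fix z assume z: "z \<in> ?S"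
    obtain c where c: "c \<in> atlas \<Sigma>" "w z \<in> fst c" using chart_at .
    obtain U g where U: "z \<in> U" "smooth_open U g" "\<And>y. y \<in> U \<Longrightarrow> y \<in> unit_square \<Longrightarrow> w y \<in> fst c \<and> g y = snd c (w y)"
      using square_smooth_local[OF w c(1) _ c(2)] z by (metis IntD1)
    have "smooth_on (?S \<inter> U) (\<lambda>y. local_rep c d f (snd c (w y)))"
    proof (rule smooth_on_compose[where f="\<lambda>y. snd c (w y)" and g="local_rep c d f" and T="snd c ` (fst c \<inter> f -` fst d)"])
      show "smooth_on (?S \<inter> U) (\<lambda>y. snd c (w y))"
        by (rule smooth_on_cong[OF smooth_open_imp_smooth_on[OF U(2)]]) (use U(3) in auto)
      show "smooth_on (snd c ` (fst c \<inter> f -` fst d)) (local_rep c d f)"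
        by (rule smooth_open_imp_smooth_on[OF local_rep_smooth[OF sm c(1) d] order_refl])
      show "(\<lambda>y. snd c (w y)) ` (?S \<inter> U) \<subseteq> snd c ` (fst c \<inter> f -` fst d)" using U(3) by auto
    qed
    then have "smooth_on (?S \<inter> U) (snd d \<circ> (f \<circ> w))"
      by (rule smooth_on_cong) (use U(3) local_rep_chart[OF c(1)] in auto)
    then show "\<exists>W. open W \<and> z \<in> W \<and> smooth_on (?S \<inter> W) (snd d \<circ> (f \<circ> w))"
      using U(1,2) unfolding smooth_open_def by blast
  qed
qed

text \<open>Both partial derivatives are transformed by the derivative of the local representative
  of \<open>f\<close>, which preserves the area form. With \<open>f = id\<close> this is
  independence of the chart.\<close>

lemma sq_density_compose:
  assumes f: "area_map f" and w: "square_smooth w" and z: "z \<in> unit_square"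
    and c: "c \<in> atlas \<Sigma>" "w z \<in> fst c" and d: "d \<in> atlas \<Sigma>" "f (w z) \<in> fst d"
  shows "sq_density d (f \<circ> w) z = sq_density c w z"
proof -
  obtain s t where st: "z = (s,t)" "s \<in> {0..1}" "t \<in> {0..1}" using z by (cases z) auto
  have sm: "smooth_self_map \<Sigma> f" using f by (simp add: area_map_def)
  then have cf: "continuous_on UNIV f" by (simp add: smooth_self_map_def)
  have cw: "continuous_on unit_square w" using w by (simp add: square_smooth_def)
  let ?L = "frechet_derivative (local_rep c d f) (at (snd c (w z)))"
  have L: "(local_rep c d f has_derivative ?L) (at (snd c (w z)))"
    by (rule local_rep_has_derivative[OF sm c(1) d(1) c(2) d(2)])
  obtain \<delta> where \<delta>: "\<delta> > 0" "\<And>y. y \<in> unit_square \<Longrightarrow> dist y z < \<delta> \<Longrightarrow> w y \<in> fst c \<inter> f -` fst d"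
    using continuous_on_near[OF cw z local_dom_open(1)[OF c(1) d(1) cf]] c(2) d(2) by auto
  have chain: "((\<lambda>r. snd d (f (w (\<gamma> r)))) has_vector_derivative ?L X) (at r0 within {0..1})"
    if X: "((\<lambda>r. snd c (w (\<gamma> r))) has_vector_derivative X) (at r0 within {0..1})" and r0: "r0 \<in> {0..1}" "\<gamma> r0 = z"
      and \<gamma>: "\<And>r. r \<in> {0..1} \<Longrightarrow> \<gamma> r \<in> unit_square" "\<And>r. dist (\<gamma> r) z \<le> dist r r0" for \<gamma> X and r0 :: real
  proof -
    have "(local_rep c d f \<circ> (\<lambda>r. snd c (w (\<gamma> r))) has_vector_derivative ?L X) (at r0 within {0..1})"
      by (rule vector_derivative_diff_chain_within[OF X]) (use has_derivative_at_withinI[OF L] r0(2) in simp)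
    then show ?thesis
    proof (rule has_vector_derivative_transform_within[OF _ \<delta>(1) r0(1)])
      fix r assume r: "r \<in> {0..1}" "dist r r0 < \<delta>"
      then have "w (\<gamma> r) \<in> fst c \<inter> f -` fst d" using \<delta>(2)[OF \<gamma>(1)[OF r(1)]] \<gamma>(2)[of r] by linarith
      then show "(local_rep c d f \<circ> (\<lambda>r. snd c (w (\<gamma> r)))) r = snd d (f (w (\<gamma> r)))"
        using local_rep_chart[OF c(1)] by simp
    qed
  qed
  note D = has_d1_d2[OF w c(1), of s t]
  have "((\<lambda>r. snd d (f (w (r,t)))) has_vector_derivative ?L (d1 c w z)) (at s within {0..1})"
    by (rule chain[of "\<lambda>r. (r,t)"]) (use D z c st in \<open>auto simp: dist_Pair_Pair\<close>)
  then have 1: "d1 d (f \<circ> w) z = ?L (d1 c w z)"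
    using vector_derivative_within_closed_interval[OF zero_less_one st(2)] by (simp add: d1_def st(1))
  have "((\<lambda>r. snd d (f (w (s,r)))) has_vector_derivative ?L (d2 c w z)) (at t within {0..1})"
    by (rule chain[of "\<lambda>r. (s,r)"]) (use D z c st in \<open>auto simp: dist_Pair_Pair\<close>)
  then have 2: "d2 d (f \<circ> w) z = ?L (d2 c w z)"
    using vector_derivative_within_closed_interval[OF zero_less_one st(3)] by (simp add: d2_def st(1))
  show ?thesis
    unfolding sq_density_def 1 2 using area_map_area_form[OF f c(1) d(1) c(2) d(2)] by simp
qed

lemma sq_density_chart:
  assumes "square_smooth w" "z \<in> unit_square" "c \<in> atlas \<Sigma>" "w z \<in> fst c" "d \<in> atlas \<Sigma>" "w z \<in> fst d"
  shows "sq_density d w z = sq_density c w z"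
  using sq_density_compose[OF area_map_id assms(1-5)] assms(6) by simp

lemma capping_square_smooth:
  assumes "capping_disk \<Sigma> H x u" shows "square_smooth (polar u)"
proof -
  have cu: "continuous_on (cball 0 1) u" using assms by (simp add: capping_disk_def)
  have "continuous_on unit_square (\<lambda>z. u (of_real (fst z) * cis (2 * pi * snd z)))"
    by (rule continuous_on_compose2[OF cu]) (auto simp: norm_mult cis_conv_exp intro!: continuous_intros)
  then have "continuous_on unit_square (polar u)" by (simp add: polar_def case_prod_unfold)
  then show ?thesis using assms by (simp add: square_smooth_def capping_disk_def)
qed

text \<open>The arbitrarily chosen chart in \<open>pullback_density\<close> may be replaced by any
  convenient one.\<close>

lemma pullback_density_chart:
  assumes "square_smooth (polar u)" "z \<in> unit_square" "c \<in> atlas \<Sigma>" "polar u z \<in> fst c"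
  shows "pullback_density \<Sigma> u z = sq_density c (polar u) z"
proof -
  obtain s t where z: "z = (s,t)" by (cases z)
  define d where "d = (SOME c. c \<in> atlas \<Sigma> \<and> polar u (s, t) \<in> fst c)"
  have d: "d \<in> atlas \<Sigma> \<and> polar u (s,t) \<in> fst d" unfolding d_def by (rule someI[of _ c]) (use assms z in auto)
  have "pullback_density \<Sigma> u z = sq_density d (polar u) z"
    by (simp add: pullback_density_def z sq_density_def d1_def d2_def Let_def d_def[symmetric])
  also have "\<dots> = sq_density c (polar u) z" by (rule sq_density_chart) (use assms d z in auto)
  finally show ?thesis .
qed

lemma polar_compose: "polar (f \<circ> u) = f \<circ> polar u"
  by (auto simp: polar_def fun_eq_iff)

text \<open>A fixed point \<open>x\<close> with cap \<open>u\<close> for the composed Hamiltonian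
  corresponds to \<open>\<psi> x\<close> with cap \<open>\<psi> \<circ> u\<close> for
  \<open>H\<close>. Both terms of the action are unchanged, the first by conjugacy of the flows and
  the second because \<open>\<psi>\<close> preserves area.\<close>

lemma action_spectrum_compose:
  assumes \<psi>: "\<psi> \<in> symp \<Sigma>" and H: "H \<in> hamiltonians \<Sigma>"
  shows "action_spectrum \<Sigma> (\<lambda>t x. H t (\<psi> x)) \<subseteq> action_spectrum \<Sigma> H"
proof
  let ?H = "\<lambda>t x. H t (\<psi> x)"
  have am: "area_map \<psi>" by (rule area_map_symp[OF \<psi>])
  have c\<psi>: "continuous_on UNIV \<psi>" using \<psi> by (simp add: symp_def smooth_self_map_def)
  fix a assume "a \<in> action_spectrum \<Sigma> ?H"
  then obtain x u where a: "a = action \<Sigma> ?H x u" and fp: "contractible_fixed_point \<Sigma> ?H x" and cap: "capping_disk \<Sigma> ?H x u"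
    by (auto simp: action_spectrum_def)
  note flow = ham_flow_conjugate[OF \<psi> H, of _ x]
  have sq: "square_smooth (polar u)" by (rule capping_square_smooth[OF cap])
  have "contractible_fixed_point \<Sigma> H (\<psi> x)"
    unfolding contractible_fixed_point_def
  proof
    show "ham_flow \<Sigma> H 1 (\<psi> x) = \<psi> x" using flow[of 1] fp by (simp add: contractible_fixed_point_def)
    obtain b where b: "homotopic_loops UNIV (\<lambda>t. ham_flow \<Sigma> ?H t x) (\<lambda>t. b)"
      using fp by (auto simp: contractible_fixed_point_def)
    have 1: "homotopic_loops UNIV (\<psi> \<circ> (\<lambda>t. ham_flow \<Sigma> ?H t x)) (\<psi> \<circ> (\<lambda>t. b))"
      by (rule homotopic_loops_continuous_image[OF b c\<psi>]) simp
    \<comment> \<open>The conjugacy of the flows is known only for times in \<open>[0,1]\<close>, so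
      the two loops are homotopic but not equal as functions on the reals.\<close>
    have "homotopic_loops UNIV (\<psi> \<circ> (\<lambda>t. ham_flow \<Sigma> ?H t x)) (\<lambda>t. ham_flow \<Sigma> H t (\<psi> x))"
      by (rule homotopic_loops_eq) (use homotopic_loops_imp_path[OF 1] homotopic_loops_imp_loop[OF 1] flow in auto)
    from homotopic_loops_trans[OF homotopic_loops_sym[OF this] 1]
    show "\<exists>a. homotopic_loops UNIV (\<lambda>t. ham_flow \<Sigma> H t (\<psi> x)) (\<lambda>t. a)" by (auto simp: o_def)
  qed
  moreover have "capping_disk \<Sigma> H (\<psi> x) (\<psi> \<circ> u)"
    unfolding capping_disk_def
  proof (intro conjI)
    show "continuous_on (cball 0 1) (\<psi> \<circ> u)"
      using cap by (intro continuous_on_compose continuous_on_subset[OF c\<psi>]) (auto simp: capping_disk_def)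
    show "\<forall>c\<in>atlas \<Sigma>. smooth_on (unit_square \<inter> polar (\<psi> \<circ> u) -` fst c) (snd c \<circ> polar (\<psi> \<circ> u))"
      using square_smooth_compose[OF am sq] unfolding polar_compose square_smooth_def by blast
    show "\<forall>t\<in>{0..1}. (\<psi> \<circ> u) (cis (2 * pi * t)) = ham_flow \<Sigma> H t (\<psi> x)"
      using cap flow by (simp add: capping_disk_def)
  qed
  moreover have "action \<Sigma> H (\<psi> x) (\<psi> \<circ> u) = a"
  proof -
    have "integral {0..1} (\<lambda>t. H t (ham_flow \<Sigma> H t (\<psi> x))) = integral {0..1} (\<lambda>t. H t (\<psi> (ham_flow \<Sigma> ?H t x)))"
      by (rule integral_cong) (simp add: flow)
    moreover have "integral unit_square (pullback_density \<Sigma> (\<psi> \<circ> u)) = integral unit_square (pullback_density \<Sigma> u)"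
    proof (rule integral_cong)
      fix z assume z: "z \<in> unit_square"
      obtain c where c: "c \<in> atlas \<Sigma>" "polar u z \<in> fst c" using chart_at .
      obtain d where d: "d \<in> atlas \<Sigma>" "\<psi> (polar u z) \<in> fst d" using chart_at .
      have "pullback_density \<Sigma> (\<psi> \<circ> u) z = sq_density d (\<psi> \<circ> polar u) z"
        using pullback_density_chart[of "\<psi> \<circ> u" z d] square_smooth_compose[OF am sq] z d by (simp add: polar_compose)
      also have "\<dots> = sq_density c (polar u) z" by (rule sq_density_compose[OF am sq z c d])
      also have "\<dots> = pullback_density \<Sigma> u z" using pullback_density_chart[OF sq z c] by simp
      finally show "pullback_density \<Sigma> (\<psi> \<circ> u) z = pullback_density \<Sigma> u z" .
    qed
    ultimately show ?thesis by (simp add: a action_def)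
  qed
  ultimately show "a \<in> action_spectrum \<Sigma> H" unfolding action_spectrum_def by blast
qed

end

section \<open>Green's theorem\<close>

text \<open>Only one of the mixed second derivatives is demanded, and no pure ones. That is enough
  for Green's theorem and is satisfied by strips between curves that are merely
  \<open>C^1\<close>.\<close>

definition rect_C2 :: "real \<Rightarrow> real \<Rightarrow> real \<Rightarrow> real \<Rightarrow> (real \<Rightarrow> real \<Rightarrow> 'e::euclidean_space) \<Rightarrow> (real \<Rightarrow> real \<Rightarrow> 'e) \<Rightarrow>
    (real \<Rightarrow> real \<Rightarrow> 'e) \<Rightarrow> (real \<Rightarrow> real \<Rightarrow> 'e) \<Rightarrow> bool" where
  "rect_C2 a b c d W Ws Wt Wst \<longleftrightarrow>
    (\<forall>s\<in>{a..b}. \<forall>t\<in>{c..d}. ((\<lambda>r. W r t) has_vector_derivative Ws s t) (at s within {a..b}) \<and>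
       ((\<lambda>r. W s r) has_vector_derivative Wt s t) (at t within {c..d}) \<and>
       ((\<lambda>r. Wt r t) has_vector_derivative Wst s t) (at s within {a..b})) \<and>
    continuous_on ({a..b} \<times> {c..d}) (\<lambda>(s,t). W s t) \<and>
    continuous_on ({a..b} \<times> {c..d}) (\<lambda>(s,t). Ws s t) \<and>
    continuous_on ({a..b} \<times> {c..d}) (\<lambda>(s,t). Wt s t) \<and>
    continuous_on ({a..b} \<times> {c..d}) (\<lambda>(s,t). Wst s t)"

lemma continuous_on_slices:
  fixes f :: "'m::topological_space \<Rightarrow> 'n::topological_space \<Rightarrow> 'o::topological_space"
  assumes "continuous_on (S \<times> T) (\<lambda>(s,t). f s t)"
  shows "s \<in> S \<Longrightarrow> continuous_on T (f s)" "t \<in> T \<Longrightarrow> continuous_on S (\<lambda>s. f s t)"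
proof -
  assume "s \<in> S"
  then have "continuous_on T (\<lambda>t. case (s,t) of (s,t) \<Rightarrow> f s t)"
    by (intro continuous_on_compose2[OF assms] continuous_intros) auto
  then show "continuous_on T (f s)" by simp
next
  assume "t \<in> T"
  then have "continuous_on S (\<lambda>s. case (s,t) of (s,t) \<Rightarrow> f s t)"
    by (intro continuous_on_compose2[OF assms] continuous_intros) auto
  then show "continuous_on S (\<lambda>s. f s t)" by simp
qed

text \<open>Symmetry of the mixed second derivative: differentiate \<open>W s t = W s c + \<integral> Wt s\<close> under the
  integral sign.\<close>

lemma rect_C2_mixed:
  assumes W: "rect_C2 a b c d W Ws Wt Wst" and ab: "a < b" and s: "s \<in> {a..b}" and t: "t \<in> {c..d}"
  shows "((\<lambda>r. Ws s r) has_vector_derivative Wst s t) (at t within {c..d})"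
proof -
  note W' = W[unfolded rect_C2_def]
  have cWt: "continuous_on {c..d} (Wt r)" if "r \<in> {a..b}" for r using W' continuous_on_slices(1) that by blast
  have cWst: "continuous_on {c..d} (Wst s)" using W' continuous_on_slices(1) s by blast
  have eq: "Ws s v = Ws s c + integral {c..v} (Wst s)" if v: "v \<in> {c..d}" for v
  proof -
    have FTC: "W r v = W r c + integral {c..v} (Wt r)" if r: "r \<in> {a..b}" for r
    proof -
      have "(Wt r has_integral (W r v - W r c)) {c..v}"
      proof (rule fundamental_theorem_of_calculus)
        show "(W r has_vector_derivative Wt r x) (at x within {c..v})" if "x \<in> {c..v}" for x
        proof -
          have "(W r has_vector_derivative Wt r x) (at x within {c..d})" using W' r v that by simp
          then show ?thesis by (rule has_vector_derivative_within_subset) (use v in auto)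
        qed
      qed (use v in auto)
      from integral_unique[OF this] show ?thesis by simp
    qed
    have LR: "((\<lambda>r. W r c + integral {c..v} (Wt r)) has_vector_derivative (Ws s c + integral {c..v} (Wst s))) (at s within {a..b})"
    proof (rule has_vector_derivative_add)
      show "((\<lambda>r. W r c) has_vector_derivative Ws s c) (at s within {a..b})" using W' s v by simp
      have "((\<lambda>r. integral (cbox c v) (Wt r)) has_vector_derivative integral (cbox c v) (Wst s)) (at s within {a..b})"
      proof (rule leibniz_rule_vector_derivative[where fx=Wst])
        show "((\<lambda>x. Wt x t) has_vector_derivative Wst x t) (at x within {a..b})" if "x \<in> {a..b}" "t \<in> cbox c v" for x t
          using W' that v by auto
        show "Wt x integrable_on cbox c v" if "x \<in> {a..b}" for x
          using continuous_on_subset[OF cWt[OF that], of "{c..v}"] v by (intro integrable_continuous) auto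
        show "continuous_on ({a..b} \<times> cbox c v) (\<lambda>(x, t). Wst x t)"
          by (rule continuous_on_subset[of "{a..b} \<times> {c..d}"]) (use W' v in auto)
      qed (use s in auto)
      then show "((\<lambda>r. integral {c..v} (Wt r)) has_vector_derivative integral {c..v} (Wst s)) (at s within {a..b})" by simp
    qed
    have "((\<lambda>r. W r v) has_vector_derivative (Ws s c + integral {c..v} (Wst s))) (at s within {a..b})"
      by (rule has_vector_derivative_transform[OF s FTC LR])
    moreover have "((\<lambda>r. W r v) has_vector_derivative Ws s v) (at s within {a..b})" using W' s v by simp
    ultimately show ?thesis using vector_derivative_within_closed_interval[OF ab s] by metis
  qed
  have "((\<lambda>r. Ws s c + integral {c..r} (Wst s)) has_vector_derivative (0 + Wst s t)) (at t within {c..d})"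
    by (rule has_vector_derivative_add[OF has_vector_derivative_const integral_has_vector_derivative[OF cWst t]])
  from has_vector_derivative_transform[OF t eq this] show ?thesis by simp
qed

text \<open>Green's theorem for the form \<open>P dy\<^sub>2\<close> with \<open>\<partial>\<^sub>1 P = \<rho>\<close>.\<close>

lemma green_rect:
  fixes P :: "real^2 \<Rightarrow> real"
  assumes W: "rect_C2 a b c d W Ws Wt Wst" and ab: "a < b" and cd: "c < d"
    and V: "\<And>s t. s \<in> {a..b} \<Longrightarrow> t \<in> {c..d} \<Longrightarrow> W s t \<in> V"
    and P: "\<And>y. y \<in> V \<Longrightarrow> (P has_derivative (\<lambda>v. \<rho> y * v$1 + Q y * v$2)) (at y)"
    and \<rho>: "continuous_on V \<rho>" and Q: "continuous_on V Q"
  shows "integral ({a..b} \<times> {c..d}) (\<lambda>(s,t). \<rho> (W s t) * cross2 (Ws s t) (Wt s t)) =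
     integral {c..d} (\<lambda>t. P (W b t) * Wt b t $ 2) - integral {c..d} (\<lambda>t. P (W a t) * Wt a t $ 2)
     - integral {a..b} (\<lambda>s. P (W s d) * Ws s d $ 2) + integral {a..b} (\<lambda>s. P (W s c) * Ws s c $ 2)"
proof -
  note W' = W[unfolded rect_C2_def]
  let ?R = "{a..b} \<times> {c..d}"
  have Pc: "continuous_on V P" by (meson P has_derivative_continuous continuous_at_imp_continuous_on)
  have comp: "continuous_on ?R (\<lambda>(s,t). h (W s t))" if "continuous_on V h" for h :: "real^2 \<Rightarrow> real"
  proof -
    have "continuous_on ?R (\<lambda>(s,t). W s t)" "(\<lambda>(s,t). W s t) ` ?R \<subseteq> V" using W' V by auto
    from continuous_on_compose2[OF that this] show ?thesis by (simp add: case_prod_unfold)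
  qed
  have nth: "continuous_on ?R (\<lambda>(s,t). X s t $ i)" if "continuous_on ?R (\<lambda>(s,t). X s t)" for X :: "real \<Rightarrow> real \<Rightarrow> real^2" and i
    using that by (auto simp: case_prod_unfold intro: continuous_intros)
  have prod: "continuous_on ?R (\<lambda>(s,t). f s t * g s t)"
    if "continuous_on ?R (\<lambda>(s,t). f s t)" "continuous_on ?R (\<lambda>(s,t). g s t)" for f g :: "real \<Rightarrow> real \<Rightarrow> real"
    using that by (auto simp: case_prod_unfold intro: continuous_intros)
  have add: "continuous_on ?R (\<lambda>(s,t). f s t + g s t)"
    if "continuous_on ?R (\<lambda>(s,t). f s t)" "continuous_on ?R (\<lambda>(s,t). g s t)" for f g :: "real \<Rightarrow> real \<Rightarrow> real"
    using that by (auto simp: case_prod_unfold intro: continuous_intros)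
  have cs: "continuous_on ?R (\<lambda>(s,t). Ws s t)" "continuous_on ?R (\<lambda>(s,t). Wt s t)" "continuous_on ?R (\<lambda>(s,t). Wst s t)"
    using W' by auto
  \<comment> \<open>\<open>f\<close> is the \<open>s\<close>-derivative of
    \<open>P (W s t) * Wt s t $ 2\<close> and \<open>g\<close> the \<open>t\<close>-derivative of
    \<open>P (W s t) * Ws s t $ 2\<close>. In \<open>f - g\<close> the mixed derivatives and the
    terms with \<open>Q\<close> cancel, leaving the density times the Jacobian.\<close>
  define f where "f s t = (\<rho> (W s t) * Ws s t $ 1 + Q (W s t) * Ws s t $ 2) * Wt s t $ 2 + P (W s t) * Wst s t $ 2" for s t
  define g where "g s t = (\<rho> (W s t) * Wt s t $ 1 + Q (W s t) * Wt s t $ 2) * Ws s t $ 2 + P (W s t) * Wst s t $ 2" for s t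
  have cf: "continuous_on ?R (\<lambda>(s,t). f s t)" "continuous_on ?R (\<lambda>(s,t). g s t)"
    unfolding f_def g_def by (intro add prod comp nth cs \<rho> Q Pc)+
  have df: "((\<lambda>r. P (W r t) * Wt r t $ 2) has_vector_derivative f s t) (at s within {a..b})"
    if s: "s \<in> {a..b}" and t: "t \<in> {c..d}" for s t
  proof -
    have 1: "((\<lambda>r. W r t) has_vector_derivative Ws s t) (at s within {a..b})" using W' s t by simp
    have 2: "((P \<circ> (\<lambda>r. W r t)) has_vector_derivative (\<rho> (W s t) * Ws s t $ 1 + Q (W s t) * Ws s t $ 2)) (at s within {a..b})"
      using vector_derivative_diff_chain_within[OF 1 has_derivative_at_withinI[OF P[OF V[OF s t]]]] by simp
    have 3: "((\<lambda>r. Wt r t $ 2) has_vector_derivative Wst s t $ 2) (at s within {a..b})"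
      using W' s t by (intro bounded_linear.has_vector_derivative[OF bounded_linear_vec_nth]) auto
    have "((\<lambda>r. P (W r t) * Wt r t $ 2) has_vector_derivative
        P (W s t) * Wst s t $ 2 + (\<rho> (W s t) * Ws s t $ 1 + Q (W s t) * Ws s t $ 2) * Wt s t $ 2) (at s within {a..b})"
      using has_vector_derivative_mult[OF 2[unfolded o_def] 3] .
    then show ?thesis by (simp add: f_def add.commute)
  qed
  have dg: "((\<lambda>r. P (W s r) * Ws s r $ 2) has_vector_derivative g s t) (at t within {c..d})"
    if s: "s \<in> {a..b}" and t: "t \<in> {c..d}" for s t
  proof -
    have 1: "((\<lambda>r. W s r) has_vector_derivative Wt s t) (at t within {c..d})" using W' s t by simp
    have 2: "((P \<circ> (\<lambda>r. W s r)) has_vector_derivative (\<rho> (W s t) * Wt s t $ 1 + Q (W s t) * Wt s t $ 2)) (at t within {c..d})"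
      using vector_derivative_diff_chain_within[OF 1 has_derivative_at_withinI[OF P[OF V[OF s t]]]] by simp
    have 3: "((\<lambda>r. Ws s r $ 2) has_vector_derivative Wst s t $ 2) (at t within {c..d})"
      by (rule bounded_linear.has_vector_derivative[OF bounded_linear_vec_nth rect_C2_mixed[OF W ab s t]])
    have "((\<lambda>r. P (W s r) * Ws s r $ 2) has_vector_derivative
        P (W s t) * Wst s t $ 2 + (\<rho> (W s t) * Wt s t $ 1 + Q (W s t) * Wt s t $ 2) * Ws s t $ 2) (at t within {c..d})"
      using has_vector_derivative_mult[OF 2[unfolded o_def] 3] .
    then show ?thesis by (simp add: g_def add.commute)
  qed
  have If: "integral {a..b} (\<lambda>s. f s t) = P (W b t) * Wt b t $ 2 - P (W a t) * Wt a t $ 2" if "t \<in> {c..d}" for t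
    by (rule integral_unique[OF fundamental_theorem_of_calculus]) (use ab df that in auto)
  have Ig: "integral {c..d} (g s) = P (W s d) * Ws s d $ 2 - P (W s c) * Ws s c $ 2" if "s \<in> {a..b}" for s
    by (rule integral_unique[OF fundamental_theorem_of_calculus]) (use cd dg that in auto)
  have cbx: "cbox (a,c) (b,d) = ?R" by (simp add: cbox_Pair_eq)
  have split: "(\<lambda>(s,t). \<rho> (W s t) * cross2 (Ws s t) (Wt s t)) = (\<lambda>z. (case z of (s,t) \<Rightarrow> f s t) - (case z of (s,t) \<Rightarrow> g s t))"
    by (auto simp: f_def g_def cross2_def fun_eq_iff algebra_simps)
  have ints: "(\<lambda>(s,t). f s t) integrable_on ?R" "(\<lambda>(s,t). g s t) integrable_on ?R"
    using integrable_continuous[of "(a,c)" "(b,d)"] cf unfolding cbx by blast+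
  have F: "integral ?R (\<lambda>(s,t). f s t) = integral {c..d} (\<lambda>t. P (W b t) * Wt b t $ 2 - P (W a t) * Wt a t $ 2)"
  proof -
    have "integral ?R (\<lambda>(s,t). f s t) = integral (cbox a b) (\<lambda>s. integral (cbox c d) (f s))"
      using integral_prod_continuous[of a c b d "\<lambda>(s,t). f s t"] cf(1) unfolding cbx by simp
    also have "\<dots> = integral (cbox c d) (\<lambda>t. integral (cbox a b) (\<lambda>s. f s t))"
      by (rule integral_swap_continuous) (use cf(1) cbx in simp)
    also have "\<dots> = integral {c..d} (\<lambda>t. P (W b t) * Wt b t $ 2 - P (W a t) * Wt a t $ 2)"
      unfolding box_real by (rule integral_cong) (rule If)
    finally show ?thesis .
  qed
  have G: "integral ?R (\<lambda>(s,t). g s t) = integral {a..b} (\<lambda>s. P (W s d) * Ws s d $ 2 - P (W s c) * Ws s c $ 2)"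
  proof -
    have "integral ?R (\<lambda>(s,t). g s t) = integral (cbox a b) (\<lambda>s. integral (cbox c d) (g s))"
      using integral_prod_continuous[of a c b d "\<lambda>(s,t). g s t"] cf(2) unfolding cbx by simp
    also have "\<dots> = integral {a..b} (\<lambda>s. P (W s d) * Ws s d $ 2 - P (W s c) * Ws s c $ 2)"
      unfolding box_real by (rule integral_cong) (rule Ig)
    finally show ?thesis .
  qed
  have i1: "(\<lambda>t. P (W s t) * Wt s t $ 2) integrable_on {c..d}" if "s \<in> {a..b}" for s
    by (rule integrable_continuous_real[OF continuous_on_slices(1)[OF prod[OF comp[OF Pc] nth[OF cs(2)]] that]])
  have i2: "(\<lambda>s. P (W s t) * Ws s t $ 2) integrable_on {a..b}" if "t \<in> {c..d}" for t
    by (rule integrable_continuous_real[OF continuous_on_slices(2)[OF prod[OF comp[OF Pc] nth[OF cs(1)]] that]])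
  show ?thesis
    unfolding split integral_diff[OF ints] F G
    using integral_diff[OF i1[of b] i1[of a]] integral_diff[OF i2[of d] i2[of c]] ab cd by simp
qed

text \<open>The interpolation is affine in \<open>s\<close>, so the mixed derivative is the
  difference of the two velocities and the curves need only be \<open>C^1\<close>.\<close>

lemma rect_C2_strip:
  fixes y0 y1 :: "real \<Rightarrow> 'e::euclidean_space"
  assumes y0: "\<And>t. t \<in> {c..d} \<Longrightarrow> (y0 has_vector_derivative y0' t) (at t within {c..d})" "continuous_on {c..d} y0'"
    and y1: "\<And>t. t \<in> {c..d} \<Longrightarrow> (y1 has_vector_derivative y1' t) (at t within {c..d})" "continuous_on {c..d} y1'"
  shows "rect_C2 0 1 c d (\<lambda>s t. (1 - s) *\<^sub>R y0 t + s *\<^sub>R y1 t) (\<lambda>s t. y1 t - y0 t)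
     (\<lambda>s t. (1 - s) *\<^sub>R y0' t + s *\<^sub>R y1' t) (\<lambda>s t. y1' t - y0' t)"
proof -
  have c0: "continuous_on {c..d} y0" "continuous_on {c..d} y1"
    using y0(1) y1(1) by (meson continuous_on_eq_continuous_within has_vector_derivative_continuous)+
  have lift: "continuous_on ({0..1} \<times> {c..d}) (\<lambda>p. h (snd p))" if "continuous_on {c..d} h" for h :: "real \<Rightarrow> 'e"
    by (rule continuous_on_compose2[OF that]) (auto intro: continuous_intros)
  note L = lift[OF c0(1)] lift[OF c0(2)] lift[OF y0(2)] lift[OF y1(2)]
  have lin: "((\<lambda>r. (1 - r) *\<^sub>R u + r *\<^sub>R v) has_vector_derivative (v - u)) (at s within {0..1})" for u v :: 'e and s
    unfolding has_vector_derivative_def by (auto intro!: derivative_eq_intros simp: algebra_simps)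
  have D: "((\<lambda>r. (1 - s) *\<^sub>R y0 r + s *\<^sub>R y1 r) has_vector_derivative ((1 - s) *\<^sub>R y0' t + s *\<^sub>R y1' t)) (at t within {c..d})"
    if "t \<in> {c..d}" for s t
    by (intro has_vector_derivative_add bounded_linear.has_vector_derivative[OF bounded_linear_scaleR_right] y0 y1 that)
  show ?thesis
    unfolding rect_C2_def case_prod_unfold
    by (intro conjI ballI lin D continuous_intros L) auto
qed

text \<open>Allows Green's theorem to be applied to the same surface patch in a second chart, after
  composition with the transition map.\<close>

lemma rect_C2_compose:
  fixes f :: "real^2 \<Rightarrow> real^2"
  assumes W: "rect_C2 a b c d W Ws Wt Wst" and f: "smooth_open U f"
    and U: "\<And>s t. s \<in> {a..b} \<Longrightarrow> t \<in> {c..d} \<Longrightarrow> W s t \<in> U"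
  obtains Z where "rect_C2 a b c d (\<lambda>s t. f (W s t)) (\<lambda>s t. frechet_derivative f (at (W s t)) (Ws s t))
     (\<lambda>s t. frechet_derivative f (at (W s t)) (Wt s t)) Z"
proof -
  note W' = W[unfolded rect_C2_def]
  let ?R = "{a..b} \<times> {c..d}"
  let ?f = "\<lambda>i y. frechet_derivative f (at y) (axis i 1)"
  have sf: "smooth_open U (?f i)" for i :: 2 by (rule smooth_open_deriv[OF f])
  have lin: "frechet_derivative f (at y) v = v$1 *\<^sub>R ?f 1 y + v$2 *\<^sub>R ?f 2 y" if "y \<in> U" for y v
    by (rule linear_real2[OF bounded_linear.linear[OF has_derivative_bounded_linear[OF smooth_open_has_derivative[OF f that]]]])
  have comp: "continuous_on ?R (\<lambda>(s,t). h (W s t))" if "continuous_on U h" for h :: "real^2 \<Rightarrow> real^2"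
  proof -
    have "continuous_on ?R (\<lambda>(s,t). W s t)" "(\<lambda>(s,t). W s t) ` ?R \<subseteq> U" using W' U by auto
    from continuous_on_compose2[OF that this] show ?thesis by (simp add: case_prod_unfold)
  qed
  have nth: "continuous_on ?R (\<lambda>(s,t). X s t $ i)" if "continuous_on ?R (\<lambda>(s,t). X s t)" for X :: "real \<Rightarrow> real \<Rightarrow> real^2" and i
    using that by (auto simp: case_prod_unfold intro: continuous_intros)
  have scal: "continuous_on ?R (\<lambda>(s,t). g s t *\<^sub>R X s t)"
    if "continuous_on ?R (\<lambda>(s,t). g s t)" "continuous_on ?R (\<lambda>(s,t). X s t)" for X :: "real \<Rightarrow> real \<Rightarrow> real^2" and g :: "real \<Rightarrow> real \<Rightarrow> real"
    using that by (auto simp: case_prod_unfold intro: continuous_intros)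
  have add: "continuous_on ?R (\<lambda>(s,t). Y s t + X s t)"
    if "continuous_on ?R (\<lambda>(s,t). Y s t)" "continuous_on ?R (\<lambda>(s,t). X s t)" for X Y :: "real \<Rightarrow> real \<Rightarrow> real^2"
    using that by (auto simp: case_prod_unfold intro: continuous_intros)
  have cs: "continuous_on ?R (\<lambda>(s,t). W s t)" "continuous_on ?R (\<lambda>(s,t). Ws s t)" "continuous_on ?R (\<lambda>(s,t). Wt s t)" "continuous_on ?R (\<lambda>(s,t). Wst s t)"
    using W' by auto
  have cD: "continuous_on ?R (\<lambda>(s,t). frechet_derivative h (at (W s t)) (X s t))"
    if h: "smooth_open U h" and X: "continuous_on ?R (\<lambda>(s,t). X s t)" for X and h :: "real^2 \<Rightarrow> real^2"
  proof -
    have C1: "continuous_on ?R (\<lambda>(s,t). X s t $ 1 *\<^sub>R frechet_derivative h (at (W s t)) (axis 1 1) + X s t $ 2 *\<^sub>R frechet_derivative h (at (W s t)) (axis 2 1))"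
      by (intro add scal nth X comp[of "\<lambda>y. frechet_derivative h (at y) (axis _ 1)"] smooth_open_continuous_on[OF smooth_open_deriv[OF h]])
    have "frechet_derivative h (at y) v = v$1 *\<^sub>R frechet_derivative h (at y) (axis 1 1) + v$2 *\<^sub>R frechet_derivative h (at y) (axis 2 1)" if "y \<in> U" for y v
      by (rule linear_real2[OF bounded_linear.linear[OF has_derivative_bounded_linear[OF smooth_open_has_derivative[OF h that]]]])
    from this[symmetric] have "continuous_on ?R (\<lambda>(s,t). X s t $ 1 *\<^sub>R frechet_derivative h (at (W s t)) (axis 1 1) + X s t $ 2 *\<^sub>R frechet_derivative h (at (W s t)) (axis 2 1))
       = continuous_on ?R (\<lambda>(s,t). frechet_derivative h (at (W s t)) (X s t))"
      by (intro continuous_on_cong refl) (clarsimp simp: U)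
    then show ?thesis using C1 by simp
  qed
  have chain: "((\<lambda>r. h (\<gamma> r)) has_vector_derivative frechet_derivative h (at (\<gamma> r0)) X) (at r0 within I)"
    if "smooth_open U h" "(\<gamma> has_vector_derivative X) (at r0 within I)" "\<gamma> r0 \<in> U" for h :: "real^2 \<Rightarrow> real^2" and \<gamma> X r0 I
    using vector_derivative_diff_chain_within[OF that(2) has_derivative_at_withinI[OF smooth_open_has_derivative[OF that(1,3)]]]
    by (simp add: o_def)
  define Z where "Z s t = (Wt s t $ 1 *\<^sub>R frechet_derivative (?f 1) (at (W s t)) (Ws s t) + Wst s t $ 1 *\<^sub>R ?f 1 (W s t)) +
     (Wt s t $ 2 *\<^sub>R frechet_derivative (?f 2) (at (W s t)) (Ws s t) + Wst s t $ 2 *\<^sub>R ?f 2 (W s t))" for s t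
  have DZ: "((\<lambda>r. frechet_derivative f (at (W r t)) (Wt r t)) has_vector_derivative Z s t) (at s within {a..b})"
    if s: "s \<in> {a..b}" and t: "t \<in> {c..d}" for s t
  proof -
    have 1: "((\<lambda>r. Wt r t $ i) has_vector_derivative Wst s t $ i) (at s within {a..b})" for i
      using W' s t by (intro bounded_linear.has_vector_derivative[OF bounded_linear_vec_nth]) auto
    have 2: "((\<lambda>r. ?f i (W r t)) has_vector_derivative frechet_derivative (?f i) (at (W s t)) (Ws s t)) (at s within {a..b})" for i
      by (rule chain[OF sf]) (use W' U s t in auto)
    have "((\<lambda>r. Wt r t $ 1 *\<^sub>R ?f 1 (W r t) + Wt r t $ 2 *\<^sub>R ?f 2 (W r t)) has_vector_derivative Z s t) (at s within {a..b})"
      unfolding Z_def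
      by (intro has_vector_derivative_add has_vector_derivative_scaleR 2 1[unfolded has_real_derivative_iff_has_vector_derivative[symmetric]])
    from has_vector_derivative_transform[OF s lin[OF U[OF _ t]] this] show ?thesis .
  qed
  have "rect_C2 a b c d (\<lambda>s t. f (W s t)) (\<lambda>s t. frechet_derivative f (at (W s t)) (Ws s t))
     (\<lambda>s t. frechet_derivative f (at (W s t)) (Wt s t)) Z"
    unfolding rect_C2_def
  proof (intro conjI ballI)
    fix s t assume s: "s \<in> {a..b}" and t: "t \<in> {c..d}"
    show "((\<lambda>r. f (W r t)) has_vector_derivative frechet_derivative f (at (W s t)) (Ws s t)) (at s within {a..b})"
      by (rule chain[OF f]) (use W' U s t in auto)
    show "((\<lambda>r. f (W s r)) has_vector_derivative frechet_derivative f (at (W s t)) (Wt s t)) (at t within {c..d})"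
      by (rule chain[OF f]) (use W' U s t in auto)
    show "((\<lambda>r. frechet_derivative f (at (W r t)) (Wt r t)) has_vector_derivative Z s t) (at s within {a..b})" by (rule DZ[OF s t])
  next
    show "continuous_on ?R (\<lambda>(s,t). f (W s t))" by (rule comp[OF smooth_open_continuous_on[OF f]])
    show "continuous_on ?R (\<lambda>(s,t). frechet_derivative f (at (W s t)) (Ws s t))" by (rule cD[OF f cs(2)])
    show "continuous_on ?R (\<lambda>(s,t). frechet_derivative f (at (W s t)) (Wt s t))" by (rule cD[OF f cs(3)])
    show "continuous_on ?R (\<lambda>(s,t). Z s t)" unfolding Z_def
      by (intro add scal nth cs cD sf comp smooth_open_continuous_on[OF sf])
  qed
  then show thesis by (rule that)
qed

text \<open>The primitive is the integral of the density along the horizontal segment from the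
  vertical line through \<open>q\<close> to \<open>y\<close>. Rescaled to \<open>[0,1]\<close> its
  integrand is \<open>f\<close>, and differentiation under the integral gives both partial
  derivatives.\<close>

lemma horizontal_primitive:
  fixes \<rho> :: "real^2 \<Rightarrow> real"
  assumes \<rho>: "smooth_open U \<rho>" and sub: "ball q r \<subseteq> U"
  obtains P Q where "\<And>y. y \<in> ball q r \<Longrightarrow> (P has_derivative (\<lambda>v. \<rho> y * v$1 + Q y * v$2)) (at y)"
    "continuous_on (ball q r) Q"
proof -
  let ?V = "ball q r"
  define A where "A \<tau> y = ((q$1 + \<tau> * (y$1 - q$1)) *\<^sub>R axis 1 1 + (y$2) *\<^sub>R axis 2 1 :: real^2)" for \<tau> and y :: "real^2"
  define f where "f \<tau> y = (y$1 - q$1) * \<rho> (A \<tau> y)" for \<tau> y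
  \<comment> \<open>The horizontal segment starts at the point with first coordinate that of
    \<open>q\<close>, whose distance from \<open>q\<close> is only the vertical part of that of
    \<open>y\<close>; convexity of the ball does the rest.\<close>
  have AV: "A \<tau> y \<in> ?V" if "\<tau> \<in> {0..1}" "y \<in> ?V" for \<tau> y
  proof -
    let ?y = "A 0 y"
    have "norm (?y - q) = \<bar>(y - q)$2\<bar>"
      by (simp add: A_def norm_vec_def L2_set_def sum_2 axis_def)
    also have "\<dots> \<le> norm (y - q)" by (rule component_le_norm_cart)
    finally have "?y \<in> ?V" using that(2) by (simp add: dist_norm norm_minus_commute)
    moreover have "A \<tau> y = (1 - \<tau>) *\<^sub>R ?y + \<tau> *\<^sub>R y"
      by (simp add: A_def vec_eq_iff forall_2 axis_def algebra_simps)
    ultimately show ?thesis using convexD[OF convex_ball _ that(2), of ?y "1-\<tau>" \<tau>] that(1) by simp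
  qed
  let ?D = "{0..1::real} \<times> ?V"
  have so: "slices_open ?D" by simp
  have cst: "family_C k ?D (\<lambda>\<tau> y. g \<tau>)" if "continuous_on UNIV g" for k and g :: "real \<Rightarrow> real"
  proof (rule family_C_const[OF so])
    show "continuous_on ?D (\<lambda>(s, z). g s)"
      using continuous_on_compose2[OF that continuous_on_fst[OF continuous_on_id], of ?D] by (simp add: case_prod_unfold)
  qed
  have cst2: "family_C k ?D (\<lambda>\<tau> y. v)" for k and v :: "real^2"
    by (rule family_C_const[OF so]) (auto simp: case_prod_unfold)
  have nth: "family_C k ?D (\<lambda>\<tau> y. y $ i)" for k i by (rule family_C_linear[OF bounded_linear_vec_nth so])
  have pd: "family_C k ?D (\<lambda>\<tau> y. y$1 - q$1)" for k
    using family_C_add[OF so nth[of k 1] cst[of "\<lambda>_. - q$1" k]] by simp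
  have pA: "family_C k ?D A" for k
  proof -
    have "family_C k ?D (\<lambda>\<tau> y. \<tau> * (y$1 - q$1))"
      by (rule family_C_bilinear[OF bounded_bilinear_mult so cst pd]) (rule continuous_on_id)
    from family_C_add[OF so cst[of "\<lambda>\<tau>. q$1"] this]
    have "family_C k ?D (\<lambda>\<tau> y. q$1 + \<tau> * (y$1 - q$1))" by simp
    from family_C_add[OF so family_C_bilinear[OF bounded_bilinear_scaleR so this cst2] family_C_bilinear[OF bounded_bilinear_scaleR so nth cst2]]
    have "family_C k ?D (\<lambda>\<tau> y. (q$1 + \<tau> * (y$1 - q$1)) *\<^sub>R axis 1 1 + (y$2) *\<^sub>R axis 2 1 :: real^2)" .
    then show ?thesis by (simp add: A_def[abs_def])
  qed
  have pf: "family_C k ?D f" for k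
  proof -
    have "family_C k ?D (\<lambda>\<tau> y. \<rho> (A \<tau> y))"
    proof (rule family_C_compose[where B="UNIV \<times> U" and F=A and G="\<lambda>\<tau>. \<rho>", OF so _ _ pA smooth_open_family_C[OF \<rho>]])
      show "slices_open (UNIV \<times> U)" using \<rho> by (simp add: smooth_open_def)
      show "(\<tau>, A \<tau> y) \<in> UNIV \<times> U" if "(\<tau>, y) \<in> ?D" for \<tau> y using AV[of \<tau> y] that sub by auto
    qed
    from family_C_bilinear[OF bounded_bilinear_mult so pd this] show ?thesis by (simp add: f_def[abs_def])
  qed
  have fd: "((\<lambda>y. f \<tau> y) has_derivative frechet_derivative (f \<tau>) (at y)) (at y)" if "\<tau> \<in> {0..1}" "y \<in> ?V" for \<tau> y
    using family_C_differentiable[OF pf[of "Suc 0"], of \<tau> y] that by simp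
  have fc: "continuous_on ?D (\<lambda>(\<tau>,y). frechet_derivative (f \<tau>) (at y) v)" for v
    using pf[of "Suc 0"] by simp
  have fc': "continuous_on (?V \<times> {0..1}) (\<lambda>(y,\<tau>). frechet_derivative (f \<tau>) (at y) v)" for v
  proof -
    have "continuous_on (?V \<times> {0..1}) (\<lambda>p. (snd p, fst p))" "(\<lambda>p. (snd p, fst p)) ` (?V \<times> {0..1}) \<subseteq> ?D"
      by (intro continuous_intros) auto
    from continuous_on_compose2[OF fc[of v] this] show ?thesis by (simp add: case_prod_unfold)
  qed
  define P where "P y = integral (cbox 0 1) (\<lambda>\<tau>. f \<tau> y)" for y
  \<comment> \<open>The Leibniz rule for total derivatives takes an integrand with values in the
    bounded linear maps.\<close>
  define E where "E y \<tau> = Blinfun (frechet_derivative (f \<tau>) (at y))" for y \<tau>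
  have E: "blinfun_apply (E y \<tau>) = frechet_derivative (f \<tau>) (at y)" if "\<tau> \<in> {0..1}" "y \<in> ?V" for y \<tau>
    unfolding E_def by (rule bounded_linear_Blinfun_apply[OF has_derivative_bounded_linear[OF fd[OF that]]])
  have Ec: "continuous_on (?V \<times> {0..1}) (\<lambda>(y,\<tau>). E y \<tau>)"
  proof (rule continuous_on_blinfun_componentwise)
    fix i :: "real^2"
    show "continuous_on (?V \<times> {0..1}) (\<lambda>x. blinfun_apply (case x of (y, \<tau>) \<Rightarrow> E y \<tau>) i)"
    proof -
      have "continuous_on (?V \<times> {0..1}) (\<lambda>x. blinfun_apply (case x of (y, \<tau>) \<Rightarrow> E y \<tau>) i) =
        continuous_on (?V \<times> {0..1}) (\<lambda>(y,\<tau>). frechet_derivative (f \<tau>) (at y) i)"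
        by (intro continuous_on_cong refl) (clarsimp simp: E)
      then show ?thesis using fc' by simp
    qed
  qed
  define Q where "Q y = integral {0..1} (\<lambda>\<tau>. frechet_derivative (f \<tau>) (at y) (axis 2 1))" for y
  have "(P has_derivative (\<lambda>v. \<rho> y * v$1 + Q y * v$2)) (at y)" if y: "y \<in> ?V" for y
  proof -
    have "((\<lambda>y. integral (cbox 0 1) (\<lambda>\<tau>. f \<tau> y)) has_derivative integral (cbox 0 1) (E y)) (at y within ?V)"
    proof (rule leibniz_rule[where fx=E])
      show "((\<lambda>y. f \<tau> y) has_derivative blinfun_apply (E y \<tau>)) (at y within ?V)" if "y \<in> ?V" "\<tau> \<in> cbox 0 1" for y \<tau>
        using has_derivative_at_withinI[OF fd[of \<tau> y]] E[of \<tau> y] that by simp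
      show "(\<lambda>\<tau>. f \<tau> y) integrable_on cbox 0 1" if "y \<in> ?V" for y
        using continuous_on_slices(2)[OF family_C_imp_continuous[OF pf[of 0]] that] by (intro integrable_continuous) simp
      show "continuous_on (?V \<times> cbox 0 1) (\<lambda>(y, \<tau>). E y \<tau>)" using Ec by simp
    qed (use y in auto)
    then have D: "(P has_derivative blinfun_apply (integral {0..1} (E y))) (at y)"
      unfolding P_def[abs_def] at_within_open[OF y open_ball] box_real .
    have Ei: "E y integrable_on {0..1}"
      using continuous_on_slices(1)[OF Ec y] by (intro integrable_continuous_real)
    have app: "blinfun_apply (integral {0..1} (E y)) v = integral {0..1} (\<lambda>\<tau>. frechet_derivative (f \<tau>) (at y) v)" for v
      unfolding blinfun_apply_integral[OF Ei] by (rule integral_cong) (simp only: E[OF _ y])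
    \<comment> \<open>The derivative of \<open>f \<tau>\<close> in the first coordinate direction is
      the derivative of \<open>\<tau> * \<rho> (A \<tau> y)\<close> with respect to
      \<open>\<tau>\<close>, so its integral is the value at \<open>\<tau> = 1\<close>, where
      \<open>A 1 y = y\<close>.\<close>
    have e1: "integral {0..1} (\<lambda>\<tau>. frechet_derivative (f \<tau>) (at y) (axis 1 1)) = \<rho> y"
    proof -
      have "((\<lambda>\<tau>. frechet_derivative (f \<tau>) (at y) (axis 1 1)) has_integral (1 * \<rho> (A 1 y) - 0 * \<rho> (A 0 y))) {0..1}"
      proof (rule fundamental_theorem_of_calculus)
        fix \<tau> :: real assume t: "\<tau> \<in> {0..1}"
        let ?L = "frechet_derivative \<rho> (at (A \<tau> y))"
        have R: "(\<rho> has_derivative ?L) (at (A \<tau> y))"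
          by (rule smooth_open_has_derivative[OF \<rho>]) (use AV[OF t y] sub in auto)
        interpret L: bounded_linear ?L using R by (rule has_derivative_bounded_linear)
        have dA: "((\<lambda>y. A \<tau> y) has_derivative (\<lambda>v. (\<tau> * v$1) *\<^sub>R axis 1 1 + v$2 *\<^sub>R axis 2 1)) (at y)"
          unfolding A_def by (auto intro!: derivative_eq_intros bounded_linear.has_derivative[OF bounded_linear_vec_nth])
        have d1: "((\<lambda>y. y$1 - q$1) has_derivative (\<lambda>v. v$1)) (at y)"
          by (auto intro!: derivative_eq_intros bounded_linear.has_derivative[OF bounded_linear_vec_nth])
        have "(f \<tau> has_derivative (\<lambda>v. (y$1 - q$1) * ?L ((\<tau> * v$1) *\<^sub>R axis 1 1 + v$2 *\<^sub>R axis 2 1) + v$1 * \<rho> (A \<tau> y))) (at y)"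
          unfolding f_def
          using has_derivative_mult[OF d1 diff_chain_at[OF dA R, unfolded o_def]] .
        then have "frechet_derivative (f \<tau>) (at y) (axis 1 1) = (y$1 - q$1) * ?L (\<tau> *\<^sub>R axis 1 1) + \<rho> (A \<tau> y)"
          by (subst frechet_derivative_at[symmetric]) (assumption, simp add: axis_def)
        moreover have "((\<lambda>\<tau>. A \<tau> y) has_vector_derivative (y$1 - q$1) *\<^sub>R axis 1 1) (at \<tau> within {0..1})"
          unfolding A_def has_vector_derivative_def by (auto intro!: derivative_eq_intros simp: algebra_simps)
        from vector_derivative_diff_chain_within[OF this has_derivative_at_withinI[OF R]]
        have "((\<lambda>\<tau>. \<rho> (A \<tau> y)) has_vector_derivative (y$1 - q$1) * ?L (axis 1 1)) (at \<tau> within {0..1})"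
          by (simp add: o_def L.scaleR)
        from has_vector_derivative_mult[OF has_vector_derivative_id[unfolded id_def] this]
        have "((\<lambda>\<tau>. \<tau> * \<rho> (A \<tau> y)) has_vector_derivative \<tau> * ((y$1 - q$1) * ?L (axis 1 1)) + 1 * \<rho> (A \<tau> y)) (at \<tau> within {0..1})" .
        ultimately show "((\<lambda>\<tau>. \<tau> * \<rho> (A \<tau> y)) has_vector_derivative frechet_derivative (f \<tau>) (at y) (axis 1 1)) (at \<tau> within {0..1})"
          by (simp add: L.scaleR mult.left_commute)
      qed simp
      moreover have "A 1 y = y" by (simp add: A_def vec_eq_iff forall_2 axis_def)
      ultimately show ?thesis using integral_unique by force
    qed
    have "blinfun_apply (integral {0..1} (E y)) v = \<rho> y * v$1 + Q y * v$2" for v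
      using linear_real2[OF blinfun.bounded_linear_right[of "integral {0..1} (E y)", THEN bounded_linear.linear], of v]
      unfolding app[of "axis 1 1"] app[of "axis 2 1"] e1 Q_def[symmetric] by (simp add: mult.commute)
    then have "blinfun_apply (integral {0..1} (E y)) = (\<lambda>v. \<rho> y * v$1 + Q y * v$2)" by blast
    then show ?thesis using D by simp
  qed
  moreover have "continuous_on ?V Q"
    unfolding Q_def using integral_continuous_on_param[of ?V 0 1 "\<lambda>y \<tau>. frechet_derivative (f \<tau>) (at y) (axis 2 1)"] fc' by simp
  ultimately show thesis by (rule that)
qed

section \<open>Line integrals in chart disks\<close>

lemma continuous_on_locally:
  fixes f :: "'m::metric_space \<Rightarrow> 'n::metric_space"
  assumes "\<And>x. x \<in> A \<Longrightarrow> \<exists>U g. open U \<and> x \<in> U \<and> continuous_on U g \<and> (\<forall>y\<in>U \<inter> A. f y = g y)"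
  shows "continuous_on A f"
  unfolding continuous_on_eq_continuous_within
proof
  fix x assume x: "x \<in> A"
  then obtain U g where U: "open U" "x \<in> U" "continuous_on U g" "\<forall>y\<in>U \<inter> A. f y = g y" using assms by blast
  have "continuous (at x within A) g"
    using U(1-3) by (simp add: continuous_on_eq_continuous_at continuous_at_imp_continuous_at_within)
  then have "(g \<longlongrightarrow> f x) (at x within A)" using U(2,4) x by (simp add: continuous_within)
  moreover have "eventually (\<lambda>y. g y = f y) (at x within A)"
    unfolding eventually_at_topological using U(1,2,4) by (intro exI[of _ U]) simp
  ultimately show "continuous (at x within A) f"
    unfolding continuous_within by (rule Lim_transform_eventually)
qed

context area_surface begin

text \<open>The value is only meaningful at times at which the curve lies in the chart.\<close>

definition curve_deriv :: "'a chart \<Rightarrow> real \<Rightarrow> real \<Rightarrow> (real \<Rightarrow> 'a) \<Rightarrow> real \<Rightarrow> real^2" where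
  "curve_deriv c a b \<gamma> t = vector_derivative (\<lambda>r. snd c (\<gamma> r)) (at t within {a..b})"

definition curve_C1 :: "real \<Rightarrow> real \<Rightarrow> (real \<Rightarrow> 'a) \<Rightarrow> bool" where
  "curve_C1 a b \<gamma> \<longleftrightarrow> continuous_on {a..b} \<gamma> \<and> (\<forall>c\<in>atlas \<Sigma>.
     (\<forall>t\<in>{a..b}. \<gamma> t \<in> fst c \<longrightarrow> ((\<lambda>r. snd c (\<gamma> r)) has_vector_derivative curve_deriv c a b \<gamma> t) (at t within {a..b})) \<and>
     continuous_on ({a..b} \<inter> \<gamma> -` fst c) (curve_deriv c a b \<gamma>))"

text \<open>The integral along the curve of the 1-form \<open>P\<close> times the differential of
  the second coordinate of the chart.\<close>

definition line_int :: "(real^2 \<Rightarrow> real) \<Rightarrow> 'a chart \<Rightarrow> real \<Rightarrow> real \<Rightarrow> (real \<Rightarrow> 'a) \<Rightarrow> real" where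
  "line_int P c a b \<gamma> = integral {a..b} (\<lambda>t. P (snd c (\<gamma> t)) * curve_deriv c a b \<gamma> t $ 2)"

text \<open>A curve that is \<open>C^1\<close> in one chart containing it is \<open>C^1\<close> in
  every chart, its velocities being related by the derivative of the transition map.\<close>

lemma curve_C1I:
  assumes ab: "a < b" and c: "c \<in> atlas \<Sigma>" and y: "\<And>t. t \<in> {a..b} \<Longrightarrow> y t \<in> snd c ` fst c"
    "\<And>t. t \<in> {a..b} \<Longrightarrow> (y has_vector_derivative y' t) (at t within {a..b})" "continuous_on {a..b} y'"
    and \<gamma>: "\<And>t. t \<in> {a..b} \<Longrightarrow> \<gamma> t = coord_inv c (y t)"
  shows "curve_C1 a b \<gamma>"
    and "\<And>d t. d \<in> atlas \<Sigma> \<Longrightarrow> t \<in> {a..b} \<Longrightarrow> \<gamma> t \<in> fst d \<Longrightarrow>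
       curve_deriv d a b \<gamma> t = frechet_derivative (local_rep c d id) (at (y t)) (y' t)"
proof -
  have sm: "smooth_self_map \<Sigma> id" using area_map_id by (simp add: area_map_def)
  have cy: "continuous_on {a..b} y"
    using y(2) by (meson continuous_on_eq_continuous_within has_vector_derivative_continuous)
  have c\<gamma>: "continuous_on {a..b} \<gamma>"
  proof -
    have "continuous_on {a..b} (\<lambda>t. coord_inv c (y t))"
      by (rule continuous_on_compose2[OF continuous_coord_inv[OF c] cy]) (use y(1) in blast)
    then show ?thesis by (rule continuous_on_eq) (simp add: \<gamma>)
  qed
  have \<gamma>c: "\<gamma> t \<in> fst c" "snd c (\<gamma> t) = y t" if "t \<in> {a..b}" for t
    using \<gamma>[OF that] coord_inv_in[OF c y(1)[OF that]] chart_coord_inv[OF c y(1)[OF that]] by auto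
  have D: "((\<lambda>r. snd d (\<gamma> r)) has_vector_derivative frechet_derivative (local_rep c d id) (at (y t)) (y' t)) (at t within {a..b})"
    if d: "d \<in> atlas \<Sigma>" and t: "t \<in> {a..b}" "\<gamma> t \<in> fst d" for d t
  proof -
    obtain \<delta> where \<delta>: "\<delta> > 0" "\<And>t'. t' \<in> {a..b} \<Longrightarrow> dist t' t < \<delta> \<Longrightarrow> \<gamma> t' \<in> fst d"
      using continuous_on_near[OF c\<gamma> t(1) open_dom[OF d] t(2)] by metis
    have L: "(local_rep c d id has_derivative frechet_derivative (local_rep c d id) (at (y t))) (at (y t))"
      using local_rep_has_derivative[OF sm c d \<gamma>c(1)[OF t(1)]] t(2) \<gamma>c(2)[OF t(1)] by simp
    show ?thesis
    proof (rule has_vector_derivative_transform_within[OF _ \<delta>(1) t(1)])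
      show "(local_rep c d id \<circ> y has_vector_derivative frechet_derivative (local_rep c d id) (at (y t)) (y' t)) (at t within {a..b})"
        by (rule vector_derivative_diff_chain_within[OF y(2)[OF t(1)] has_derivative_at_withinI[OF L]])
      show "(local_rep c d id \<circ> y) t' = snd d (\<gamma> t')" if "t' \<in> {a..b}" "dist t' t < \<delta>" for t'
        using local_rep_chart[OF c \<gamma>c(1)[OF that(1)], of d id] \<gamma>c(2)[OF that(1)] by simp
    qed
  qed
  show E: "curve_deriv d a b \<gamma> t = frechet_derivative (local_rep c d id) (at (y t)) (y' t)"
    if "d \<in> atlas \<Sigma>" "t \<in> {a..b}" "\<gamma> t \<in> fst d" for d t
    unfolding curve_deriv_def by (rule vector_derivative_within_closed_interval[OF ab that(2) D[OF that]])
  have "continuous_on ({a..b} \<inter> \<gamma> -` fst d) (curve_deriv d a b \<gamma>)" if d: "d \<in> atlas \<Sigma>" for d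
  proof -
    let ?A = "{a..b} \<inter> \<gamma> -` fst d" and ?U = "snd c ` (fst c \<inter> id -` fst d)"
    let ?f = "\<lambda>i y. frechet_derivative (local_rep c d id) (at y) (axis i 1)"
    have so: "smooth_open ?U (local_rep c d id)" by (rule local_rep_smooth[OF sm c d])
    have U: "y t \<in> ?U" if "t \<in> ?A" for t using \<gamma>c[of t] that by (metis IntD1 IntD2 IntI id_apply image_eqI vimage_eq)
    have "continuous_on ?A (\<lambda>t. ?f i (y t))" for i
      by (rule continuous_on_compose2[OF smooth_open_continuous_on[OF smooth_open_deriv[OF so]]])
         (use U continuous_on_subset[OF cy] in auto)
    then have C: "continuous_on ?A (\<lambda>t. y' t $ 1 *\<^sub>R ?f 1 (y t) + y' t $ 2 *\<^sub>R ?f 2 (y t))"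
      by (intro continuous_intros continuous_on_subset[OF y(3)]) auto
    have "y' t $ 1 *\<^sub>R ?f 1 (y t) + y' t $ 2 *\<^sub>R ?f 2 (y t) = curve_deriv d a b \<gamma> t" if t: "t \<in> ?A" for t
    proof -
      have t': "t \<in> {a..b}" "\<gamma> t \<in> fst d" using t by auto
      show ?thesis unfolding E[OF d t']
        by (rule linear_real2[OF bounded_linear.linear[OF has_derivative_bounded_linear[OF smooth_open_has_derivative[OF so U[OF t]]]], symmetric])
    qed
    from continuous_on_eq[OF C this] show ?thesis .
  qed
  then show "curve_C1 a b \<gamma>" unfolding curve_C1_def using c\<gamma> D E by simp
qed

lemma curve_C1_chart:
  assumes "curve_C1 a b \<gamma>" "c \<in> atlas \<Sigma>" "\<gamma> ` {a..b} \<subseteq> fst c"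
  shows "t \<in> {a..b} \<Longrightarrow> ((\<lambda>r. snd c (\<gamma> r)) has_vector_derivative curve_deriv c a b \<gamma> t) (at t within {a..b})"
    and "continuous_on {a..b} (curve_deriv c a b \<gamma>)"
    and "continuous_on {a..b} (\<lambda>t. snd c (\<gamma> t))"
proof -
  have "{a..b} \<inter> \<gamma> -` fst c = {a..b}" using assms(3) by auto
  then show "continuous_on {a..b} (curve_deriv c a b \<gamma>)" using assms unfolding curve_C1_def by metis
  show 1: "((\<lambda>r. snd c (\<gamma> r)) has_vector_derivative curve_deriv c a b \<gamma> t) (at t within {a..b})" if "t \<in> {a..b}" for t
    using assms that unfolding curve_C1_def by blast
  show "continuous_on {a..b} (\<lambda>t. snd c (\<gamma> t))"
    using 1 by (meson continuous_on_eq_continuous_within has_vector_derivative_continuous)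
qed

lemma curve_deriv_transform:
  assumes ab: "a < b" and \<gamma>: "curve_C1 a b \<gamma>" and c: "c \<in> atlas \<Sigma>" "\<gamma> ` {a..b} \<subseteq> fst c" and d: "d \<in> atlas \<Sigma>" "\<gamma> t \<in> fst d"
    and t: "t \<in> {a..b}"
  shows "curve_deriv d a b \<gamma> t = frechet_derivative (local_rep c d id) (at (snd c (\<gamma> t))) (curve_deriv c a b \<gamma> t)"
  by (rule curve_C1I(2)[where y="\<lambda>t. snd c (\<gamma> t)" and y'="curve_deriv c a b \<gamma>" and \<gamma>=\<gamma>, OF ab c(1) _ curve_C1_chart(1)[OF \<gamma> c] curve_C1_chart(2)[OF \<gamma> c] _ d(1) t d(2)])
     (use c coord_inv_chart[OF c(1)] in \<open>auto simp: image_subset_iff\<close>)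

text \<open>Provides the mixed derivative and the continuity that Green's theorem needs. On the
  square these are properties of local extensions, hence the local comparison.\<close>

lemma square_smooth_d2_d1:
  assumes w: "square_smooth w" and c: "c \<in> atlas \<Sigma>"
  obtains d12 where
    "\<And>s t. (s,t) \<in> unit_square \<Longrightarrow> w (s,t) \<in> fst c \<Longrightarrow> ((\<lambda>r. d2 c w (r,t)) has_vector_derivative d12 (s,t)) (at s within {0..1})"
    "continuous_on (unit_square \<inter> w -` fst c) d12"
    "continuous_on (unit_square \<inter> w -` fst c) (d1 c w)"
    "continuous_on (unit_square \<inter> w -` fst c) (d2 c w)"
proof -
  let ?A = "unit_square \<inter> w -` fst c"
  define d12 where "d12 = (\<lambda>(s,t). vector_derivative (\<lambda>r. d2 c w (r,t)) (at s within {0..1}))"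
  have loc: "\<exists>U g. open U \<and> z \<in> U \<and> smooth_open U g \<and> (\<forall>y\<in>U \<inter> ?A. d1 c w y = frechet_derivative g (at y) (1,0) \<and>
      d2 c w y = frechet_derivative g (at y) (0,1) \<and>
      d12 y = frechet_derivative (\<lambda>y. frechet_derivative g (at y) (0,1)) (at y) (1,0) \<and>
      ((\<lambda>r. d2 c w (r, snd y)) has_vector_derivative d12 y) (at (fst y) within {0..1}))" if z: "z \<in> ?A" for z
  proof -
    obtain U g where U: "z \<in> U" "smooth_open U g" "\<And>y. y \<in> U \<Longrightarrow> y \<in> unit_square \<Longrightarrow> w y \<in> fst c \<and> g y = snd c (w y)"
      using square_smooth_local[OF w c, of z] z by (metis IntD1 IntD2 vimageD)
    let ?h = "\<lambda>y. frechet_derivative g (at y) (0,1)"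
    have h: "smooth_open U ?h" by (rule smooth_open_deriv[OF U(2)])
    have d2h: "d2 c w y = ?h y" if "y \<in> U" "y \<in> unit_square" for y using local_d1_d2(2)[OF U(2,3) that] .
    have "((\<lambda>r. d2 c w (r, t)) has_vector_derivative frechet_derivative ?h (at (s,t)) (1,0)) (at s within {0..1})"
      if st: "(s,t) \<in> U" "(s,t) \<in> unit_square" for s t
    proof -
      obtain r where r: "r > 0" "ball (s,t) r \<subseteq> U" using U(2) st(1) unfolding smooth_open_def by (meson openE)
      have 1: "((\<lambda>r. (r, t)) has_vector_derivative (1,0)) (at s within {0..1})"
        unfolding has_vector_derivative_def by (auto intro!: derivative_eq_intros)
      have "((?h \<circ> (\<lambda>r. (r, t))) has_vector_derivative frechet_derivative ?h (at (s,t)) (1,0)) (at s within {0..1})"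
        by (rule vector_derivative_diff_chain_within[OF 1 has_derivative_at_withinI[OF smooth_open_has_derivative[OF h st(1)]]])
      then show ?thesis
      proof (rule has_vector_derivative_transform_within[OF _ r(1)])
        show "s \<in> {0..1}" using st by simp
        show "(?h \<circ> (\<lambda>r. (r, t))) x' = d2 c w (x', t)" if "x' \<in> {0..1}" "dist x' s < r" for x'
          using d2h[of "(x',t)"] r(2) that st by (auto simp: subset_iff dist_Pair_Pair dist_commute)
      qed
    qed
    moreover from this have "d12 (s,t) = frechet_derivative ?h (at (s,t)) (1,0)" if "(s,t) \<in> U" "(s,t) \<in> unit_square" for s t
      using vector_derivative_within_closed_interval[OF zero_less_one, of s "\<lambda>r. d2 c w (r,t)"] that by (simp add: d12_def)
    ultimately show ?thesis
      using U(1,2) local_d1_d2[OF U(2,3)]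
      by (intro exI[of _ U] exI[of _ g]) (auto simp: smooth_open_def)
  qed
  have "((\<lambda>r. d2 c w (r,t)) has_vector_derivative d12 (s,t)) (at s within {0..1})" if z: "(s,t) \<in> ?A" for s t
  proof -
    obtain U g where "(s,t) \<in> U" "\<forall>y\<in>U \<inter> ?A. ((\<lambda>r. d2 c w (r, snd y)) has_vector_derivative d12 y) (at (fst y) within {0..1})"
      using loc[OF z] by meson
    from bspec[OF this(2), of "(s,t)"] this(1) z show ?thesis by simp
  qed
  moreover have "continuous_on ?A d12"
  proof (rule continuous_on_locally)
    fix x assume "x \<in> ?A"
    then obtain U g where U: "open U" "x \<in> U" "smooth_open U g" "\<forall>y\<in>U \<inter> ?A. d12 y = frechet_derivative (\<lambda>y. frechet_derivative g (at y) (0,1)) (at y) (1,0)"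
      using loc by meson
    then show "\<exists>U g. open U \<and> x \<in> U \<and> continuous_on U g \<and> (\<forall>y\<in>U \<inter> ?A. d12 y = g y)"
      using smooth_open_continuous_on[OF smooth_open_deriv[OF smooth_open_deriv[OF U(3)]]] by meson
  qed
  moreover have "continuous_on ?A (d1 c w)"
  proof (rule continuous_on_locally)
    fix x assume "x \<in> ?A"
    then obtain U g where U: "open U" "x \<in> U" "smooth_open U g" "\<forall>y\<in>U \<inter> ?A. d1 c w y = frechet_derivative g (at y) (1,0)"
      using loc by meson
    then show "\<exists>U g. open U \<and> x \<in> U \<and> continuous_on U g \<and> (\<forall>y\<in>U \<inter> ?A. d1 c w y = g y)"
      using smooth_open_continuous_on[OF smooth_open_deriv[OF U(3)]] by meson
  qed
  moreover have "continuous_on ?A (d2 c w)"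
  proof (rule continuous_on_locally)
    fix x assume "x \<in> ?A"
    then obtain U g where U: "open U" "x \<in> U" "smooth_open U g" "\<forall>y\<in>U \<inter> ?A. d2 c w y = frechet_derivative g (at y) (0,1)"
      using loc by meson
    then show "\<exists>U g. open U \<and> x \<in> U \<and> continuous_on U g \<and> (\<forall>y\<in>U \<inter> ?A. d2 c w y = g y)"
      using smooth_open_continuous_on[OF smooth_open_deriv[OF U(3)]] by meson
  qed
  ultimately show thesis by (intro that[of d12]) auto
qed

lemma square_edge_C1:
  assumes w: "square_smooth w" and ab: "a < b" "{a..b} \<subseteq> {0..1}" and v: "v \<in> {0..1}"
  shows "curve_C1 a b (\<lambda>t. w (v,t))" "curve_C1 a b (\<lambda>s. w (s,v))"
    and "c \<in> atlas \<Sigma> \<Longrightarrow> t \<in> {a..b} \<Longrightarrow> w (v,t) \<in> fst c \<Longrightarrow> curve_deriv c a b (\<lambda>t. w (v,t)) t = d2 c w (v,t)"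
    and "c \<in> atlas \<Sigma> \<Longrightarrow> s \<in> {a..b} \<Longrightarrow> w (s,v) \<in> fst c \<Longrightarrow> curve_deriv c a b (\<lambda>s. w (s,v)) s = d1 c w (s,v)"
proof -
  have D2: "((\<lambda>r. snd c (w (v,r))) has_vector_derivative d2 c w (v,t)) (at t within {a..b})"
    if "c \<in> atlas \<Sigma>" "t \<in> {a..b}" "w (v,t) \<in> fst c" for c t
    by (rule has_vector_derivative_within_subset[OF has_d1_d2(2)[OF w that(1) _ that(3)] ab(2)]) (use that ab v in auto)
  have D1: "((\<lambda>r. snd c (w (r,v))) has_vector_derivative d1 c w (s,v)) (at s within {a..b})"
    if "c \<in> atlas \<Sigma>" "s \<in> {a..b}" "w (s,v) \<in> fst c" for c s
    by (rule has_vector_derivative_within_subset[OF has_d1_d2(1)[OF w that(1) _ that(3)] ab(2)]) (use that ab v in auto)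
  show E2: "curve_deriv c a b (\<lambda>t. w (v,t)) t = d2 c w (v,t)" if "c \<in> atlas \<Sigma>" "t \<in> {a..b}" "w (v,t) \<in> fst c" for c t
    unfolding curve_deriv_def by (rule vector_derivative_within_closed_interval[OF ab(1) that(2) D2[OF that]])
  show E1: "curve_deriv c a b (\<lambda>s. w (s,v)) s = d1 c w (s,v)" if "c \<in> atlas \<Sigma>" "s \<in> {a..b}" "w (s,v) \<in> fst c" for c s
    unfolding curve_deriv_def by (rule vector_derivative_within_closed_interval[OF ab(1) that(2) D1[OF that]])
  have cw: "continuous_on unit_square w" using w by (simp add: square_smooth_def)
  have c2: "continuous_on ({a..b} \<inter> (\<lambda>t. w (v,t)) -` fst c) (\<lambda>t. d2 c w (v,t))"
    and c1: "continuous_on ({a..b} \<inter> (\<lambda>s. w (s,v)) -` fst c) (\<lambda>s. d1 c w (s,v))" if c: "c \<in> atlas \<Sigma>" for c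
  proof -
    obtain d12 :: "real \<times> real \<Rightarrow> real^2" where d: "continuous_on (unit_square \<inter> w -` fst c) (d1 c w)"
      "continuous_on (unit_square \<inter> w -` fst c) (d2 c w)" using square_smooth_d2_d1[OF w c] by metis
    show "continuous_on ({a..b} \<inter> (\<lambda>t. w (v,t)) -` fst c) (\<lambda>t. d2 c w (v,t))"
      by (rule continuous_on_compose2[OF d(2)]) (use ab v in \<open>auto intro: continuous_intros\<close>)
    show "continuous_on ({a..b} \<inter> (\<lambda>s. w (s,v)) -` fst c) (\<lambda>s. d1 c w (s,v))"
      by (rule continuous_on_compose2[OF d(1)]) (use ab v in \<open>auto intro: continuous_intros\<close>)
  qed
  have "continuous_on {a..b} (\<lambda>t. w (v,t))" "continuous_on {a..b} (\<lambda>s. w (s,v))"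
    by (rule continuous_on_compose2[OF cw]; use ab v in \<open>auto intro: continuous_intros\<close>)+
  then show "curve_C1 a b (\<lambda>t. w (v,t))" "curve_C1 a b (\<lambda>s. w (s,v))"
    unfolding curve_C1_def
    by (intro conjI ballI impI; auto simp: E1 E2 intro!: D1 D2 continuous_on_eq[OF c1] continuous_on_eq[OF c2])+
qed

text \<open>A cell is a chart with the centre and the radius of a closed ball inside its image.\<close>

definition cell :: "'a chart \<times> (real^2) \<times> real \<Rightarrow> bool" where
  "cell = (\<lambda>(c,q,r). c \<in> atlas \<Sigma> \<and> 0 < r \<and> cball q r \<subseteq> snd c ` fst c)"

definition cell_set :: "'a chart \<times> (real^2) \<times> real \<Rightarrow> 'a set" where
  "cell_set = (\<lambda>(c,q,r). coord_inv c ` ball q r)"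

text \<open>A fixed choice of primitive of the area form for each cell, depending on nothing but the
  cell. Line integrals along an edge computed from two neighbouring squares can therefore be
  compared.\<close>

definition cell_prim :: "'a chart \<times> (real^2) \<times> real \<Rightarrow> real^2 \<Rightarrow> real" where
  "cell_prim = (\<lambda>(c,q,r). SOME P. \<exists>Q. continuous_on (ball q r) Q \<and>
     (\<forall>y\<in>ball q r. (P has_derivative (\<lambda>v. dens c y * v$1 + Q y * v$2)) (at y)))"

abbreviation cell_int :: "'a chart \<times> (real^2) \<times> real \<Rightarrow> real \<Rightarrow> real \<Rightarrow> (real \<Rightarrow> 'a) \<Rightarrow> real" where
  "cell_int B \<equiv> line_int (cell_prim B) (fst B)"

lemma cell_ball: "cell (c,q,r) \<Longrightarrow> ball q r \<subseteq> snd c ` fst c"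
  using ball_subset_cball by (auto simp: cell_def)

lemma cell_prim:
  assumes "cell (c,q,r)"
  obtains Q where "continuous_on (ball q r) Q"
    "\<And>y. y \<in> ball q r \<Longrightarrow> (cell_prim (c,q,r) has_derivative (\<lambda>v. dens c y * v$1 + Q y * v$2)) (at y)"
proof -
  have c: "c \<in> atlas \<Sigma>" using assms by (simp add: cell_def)
  obtain P Q where "\<And>y. y \<in> ball q r \<Longrightarrow> (P has_derivative (\<lambda>v. dens c y * v$1 + Q y * v$2)) (at y)" "continuous_on (ball q r) Q"
    by (rule horizontal_primitive[OF dens_smooth[OF c] cell_ball[OF assms]]) (rule that, assumption+)
  then have "\<exists>P Q. continuous_on (ball q r) Q \<and> (\<forall>y\<in>ball q r. (P has_derivative (\<lambda>v. dens c y * v$1 + Q y * v$2)) (at y))" by blast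
  from someI_ex[OF this] have "\<exists>Q. continuous_on (ball q r) Q \<and> (\<forall>y\<in>ball q r. (cell_prim (c,q,r) has_derivative (\<lambda>v. dens c y * v$1 + Q y * v$2)) (at y))"
    unfolding cell_prim_def case_prod_conv .
  then show thesis using that by meson
qed

lemma cell_set_iff:
  assumes "cell (c,q,r)" shows "p \<in> cell_set (c,q,r) \<longleftrightarrow> p \<in> fst c \<and> snd c p \<in> ball q r"
proof -
  have c: "c \<in> atlas \<Sigma>" using assms by (simp add: cell_def)
  show ?thesis
  proof
    assume "p \<in> cell_set (c,q,r)"
    then obtain y where y: "y \<in> ball q r" "p = coord_inv c y" by (auto simp: cell_set_def)
    then have "y \<in> snd c ` fst c" using cell_ball[OF assms] by blast
    from chart_coord_inv[OF c this] coord_inv_in[OF c this] y show "p \<in> fst c \<and> snd c p \<in> ball q r" by simp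
  next
    assume "p \<in> fst c \<and> snd c p \<in> ball q r"
    then show "p \<in> cell_set (c,q,r)" using coord_inv_chart[OF c, of p] unfolding cell_set_def by (auto simp: image_iff intro!: bexI[of _ "snd c p"])
  qed
qed

lemma open_cell_set: "cell B \<Longrightarrow> open (cell_set B)"
  using open_coord_image cell_ball by (cases B) (auto simp: cell_set_def cell_def)

lemma dens_transition:
  assumes c: "c \<in> atlas \<Sigma>" "p \<in> fst c" and d: "d \<in> atlas \<Sigma>" "p \<in> fst d"
  shows "dens d (snd d p) * cross2 (frechet_derivative (local_rep c d id) (at (snd c p)) v) (frechet_derivative (local_rep c d id) (at (snd c p)) w)
     = dens c (snd c p) * cross2 v w"
  using area_map_area_form[OF area_map_id c(1) d(1) c(2), of v w] d(2) dens_chart[OF c] dens_chart[OF d]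
  by (simp add: area_form_cross2)

text \<open>Both sides are compared on the cone from the centre of \<open>V\<close> over \<open>\<gamma>\<close>: its area does not depend on
  the chart, and the rays to the end points give \<open>F\<close>.\<close>

lemma cell_int_difference:
  assumes V: "cell V" and B: "cell B" and sub: "cell_set V \<subseteq> cell_set B"
  obtains F where "\<And>a b \<gamma>. a < b \<Longrightarrow> curve_C1 a b \<gamma> \<Longrightarrow> \<gamma> ` {a..b} \<subseteq> cell_set V \<Longrightarrow>
     cell_int B a b \<gamma> - cell_int V a b \<gamma> = F (\<gamma> b) - F (\<gamma> a)"
proof -
  obtain c q r where Vc: "V = (c,q,r)" by (cases V) auto
  obtain d q' r' where Bd: "B = (d,q',r')" by (cases B) auto
  have c: "c \<in> atlas \<Sigma>" and r: "r > 0" using V by (auto simp: Vc cell_def)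
  have d: "d \<in> atlas \<Sigma>" using B by (auto simp: Bd cell_def)
  obtain Q where Q: "continuous_on (ball q r) Q"
    "\<And>y. y \<in> ball q r \<Longrightarrow> (cell_prim V has_derivative (\<lambda>v. dens c y * v$1 + Q y * v$2)) (at y)"
    by (rule cell_prim[OF V[unfolded Vc], folded Vc]) (rule that, assumption+)
  obtain Q' where Q': "continuous_on (ball q' r') Q'"
    "\<And>y. y \<in> ball q' r' \<Longrightarrow> (cell_prim B has_derivative (\<lambda>v. dens d y * v$1 + Q' y * v$2)) (at y)"
    by (rule cell_prim[OF B[unfolded Bd], folded Bd]) (rule that, assumption+)
  let ?U = "snd c ` (fst c \<inter> id -` fst d)" and ?T = "local_rep c d id"
  let ?D = "\<lambda>y. frechet_derivative ?T (at y)"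
  have so: "smooth_open ?U ?T" using local_rep_smooth[of id c d] area_map_id c d by (simp add: area_map_def)
  have Vm: "coord_inv c y \<in> cell_set B" "y \<in> ?U" "?T y \<in> ball q' r'" if y: "y \<in> ball q r" for y
  proof -
    have yI: "y \<in> snd c ` fst c" using cell_ball V y unfolding Vc by blast
    show 1: "coord_inv c y \<in> cell_set B" using sub y by (auto simp: Vc cell_set_def)
    then have 2: "coord_inv c y \<in> fst d" "snd d (coord_inv c y) \<in> ball q' r'"
      using cell_set_iff[OF B[unfolded Bd]] unfolding Bd by auto
    then show "y \<in> ?U" using chart_coord_inv[OF c yI] coord_inv_in[OF c yI] by (metis IntI id_apply image_eqI vimage_eq)
    show "?T y \<in> ball q' r'" using 2 by (simp add: local_rep_def)
  qed
  define RV where "RV y = integral {0..1} (\<lambda>s. cell_prim V ((1 - s) *\<^sub>R q + s *\<^sub>R y) * (y - q) $ 2)" for y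
  define RB where "RB y = integral {0..1} (\<lambda>s. cell_prim B (?T ((1 - s) *\<^sub>R q + s *\<^sub>R y)) * ?D ((1 - s) *\<^sub>R q + s *\<^sub>R y) (y - q) $ 2)" for y
  show thesis
  proof (rule that[of "\<lambda>p. RB (snd c p) - RV (snd c p)"])
    fix a b :: real and \<gamma> assume ab: "a < b" and \<gamma>: "curve_C1 a b \<gamma>" "\<gamma> ` {a..b} \<subseteq> cell_set V"
    have \<gamma>V: "\<gamma> t \<in> fst c" "snd c (\<gamma> t) \<in> ball q r" if "t \<in> {a..b}" for t
      using cell_set_iff[OF V[unfolded Vc], of "\<gamma> t"] \<gamma>(2) that unfolding Vc by (auto simp: image_subset_iff)
    have \<gamma>d: "\<gamma> t \<in> fst d" if "t \<in> {a..b}" for t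
      using cell_set_iff[OF B[unfolded Bd], of "\<gamma> t"] \<gamma>(2) sub that unfolding Bd by (auto simp: image_subset_iff subset_iff)
    have \<gamma>c: "\<gamma> ` {a..b} \<subseteq> fst c" using \<gamma>V by blast
    let ?y = "\<lambda>t. snd c (\<gamma> t)" and ?y' = "curve_deriv c a b \<gamma>"
    let ?W = "\<lambda>s t. (1 - s) *\<^sub>R q + s *\<^sub>R ?y t"
    \<comment> \<open>The cone as a strip: the curve at \<open>s = 0\<close> is constant at the
      centre \<open>q\<close> and contributes nothing, the curve at \<open>s = 1\<close> is
      \<open>\<gamma>\<close>, and the two sides are the rays to its end points.\<close>
    have R: "rect_C2 0 1 a b ?W (\<lambda>s t. ?y t - q) (\<lambda>s t. (1 - s) *\<^sub>R 0 + s *\<^sub>R ?y' t) (\<lambda>s t. ?y' t - 0)"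
      by (rule rect_C2_strip) (use curve_C1_chart[OF \<gamma>(1) c \<gamma>c] in auto)
    have W: "?W s t \<in> ball q r" if "s \<in> {0..1}" "t \<in> {a..b}" for s t
      using convexD[OF convex_ball, of q q r "?y t" "1-s" s] \<gamma>V(2)[OF that(2)] that(1) r by simp
    have G1: "integral ({0..1} \<times> {a..b}) (\<lambda>(s,t). dens c (?W s t) * cross2 (?y t - q) ((1 - s) *\<^sub>R 0 + s *\<^sub>R ?y' t)) =
       cell_int V a b \<gamma> - RV (?y b) + RV (?y a)"
      using green_rect[OF R zero_less_one ab W Q(2) smooth_open_continuous_on[OF smooth_open_subset[OF dens_smooth[OF c] open_ball cell_ball[OF V[unfolded Vc]]]] Q(1)]
      by (simp add: line_int_def Vc RV_def)
    obtain Z where Z: "rect_C2 0 1 a b (\<lambda>s t. ?T (?W s t)) (\<lambda>s t. ?D (?W s t) (?y t - q)) (\<lambda>s t. ?D (?W s t) ((1 - s) *\<^sub>R 0 + s *\<^sub>R ?y' t)) Z"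
      by (rule rect_C2_compose[OF R so Vm(2)[OF W]]) (assumption, assumption, rule that, assumption)
    have lin0: "?D y 0 = 0" if "y \<in> ?U" for y
      using linear_0[OF bounded_linear.linear[OF has_derivative_bounded_linear[OF smooth_open_has_derivative[OF so that]]]] .
    have qU: "q \<in> ?U" using Vm(2)[of q] r by simp
    have y1: "integral {a..b} (\<lambda>t. cell_prim B (?T (?W 1 t)) * ?D (?W 1 t) ((1 - 1) *\<^sub>R 0 + 1 *\<^sub>R ?y' t) $ 2) = cell_int B a b \<gamma>"
      unfolding line_int_def
    proof (rule integral_cong)
      fix t assume t: "t \<in> {a..b}"
      show "cell_prim B (?T (?W 1 t)) * ?D (?W 1 t) ((1 - 1) *\<^sub>R 0 + 1 *\<^sub>R ?y' t) $ 2 = cell_prim B (snd (fst B) (\<gamma> t)) * curve_deriv (fst B) a b \<gamma> t $ 2"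
        using curve_deriv_transform[OF ab \<gamma>(1) c \<gamma>c d \<gamma>d[OF t] t] local_rep_chart[OF c \<gamma>V(1)[OF t], of d id] by (simp add: Bd)
    qed
    have G2: "integral ({0..1} \<times> {a..b}) (\<lambda>(s,t). dens d (?T (?W s t)) * cross2 (?D (?W s t) (?y t - q)) (?D (?W s t) ((1 - s) *\<^sub>R 0 + s *\<^sub>R ?y' t))) =
       cell_int B a b \<gamma> - RB (?y b) + RB (?y a)"
      using green_rect[OF Z zero_less_one ab Vm(3)[OF W] Q'(2) smooth_open_continuous_on[OF smooth_open_subset[OF dens_smooth[OF d] open_ball cell_ball[OF B[unfolded Bd]]]] Q'(1)]
      unfolding y1 RB_def by (simp add: lin0[OF qU])
    have "integral ({0..1} \<times> {a..b}) (\<lambda>(s,t). dens c (?W s t) * cross2 (?y t - q) ((1 - s) *\<^sub>R 0 + s *\<^sub>R ?y' t)) =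
       integral ({0..1} \<times> {a..b}) (\<lambda>(s,t). dens d (?T (?W s t)) * cross2 (?D (?W s t) (?y t - q)) (?D (?W s t) ((1 - s) *\<^sub>R 0 + s *\<^sub>R ?y' t)))"
    proof (rule integral_cong, clarify)
      fix s t assume st: "s \<in> {0..1::real}" "t \<in> {a..b}"
      let ?p = "coord_inv c (?W s t)"
      have I: "?W s t \<in> snd c ` fst c" using W[OF st] cell_ball V unfolding Vc by blast
      have p: "?p \<in> fst c" "snd c ?p = ?W s t" using coord_inv_in[OF c I] chart_coord_inv[OF c I] by auto
      have pd: "?p \<in> fst d" using Vm(1)[OF W[OF st]] cell_set_iff[OF B[unfolded Bd]] unfolding Bd by blast
      have "snd d ?p = ?T (?W s t)" by (simp add: local_rep_def)
      then show "dens c (?W s t) * cross2 (?y t - q) ((1 - s) *\<^sub>R 0 + s *\<^sub>R ?y' t)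
          = dens d (?T (?W s t)) * cross2 (?D (?W s t) (?y t - q)) (?D (?W s t) ((1 - s) *\<^sub>R 0 + s *\<^sub>R ?y' t))"
        using dens_transition[OF c p(1) d pd, of "?y t - q" "(1 - s) *\<^sub>R 0 + s *\<^sub>R ?y' t"] unfolding p(2) by simp
    qed
    with G1 G2 show "cell_int B a b \<gamma> - cell_int V a b \<gamma> = (RB (?y b) - RV (?y b)) - (RB (?y a) - RV (?y a))"
      by linarith
  qed
qed

text \<open>The circulation around the strip bounded by \<open>\<gamma>\<close>,
  \<open>\<gamma>'\<close> and the transverse paths \<open>\<sigma>1\<close> over \<open>a\<close>
  and \<open>\<sigma>2\<close> over \<open>b\<close>, with the orientation used in Green's
  theorem.\<close>

definition loop_int :: "'a chart \<times> (real^2) \<times> real \<Rightarrow> real \<Rightarrow> real \<Rightarrow> (real \<Rightarrow> 'a) \<Rightarrow> (real \<Rightarrow> 'a) \<Rightarrow> (real \<Rightarrow> 'a) \<Rightarrow> (real \<Rightarrow> 'a) \<Rightarrow> real" where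
  "loop_int B a b \<gamma> \<gamma>' \<sigma>1 \<sigma>2 = cell_int B a b \<gamma>' - cell_int B a b \<gamma> - cell_int B 0 1 \<sigma>2 + cell_int B 0 1 \<sigma>1"

text \<open>The primitives of the two cells differ by an exact form: each of the four line integrals
  changes by a difference of values of \<open>F\<close> at its end points, and these cancel around
  the closed loop.\<close>

lemma loop_int_eq:
  assumes V: "cell V" and B: "cell B" and sub: "cell_set V \<subseteq> cell_set B" and ab: "a < b"
    and C: "curve_C1 a b \<gamma>" "curve_C1 a b \<gamma>'" "curve_C1 0 1 \<sigma>1" "curve_C1 0 1 \<sigma>2"
    and I: "\<gamma> ` {a..b} \<subseteq> cell_set V" "\<gamma>' ` {a..b} \<subseteq> cell_set V" "\<sigma>1 ` {0..1} \<subseteq> cell_set V" "\<sigma>2 ` {0..1} \<subseteq> cell_set V"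
    and E: "\<sigma>1 0 = \<gamma> a" "\<sigma>1 1 = \<gamma>' a" "\<sigma>2 0 = \<gamma> b" "\<sigma>2 1 = \<gamma>' b"
  shows "loop_int B a b \<gamma> \<gamma>' \<sigma>1 \<sigma>2 = loop_int V a b \<gamma> \<gamma>' \<sigma>1 \<sigma>2"
proof -
  obtain F where F: "\<And>a b \<gamma>. a < b \<Longrightarrow> curve_C1 a b \<gamma> \<Longrightarrow> \<gamma> ` {a..b} \<subseteq> cell_set V \<Longrightarrow>
     cell_int B a b \<gamma> - cell_int V a b \<gamma> = F (\<gamma> b) - F (\<gamma> a)"
    using cell_int_difference[OF V B sub] by metis
  show ?thesis
    unfolding loop_int_def
    using F[OF ab C(1) I(1)] F[OF ab C(2) I(2)] F[OF zero_less_one C(3) I(3)] F[OF zero_less_one C(4) I(4)] E by simp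
qed

lemma green_square:
  assumes w: "square_smooth w" and B: "cell B" and ab: "a < b" "{a..b} \<subseteq> {0..1}" and cd: "c < d" "{c..d} \<subseteq> {0..1}"
    and I: "w ` ({a..b} \<times> {c..d}) \<subseteq> cell_set B"
  shows "integral ({a..b} \<times> {c..d}) (sq_density (fst B) w) =
    cell_int B c d (\<lambda>t. w (b,t)) - cell_int B c d (\<lambda>t. w (a,t)) - cell_int B a b (\<lambda>s. w (s,d)) + cell_int B a b (\<lambda>s. w (s,c))"
proof -
  obtain e q r where Be: "B = (e,q,r)" by (cases B) auto
  have e: "e \<in> atlas \<Sigma>" using B by (auto simp: Be cell_def)
  obtain Q where Q: "continuous_on (ball q r) Q"
    "\<And>y. y \<in> ball q r \<Longrightarrow> (cell_prim B has_derivative (\<lambda>v. dens e y * v$1 + Q y * v$2)) (at y)"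
    by (rule cell_prim[OF B[unfolded Be], folded Be]) (rule that, assumption+)
  let ?R = "{a..b} \<times> {c..d}"
  have sub: "?R \<subseteq> unit_square" using ab cd by auto
  have wB: "w z \<in> fst e" "snd e (w z) \<in> ball q r" if "z \<in> ?R" for z
    using cell_set_iff[OF B[unfolded Be], of "w z"] I that unfolding Be by auto
  have sub': "?R \<subseteq> unit_square \<inter> w -` fst e" using sub wB by auto
  obtain d12 where d12: "\<And>s t. (s,t) \<in> unit_square \<Longrightarrow> w (s,t) \<in> fst e \<Longrightarrow> ((\<lambda>r. d2 e w (r,t)) has_vector_derivative d12 (s,t)) (at s within {0..1})"
    "continuous_on (unit_square \<inter> w -` fst e) d12"
    "continuous_on (unit_square \<inter> w -` fst e) (d1 e w)"
    "continuous_on (unit_square \<inter> w -` fst e) (d2 e w)"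
    using square_smooth_d2_d1[OF w e] by metis
  have cw: "continuous_on (unit_square \<inter> w -` fst e) (\<lambda>z. snd e (w z))"
  proof -
    have "smooth_on (unit_square \<inter> w -` fst e) (snd e \<circ> w)" using w e by (simp add: square_smooth_def)
    from smooth_on_imp_continuous_on[OF this] show ?thesis by (simp add: o_def)
  qed
  have R: "rect_C2 a b c d (\<lambda>s t. snd e (w (s,t))) (\<lambda>s t. d1 e w (s,t)) (\<lambda>s t. d2 e w (s,t)) (\<lambda>s t. d12 (s,t))"
    unfolding rect_C2_def
  proof (intro conjI ballI)
    fix s t assume "s \<in> {a..b}" "t \<in> {c..d}"
    then have "(s,t) \<in> ?R" by simp
    from subsetD[OF sub this] wB(1)[OF this] have z: "(s,t) \<in> unit_square" "w (s,t) \<in> fst e" .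
    show "((\<lambda>r. snd e (w (r, t))) has_vector_derivative d1 e w (s, t)) (at s within {a..b})"
      by (rule has_vector_derivative_within_subset[OF has_d1_d2(1)[OF w e z] ab(2)])
    show "((\<lambda>r. snd e (w (s, r))) has_vector_derivative d2 e w (s, t)) (at t within {c..d})"
      by (rule has_vector_derivative_within_subset[OF has_d1_d2(2)[OF w e z] cd(2)])
    show "((\<lambda>r. d2 e w (r, t)) has_vector_derivative d12 (s, t)) (at s within {a..b})"
      by (rule has_vector_derivative_within_subset[OF d12(1)[OF z] ab(2)])
  qed (use continuous_on_subset[OF _ sub'] cw d12 in \<open>simp_all add: case_prod_unfold\<close>)
  have G: "integral ?R (\<lambda>(s,t). dens e (snd e (w (s,t))) * cross2 (d1 e w (s,t)) (d2 e w (s,t))) =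
     integral {c..d} (\<lambda>t. cell_prim B (snd e (w (b,t))) * d2 e w (b,t) $ 2) - integral {c..d} (\<lambda>t. cell_prim B (snd e (w (a,t))) * d2 e w (a,t) $ 2)
     - integral {a..b} (\<lambda>s. cell_prim B (snd e (w (s,d))) * d1 e w (s,d) $ 2) + integral {a..b} (\<lambda>s. cell_prim B (snd e (w (s,c))) * d1 e w (s,c) $ 2)"
    by (rule green_rect[OF R ab(1) cd(1) _ Q(2) smooth_open_continuous_on[OF smooth_open_subset[OF dens_smooth[OF e] open_ball cell_ball[OF B[unfolded Be]]]] Q(1)])
       (use wB in auto)
  have 0: "integral ?R (sq_density (fst B) w) = integral ?R (\<lambda>(s,t). dens e (snd e (w (s,t))) * cross2 (d1 e w (s,t)) (d2 e w (s,t)))"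
  proof (rule integral_cong)
    fix z assume "z \<in> ?R"
    then show "sq_density (fst B) w z = (case z of (s,t) \<Rightarrow> dens e (snd e (w (s,t))) * cross2 (d1 e w (s,t)) (d2 e w (s,t)))"
      using dens_chart[OF e wB(1)] by (cases z) (auto simp: sq_density_def area_form_cross2 Be)
  qed
  have E2: "integral {c..d} (\<lambda>t. cell_prim B (snd e (w (v,t))) * d2 e w (v,t) $ 2) = cell_int B c d (\<lambda>t. w (v,t))" if "v \<in> {a..b}" for v
    unfolding line_int_def
    by (rule integral_cong) (use square_edge_C1(3)[OF w cd, of v e] e wB that ab in \<open>auto simp: Be\<close>)
  have E1: "integral {a..b} (\<lambda>s. cell_prim B (snd e (w (s,v))) * d1 e w (s,v) $ 2) = cell_int B a b (\<lambda>s. w (s,v))" if "v \<in> {c..d}" for v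
    unfolding line_int_def
    by (rule integral_cong) (use square_edge_C1(4)[OF w ab, of v e] e wB that cd in \<open>auto simp: Be\<close>)
  show ?thesis unfolding 0 G using E1[of c] E1[of d] E2[of a] E2[of b] ab cd by simp
qed

end

section \<open>The area difference of two capping disks\<close>

definition gridpt :: "nat \<Rightarrow> nat \<Rightarrow> real" where "gridpt n i = real i / real n"

lemma gridpt:
  assumes "n > 0"
  shows "gridpt n 0 = 0" "gridpt n n = 1" "gridpt n i < gridpt n (Suc i)" "i \<le> n \<Longrightarrow> gridpt n i \<in> {0..1}"
    "i < n \<Longrightarrow> {gridpt n i..gridpt n (Suc i)} \<subseteq> {0..1}"
  using assms by (auto simp: gridpt_def divide_simps)

lemma integral_grid:
  fixes h :: "real \<Rightarrow> real"
  assumes h: "h integrable_on {0..1}" and n: "n > 0"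
  shows "integral {0..1} h = (\<Sum>i<n. integral {gridpt n i..gridpt n (Suc i)} h)"
proof -
  have "integral {0..gridpt n k} h = (\<Sum>i<k. integral {gridpt n i..gridpt n (Suc i)} h)" if "k \<le> n" for k
    using that
  proof (induction k)
    case 0 then show ?case using gridpt(1)[OF n] by simp
  next
    case (Suc k)
    have "h integrable_on {0..gridpt n (Suc k)}"
      by (rule integrable_on_subinterval[OF h]) (use gridpt(4)[OF n, of "Suc k"] Suc.prems in auto)
    then have "integral {0..gridpt n k} h + integral {gridpt n k..gridpt n (Suc k)} h = integral {0..gridpt n (Suc k)} h"
      using gridpt(3)[OF n, of k] gridpt(4)[OF n, of k] Suc.prems by (intro Henstock_Kurzweil_Integration.integral_combine) auto
    then show ?case using Suc by simp
  qed
  from this[of n] show ?thesis using gridpt(2)[OF n] by simp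
qed

lemma integral_grid_square:
  fixes f :: "real \<times> real \<Rightarrow> real"
  assumes f: "continuous_on unit_square f" and n: "n > 0"
  shows "integral unit_square f =
    (\<Sum>i<n. \<Sum>j<n. integral ({gridpt n i..gridpt n (Suc i)} \<times> {gridpt n j..gridpt n (Suc j)}) f)"
proof -
  let ?I = "\<lambda>i. {gridpt n i..gridpt n (Suc i)}"
  have sub: "?I i \<subseteq> {0..1}" if "i < n" for i using gridpt(5)[OF n that] .
  have prod: "integral ({a..b} \<times> {c..d}) f = integral {a..b} (\<lambda>s. integral {c..d} (\<lambda>t. f (s,t)))"
    if "{a..b} \<subseteq> {0..1}" "{c..d} \<subseteq> {0..1}" for a b c d
  proof -
    have "continuous_on (cbox (a,c) (b,d)) f"
      by (rule continuous_on_subset[OF f]) (use that in \<open>auto simp: cbox_Pair_eq\<close>)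
    from integral_prod_continuous[OF this] show ?thesis by (simp add: cbox_Pair_eq)
  qed
  have inner: "continuous_on {0..1} (\<lambda>s. integral {c..d} (\<lambda>t. f (s,t)))" if "{c..d} \<subseteq> {0..1}" for c d
  proof -
    have "continuous_on ({0..1} \<times> cbox c d) (\<lambda>(s,t). f (s,t))"
      by (simp, rule continuous_on_subset[OF f]) (use that in auto)
    from integral_continuous_on_param[OF this] show ?thesis by simp
  qed
  have slice: "(\<lambda>t. f (s,t)) integrable_on {0..1}" if "s \<in> {0..1}" for s
    by (intro integrable_continuous_real continuous_on_compose2[OF f] continuous_intros) (use that in auto)
  have "integral unit_square f = integral {0..1} (\<lambda>s. integral {0..1} (\<lambda>t. f (s,t)))" by (rule prod) auto
  also have "\<dots> = integral {0..1} (\<lambda>s. \<Sum>j<n. integral (?I j) (\<lambda>t. f (s,t)))"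
    by (rule integral_cong) (rule integral_grid[OF slice n])
  also have "\<dots> = (\<Sum>j<n. integral {0..1} (\<lambda>s. integral (?I j) (\<lambda>t. f (s,t))))"
    by (rule integral_sum) (auto intro!: integrable_continuous_real inner sub)
  also have "\<dots> = (\<Sum>j<n. \<Sum>i<n. integral (?I i) (\<lambda>s. integral (?I j) (\<lambda>t. f (s,t))))"
    by (intro sum.cong refl integral_grid[OF _ n] integrable_continuous_real inner sub) auto
  also have "\<dots> = (\<Sum>j<n. \<Sum>i<n. integral (?I i \<times> ?I j) f)"
    by (intro sum.cong refl prod[symmetric] sub) auto
  finally show ?thesis by (subst sum.swap)
qed

context area_surface begin

type_synonym 'b cell = "'b chart \<times> (real^2) \<times> real"

text \<open>The segment from \<open>p\<close> to \<open>p'\<close> in the coordinates of the cell. A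
  cell is a ball there, so the segment does not leave it.\<close>

definition vpath :: "'a cell \<Rightarrow> 'a \<Rightarrow> 'a \<Rightarrow> real \<Rightarrow> 'a" where
  "vpath V p p' \<tau> = coord_inv (fst V) ((1 - \<tau>) *\<^sub>R snd (fst V) p + \<tau> *\<^sub>R snd (fst V) p')"

lemma vpath:
  assumes V: "cell V" and p: "p \<in> cell_set V" "p' \<in> cell_set V"
  shows "curve_C1 0 1 (vpath V p p')" "vpath V p p' ` {0..1} \<subseteq> cell_set V" "vpath V p p' 0 = p" "vpath V p p' 1 = p'"
proof -
  obtain c q r where Vc: "V = (c,q,r)" by (cases V) auto
  have c: "c \<in> atlas \<Sigma>" using V by (simp add: Vc cell_def)
  have pc: "p \<in> fst c" "snd c p \<in> ball q r" "p' \<in> fst c" "snd c p' \<in> ball q r"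
    using cell_set_iff[OF V[unfolded Vc]] p unfolding Vc by auto
  let ?y = "\<lambda>\<tau>. (1 - \<tau>) *\<^sub>R snd c p + \<tau> *\<^sub>R snd c p'"
  have y: "?y \<tau> \<in> ball q r" if "\<tau> \<in> {0..1}" for \<tau>
    using convexD[OF convex_ball pc(2,4), of "1-\<tau>" \<tau>] that by simp
  have d: "(?y has_vector_derivative (snd c p' - snd c p)) (at \<tau> within {0..1})" for \<tau>
    unfolding has_vector_derivative_def by (auto intro!: derivative_eq_intros simp: algebra_simps)
  show "curve_C1 0 1 (vpath V p p')"
    by (rule curve_C1I(1)[OF zero_less_one c _ d]) (use y cell_ball[OF V[unfolded Vc]] in \<open>auto simp: vpath_def Vc\<close>)
  show "vpath V p p' ` {0..1} \<subseteq> cell_set V" using y by (auto simp: vpath_def Vc cell_set_def)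
  show "vpath V p p' 0 = p" "vpath V p p' 1 = p'" using coord_inv_chart[OF c] pc by (auto simp: vpath_def Vc)
qed

text \<open>Abstracts from the choice of chart made pointwise in
  \<open>pullback_density\<close>.\<close>

definition area_density :: "(real \<times> real \<Rightarrow> 'a) \<Rightarrow> (real \<times> real \<Rightarrow> real) \<Rightarrow> bool" where
  "area_density w \<rho> \<longleftrightarrow> (\<forall>z\<in>unit_square. \<forall>c\<in>atlas \<Sigma>. w z \<in> fst c \<longrightarrow> \<rho> z = sq_density c w z)"

lemma area_density_continuous:
  assumes w: "square_smooth w" and \<rho>: "area_density w \<rho>"
  shows "continuous_on unit_square \<rho>"
proof (rule continuous_on_locally)
  fix z assume z: "z \<in> unit_square"
  obtain c where c: "c \<in> atlas \<Sigma>" "w z \<in> fst c" using chart_at .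
  obtain U g where U: "z \<in> U" "smooth_open U g" "\<And>y. y \<in> U \<Longrightarrow> y \<in> unit_square \<Longrightarrow> w y \<in> fst c \<and> g y = snd c (w y)"
    using square_smooth_local[OF w c(1) z c(2)] by metis
  let ?W = "U \<inter> g -` (snd c ` fst c)"
  let ?h = "\<lambda>y. dens c (g y) * cross2 (frechet_derivative g (at y) (1,0)) (frechet_derivative g (at y) (0,1))"
  have "open ?W" using U(2) open_img[OF c(1)] smooth_open_continuous_on[OF U(2)]
    by (auto simp: smooth_open_def intro!: continuous_open_preimage)
  moreover have "z \<in> ?W" using U(1) U(3)[OF U(1) z] by auto
  moreover have "continuous_on ?W ?h"
    unfolding cross2_def
    by (intro continuous_intros continuous_on_compose2[OF smooth_open_continuous_on[OF dens_smooth[OF c(1)]]]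
        continuous_on_subset[OF smooth_open_continuous_on[OF U(2)]]
        continuous_on_subset[OF smooth_open_continuous_on[OF smooth_open_deriv[OF U(2)]]]) auto
  moreover have "\<rho> y = ?h y" if y: "y \<in> ?W \<inter> unit_square" for y
  proof -
    have yU: "y \<in> U" "y \<in> unit_square" using y by auto
    have "\<rho> y = sq_density c w y" using \<rho> c(1) U(3)[OF yU] yU(2) unfolding area_density_def by blast
    then show ?thesis
      using local_d1_d2[OF U(2,3) yU] U(3)[OF yU] dens_chart[OF c(1), of "w y"] by (simp add: sq_density_def area_form_cross2)
  qed
  ultimately show "\<exists>U g. open U \<and> z \<in> U \<and> continuous_on U g \<and> (\<forall>y\<in>U \<inter> unit_square. \<rho> y = g y)" by blast
qed

text \<open>A grid of \<open>n \<times> n\<close> squares with cells \<open>B\<close> for the squares, \<open>E\<close> (first coordinate varies) and \<open>F\<close>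
  (second coordinate varies) for the edges and \<open>V\<close> for the vertices. The last line reflects
  that the square parametrises a disk in polar coordinates.\<close>

definition grid_cells :: "nat \<Rightarrow> (nat \<times> nat \<Rightarrow> 'a cell) \<Rightarrow> (nat \<times> nat \<Rightarrow> 'a cell) \<Rightarrow> (nat \<times> nat \<Rightarrow> 'a cell) \<Rightarrow>
    (nat \<times> nat \<Rightarrow> 'a cell) \<Rightarrow> bool" where
  "grid_cells n B E F V \<longleftrightarrow> n > 0 \<and> (\<forall>i<n. \<forall>j<n. cell (B (i,j))) \<and>
    (\<forall>i<n. \<forall>j\<le>n. cell (E (i,j))) \<and> (\<forall>i\<le>n. \<forall>j<n. cell (F (i,j))) \<and> (\<forall>i\<le>n. \<forall>j\<le>n. cell (V (i,j))) \<and>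
    (\<forall>i<n. \<forall>j<n. cell_set (E (i,j)) \<subseteq> cell_set (B (i,j)) \<and> cell_set (E (i,Suc j)) \<subseteq> cell_set (B (i,j)) \<and>
       cell_set (F (i,j)) \<subseteq> cell_set (B (i,j)) \<and> cell_set (F (Suc i,j)) \<subseteq> cell_set (B (i,j))) \<and>
    (\<forall>i<n. \<forall>j\<le>n. cell_set (V (i,j)) \<subseteq> cell_set (E (i,j)) \<and> cell_set (V (Suc i,j)) \<subseteq> cell_set (E (i,j))) \<and>
    (\<forall>i\<le>n. \<forall>j<n. cell_set (V (i,j)) \<subseteq> cell_set (F (i,j)) \<and> cell_set (V (i,Suc j)) \<subseteq> cell_set (F (i,j))) \<and>
    (\<forall>i<n. E (i,n) = E (i,0)) \<and> (\<forall>i\<le>n. V (i,n) = V (i,0)) \<and> (\<forall>j\<le>n. V (0,j) = V (0,0))"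

text \<open>Kept apart from \<open>grid_cells\<close>, which does not mention any map: the cells are
  the combinatorial pattern, and two caps have the same pattern when both fit it.\<close>

definition grid_fit :: "nat \<Rightarrow> (nat \<times> nat \<Rightarrow> 'a cell) \<Rightarrow> (nat \<times> nat \<Rightarrow> 'a cell) \<Rightarrow> (nat \<times> nat \<Rightarrow> 'a cell) \<Rightarrow>
    (nat \<times> nat \<Rightarrow> 'a cell) \<Rightarrow> (real \<times> real \<Rightarrow> 'a) \<Rightarrow> bool" where
  "grid_fit n B E F V w \<longleftrightarrow>
    (\<forall>i<n. \<forall>j<n. w ` ({gridpt n i..gridpt n (Suc i)} \<times> {gridpt n j..gridpt n (Suc j)}) \<subseteq> cell_set (B (i,j))) \<and>
    (\<forall>i<n. \<forall>j\<le>n. (\<lambda>s. w (s, gridpt n j)) ` {gridpt n i..gridpt n (Suc i)} \<subseteq> cell_set (E (i,j))) \<and>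
    (\<forall>i\<le>n. \<forall>j<n. (\<lambda>t. w (gridpt n i, t)) ` {gridpt n j..gridpt n (Suc j)} \<subseteq> cell_set (F (i,j))) \<and>
    (\<forall>i\<le>n. \<forall>j\<le>n. w (gridpt n i, gridpt n j) \<in> cell_set (V (i,j)))"

lemma line_int_const:
  assumes "a < b" "\<And>t. t \<in> {a..b} \<Longrightarrow> \<gamma> t = p"
  shows "line_int P c a b \<gamma> = 0"
proof -
  have "curve_deriv c a b \<gamma> t = 0" if t: "t \<in> {a..b}" for t
    unfolding curve_deriv_def
  proof (rule vector_derivative_within_closed_interval[OF assms(1) t])
    show "((\<lambda>r. snd c (\<gamma> r)) has_vector_derivative 0) (at t within {a..b})"
      by (rule has_vector_derivative_transform[OF t _ has_vector_derivative_const[of "snd c p"]]) (simp add: assms(2))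
  qed
  then have "integral {a..b} (\<lambda>t. P (snd c (\<gamma> t)) * curve_deriv c a b \<gamma> t $ 2) = integral {a..b} (\<lambda>t. 0)"
    by (intro integral_cong) simp
  then show ?thesis by (simp add: line_int_def)
qed

lemma line_int_cong:
  assumes "\<And>t. t \<in> {a..b} \<Longrightarrow> \<gamma> t = \<gamma>' t"
  shows "line_int P c a b \<gamma> = line_int P c a b \<gamma>'"
  unfolding line_int_def
proof (rule integral_cong)
  fix t assume t: "t \<in> {a..b}"
  have "((\<lambda>r. snd c (\<gamma> r)) has_vector_derivative X) (at t within {a..b}) = ((\<lambda>r. snd c (\<gamma>' r)) has_vector_derivative X) (at t within {a..b})" for X
    using has_vector_derivative_transform[OF t, of "\<lambda>r. snd c (\<gamma>' r)" "\<lambda>r. snd c (\<gamma> r)" X]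
      has_vector_derivative_transform[OF t, of "\<lambda>r. snd c (\<gamma> r)" "\<lambda>r. snd c (\<gamma>' r)" X] assms by auto
  then have "curve_deriv c a b \<gamma> t = curve_deriv c a b \<gamma>' t"
    by (simp add: curve_deriv_def vector_derivative_def)
  then show "P (snd c (\<gamma> t)) * curve_deriv c a b \<gamma> t $ 2 = P (snd c (\<gamma>' t)) * curve_deriv c a b \<gamma>' t $ 2"
    using assms[OF t] by simp
qed

text \<open>On each square the two areas differ by four loop integrals. A loop integral may be computed
  in the smaller cell of its edge, so the two squares sharing an edge contribute opposite values; what
  remains belongs to the boundary \<open>s = 1\<close>.\<close>

lemma area_difference:
  assumes G: "grid_cells n B E F V"
    and w: "square_smooth w" "grid_fit n B E F V w" "area_density w \<rho>"
      "\<And>s. s \<in> {0..1} \<Longrightarrow> w (s,1) = w (s,0)" "\<And>t. t \<in> {0..1} \<Longrightarrow> w (0,t) = w (0,0)"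
    and w': "square_smooth w'" "grid_fit n B E F V w'" "area_density w' \<rho>'"
      "\<And>s. s \<in> {0..1} \<Longrightarrow> w' (s,1) = w' (s,0)" "\<And>t. t \<in> {0..1} \<Longrightarrow> w' (0,t) = w' (0,0)"
  shows "integral unit_square \<rho>' - integral unit_square \<rho> =
    (\<Sum>j<n. loop_int (F (n,j)) (gridpt n j) (gridpt n (Suc j)) (\<lambda>t. w (1,t)) (\<lambda>t. w' (1,t))
       (vpath (V (n,j)) (w (1,gridpt n j)) (w' (1,gridpt n j)))
       (vpath (V (n,Suc j)) (w (1,gridpt n (Suc j))) (w' (1,gridpt n (Suc j)))))"
proof -
  let ?g = "gridpt n"
  note G' = G[unfolded grid_cells_def]
  have n: "n > 0"
    and GB: "\<forall>i<n. \<forall>j<n. cell (B (i,j))" and GE: "\<forall>i<n. \<forall>j\<le>n. cell (E (i,j))"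
    and GF: "\<forall>i\<le>n. \<forall>j<n. cell (F (i,j))" and GV: "\<forall>i\<le>n. \<forall>j\<le>n. cell (V (i,j))"
    and Gsub: "\<forall>i<n. \<forall>j<n. cell_set (E (i,j)) \<subseteq> cell_set (B (i,j)) \<and> cell_set (E (i,Suc j)) \<subseteq> cell_set (B (i,j)) \<and>
       cell_set (F (i,j)) \<subseteq> cell_set (B (i,j)) \<and> cell_set (F (Suc i,j)) \<subseteq> cell_set (B (i,j))"
    and GVE: "\<forall>i<n. \<forall>j\<le>n. cell_set (V (i,j)) \<subseteq> cell_set (E (i,j)) \<and> cell_set (V (Suc i,j)) \<subseteq> cell_set (E (i,j))"
    and GVF: "\<forall>i\<le>n. \<forall>j<n. cell_set (V (i,j)) \<subseteq> cell_set (F (i,j)) \<and> cell_set (V (i,Suc j)) \<subseteq> cell_set (F (i,j))"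
    and Gn: "\<forall>i<n. E (i,n) = E (i,0)" "\<forall>i\<le>n. V (i,n) = V (i,0)" "\<forall>j\<le>n. V (0,j) = V (0,0)"
    using G' by - (elim conjE, assumption)+
  note g = gridpt[OF n]
  have fB: "\<forall>i<n. \<forall>j<n. w ` ({?g i..?g (Suc i)} \<times> {?g j..?g (Suc j)}) \<subseteq> cell_set (B (i,j))"
    and fE: "\<forall>i<n. \<forall>j\<le>n. (\<lambda>s. w (s, ?g j)) ` {?g i..?g (Suc i)} \<subseteq> cell_set (E (i,j))"
    and fF: "\<forall>i\<le>n. \<forall>j<n. (\<lambda>t. w (?g i, t)) ` {?g j..?g (Suc j)} \<subseteq> cell_set (F (i,j))"
    and fV: "\<forall>i\<le>n. \<forall>j\<le>n. w (?g i, ?g j) \<in> cell_set (V (i,j))"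
    using w(2) unfolding grid_fit_def by - (elim conjE, assumption)+
  have fB': "\<forall>i<n. \<forall>j<n. w' ` ({?g i..?g (Suc i)} \<times> {?g j..?g (Suc j)}) \<subseteq> cell_set (B (i,j))"
    and fE': "\<forall>i<n. \<forall>j\<le>n. (\<lambda>s. w' (s, ?g j)) ` {?g i..?g (Suc i)} \<subseteq> cell_set (E (i,j))"
    and fF': "\<forall>i\<le>n. \<forall>j<n. (\<lambda>t. w' (?g i, t)) ` {?g j..?g (Suc j)} \<subseteq> cell_set (F (i,j))"
    and fV': "\<forall>i\<le>n. \<forall>j\<le>n. w' (?g i, ?g j) \<in> cell_set (V (i,j))"
    using w'(2) unfolding grid_fit_def by - (elim conjE, assumption)+
  define S where "S i j = vpath (V (i,j)) (w (?g i,?g j)) (w' (?g i,?g j))" for i j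
  \<comment> \<open>\<open>FL\<close> and \<open>EL\<close> are the circulations around the strips
    swept out between corresponding edges of the two grids, with the second and the first coordinate
    varying respectively, each computed in the cell of its edge.\<close>
  define FL where "FL i j = loop_int (F (i,j)) (?g j) (?g (Suc j)) (\<lambda>t. w (?g i,t)) (\<lambda>t. w' (?g i,t)) (S i j) (S i (Suc j))" for i j
  define EL where "EL i j = loop_int (E (i,j)) (?g i) (?g (Suc i)) (\<lambda>s. w (s,?g j)) (\<lambda>s. w' (s,?g j)) (S i j) (S (Suc i) j)" for i j
  have vin: "w (?g i,?g j) \<in> cell_set (V (i,j))" "w' (?g i,?g j) \<in> cell_set (V (i,j))" "cell (V (i,j))" if "i \<le> n" "j \<le> n" for i j
  proof -
    show "w (?g i,?g j) \<in> cell_set (V (i,j))" using fV that by simp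
    show "w' (?g i,?g j) \<in> cell_set (V (i,j))" using fV' that by simp
    show "cell (V (i,j))" using GV that by simp
  qed
  have S: "curve_C1 0 1 (S i j)" "S i j ` {0..1} \<subseteq> cell_set (V (i,j))" "S i j 0 = w (?g i,?g j)" "S i j 1 = w' (?g i,?g j)"
    if "i \<le> n" "j \<le> n" for i j
    using vpath[OF vin(3)[OF that] vin(1)[OF that] vin(2)[OF that]] unfolding S_def .
  \<comment> \<open>The edge cell lies in the square cell, so the circulation may be moved from the
    square to the edge, where it no longer depends on which of the adjacent squares it came
    from.\<close>
  have FB: "loop_int (B (i,j)) (?g j) (?g (Suc j)) (\<lambda>t. w (?g k,t)) (\<lambda>t. w' (?g k,t)) (S k j) (S k (Suc j)) = FL k j"
    if ij: "i < n" "j < n" "k = i \<or> k = Suc i" for i j k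
    unfolding FL_def
  proof (rule loop_int_eq)
    have k: "k \<le> n" using ij by auto
    show "cell (F (k,j))" "cell (B (i,j))" using GF GB ij k by auto
    show "cell_set (F (k,j)) \<subseteq> cell_set (B (i,j))" using Gsub[rule_format, OF ij(1,2)] ij(3) by blast
    show "?g j < ?g (Suc j)" by (rule g(3))
    show "curve_C1 (?g j) (?g (Suc j)) (\<lambda>t. w (?g k, t))" "curve_C1 (?g j) (?g (Suc j)) (\<lambda>t. w' (?g k, t))"
      by (rule square_edge_C1(1)[OF w(1) g(3) g(5)[OF ij(2)] g(4)[OF k]] square_edge_C1(1)[OF w'(1) g(3) g(5)[OF ij(2)] g(4)[OF k]])+
    show "curve_C1 0 1 (S k j)" "curve_C1 0 1 (S k (Suc j))" "S k j 0 = w (?g k, ?g j)" "S k j 1 = w' (?g k, ?g j)"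
      "S k (Suc j) 0 = w (?g k, ?g (Suc j))" "S k (Suc j) 1 = w' (?g k, ?g (Suc j))"
      using S[of k j] S[of k "Suc j"] k ij by auto
    have "cell_set (V (k,j)) \<subseteq> cell_set (F (k,j))" "cell_set (V (k,Suc j)) \<subseteq> cell_set (F (k,j))" using GVF[rule_format, OF k ij(2)] by blast+
    moreover have "S k j ` {0..1} \<subseteq> cell_set (V (k,j))" "S k (Suc j) ` {0..1} \<subseteq> cell_set (V (k,Suc j))"
      using S(2)[of k j] S(2)[of k "Suc j"] k ij(2) by simp_all
    ultimately show "S k j ` {0..1} \<subseteq> cell_set (F (k,j))" "S k (Suc j) ` {0..1} \<subseteq> cell_set (F (k,j))" by (meson order_trans)+
    show "(\<lambda>t. w (?g k, t)) ` {?g j..?g (Suc j)} \<subseteq> cell_set (F (k, j))" "(\<lambda>t. w' (?g k, t)) ` {?g j..?g (Suc j)} \<subseteq> cell_set (F (k, j))"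
      by (rule fF[rule_format, OF k ij(2)] fF'[rule_format, OF k ij(2)])+
  qed
  have EB: "loop_int (B (i,j)) (?g i) (?g (Suc i)) (\<lambda>s. w (s,?g k)) (\<lambda>s. w' (s,?g k)) (S i k) (S (Suc i) k) = EL i k"
    if ij: "i < n" "j < n" "k = j \<or> k = Suc j" for i j k
    unfolding EL_def
  proof (rule loop_int_eq)
    have k: "k \<le> n" using ij by auto
    show "cell (E (i,k))" "cell (B (i,j))" using GE GB ij k by auto
    show "cell_set (E (i,k)) \<subseteq> cell_set (B (i,j))" using Gsub[rule_format, OF ij(1,2)] ij(3) by blast
    show "?g i < ?g (Suc i)" by (rule g(3))
    show "curve_C1 (?g i) (?g (Suc i)) (\<lambda>s. w (s, ?g k))" "curve_C1 (?g i) (?g (Suc i)) (\<lambda>s. w' (s, ?g k))"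
      by (rule square_edge_C1(2)[OF w(1) g(3) g(5)[OF ij(1)] g(4)[OF k]] square_edge_C1(2)[OF w'(1) g(3) g(5)[OF ij(1)] g(4)[OF k]])+
    show "curve_C1 0 1 (S i k)" "curve_C1 0 1 (S (Suc i) k)" "S i k 0 = w (?g i, ?g k)" "S i k 1 = w' (?g i, ?g k)"
      "S (Suc i) k 0 = w (?g (Suc i), ?g k)" "S (Suc i) k 1 = w' (?g (Suc i), ?g k)"
      using S[of i k] S[of "Suc i" k] k ij by auto
    have "cell_set (V (i,k)) \<subseteq> cell_set (E (i,k))" "cell_set (V (Suc i,k)) \<subseteq> cell_set (E (i,k))" using GVE[rule_format, OF ij(1) k] by blast+
    moreover have "S i k ` {0..1} \<subseteq> cell_set (V (i,k))" "S (Suc i) k ` {0..1} \<subseteq> cell_set (V (Suc i,k))"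
      using S(2)[of i k] S(2)[of "Suc i" k] k ij(1) by simp_all
    ultimately show "S i k ` {0..1} \<subseteq> cell_set (E (i,k))" "S (Suc i) k ` {0..1} \<subseteq> cell_set (E (i,k))" by (meson order_trans)+
    show "(\<lambda>s. w (s, ?g k)) ` {?g i..?g (Suc i)} \<subseteq> cell_set (E (i, k))" "(\<lambda>s. w' (s, ?g k)) ` {?g i..?g (Suc i)} \<subseteq> cell_set (E (i, k))"
      by (rule fE[rule_format, OF ij(1) k] fE'[rule_format, OF ij(1) k])+
  qed
  let ?Q = "\<lambda>i j. {?g i..?g (Suc i)} \<times> {?g j..?g (Suc j)}"
  have dens: "integral (?Q i j) r = integral (?Q i j) (sq_density (fst (B (i,j))) v)"
    if ij: "i < n" "j < n" and r: "area_density v r" "grid_fit n B E F V v" for i j v r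
  proof (rule integral_cong)
    fix z assume z: "z \<in> ?Q i j"
    then have z1: "z \<in> unit_square" using g(5)[OF ij(1)] g(5)[OF ij(2)] by auto
    obtain c q rr where B: "B (i,j) = (c,q,rr)" by (cases "B (i,j)") auto
    have cB: "cell (c,q,rr)" using GB ij B by metis
    have "v ` ?Q i j \<subseteq> cell_set (B (i,j))"
      using r(2)[unfolded grid_fit_def, THEN conjunct1, rule_format, OF ij] .
    then have "v z \<in> cell_set (B (i,j))" using z by (rule subsetD[OF _ imageI])
    then have "v z \<in> fst c" using cell_set_iff[OF cB] B by simp
    then show "r z = sq_density (fst (B (i,j))) v z"
      using r(1)[unfolded area_density_def, rule_format, OF z1, of c] cB unfolding B cell_def by simp
  qed
  \<comment> \<open>Green's theorem writes both areas as boundary integrals with the same primitive.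
    The transverse paths at the four corners are each used twice with opposite signs, so inserting
    them costs nothing.\<close>
  have sq: "integral (?Q i j) \<rho>' - integral (?Q i j) \<rho> = (FL (Suc i) j - FL i j) - (EL i (Suc j) - EL i j)"
    if ij: "i < n" "j < n" for i j
  proof -
    have cB: "cell (B (i,j))" using GB ij by blast
    have IB: "w ` ?Q i j \<subseteq> cell_set (B (i,j))" "w' ` ?Q i j \<subseteq> cell_set (B (i,j))"
      by (rule fB[rule_format, OF ij] fB'[rule_format, OF ij])+
    note gs = green_square[OF _ cB g(3) g(5)[OF ij(1)] g(3) g(5)[OF ij(2)]]
    show ?thesis
      unfolding dens[OF ij w(3,2)] dens[OF ij w'(3,2)] gs[OF w(1) IB(1)] gs[OF w'(1) IB(2)]
      using FB[OF ij, of i] FB[OF ij, of "Suc i"] EB[OF ij, of j] EB[OF ij, of "Suc j"]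
      unfolding loop_int_def by simp
  qed
  have "integral unit_square \<rho>' - integral unit_square \<rho> = (\<Sum>i<n. \<Sum>j<n. integral (?Q i j) \<rho>' - integral (?Q i j) \<rho>)"
    unfolding integral_grid_square[OF area_density_continuous[OF w(1,3)] n] integral_grid_square[OF area_density_continuous[OF w'(1,3)] n]
    by (simp add: sum_subtractf)
  also have "\<dots> = (\<Sum>i<n. \<Sum>j<n. (FL (Suc i) j - FL i j) - (EL i (Suc j) - EL i j))"
    by (intro sum.cong refl sq) auto
  also have "\<dots> = (\<Sum>i<n. \<Sum>j<n. FL (Suc i) j - FL i j) - (\<Sum>i<n. \<Sum>j<n. EL i (Suc j) - EL i j)"
    by (simp only: sum_subtractf)
  also have "(\<Sum>i<n. \<Sum>j<n. FL (Suc i) j - FL i j) = (\<Sum>j<n. \<Sum>i<n. FL (Suc i) j - FL i j)" by (rule sum.swap)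
  also have "(\<Sum>j<n. \<Sum>i<n. FL (Suc i) j - FL i j) - (\<Sum>i<n. \<Sum>j<n. EL i (Suc j) - EL i j)
      = (\<Sum>j<n. FL n j - FL 0 j) - (\<Sum>i<n. EL i n - EL i 0)"
  proof -
    have "(\<Sum>i<n. FL (Suc i) j - FL i j) = FL n j - FL 0 j" for j
      using sum_lessThan_telescope[of "\<lambda>i. FL i j" n] .
    moreover have "(\<Sum>j<n. EL i (Suc j) - EL i j) = EL i n - EL i 0" for i
      using sum_lessThan_telescope[of "\<lambda>j. EL i j" n] .
    ultimately show ?thesis by simp
  qed
  also have "\<dots> = (\<Sum>j<n. FL n j)"
  proof -
    \<comment> \<open>The edge \<open>s = 0\<close> is collapsed to the centre of the disk: both
      curves are constant and the two transverse paths coincide.\<close>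
    have "FL 0 j = 0" if j: "j < n" for j
    proof -
      have "S 0 (Suc j) = S 0 j"
      proof -
        have "V (0,Suc j) = V (0,j)" using Gn(3) j by (metis Suc_leI less_imp_le)
        then show ?thesis unfolding S_def g(1) using w(5) w'(5) g(4)[of j] g(4)[of "Suc j"] j by (metis Suc_leI less_imp_le)
      qed
      moreover have "cell_int (F (0,j)) (?g j) (?g (Suc j)) (\<lambda>t. w (?g 0, t)) = 0"
      proof (rule line_int_const[OF g(3)])
        show "w (?g 0, t) = w (0,0)" if "t \<in> {?g j..?g (Suc j)}" for t
          unfolding g(1) by (rule w(5)[OF subsetD[OF g(5)[OF j] that]])
      qed
      moreover have "cell_int (F (0,j)) (?g j) (?g (Suc j)) (\<lambda>t. w' (?g 0, t)) = 0"
      proof (rule line_int_const[OF g(3)])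
        show "w' (?g 0, t) = w' (0,0)" if "t \<in> {?g j..?g (Suc j)}" for t
          unfolding g(1) by (rule w'(5)[OF subsetD[OF g(5)[OF j] that]])
      qed
      ultimately show ?thesis by (simp add: FL_def loop_int_def)
    qed
    \<comment> \<open>The edges \<open>t = 0\<close> and \<open>t = 1\<close> are the same ray of
      the disk, and the pattern assigns them the same cells.\<close>
    moreover have "EL i n = EL i 0" if i: "i < n" for i
    proof -
      have SS: "S k n = S k 0" if "k \<le> n" for k
        using Gn(2) that w(4)[OF g(4)[OF that]] w'(4)[OF g(4)[OF that]] unfolding S_def g(1,2) by metis
      have "cell_int X (?g i) (?g (Suc i)) (\<lambda>s. w (s, ?g n)) = cell_int X (?g i) (?g (Suc i)) (\<lambda>s. w (s, ?g 0))"
        "cell_int X (?g i) (?g (Suc i)) (\<lambda>s. w' (s, ?g n)) = cell_int X (?g i) (?g (Suc i)) (\<lambda>s. w' (s, ?g 0))" for X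
        by (rule line_int_cong, use w(4) w'(4) g(1,2) g(5)[OF i] in auto)+
      then show ?thesis using SS[of i] SS[of "Suc i"] i Gn(1) unfolding EL_def loop_int_def by simp
    qed
    ultimately show ?thesis by simp
  qed
  finally show ?thesis unfolding FL_def S_def g(2) .
qed

section \<open>Grids subordinate to a countable family of cells\<close>

lemma countable_cell_base:
  obtains \<B> where "countable \<B>" "\<And>b. b \<in> \<B> \<Longrightarrow> cell b"
    "\<And>p O'. open O' \<Longrightarrow> p \<in> O' \<Longrightarrow> \<exists>b\<in>\<B>. p \<in> cell_set b \<and> cell_set b \<subseteq> O'"
proof -
  obtain \<F> where F: "\<F> \<subseteq> fst ` atlas \<Sigma>" "countable \<F>" "\<Union>\<F> = \<Union>(fst ` atlas \<Sigma>)"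
    using Lindelof[of "fst ` atlas \<Sigma>"] open_dom by (metis imageE)
  have "\<forall>f\<in>\<F>. \<exists>c\<in>atlas \<Sigma>. fst c = f" using F(1) by blast
  then obtain C where C: "\<And>f. f \<in> \<F> \<Longrightarrow> C f \<in> atlas \<Sigma> \<and> fst (C f) = f" by metis
  obtain D :: "(real^2) set" where D: "countable D" "\<And>X. open X \<Longrightarrow> X \<noteq> {} \<Longrightarrow> \<exists>d\<in>D. d \<in> X"
    using countable_dense_exists by metis
  \<comment> \<open>Countably many charts by Lindelof's theorem, centres in a countable dense set,
    and radii \<open>1 / (k + 1)\<close>.\<close>
  define \<B> where "\<B> = {b \<in> C ` \<F> \<times> D \<times> range (\<lambda>k. 1 / real (Suc k)). cell b}"
  have "countable (C ` \<F> \<times> D \<times> range (\<lambda>k. 1 / real (Suc k)))" using F(2) D(1) by auto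
  then have "countable \<B>" by (rule countable_subset[rotated]) (auto simp: \<B>_def)
  moreover have "cell b" if "b \<in> \<B>" for b using that by (simp add: \<B>_def)
  moreover have "\<exists>b\<in>\<B>. p \<in> cell_set b \<and> cell_set b \<subseteq> O'" if O: "open O'" "p \<in> O'" for p O'
  proof -
    have "p \<in> \<Union>\<F>" unfolding F(3) using chart_at[of p] by blast
    then obtain f where f: "f \<in> \<F>" "p \<in> f" by blast
    let ?c = "C f"
    have c: "?c \<in> atlas \<Sigma>" "p \<in> fst ?c" using C[OF f(1)] f(2) by auto
    let ?W = "snd ?c ` (O' \<inter> fst ?c)"
    have "open ?W" by (intro open_chart_image[OF c(1)] open_Int O(1) open_dom[OF c(1)]) auto
    moreover have "snd ?c p \<in> ?W" using c O by blast
    ultimately obtain e where e: "e > 0" "ball (snd ?c p) e \<subseteq> ?W" by (meson openE)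
    \<comment> \<open>The centre \<open>q\<close> is within \<open>?r\<close> of the image of
      \<open>p\<close>, and so is everything in the ball from \<open>q\<close>; two such distances
      stay below \<open>e\<close>.\<close>
    obtain k where k: "1 / real (Suc k) < e / 2" using e(1) nat_approx_posE[of "e/2"] by auto
    let ?r = "1 / real (Suc k)"
    have r: "?r > 0" by simp
    then have "ball (snd ?c p) ?r \<noteq> {}" by (metis centre_in_ball empty_iff)
    then obtain q where q: "q \<in> D" "q \<in> ball (snd ?c p) ?r" using D(2)[OF open_ball] by blast
    have sub: "cball q ?r \<subseteq> ?W"
    proof
      fix y assume "y \<in> cball q ?r"
      then have "dist (snd ?c p) y < e" using q(2) k dist_triangle[of "snd ?c p" y q] by simp
      then show "y \<in> ?W" using e(2) by auto
    qed
    have cl: "cell (?c, q, ?r)" unfolding cell_def using c(1) r sub by auto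
    have "p \<in> cell_set (?c, q, ?r)" using cell_set_iff[OF cl] c(2) q(2) by (simp add: dist_commute)
    moreover have "cell_set (?c, q, ?r) \<subseteq> O'"
    proof
      fix x assume "x \<in> cell_set (?c, q, ?r)"
      then have x: "x \<in> fst ?c" "snd ?c x \<in> ball q ?r" using cell_set_iff[OF cl] by auto
      then obtain x' where x': "x' \<in> O'" "x' \<in> fst ?c" "snd ?c x' = snd ?c x" using sub ball_subset_cball by (smt (verit) IntD1 IntD2 image_iff subsetD)
      then show "x \<in> O'" using coord_inv_chart[OF c(1) x(1)] coord_inv_chart[OF c(1) x'(2)] by simp
    qed
    moreover have "(?c, q, ?r) \<in> \<B>" using cl f(1) q(1) by (auto simp: \<B>_def)
    ultimately show ?thesis by blast
  qed
  ultimately show thesis by (rule that)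
qed

text \<open>Lebesgue's number lemma on the disk, refined twofold: the cell is tied by
  \<open>P\<close> to the centre \<open>z\<close> of the covering ball, and small sets lie within
  \<open>\<rho>0\<close> of that centre. Finiteness of \<open>\<B>0\<close> keeps intersections of
  its cells open.\<close>

lemma cell_Lebesgue:
  fixes u :: "complex \<Rightarrow> 'a"
  assumes u: "continuous_on (cball 0 1) u" and \<rho>0: "\<rho>0 > 0"
    and ex: "\<And>z. z \<in> cball 0 1 \<Longrightarrow> \<exists>b\<in>\<B>. cell b \<and> P z b \<and> u z \<in> cell_set b"
  obtains \<epsilon> \<B>0 where "\<epsilon> > 0" "finite \<B>0" "\<B>0 \<subseteq> \<B>"
    "\<And>T. T \<subseteq> cball 0 1 \<Longrightarrow> diameter T < \<epsilon> \<Longrightarrow> \<exists>z\<in>cball 0 1. \<exists>b\<in>\<B>0. P z b \<and> T \<subseteq> ball z \<rho>0 \<and> u ` T \<subseteq> cell_set b"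
proof -
  have "\<exists>r b. 0 < r \<and> r \<le> \<rho>0 \<and> b \<in> \<B> \<and> P z b \<and> (\<forall>z'\<in>cball 0 1. dist z' z < r \<longrightarrow> u z' \<in> cell_set b)" if z: "z \<in> cball 0 1" for z
  proof -
    obtain b where b: "b \<in> \<B>" "cell b" "P z b" "u z \<in> cell_set b" using ex[OF z] by blast
    obtain \<delta> where d: "\<delta> > 0" "\<And>z'. z' \<in> cball 0 1 \<Longrightarrow> dist z' z < \<delta> \<Longrightarrow> u z' \<in> cell_set b"
      using continuous_on_near[OF u z open_cell_set[OF b(2)] b(4)] by metis
    show ?thesis using b d \<rho>0 by (intro exI[of _ "min \<delta> \<rho>0"] exI[of _ b]) auto
  qed
  then obtain r b where rb: "\<And>z. z \<in> cball 0 1 \<Longrightarrow> 0 < r z \<and> r z \<le> \<rho>0 \<and> b z \<in> \<B> \<and> P z (b z) \<and>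
      (\<forall>z'\<in>cball 0 1. dist z' z < r z \<longrightarrow> u z' \<in> cell_set (b z))" by metis
  let ?K = "cball 0 1 :: complex set"
  have cov: "?K \<subseteq> (\<Union>z\<in>?K. ball z (r z))"
  proof
    fix z :: complex assume "z \<in> ?K"
    then show "z \<in> (\<Union>z\<in>?K. ball z (r z))" using rb[of z] by (intro UN_I[of z]) auto
  qed
  obtain Z where Z: "Z \<subseteq> ?K" "finite Z" "?K \<subseteq> (\<Union>z\<in>Z. ball z (r z))"
    by (rule compactE_image[OF compact_cball _ cov]) auto
  have "(\<lambda>z. ball z (r z)) ` Z \<noteq> {}" using Z(3) by (metis UN_empty centre_in_cball empty_iff image_is_empty subset_empty zero_le_one)
  then obtain \<epsilon> where e: "\<epsilon> > 0" "\<And>T. T \<subseteq> ?K \<Longrightarrow> diameter T < \<epsilon> \<Longrightarrow> \<exists>B\<in>(\<lambda>z. ball z (r z)) ` Z. T \<subseteq> B"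
    by (rule Lebesgue_number_lemma[OF compact_cball _ Z(3)]) auto
  show thesis
  proof (rule that[OF e(1), of "b ` Z"])
    show "finite (b ` Z)" using Z(2) by simp
    show "b ` Z \<subseteq> \<B>" using rb Z(1) by blast
    fix T assume T: "T \<subseteq> ?K" "diameter T < \<epsilon>"
    obtain z where z: "z \<in> Z" "T \<subseteq> ball z (r z)" using e(2)[OF T] by blast
    have zK: "z \<in> ?K" using z(1) Z(1) by blast
    have "T \<subseteq> ball z \<rho>0" using z(2) rb[OF zK] by (meson order_trans subset_ball)
    moreover have "u ` T \<subseteq> cell_set (b z)" using z(2) rb[OF zK] T(1) by (auto simp: dist_commute subset_iff)
    ultimately show "\<exists>z\<in>?K. \<exists>b'\<in>b ` Z. P z b' \<and> T \<subseteq> ball z \<rho>0 \<and> u ` T \<subseteq> cell_set b'"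
      using rb[OF zK] z(1) zK by blast
  qed
qed

text \<open>The inclusions run from vertices to edges to squares, so the cells are chosen at three
  scales. Square cells come from a finite family. Edge cells are taken inside the intersection of
  all square cells containing a nearby point, again from a finite family, and vertex cells inside
  the intersection of all edge cells containing the vertex.\<close>

lemma grid_cells_exist:
  fixes u :: "complex \<Rightarrow> 'a"
  assumes u: "continuous_on (cball 0 1) u"
    and \<B>: "\<And>b. b \<in> \<B> \<Longrightarrow> cell b" "\<And>p O'. open O' \<Longrightarrow> p \<in> O' \<Longrightarrow> \<exists>b\<in>\<B>. p \<in> cell_set b \<and> cell_set b \<subseteq> O'"
  obtains n B E F V where "range B \<subseteq> \<B>" "range E \<subseteq> \<B>" "range F \<subseteq> \<B>" "range V \<subseteq> \<B>"
    "grid_cells n B E F V" "grid_fit n B E F V (polar u)"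
proof -
  let ?K = "cball 0 1 :: complex set"
  define \<zeta> where "\<zeta> = (\<lambda>z :: real \<times> real. of_real (fst z) * cis (2 * pi * snd z))"
  have pol: "polar u z = u (\<zeta> z)" for z by (cases z) (simp add: polar_def \<zeta>_def)
  have \<zeta>K: "\<zeta> z \<in> ?K" if "z \<in> unit_square" for z using that by (auto simp: \<zeta>_def norm_mult)
  have ex: "\<exists>b\<in>\<B>. p \<in> cell_set b \<and> cell_set b \<subseteq> O'" if "open O'" "p \<in> O'" for p O' using \<B>(2) that .
  obtain \<epsilon>1 \<B>1 where 1: "\<epsilon>1 > 0" "finite \<B>1" "\<B>1 \<subseteq> \<B>"
    "\<And>T. T \<subseteq> ?K \<Longrightarrow> diameter T < \<epsilon>1 \<Longrightarrow> \<exists>z\<in>?K. \<exists>b\<in>\<B>1. True \<and> T \<subseteq> ball z 1 \<and> u ` T \<subseteq> cell_set b"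
  proof (rule cell_Lebesgue[OF u zero_less_one, of \<B> "\<lambda>z b. True"])
    show "\<exists>b\<in>\<B>. cell b \<and> True \<and> u z \<in> cell_set b" for z using ex[OF open_UNIV, of "u z"] \<B>(1) by blast
  qed (rule that, assumption+)
  define inter where "inter p = (\<Inter>b\<in>{b \<in> \<B>1. p \<in> cell_set b}. cell_set b)" for p
  have inter: "open (inter p)" "p \<in> inter p" for p
    unfolding inter_def using 1(2,3) \<B>(1) by (auto intro!: open_INT open_cell_set)
  have e6: "\<epsilon>1 / 6 > 0" using 1(1) by simp
  obtain \<epsilon>2 \<B>2 where 2: "\<epsilon>2 > 0" "finite \<B>2" "\<B>2 \<subseteq> \<B>"
    "\<And>T. T \<subseteq> ?K \<Longrightarrow> diameter T < \<epsilon>2 \<Longrightarrow> \<exists>z\<in>?K. \<exists>b\<in>\<B>2. cell_set b \<subseteq> inter (u z) \<and> T \<subseteq> ball z (\<epsilon>1/6) \<and> u ` T \<subseteq> cell_set b"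
  proof (rule cell_Lebesgue[OF u e6, of \<B> "\<lambda>z b. cell_set b \<subseteq> inter (u z)"])
    show "\<exists>b\<in>\<B>. cell b \<and> cell_set b \<subseteq> inter (u z) \<and> u z \<in> cell_set b" for z
      using ex[OF inter, of "u z"] \<B>(1) by blast
  qed (rule that, assumption+)
  \<comment> \<open>Bounds the images of grid squares in the disk: below
    \<open>\<epsilon>1/6\<close> they lie well inside the enlarged sets \<open>?T\<close>, and
    \<open>\<epsilon>2/2\<close> makes them small enough for the second Lebesgue number.\<close>
  define \<eta> where "\<eta> = min (\<epsilon>1/6) (\<epsilon>2/2)"
  have \<eta>: "\<eta> > 0" "\<eta> \<le> \<epsilon>1/6" "\<eta> \<le> \<epsilon>2/2" using 1(1) 2(1) by (auto simp: \<eta>_def)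
  have "uniformly_continuous_on unit_square \<zeta>"
    unfolding \<zeta>_def by (rule compact_uniformly_continuous) (auto simp: cis_conv_exp compact_Times intro!: continuous_intros)
  then obtain \<delta> where \<delta>: "\<delta> > 0" "\<And>z z'. z \<in> unit_square \<Longrightarrow> z' \<in> unit_square \<Longrightarrow> dist z' z < \<delta> \<Longrightarrow> dist (\<zeta> z') (\<zeta> z) < \<eta>"
    using \<eta>(1) unfolding uniformly_continuous_on_def by metis
  \<comment> \<open>Half of \<open>\<delta>\<close>, because the distance in the square is bounded
    by the sum of two coordinate differences.\<close>
  obtain n0 where "1 / real (Suc n0) < \<delta> / 2" using \<delta>(1) nat_approx_posE[of "\<delta>/2"] by auto
  then obtain n where n: "n > 0" "1 / real n < \<delta> / 2" by blast
  note g = gridpt[OF n(1)]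
  let ?g = "gridpt n"
  let ?I = "\<lambda>i. {?g i..?g (Suc i)}"
  have len: "\<bar>s - s'\<bar> < \<delta>/2" if "s \<in> ?I i" "s' \<in> ?I i" for s s' i
  proof -
    have "?g (Suc i) - ?g i = 1 / real n" by (simp add: gridpt_def diff_divide_distrib[symmetric])
    moreover have "\<bar>s - s'\<bar> \<le> ?g (Suc i) - ?g i" using that by (simp add: abs_le_iff)
    ultimately show ?thesis using n(2) by linarith
  qed
  have close: "dist (\<zeta> (s',t')) (\<zeta> (s,t)) < \<eta>" if "s \<in> ?I i" "s' \<in> ?I i" "t \<in> ?I j" "t' \<in> ?I j" "i < n" "j < n" for s s' t t' i j
  proof (rule \<delta>(2))
    show "(s,t) \<in> unit_square" "(s',t') \<in> unit_square" using that g(5)[OF that(5)] g(5)[OF that(6)] by auto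
    have "dist (s',t') (s,t) \<le> \<bar>s' - s\<bar> + \<bar>t' - t\<bar>"
      unfolding dist_Pair_Pair dist_real_def by (rule sqrt_sum_squares_le_sum) auto
    then show "dist (s',t') (s,t) < \<delta>" using len[OF that(2,1)] len[OF that(4,3)] by linarith
  qed
  \<comment> \<open>A default cell for indices outside the grid, so that the whole range of the edge
    assignments lies in \<open>\<B>\<close>.\<close>
  obtain b0 where b0: "b0 \<in> \<B>" using ex[OF open_UNIV] by blast
  define sq where "sq i j = \<zeta> ` (?I i \<times> ?I j)" for i j
  have sqK: "sq i j \<subseteq> ?K" if "i < n" "j < n" for i j
    unfolding sq_def using g(5)[OF that(1)] g(5)[OF that(2)] by (intro image_subsetI \<zeta>K) auto
  define c where "c i j = \<zeta> (?g i, ?g j)" for i j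
  have gi: "?g i \<in> ?I i" "?g (Suc i) \<in> ?I i" for i using g(3)[of i] by auto
  have sqc: "sq i j \<subseteq> ball (c i j) \<eta>" if "i < n" "j < n" for i j
    unfolding sq_def c_def using close[OF gi(1) _ gi(1) _ that] by (auto simp: dist_commute)
  \<comment> \<open>The square cell covers the image of more than its square. The margin is what
    allows it to contain edge cells selected relative to nearby centres; the radius
    \<open>\<epsilon>1/3\<close> keeps the diameter below \<open>\<epsilon>1\<close>.\<close>
  let ?T = "\<lambda>i j. ?K \<inter> ball (c i j) (\<epsilon>1/3)"
  have "\<exists>b\<in>\<B>1. u ` ?T i j \<subseteq> cell_set b" for i j
  proof -
    have "diameter (?T i j) \<le> 2 * (\<epsilon>1/3)"
    proof (rule diameter_le)
      fix x y assume "x \<in> ?T i j" "y \<in> ?T i j"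
      then show "norm (x - y) \<le> 2 * (\<epsilon>1/3)"
        using dist_triangle[of x y "c i j"] by (simp add: dist_norm norm_minus_commute)
    qed (use 1(1) in auto)
    then have "diameter (?T i j) < \<epsilon>1" using 1(1) by simp
    then show ?thesis using 1(4)[of "?T i j"] by blast
  qed
  then obtain Bq where Bq: "\<And>i j. Bq i j \<in> \<B>1" "\<And>i j. u ` ?T i j \<subseteq> cell_set (Bq i j)" by metis
  \<comment> \<open>Chosen as a function of the image of the edge in the disk rather than of its
    indices, so that edges with equal image, such as those at \<open>t = 0\<close> and
    \<open>t = 1\<close>, receive the same cell.\<close>
  define Ed where "Ed T = (SOME b. b \<in> \<B>2 \<and> u ` T \<subseteq> cell_set b \<and> (\<exists>z\<in>?K. cell_set b \<subseteq> inter (u z) \<and> T \<subseteq> ball z (\<epsilon>1/6)))" for T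
  have Ed: "Ed T \<in> \<B>2 \<and> u ` T \<subseteq> cell_set (Ed T) \<and> (\<exists>z\<in>?K. cell_set (Ed T) \<subseteq> inter (u z) \<and> T \<subseteq> ball z (\<epsilon>1/6))"
    if T: "T \<subseteq> sq i j" and ij: "i < n" "j < n" for T i j
  proof -
    have "diameter T \<le> \<epsilon>2/2"
    proof (rule diameter_le)
      fix x y assume "x \<in> T" "y \<in> T"
      then have "x \<in> sq i j" "y \<in> sq i j" using T by blast+
      then obtain s t s' t' where "x = \<zeta> (s',t')" "y = \<zeta> (s,t)" "s \<in> ?I i" "s' \<in> ?I i" "t \<in> ?I j" "t' \<in> ?I j"
        unfolding sq_def by (elim imageE SigmaE) simp
      then show "norm (x - y) \<le> \<epsilon>2/2" using close[of s i s' t j t'] ij \<eta>(3) by (simp add: dist_norm)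
    qed (use 2(1) in auto)
    then have "diameter T < \<epsilon>2" using 2(1) by simp
    then show ?thesis unfolding Ed_def
      using someI_ex[of "\<lambda>b. b \<in> \<B>2 \<and> u ` T \<subseteq> cell_set b \<and> (\<exists>z\<in>?K. cell_set b \<subseteq> inter (u z) \<and> T \<subseteq> ball z (\<epsilon>1/6))"]
        2(4)[of T] T sqK[OF ij] by (meson order_trans)
  qed
  have EdB: "cell_set (Ed T) \<subseteq> cell_set (Bq i j)" if T: "T \<subseteq> sq i j" "T \<noteq> {}" and ij: "i < n" "j < n" for T i j
  proof -
    obtain z where z: "z \<in> ?K" "cell_set (Ed T) \<subseteq> inter (u z)" "T \<subseteq> ball z (\<epsilon>1/6)" using Ed[OF T(1) ij] by blast
    obtain x where x: "x \<in> T" using T(2) by blast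
    have "dist z x < \<epsilon>1/6" "dist (c i j) x < \<epsilon>1/6"
      using z(3) x sqc[OF ij] T(1) \<eta>(2) by (auto simp: subset_iff dest!: bspec)
    \<comment> \<open>Two distances below \<open>\<epsilon>1/6\<close> put the centre
      \<open>z\<close> into \<open>?T i j\<close>. Hence the square cell contains \<open>u z\<close>
      and is one of the sets intersected in \<open>inter (u z)\<close>.\<close>
    then have "dist (c i j) z < \<epsilon>1/3" using dist_triangle[of "c i j" z x] by (simp add: dist_commute)
    then have "u z \<in> cell_set (Bq i j)" using Bq(2)[of i j] z(1) by (auto simp: image_subset_iff)
    then show ?thesis using z(2) Bq(1)[of i j] unfolding inter_def by blast
  qed
  define TE where "TE i j = \<zeta> ` (?I i \<times> {?g j})" for i j
  define TF where "TF i j = \<zeta> ` ({?g i} \<times> ?I j)" for i j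
  have TE: "TE i j \<subseteq> sq i j" "TE i (Suc j) \<subseteq> sq i j" "TE i j \<noteq> {}" for i j
    unfolding TE_def sq_def using gi[of j] gi[of i] by auto
  have TF: "TF i j \<subseteq> sq i j" "TF (Suc i) j \<subseteq> sq i j" "TF i j \<noteq> {}" for i j
    unfolding TF_def sq_def using gi[of i] gi[of j] by auto
  have TEn: "TE i n = TE i 0" for i
    unfolding TE_def g(1,2) by (intro equalityI subsetI; force simp: \<zeta>_def cis.ctr)
  define interV where "interV p = (\<Inter>b\<in>{b \<in> \<B>2. p \<in> cell_set b}. cell_set b)" for p
  have interV: "open (interV p)" "p \<in> interV p" for p
    unfolding interV_def using 2(2,3) \<B>(1) by (auto intro!: open_INT open_cell_set)
  have "\<forall>p. \<exists>b\<in>\<B>. p \<in> cell_set b \<and> cell_set b \<subseteq> interV p" using ex[OF interV] by blast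
  then obtain Vf where Vf: "\<And>p. Vf p \<in> \<B>" "\<And>p. p \<in> cell_set (Vf p)" "\<And>p. cell_set (Vf p) \<subseteq> interV p" by metis
  define B where "B = (\<lambda>(i,j). Bq i j)"
  define E where "E = (\<lambda>(i,j). if i < n \<and> j \<le> n then Ed (TE i j) else b0)"
  define F where "F = (\<lambda>(i,j). if i \<le> n \<and> j < n then Ed (TF i j) else b0)"
  \<comment> \<open>Depends on the vertex only through its image in the surface, which gives equal
    cells at the seam and at the centre of the disk.\<close>
  define V where "V = (\<lambda>(i,j). Vf (u (c i j)))"
  have EE: "Ed (TE i j) \<in> \<B>2 \<and> u ` TE i j \<subseteq> cell_set (Ed (TE i j))" if "i < n" "j \<le> n" for i j
  proof (cases "j < n")
    case True then show ?thesis using Ed[OF TE(1) that(1) True] by blast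
  next
    case False
    \<comment> \<open>The last grid line has no square after it, so the edge is regarded as
      belonging to the preceding square.\<close>
    obtain k where k: "n = Suc k" using n(1) gr0_implies_Suc by blast
    have "j = Suc k" "k < n" using False that k by auto
    then show ?thesis using Ed[OF TE(2)[of i k] that(1)] by simp
  qed
  have FF: "Ed (TF i j) \<in> \<B>2 \<and> u ` TF i j \<subseteq> cell_set (Ed (TF i j))" if "i \<le> n" "j < n" for i j
  proof (cases "i < n")
    case True then show ?thesis using Ed[OF TF(1) True that(2)] by blast
  next
    case False
    obtain k where k: "n = Suc k" using n(1) gr0_implies_Suc by blast
    have "i = Suc k" "k < n" using False that k by auto
    then show ?thesis using Ed[OF TF(2)[of k j] _ that(2)] by simp
  qed
  have VV: "cell_set (V (i,j)) \<subseteq> cell_set b" if "b \<in> \<B>2" "u (c i j) \<in> cell_set b" for i j b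
    using Vf(3)[of "u (c i j)"] that unfolding interV_def V_def by auto
  have cE: "c i j \<in> TE i j" "c (Suc i) j \<in> TE i j" for i j unfolding c_def TE_def using gi[of i] by auto
  have cF: "c i j \<in> TF i j" "c i (Suc j) \<in> TF i j" for i j unfolding c_def TF_def using gi[of j] by auto
  have c0: "c 0 j = c 0 0" for j unfolding c_def g(1) by (simp add: \<zeta>_def)
  have cn: "c i n = c i 0" for i unfolding c_def g(1,2) by (simp add: \<zeta>_def)
  have rB: "range B \<subseteq> \<B>" using Bq(1) 1(3) by (auto simp: B_def)
  have rE: "range E \<subseteq> \<B>"
  proof (rule image_subsetI)
    show "E x \<in> \<B>" for x
      using subsetD[OF 2(3)] EE[of "fst x" "snd x"] b0 by (simp add: E_def case_prod_unfold)
  qed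
  have rF: "range F \<subseteq> \<B>"
  proof (rule image_subsetI)
    show "F x \<in> \<B>" for x
      using subsetD[OF 2(3)] FF[of "fst x" "snd x"] b0 by (simp add: F_def case_prod_unfold)
  qed
  have rV: "range V \<subseteq> \<B>" using Vf(1) by (auto simp: V_def)
  have "grid_cells n B E F V"
    unfolding grid_cells_def
  proof (intro conjI allI impI)
    fix i j
    show "cell (B (i,j))" "cell (E (i,j))" "cell (F (i,j))" "cell (V (i,j))"
      by (rule \<B>(1); use rB rE rF rV in blast)+
    show "cell_set (E (i,j)) \<subseteq> cell_set (B (i,j))" if "i < n" "j < n"
      using EdB[OF TE(1,3) that] that by (simp add: E_def B_def)
    show "cell_set (E (i,Suc j)) \<subseteq> cell_set (B (i,j))" if "i < n" "j < n"
      using EdB[OF TE(2,3) that] that by (simp add: E_def B_def)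
    show "cell_set (F (i,j)) \<subseteq> cell_set (B (i,j))" if "i < n" "j < n"
      using EdB[OF TF(1,3) that] that by (simp add: F_def B_def)
    show "cell_set (F (Suc i,j)) \<subseteq> cell_set (B (i,j))" if "i < n" "j < n"
      using EdB[OF TF(2,3) that] that by (simp add: F_def B_def)
    show "cell_set (V (i,j)) \<subseteq> cell_set (E (i,j))" "cell_set (V (Suc i,j)) \<subseteq> cell_set (E (i,j))" if "i < n" "j \<le> n"
      using VV[of "Ed (TE i j)"] EE[OF that] cE that by (auto simp: E_def image_subset_iff)
    show "cell_set (V (i,j)) \<subseteq> cell_set (F (i,j))" "cell_set (V (i,Suc j)) \<subseteq> cell_set (F (i,j))" if "i \<le> n" "j < n"
      using VV[of "Ed (TF i j)"] FF[OF that] cF that by (auto simp: F_def image_subset_iff)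
    show "E (i,n) = E (i,0)" if "i < n" using that TEn by (simp add: E_def)
    show "V (i,n) = V (i,0)" by (simp add: V_def cn)
    show "V (0,j) = V (0,0)" by (simp add: V_def c0[of j])
  qed (fact n(1))
  moreover have "grid_fit n B E F V (polar u)"
    unfolding grid_fit_def
  proof (intro conjI allI impI)
    fix i j
    show "polar u ` (?I i \<times> ?I j) \<subseteq> cell_set (B (i,j))" if ij: "i < n" "j < n"
    proof -
      have "ball (c i j) \<eta> \<subseteq> ball (c i j) (\<epsilon>1/3)" using \<eta>(2) 1(1) by (intro subset_ball) simp
      then have "sq i j \<subseteq> ?T i j" using sqK[OF ij] sqc[OF ij] by blast
      then have "u ` sq i j \<subseteq> cell_set (Bq i j)" using Bq(2)[of i j] by blast
      then show ?thesis by (auto simp: B_def sq_def pol)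
    qed
    show "(\<lambda>s. polar u (s, ?g j)) ` ?I i \<subseteq> cell_set (E (i,j))" if "i < n" "j \<le> n"
      using EE[OF that] that by (auto simp: E_def TE_def pol)
    show "(\<lambda>t. polar u (?g i, t)) ` ?I j \<subseteq> cell_set (F (i,j))" if "i \<le> n" "j < n"
      using FF[OF that] that by (auto simp: F_def TF_def pol)
    show "polar u (?g i, ?g j) \<in> cell_set (V (i,j))" using Vf(2)[of "u (c i j)"] by (simp add: V_def c_def pol)
  qed
  ultimately show thesis using that rB rE rF rV by blast
qed

end

section \<open>Actions of nearby fixed points\<close>

lemma continuous_on_relative:
  fixes f :: "'m::metric_space \<Rightarrow> 'n::topological_space"
  assumes "\<And>x. x \<in> A \<Longrightarrow> \<exists>U. open U \<and> x \<in> U \<and> continuous_on (A \<inter> U) f"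
  shows "continuous_on A f"
  unfolding continuous_on_eq_continuous_within
proof
  fix x assume x: "x \<in> A"
  then obtain U where U: "open U" "x \<in> U" "continuous_on (A \<inter> U) f" using assms by blast
  have "at x within (A \<inter> U) = at x within A" by (rule at_within_nhd[OF U(2,1)]) auto
  moreover have "continuous (at x within (A \<inter> U)) f" using U x by (simp add: continuous_on_eq_continuous_within)
  ultimately show "continuous (at x within A) f" by simp
qed

context area_surface begin

text \<open>The closed ball of the larger cell has compact, hence closed, image in the surface, so
  an inclusion of open cells extends to closed balls. Transition maps are thereby defined on compact
  sets and admit uniform estimates.\<close>

lemma cell_closed_subset:
  assumes V: "cell (c,q,r)" and F: "cell (d,q',r')" and sub: "cell_set (c,q,r) \<subseteq> cell_set (d,q',r')"
    and y: "y \<in> cball q r"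
  shows "coord_inv c y \<in> fst d" "snd d (coord_inv c y) \<in> cball q' r'" "y \<in> snd c ` (fst c \<inter> id -` fst d)"
proof -
  have c: "c \<in> atlas \<Sigma>" "r > 0" "cball q r \<subseteq> snd c ` fst c" and d: "d \<in> atlas \<Sigma>" "cball q' r' \<subseteq> snd d ` fst d"
    using V F by (auto simp: cell_def)
  let ?T = "coord_inv d ` cball q' r'"
  have "compact ?T"
    by (intro compact_continuous_image continuous_on_subset[OF continuous_coord_inv[OF d(1)] d(2)]) simp
  then have "closed ?T" by (rule compact_imp_closed)
  moreover have "continuous_on (closure (ball q r)) (coord_inv c)"
    using c(2,3) continuous_on_subset[OF continuous_coord_inv[OF c(1)]] by simp
  moreover have "coord_inv c ` ball q r \<subseteq> ?T"
    using sub ball_subset_cball unfolding cell_set_def by fastforce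
  ultimately have "coord_inv c ` closure (ball q r) \<subseteq> ?T" by (metis image_closure_subset)
  then have "coord_inv c y \<in> ?T" using y c(2) by auto
  then obtain z where z: "z \<in> cball q' r'" "coord_inv c y = coord_inv d z" by blast
  then have zI: "z \<in> snd d ` fst d" using d(2) by blast
  show 1: "coord_inv c y \<in> fst d" "snd d (coord_inv c y) \<in> cball q' r'"
    using z coord_inv_in[OF d(1) zI] chart_coord_inv[OF d(1) zI] by auto
  have yI: "y \<in> snd c ` fst c" using y c(3) by blast
  show "y \<in> snd c ` (fst c \<inter> id -` fst d)"
    using 1(1) coord_inv_in[OF c(1) yI] chart_coord_inv[OF c(1) yI] by (intro image_eqI[of _ _ "coord_inv c y"]) auto
qed

lemma transition_smooth: "c \<in> atlas \<Sigma> \<Longrightarrow> d \<in> atlas \<Sigma> \<Longrightarrow> smooth_open (snd c ` (fst c \<inter> id -` fst d)) (local_rep c d id)"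
  using local_rep_smooth[of id c d] area_map_id by (simp add: area_map_def)

text \<open>Compares distances of points of \<open>V\<close> measured in two larger cells; needed
  when a trajectory passes from one boundary edge to the next.\<close>

lemma cell_transition_Lipschitz:
  assumes V: "cell V" and F: "cell F" and F': "cell F'" and sub: "cell_set V \<subseteq> cell_set F" "cell_set V \<subseteq> cell_set F'"
  obtains C where "C \<ge> 0" "\<And>p p'. p \<in> cell_set V \<Longrightarrow> p' \<in> cell_set V \<Longrightarrow>
    norm (snd (fst F') p - snd (fst F') p') \<le> C * norm (snd (fst F) p - snd (fst F) p')"
proof -
  obtain e q r where Ve: "V = (e,q,r)" by (cases V) auto
  obtain c q1 r1 where Fc: "F = (c,q1,r1)" by (cases F) auto
  obtain d q2 r2 where Fd: "F' = (d,q2,r2)" by (cases F') auto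
  have at: "e \<in> atlas \<Sigma>" "c \<in> atlas \<Sigma>" "d \<in> atlas \<Sigma>" using V F F' by (auto simp: Ve Fc Fd cell_def)
  note c1 = cell_closed_subset[OF V[unfolded Ve] F[unfolded Fc] sub(1)[unfolded Ve Fc]]
  note c2 = cell_closed_subset[OF V[unfolded Ve] F'[unfolded Fd] sub(2)[unfolded Ve Fd]]
  let ?K = "(\<lambda>y. snd c (coord_inv e y)) ` cball q r"
  have "cball q r \<subseteq> snd e ` fst e" using V by (simp add: Ve cell_def)
  then have "continuous_on (cball q r) (\<lambda>y. snd c (coord_inv e y))"
    by (intro continuous_on_compose2[OF continuous_chart[OF at(2)] continuous_on_subset[OF continuous_coord_inv[OF at(1)]]])
       (use c1(1) in auto)
  then have K: "compact ?K" by (intro compact_continuous_image) simp_all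
  have Ks: "?K \<subseteq> snd c ` (fst c \<inter> id -` fst d)" using c1(1) c2(1) by auto
  obtain C where C: "C \<ge> 0" "\<And>x y. x \<in> ?K \<Longrightarrow> y \<in> ?K \<Longrightarrow> norm (local_rep c d id x - local_rep c d id y) \<le> C * norm (x - y)"
    by (rule smooth_on_compact_estimates[OF smooth_open_imp_smooth_on[OF transition_smooth[OF at(2,3)] order_refl] K Ks]) (rule that, assumption+)
  show thesis
  proof (rule that[OF C(1)])
    fix p p' assume p: "p \<in> cell_set V" "p' \<in> cell_set V"
    have "snd c x \<in> ?K" "local_rep c d id (snd c x) = snd d x" if x: "x \<in> cell_set V" for x
    proof -
      obtain y where y: "y \<in> ball q r" "x = coord_inv e y" using x by (auto simp: Ve cell_set_def)
      then have y': "y \<in> cball q r" using ball_subset_cball by blast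
      show "snd c x \<in> ?K" using y y' by blast
      show "local_rep c d id (snd c x) = snd d x" using local_rep_chart[OF at(2), of x d id] c1(1)[OF y'] y(2) by simp
    qed
    then show "norm (snd (fst F') p - snd (fst F') p') \<le> C * norm (snd (fst F) p - snd (fst F) p')"
      using C(2)[of "snd c p" "snd c p'"] p by (simp add: Fc Fd)
  qed
qed

text \<open>\<open>cell_prim F\<close> integrated over a strip between two curves with the same end points.\<close>

lemma lens_area:
  assumes F: "cell (d,q',r')" and M: "\<And>y. y \<in> ball q' r' \<Longrightarrow> \<bar>dens d y\<bar> \<le> M"
    and S: "\<And>t. t \<in> {0..1} \<Longrightarrow> (S has_vector_derivative S' t) (at t within {0..1})" "continuous_on {0..1} S'"
      "\<And>t. t \<in> {0..1} \<Longrightarrow> S t \<in> ball q' r'"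
    and \<delta>: "\<And>t. t \<in> {0..1} \<Longrightarrow> norm (S t - ((1 - t) *\<^sub>R S 0 + t *\<^sub>R S 1)) \<le> \<delta>" "\<And>t. t \<in> {0..1} \<Longrightarrow> norm (S' t) \<le> \<mu>" "norm (S 1 - S 0) \<le> \<mu>"
  shows "\<bar>integral {0..1} (\<lambda>t. cell_prim (d,q',r') (S t) * S' t $ 2) -
    integral {0..1} (\<lambda>t. cell_prim (d,q',r') ((1 - t) *\<^sub>R S 0 + t *\<^sub>R S 1) * (S 1 - S 0) $ 2)\<bar> \<le> M * (2 * (\<delta> * \<mu>))"
proof -
  have d: "d \<in> atlas \<Sigma>" using F by (simp add: cell_def)
  obtain Q where Q: "continuous_on (ball q' r') Q"
    "\<And>y. y \<in> ball q' r' \<Longrightarrow> (cell_prim (d,q',r') has_derivative (\<lambda>v. dens d y * v$1 + Q y * v$2)) (at y)"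
    by (rule cell_prim[OF F]) (rule that, assumption+)
  let ?l = "\<lambda>t. (1 - t) *\<^sub>R S 0 + t *\<^sub>R S 1"
  have l: "(?l has_vector_derivative (S 1 - S 0)) (at t within {0..1})" for t
    unfolding has_vector_derivative_def by (auto intro!: derivative_eq_intros simp: algebra_simps)
  have lb: "?l t \<in> ball q' r'" if "t \<in> {0..1}" for t
    using convexD[OF convex_ball S(3)[of 0] S(3)[of 1], of "1-t" t] that by simp
  let ?W = "\<lambda>s t. (1 - s) *\<^sub>R ?l t + s *\<^sub>R S t"
  \<comment> \<open>The strip between the curve and its chord. Its transverse sides are constant,
    since the end points agree.\<close>
  have R: "rect_C2 0 1 0 1 ?W (\<lambda>s t. S t - ?l t) (\<lambda>s t. (1 - s) *\<^sub>R (S 1 - S 0) + s *\<^sub>R S' t) (\<lambda>s t. S' t - (S 1 - S 0))"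
    by (rule rect_C2_strip[OF l _ S(1,2)]) auto
  have Wb: "?W s t \<in> ball q' r'" if "s \<in> {0..1}" "t \<in> {0..1}" for s t
    using convexD[OF convex_ball lb[OF that(2)] S(3)[OF that(2)], of "1-s" s] that(1) by simp
  have dc: "continuous_on (ball q' r') (dens d)"
    by (rule smooth_open_continuous_on[OF smooth_open_subset[OF dens_smooth[OF d] open_ball cell_ball[OF F]]])
  let ?f = "\<lambda>(s,t). dens d (?W s t) * cross2 (S t - ?l t) ((1 - s) *\<^sub>R (S 1 - S 0) + s *\<^sub>R S' t)"
  have G: "integral unit_square ?f =
     integral {0..1} (\<lambda>t. cell_prim (d,q',r') (S t) * S' t $ 2) - integral {0..1} (\<lambda>t. cell_prim (d,q',r') (?l t) * (S 1 - S 0) $ 2)"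
    using green_rect[OF R zero_less_one zero_less_one Wb Q(2) dc Q(1)] by simp
  have 0: "\<delta> \<ge> 0" "\<mu> \<ge> 0" "M \<ge> 0"
  proof -
    show "\<delta> \<ge> 0" using \<delta>(1)[of 0] by simp
    show "\<mu> \<ge> 0" using \<delta>(3) norm_ge_zero[of "S 1 - S 0"] by linarith
    show "M \<ge> 0" using M[OF S(3)[of 0]] by simp
  qed
  have bd: "norm (?f z) \<le> M * (2 * (\<delta> * \<mu>))" if z: "z \<in> unit_square" for z
  proof -
    obtain s t where st: "z = (s,t)" "s \<in> {0..1}" "t \<in> {0..1}" using z by (cases z) auto
    let ?v = "(1 - s) *\<^sub>R (S 1 - S 0) + s *\<^sub>R S' t"
    have "norm ?v \<le> (1 - s) * norm (S 1 - S 0) + s * norm (S' t)"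
      using norm_triangle_ineq[of "(1 - s) *\<^sub>R (S 1 - S 0)" "s *\<^sub>R S' t"] st(2) by simp
    also have "\<dots> \<le> (1 - s) * \<mu> + s * \<mu>" using st \<delta>(2)[OF st(3)] \<delta>(3) by (intro add_mono mult_left_mono) auto
    finally have v: "norm ?v \<le> \<mu>" by (simp add: algebra_simps)
    have "\<bar>cross2 (S t - ?l t) ?v\<bar> \<le> 2 * (norm (S t - ?l t) * norm ?v)" by (rule cross2_le)
    also have "\<dots> \<le> 2 * (\<delta> * \<mu>)" using \<delta>(1)[OF st(3)] v 0 by (intro mult_left_mono mult_mono) auto
    finally have "\<bar>cross2 (S t - ?l t) ?v\<bar> \<le> 2 * (\<delta> * \<mu>)" .
    then show ?thesis using M[OF Wb[OF st(2,3)]] 0 st(1) by (auto simp: abs_mult intro!: mult_mono)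
  qed
  have B: "\<bar>integral unit_square ?f\<bar> \<le> M * (2 * (\<delta> * \<mu>))"
  proof (cases "?f integrable_on unit_square")
    case True
    have "norm (integral unit_square ?f) \<le> M * (2 * (\<delta> * \<mu>)) * measure lborel (cbox (0::real,0::real) (1,1))"
      using integrable_bound[of "M * (2 * (\<delta> * \<mu>))" ?f "(0,0)" "(1,1)"] 0 True bd by (simp add: cbox_Pair_eq)
    moreover have "measure lborel (cbox (0::real,0::real) (1,1)) = 1" by (simp add: content_Pair)
    ultimately show ?thesis by simp
  next
    case False then show ?thesis using 0 by (simp add: not_integrable_integral)
  qed
  then show ?thesis unfolding G .
qed

lemma vpath_own_chart:
  assumes F: "cell F" and p: "p \<in> cell_set F" "p' \<in> cell_set F" and t: "t \<in> {0..1}"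
  shows "snd (fst F) (vpath F p p' t) = (1 - t) *\<^sub>R snd (fst F) p + t *\<^sub>R snd (fst F) p'"
    "curve_deriv (fst F) 0 1 (vpath F p p') t = snd (fst F) p' - snd (fst F) p"
proof -
  obtain c q r where Fc: "F = (c,q,r)" by (cases F) auto
  have c: "c \<in> atlas \<Sigma>" using F by (simp add: Fc cell_def)
  have pc: "snd c p \<in> ball q r" "snd c p' \<in> ball q r"
    using cell_set_iff[OF F[unfolded Fc]] p unfolding Fc by auto
  have eq: "snd c (vpath F p p' t) = (1 - t) *\<^sub>R snd c p + t *\<^sub>R snd c p'" if t: "t \<in> {0..1}" for t
  proof -
    have "(1 - t) *\<^sub>R snd c p + t *\<^sub>R snd c p' \<in> ball q r" using convexD[OF convex_ball pc, of "1-t" t] t by simp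
    then show ?thesis unfolding vpath_def Fc using chart_coord_inv[OF c] cell_ball[OF F[unfolded Fc]] by auto
  qed
  show "snd (fst F) (vpath F p p' t) = (1 - t) *\<^sub>R snd (fst F) p + t *\<^sub>R snd (fst F) p'" using eq[OF t] by (simp add: Fc)
  have "((\<lambda>t. (1 - t) *\<^sub>R snd c p + t *\<^sub>R snd c p') has_vector_derivative (snd c p' - snd c p)) (at t within {0..1})"
    unfolding has_vector_derivative_def by (auto intro!: derivative_eq_intros simp: algebra_simps)
  from has_vector_derivative_transform[OF t eq this]
  have "((\<lambda>r. snd c (vpath F p p' r)) has_vector_derivative (snd c p' - snd c p)) (at t within {0..1})" .
  then show "curve_deriv (fst F) 0 1 (vpath F p p') t = snd (fst F) p' - snd (fst F) p"
    unfolding curve_deriv_def by (simp add: Fc vector_derivative_within_closed_interval[OF zero_less_one t])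
qed

lemma dens_bounded:
  assumes "cell (d,q,r)" obtains M where "M \<ge> 0" "\<And>y. y \<in> ball q r \<Longrightarrow> \<bar>dens d y\<bar> \<le> M"
proof -
  have d: "d \<in> atlas \<Sigma>" "cball q r \<subseteq> snd d ` fst d" using assms by (auto simp: cell_def)
  have "bounded (dens d ` cball q r)"
    by (intro compact_imp_bounded compact_continuous_image continuous_on_subset[OF smooth_open_continuous_on[OF dens_smooth[OF d(1)]] d(2)]) simp
  then obtain M where "\<forall>x\<in>dens d ` cball q r. norm x \<le> M" unfolding bounded_iff by blast
  then have "\<And>y. y \<in> cball q r \<Longrightarrow> \<bar>dens d y\<bar> \<le> M" by simp
  then have "\<bar>dens d y\<bar> \<le> max M 0" if "y \<in> ball q r" for y using that ball_subset_cball by (metis max.coboundedI1 subsetD)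
  then show thesis using that[of "max M 0"] by simp
qed

text \<open>Seen in the chart of \<open>F\<close>, the segment of \<open>V\<close> is a curve with
  the same end points as the segment of \<open>F\<close>. It deviates from it quadratically in the
  distance and has speed linear in the distance, so the enclosed area is cubic.\<close>

lemma lens_estimate:
  assumes V: "cell V" and F: "cell F" and sub: "cell_set V \<subseteq> cell_set F"
  obtains C where "C \<ge> 0" "\<And>p p'. p \<in> cell_set V \<Longrightarrow> p' \<in> cell_set V \<Longrightarrow>
    \<bar>cell_int F 0 1 (vpath V p p') - cell_int F 0 1 (vpath F p p')\<bar> \<le> C * norm (snd (fst F) p' - snd (fst F) p) ^ 3"
proof -
  obtain c q r where Vc: "V = (c,q,r)" by (cases V) auto
  obtain d q' r' where Fd: "F = (d,q',r')" by (cases F) auto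
  have c: "c \<in> atlas \<Sigma>" and d: "d \<in> atlas \<Sigma>" using V F by (auto simp: Vc Fd cell_def)
  note cs = cell_closed_subset[OF V[unfolded Vc] F[unfolded Fd] sub[unfolded Vc Fd]]
  let ?T = "local_rep c d id" and ?U = "snd c ` (fst c \<inter> id -` fst d)"
  have so: "smooth_open ?U ?T" by (rule transition_smooth[OF c d])
  have KU: "cball q r \<subseteq> ?U" using cs(3) by blast
  obtain C1 where C1: "C1 \<ge> 0" "\<And>x y. x \<in> cball q r \<Longrightarrow> y \<in> cball q r \<Longrightarrow> norm (?T x - ?T y) \<le> C1 * norm (x - y)"
    "\<And>x v. x \<in> cball q r \<Longrightarrow> norm (frechet_derivative ?T (at x) v) \<le> C1 * norm v"
    by (rule smooth_open_Lipschitz_cball[OF so KU]) (rule that, assumption+)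
  obtain C2 where C2: "C2 \<ge> 0" "\<And>x y \<tau>. x \<in> cball q r \<Longrightarrow> y \<in> cball q r \<Longrightarrow> \<tau> \<in> {0..1} \<Longrightarrow>
     norm (?T ((1 - \<tau>) *\<^sub>R x + \<tau> *\<^sub>R y) - ((1 - \<tau>) *\<^sub>R ?T x + \<tau> *\<^sub>R ?T y)) \<le> C2 * (norm (x - y))\<^sup>2"
    by (rule smooth_open_interpolation_cball[OF so KU]) (rule that, assumption+)
  obtain C3 where C3: "C3 \<ge> 0" "\<And>p p'. p \<in> cell_set V \<Longrightarrow> p' \<in> cell_set V \<Longrightarrow>
    norm (snd (fst V) p - snd (fst V) p') \<le> C3 * norm (snd (fst F) p - snd (fst F) p')"
    by (rule cell_transition_Lipschitz[OF V F V sub order_refl]) (rule that, assumption+)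
  obtain M where M: "M \<ge> 0" "\<And>y. y \<in> ball q' r' \<Longrightarrow> \<bar>dens d y\<bar> \<le> M"
    by (rule dens_bounded[OF F[unfolded Fd]]) (rule that, assumption+)
  \<comment> \<open>Density bound, deviation and speed from \<open>lens_area\<close>; the factor
    \<open>C3 ^ 3\<close> converts the distance from the chart of \<open>V\<close> to that of
    \<open>F\<close>.\<close>
  define C where "C = M * (2 * (C2 * C1)) * C3 ^ 3"
  show thesis
  proof (rule that[of C])
    show "0 \<le> C" using M(1) C1(1) C2(1) C3(1) by (simp add: C_def)
    fix p p' assume p: "p \<in> cell_set V" "p' \<in> cell_set V"
    have pV: "p \<in> fst c" "p' \<in> fst c" "snd c p \<in> ball q r" "snd c p' \<in> ball q r"
      using cell_set_iff[OF V[unfolded Vc]] p unfolding Vc by auto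
    then have pk: "snd c p \<in> cball q r" "snd c p' \<in> cball q r" by auto
    let ?D = "norm (snd c p - snd c p')"
    let ?y = "\<lambda>t. (1 - t) *\<^sub>R snd c p + t *\<^sub>R snd c p'"
    have yb: "?y t \<in> ball q r" if "t \<in> {0..1}" for t using convexD[OF convex_ball pV(3,4), of "1-t" t] that by simp
    then have yk: "?y t \<in> cball q r" if "t \<in> {0..1}" for t using that ball_subset_cball by blast
    have yd: "(?y has_vector_derivative (snd c p' - snd c p)) (at t within {0..1})" for t
      unfolding has_vector_derivative_def by (auto intro!: derivative_eq_intros simp: algebra_simps)
    define S where "S t = ?T (?y t)" for t
    define S' where "S' t = frechet_derivative ?T (at (?y t)) (snd c p' - snd c p)" for t
    have S01: "S 0 = snd d p" "S 1 = snd d p'" using local_rep_chart[OF c, of _ d id] pV by (auto simp: S_def)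
    have dS: "(S has_vector_derivative S' t) (at t within {0..1})" if t: "t \<in> {0..1}" for t
      unfolding S_def S'_def
      using vector_derivative_diff_chain_within[OF yd has_derivative_at_withinI[OF smooth_open_has_derivative[OF so subsetD[OF KU yk[OF t]]]]]
      by (simp add: o_def)
    have cS: "continuous_on {0..1} S'"
      unfolding S'_def
      by (rule continuous_on_compose2[OF smooth_open_continuous_on[OF smooth_open_deriv[OF so]]])
         (use yk KU in \<open>auto intro!: continuous_intros\<close>)
    have Seq: "snd d (vpath V p p' t) = S t" if t: "t \<in> {0..1}" for t
      by (simp add: S_def vpath_def Vc local_rep_def)
    have Sb: "S t \<in> ball q' r'" if t: "t \<in> {0..1}" for t
    proof -
      have "vpath V p p' t \<in> cell_set F" using vpath(2)[OF V p] sub t by blast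
      then show ?thesis using cell_set_iff[OF F[unfolded Fd]] Seq[OF t] unfolding Fd by metis
    qed
    have i1: "cell_int F 0 1 (vpath V p p') = integral {0..1} (\<lambda>t. cell_prim (d,q',r') (S t) * S' t $ 2)"
      unfolding line_int_def
    proof (rule integral_cong)
      fix t :: real assume t: "t \<in> {0..1}"
      have "((\<lambda>r. snd d (vpath V p p' r)) has_vector_derivative S' t) (at t within {0..1})"
        by (rule has_vector_derivative_transform[OF t Seq dS[OF t]])
      then have "curve_deriv d 0 1 (vpath V p p') t = S' t"
        unfolding curve_deriv_def by (rule vector_derivative_within_closed_interval[OF zero_less_one t])
      then show "cell_prim F (snd (fst F) (vpath V p p' t)) * curve_deriv (fst F) 0 1 (vpath V p p') t $ 2 = cell_prim (d,q',r') (S t) * S' t $ 2"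
        using Seq[OF t] by (simp add: Fd)
    qed
    have pF: "p \<in> cell_set F" "p' \<in> cell_set F" using p sub by auto
    have i2: "cell_int F 0 1 (vpath F p p') = integral {0..1} (\<lambda>t. cell_prim (d,q',r') ((1 - t) *\<^sub>R S 0 + t *\<^sub>R S 1) * (S 1 - S 0) $ 2)"
      unfolding line_int_def
      by (rule integral_cong) (use vpath_own_chart[OF F pF] in \<open>simp add: Fd S01\<close>)
    have "\<bar>cell_int F 0 1 (vpath V p p') - cell_int F 0 1 (vpath F p p')\<bar> \<le> M * (2 * ((C2 * ?D\<^sup>2) * (C1 * ?D)))"
      unfolding i1 i2
    proof (rule lens_area[OF F[unfolded Fd] M(2) dS cS Sb])
      show "norm (S t - ((1 - t) *\<^sub>R S 0 + t *\<^sub>R S 1)) \<le> C2 * ?D\<^sup>2" if "t \<in> {0..1}" for t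
        using C2(2)[OF pk that] by (simp add: S_def)
      show "norm (S' t) \<le> C1 * ?D" if "t \<in> {0..1}" for t
        using C1(3)[OF yk[OF that], of "snd c p' - snd c p"] by (simp add: S'_def norm_minus_commute)
      show "norm (S 1 - S 0) \<le> C1 * ?D" using C1(2)[OF pk(2,1)] by (simp add: S_def norm_minus_commute)
    qed
    also have "\<dots> = M * (2 * (C2 * C1)) * ?D ^ 3" by (simp add: power2_eq_square power3_eq_cube)
    also have "\<dots> \<le> M * (2 * (C2 * C1)) * (C3 * norm (snd d p' - snd d p)) ^ 3"
      using C3(2)[OF p] M(1) C1(1) C2(1) by (intro mult_left_mono power_mono) (auto simp: Vc Fd norm_minus_commute)
    also have "\<dots> = C * norm (snd (fst F) p' - snd (fst F) p) ^ 3" by (simp add: C_def power_mult_distrib Fd)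
    finally show "\<bar>cell_int F 0 1 (vpath V p p') - cell_int F 0 1 (vpath F p p')\<bar> \<le> C * norm (snd (fst F) p' - snd (fst F) p) ^ 3" .
  qed
qed

end

section \<open>From a cubic estimate to a null image\<close>

lemma cubic_image_negligible:
  fixes R :: "((real^2) \<times> real) set"
  assumes C: "C \<ge> 0" and est: "\<And>y a y' a'. (y,a) \<in> R \<Longrightarrow> (y',a') \<in> R \<Longrightarrow> \<bar>a' - a\<bar> \<le> C * norm (y' - y) ^ 3"
    and bd: "\<And>y a. (y,a) \<in> R \<Longrightarrow> y \<in> ball q r"
  shows "negligible (snd ` R)"
proof (cases "R = {}")
  case False
  then obtain y0 a0 where "(y0,a0) \<in> R" by (metis ex_in_conv surj_pair)
  then have r: "r > 0" using bd by (metis ball_eq_empty empty_iff not_le)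
  show ?thesis
    unfolding negligible_outer_le
  proof (intro allI impI)
    fix e :: real assume e: "e > 0"
    \<comment> \<open>With squares of side \<open>2 * r / N\<close>, each contributes an interval of
      length \<open>2 * C * (4 * r / N) ^ 3\<close>; there are \<open>N * N\<close> of them, and 128
      is twice the cube of 4.\<close>
    let ?K = "128 * C * r ^ 3"
    obtain N0 :: nat where "?K / e < real N0" using reals_Archimedean2 by blast
    then obtain N :: nat where N: "N > 0" "?K / e < real N" by (metis gr0I less_trans of_nat_0 of_nat_less_iff zero_less_Suc lessI of_nat_less_iff)
    define ix where "ix k y = nat \<lfloor>(y $ k - q $ k + r) * real N / (2 * r)\<rfloor>" for k :: 2 and y :: "real^2"
    have comp: "\<bar>y $ k - q $ k\<bar> < r" if "y \<in> ball q r" for y k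
      using component_le_norm_cart[of "y - q" k] that by (simp add: dist_norm norm_minus_commute)
    have ixN: "ix k y < N" if "y \<in> ball q r" for k y
    proof -
      have "(y $ k - q $ k + r) * real N / (2 * r) < real N"
      proof -
        have "(y $ k - q $ k + r) * real N < (2 * r) * real N"
          using comp[OF that, of k] N(1) by (intro mult_strict_right_mono) auto
        then show ?thesis using r by (simp add: pos_divide_less_eq mult.commute)
      qed
      then show ?thesis using N(1) unfolding ix_def by linarith
    qed
    \<comment> \<open>Each coordinate contributes at most the side \<open>2 * r / N\<close>, and the
      norm is at most the sum of the two.\<close>
    have near: "norm (y' - y) \<le> 4 * r / N" if y: "y \<in> ball q r" "y' \<in> ball q r" and eq: "ix 1 y = ix 1 y'" "ix 2 y = ix 2 y'" for y y'
    proof -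
      have c: "\<bar>y' $ k - y $ k\<bar> \<le> 2 * r / N" if "ix k y = ix k y'" for k
      proof -
        let ?f = "\<lambda>y. (y $ k - q $ k + r) * real N / (2 * r)"
        have "?f y \<ge> 0" "?f y' \<ge> 0" using comp[OF y(1), of k] comp[OF y(2), of k] r by auto
        then have "\<lfloor>?f y\<rfloor> = \<lfloor>?f y'\<rfloor>" using that unfolding ix_def by linarith
        then have "\<bar>?f y' - ?f y\<bar> < 1" by linarith
        moreover have "?f y' - ?f y = (y' $ k - y $ k) * (real N / (2 * r))" using r by (simp add: field_simps)
        ultimately have "\<bar>y' $ k - y $ k\<bar> * (real N / (2 * r)) < 1" using r N(1) by (simp add: abs_mult)
        then show ?thesis using r N(1) by (simp add: field_simps)
      qed
      have "norm (y' - y) \<le> (\<Sum>k\<in>UNIV. \<bar>(y' - y) $ k\<bar>)" by (rule norm_le_l1_cart)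
      then show ?thesis using c[OF eq(1)] c[OF eq(2)] by (simp add: sum_2)
    qed
    let ?I = "{..<N} \<times> {..<N}"
    define Rc where "Rc = (\<lambda>(i,j). {(y,a) \<in> R. ix 1 y = i \<and> ix 2 y = j})"
    \<comment> \<open>One value of the relation over the square, around which all the others lie
      within \<open>h\<close>; 0 serves as default for an empty square.\<close>
    define ctr where "ctr p = (if Rc p = {} then 0 else snd (SOME z. z \<in> Rc p))" for p
    define h where "h = C * (4 * r / N) ^ 3"
    have h: "h \<ge> 0" using C r by (simp add: h_def)
    let ?T = "\<Union>p\<in>?I. {ctr p - h..ctr p + h}"
    have "snd ` R \<subseteq> ?T"
    proof
      fix a assume "a \<in> snd ` R"
      then obtain y where ya: "(y,a) \<in> R" by auto
      let ?p = "(ix 1 y, ix 2 y)"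
      have in1: "(y,a) \<in> Rc ?p" using ya by (simp add: Rc_def)
      then have "(SOME z. z \<in> Rc ?p) \<in> Rc ?p" by (rule someI)
      moreover obtain y' a' where z: "(SOME z. z \<in> Rc ?p) = (y',a')" by (metis surj_pair)
      ultimately have R': "(y',a') \<in> R" "ix 1 y' = ix 1 y" "ix 2 y' = ix 2 y" by (auto simp: Rc_def)
      have "ctr ?p = a'" using in1 z by (auto simp: ctr_def)
      moreover have "\<bar>a - a'\<bar> \<le> h"
      proof -
        have "\<bar>a - a'\<bar> \<le> C * norm (y - y') ^ 3" by (rule est[OF R'(1) ya])
        also have "\<dots> \<le> h" unfolding h_def
          using near[OF bd[OF R'(1)] bd[OF ya] R'(2,3)] C by (intro mult_left_mono power_mono) auto
        finally show ?thesis .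
      qed
      moreover have "?p \<in> ?I" using ixN[OF bd[OF ya]] by simp
      ultimately show "a \<in> ?T" by (intro UN_I[of ?p]) auto
    qed
    moreover have "?T \<in> lmeasurable" by (intro fmeasurable.finite_UN) auto
    moreover have "measure lebesgue ?T \<le> e"
    proof -
      have "measure lebesgue ?T \<le> (\<Sum>p\<in>?I. measure lebesgue {ctr p - h..ctr p + h})"
        by (rule measure_UNION_le) auto
      also have "\<dots> = (\<Sum>p\<in>?I. 2 * h)" using h by (intro sum.cong) auto
      also have "\<dots> = real N * real N * (2 * h)" by simp
      also have "\<dots> = ?K / real N" using N(1) by (simp add: h_def power3_eq_cube field_simps)
      also have "\<dots> \<le> e" using N e by (simp add: field_simps)
      finally show ?thesis .
    qed
    ultimately show "\<exists>T. snd ` R \<subseteq> T \<and> T \<in> lmeasurable \<and> measure lebesgue T \<le> e" by blast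
  qed
qed simp

lemma continuous_on_mult_cross2:
  assumes "continuous_on S f" "continuous_on S g" "continuous_on S h"
  shows "continuous_on S (\<lambda>x. f x * cross2 (g x) (h x))"
  unfolding cross2_def using assms by (intro continuous_intros)

context area_surface begin

lemma traj_on_subset: "traj_on H a b \<gamma> \<Longrightarrow> {a'..b'} \<subseteq> {a..b} \<Longrightarrow> traj_on H a' b' \<gamma>"
  unfolding traj_on_def by (meson continuous_on_subset has_vector_derivative_within_subset subsetD)

lemma ham_along_continuous:
  assumes H: "H \<in> hamiltonians \<Sigma>" and ab: "{a..b} \<subseteq> {0..1}" and \<gamma>: "continuous_on {a..b} \<gamma>"
  shows "continuous_on {a..b} (\<lambda>t. H t (\<gamma> t))"
proof (rule continuous_on_relative)
  fix t assume t: "t \<in> {a..b}"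
  obtain c where c: "c \<in> atlas \<Sigma>" "\<gamma> t \<in> fst c" using chart_at .
  obtain \<delta> where \<delta>: "\<delta> > 0" "\<And>t'. t' \<in> {a..b} \<Longrightarrow> dist t' t < \<delta> \<Longrightarrow> \<gamma> t' \<in> fst c"
    using continuous_on_near[OF \<gamma> t open_dom[OF c(1)] c(2)] by metis
  let ?A = "{a..b} \<inter> ball t \<delta>"
  have A: "\<gamma> s \<in> fst c" "s \<in> {0..1}" if "s \<in> ?A" for s using \<delta>(2)[of s] that ab by (auto simp: dist_commute)
  have "continuous_on ({0..1} \<times> snd c ` fst c) (ham_rep c H)"
    using H c(1) smooth_on_imp_continuous_on unfolding hamiltonians_def by blast
  moreover have "continuous_on ?A (\<lambda>s. (s, snd c (\<gamma> s)))"
    by (intro continuous_on_Pair continuous_on_id continuous_on_compose2[OF continuous_chart[OF c(1)]] continuous_on_subset[OF \<gamma>])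
       (use A in auto)
  ultimately have "continuous_on ?A (\<lambda>s. ham_rep c H (s, snd c (\<gamma> s)))"
    by (rule continuous_on_compose2) (use A in auto)
  moreover have "ham_rep c H (s, snd c (\<gamma> s)) = H s (\<gamma> s)" if "s \<in> ?A" for s
    using coord_inv_chart[OF c(1) A(1)[OF that]] by (simp add: ham_rep_def)
  ultimately have "continuous_on ?A (\<lambda>s. H s (\<gamma> s))" by (rule continuous_on_eq)
  then show "\<exists>U. open U \<and> t \<in> U \<and> continuous_on ({a..b} \<inter> U) (\<lambda>s. H s (\<gamma> s))"
    using \<delta>(1) by (intro exI[of _ "ball t \<delta>"]) auto
qed

text \<open>The strip between two trajectories: \<open>H\<close> and the area cancel up to the error made by
  interpolating the vector field linearly, which is quadratic in the distance.\<close>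

lemma edge_estimate:
  assumes H: "H \<in> hamiltonians \<Sigma>" and F: "cell F" and V1: "cell V1" "cell_set V1 \<subseteq> cell_set F"
    and V2: "cell V2" "cell_set V2 \<subseteq> cell_set F" and ab: "a < b" "{a..b} \<subseteq> {0..1}"
  obtains C where "C \<ge> 0"
   "\<And>\<gamma> \<gamma>'. traj_on H a b \<gamma> \<Longrightarrow> traj_on H a b \<gamma>' \<Longrightarrow> curve_C1 a b \<gamma> \<Longrightarrow> curve_C1 a b \<gamma>' \<Longrightarrow>
      \<gamma> ` {a..b} \<subseteq> cell_set F \<Longrightarrow> \<gamma>' ` {a..b} \<subseteq> cell_set F \<Longrightarrow> \<gamma> a \<in> cell_set V1 \<Longrightarrow> \<gamma>' a \<in> cell_set V1 \<Longrightarrow>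
      \<gamma> b \<in> cell_set V2 \<Longrightarrow> \<gamma>' b \<in> cell_set V2 \<Longrightarrow>
      \<bar>integral {a..b} (\<lambda>t. H t (\<gamma>' t)) - integral {a..b} (\<lambda>t. H t (\<gamma> t)) -
        loop_int F a b \<gamma> \<gamma>' (vpath V1 (\<gamma> a) (\<gamma>' a)) (vpath V2 (\<gamma> b) (\<gamma>' b))\<bar>
        \<le> C * norm (snd (fst F) (\<gamma>' a) - snd (fst F) (\<gamma> a)) ^ 3 \<and>
      norm (snd (fst F) (\<gamma>' b) - snd (fst F) (\<gamma> b)) \<le> C * norm (snd (fst F) (\<gamma>' a) - snd (fst F) (\<gamma> a))"
proof -
  obtain c q r where Fc: "F = (c,q,r)" by (cases F) auto
  have c: "c \<in> atlas \<Sigma>" "cball q r \<subseteq> snd c ` fst c" using F by (auto simp: Fc cell_def)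
  obtain L where L: "L \<ge> 0"
    "\<And>t y y'. t \<in> {0..1} \<Longrightarrow> y \<in> cball q r \<Longrightarrow> y' \<in> cball q r \<Longrightarrow> norm (vf c H (t,y) - vf c H (t,y')) \<le> L * norm (y - y')"
    "\<And>t y y' \<tau>. t \<in> {0..1} \<Longrightarrow> y \<in> cball q r \<Longrightarrow> y' \<in> cball q r \<Longrightarrow> \<tau> \<in> {0..1} \<Longrightarrow>
       norm (vf c H (t, (1 - \<tau>) *\<^sub>R y + \<tau> *\<^sub>R y') - ((1 - \<tau>) *\<^sub>R vf c H (t,y) + \<tau> *\<^sub>R vf c H (t,y'))) \<le> L * (norm (y - y'))\<^sup>2"
    by (rule vf_estimates[OF H c]) (rule that, assumption+)
  obtain M where M: "M \<ge> 0" "\<And>y. y \<in> ball q r \<Longrightarrow> \<bar>dens c y\<bar> \<le> M"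
    by (rule dens_bounded[OF F[unfolded Fc]]) (rule that, assumption+)
  obtain C1 where C1: "C1 \<ge> 0" "\<And>p p'. p \<in> cell_set V1 \<Longrightarrow> p' \<in> cell_set V1 \<Longrightarrow>
    \<bar>cell_int F 0 1 (vpath V1 p p') - cell_int F 0 1 (vpath F p p')\<bar> \<le> C1 * norm (snd (fst F) p' - snd (fst F) p) ^ 3"
    by (rule lens_estimate[OF V1(1) F V1(2)]) (rule that, assumption+)
  obtain C2 where C2: "C2 \<ge> 0" "\<And>p p'. p \<in> cell_set V2 \<Longrightarrow> p' \<in> cell_set V2 \<Longrightarrow>
    \<bar>cell_int F 0 1 (vpath V2 p p') - cell_int F 0 1 (vpath F p p')\<bar> \<le> C2 * norm (snd (fst F) p' - snd (fst F) p) ^ 3"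
    by (rule lens_estimate[OF V2(1) F V2(2)]) (rule that, assumption+)
  obtain Q where Q: "continuous_on (ball q r) Q"
    "\<And>y. y \<in> ball q r \<Longrightarrow> (cell_prim F has_derivative (\<lambda>v. dens c y * v$1 + Q y * v$2)) (at y)"
    by (rule cell_prim[OF F[unfolded Fc], folded Fc]) (rule that, assumption+)
  have dc: "continuous_on (ball q r) (dens c)"
    by (rule smooth_open_continuous_on[OF smooth_open_subset[OF dens_smooth[OF c(1)] open_ball cell_ball[OF F[unfolded Fc]]]])
  \<comment> \<open>The Gronwall factor for the distance between two trajectories over the
    interval.\<close>
  define e where "e = exp (L * (b - a))"
  have e0: "e \<ge> 0" by (simp add: e_def)
  \<comment> \<open>The four terms come from the strip, the two lenses at the ends, which replace
    the segments of \<open>V1\<close> and \<open>V2\<close> by those of \<open>F\<close>, and the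
    growth of the distance along the edge.\<close>
  define C where "C = M * (2 * L) * e ^ 3 + C1 + C2 * e ^ 3 + e"
  show thesis
  proof (rule that[of C])
    have p0: "0 \<le> M * (2 * L) * e ^ 3" "0 \<le> C2 * e ^ 3" using M(1) L(1) C2(1) e0 by auto
    then show "0 \<le> C" using C1(1) e0 by (simp add: C_def)
    fix \<gamma> \<gamma>' assume tr: "traj_on H a b \<gamma>" "traj_on H a b \<gamma>'" and cv: "curve_C1 a b \<gamma>" "curve_C1 a b \<gamma>'"
      and im: "\<gamma> ` {a..b} \<subseteq> cell_set F" "\<gamma>' ` {a..b} \<subseteq> cell_set F"
      and v1: "\<gamma> a \<in> cell_set V1" "\<gamma>' a \<in> cell_set V1" and v2: "\<gamma> b \<in> cell_set V2" "\<gamma>' b \<in> cell_set V2"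
    let ?y = "\<lambda>t. snd c (\<gamma> t)" and ?z = "\<lambda>t. snd c (\<gamma>' t)"
    let ?y' = "curve_deriv c a b \<gamma>" and ?z' = "curve_deriv c a b \<gamma>'"
    have inF: "\<gamma> t \<in> cell_set F" "\<gamma>' t \<in> cell_set F" if "t \<in> {a..b}" for t using im that by auto
    have iny: "\<gamma> t \<in> fst c" "?y t \<in> ball q r" "\<gamma>' t \<in> fst c" "?z t \<in> ball q r" if "t \<in> {a..b}" for t
      using inF[OF that] cell_set_iff[OF F[unfolded Fc]] unfolding Fc by auto
    then have iny': "?y t \<in> cball q r" "?z t \<in> cball q r" if "t \<in> {a..b}" for t using that ball_subset_cball by blast+
    have fc: "\<gamma> ` {a..b} \<subseteq> fst c" "\<gamma>' ` {a..b} \<subseteq> fst c" using iny by auto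
    have dy: "(?y has_vector_derivative vf c H (t, ?y t)) (at t within {a..b})" if "t \<in> {a..b}" for t
      by (rule traj_on_chart[OF tr(1) that c(1) iny(1)[OF that]])
    have dz: "(?z has_vector_derivative vf c H (t, ?z t)) (at t within {a..b})" if "t \<in> {a..b}" for t
      by (rule traj_on_chart[OF tr(2) that c(1) iny(3)[OF that]])
    have vy: "?y' t = vf c H (t, ?y t)" if "t \<in> {a..b}" for t
      unfolding curve_deriv_def by (rule vector_derivative_within_closed_interval[OF ab(1) that dy[OF that]])
    have vz: "?z' t = vf c H (t, ?z t)" if "t \<in> {a..b}" for t
      unfolding curve_deriv_def by (rule vector_derivative_within_closed_interval[OF ab(1) that dz[OF that]])
    define D where "D = norm (?z a - ?y a)"
    have a_in: "a \<in> {a..b}" "b \<in> {a..b}" using ab(1) by auto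
    have gr: "norm (?z t - ?y t) \<le> e * D" if t: "t \<in> {a..b}" for t
      unfolding e_def D_def
    proof (rule gronwall[OF dz dy _ L(1) a_in(1) t])
      show "norm (vf c H (t, ?z t) - vf c H (t, ?y t)) \<le> L * norm (?z t - ?y t)" if "t \<in> {a..b}" for t
        by (rule L(2)) (use that ab(2) iny' in auto)
    qed
    let ?W = "\<lambda>s t. (1 - s) *\<^sub>R ?y t + s *\<^sub>R ?z t" and ?Wt = "\<lambda>s t. (1 - s) *\<^sub>R ?y' t + s *\<^sub>R ?z' t"
    have R: "rect_C2 0 1 a b ?W (\<lambda>s t. ?z t - ?y t) ?Wt (\<lambda>s t. ?z' t - ?y' t)"
      by (rule rect_C2_strip) (use curve_C1_chart[OF cv(1) c(1) fc(1)] curve_C1_chart[OF cv(2) c(1) fc(2)] in auto)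
    have Wb: "?W s t \<in> ball q r" if "s \<in> {0..1}" "t \<in> {a..b}" for s t
      using convexD[OF convex_ball iny(2)[OF that(2)] iny(4)[OF that(2)], of "1-s" s] that(1) by simp
    let ?f = "\<lambda>s t. dens c (?W s t) * cross2 (?z t - ?y t) (?Wt s t)"
    have ends: "integral {0..1} (\<lambda>s. cell_prim F (?W s t) * (?z t - ?y t) $ 2) = cell_int F 0 1 (vpath F (\<gamma> t) (\<gamma>' t))"
      if t: "t \<in> {a..b}" for t
      unfolding line_int_def
      by (rule integral_cong) (use vpath_own_chart[OF F inF[OF t]] in \<open>simp add: Fc\<close>)
    have G: "integral ({0..1} \<times> {a..b}) (\<lambda>(s,t). ?f s t) =
       cell_int F a b \<gamma>' - cell_int F a b \<gamma> - cell_int F 0 1 (vpath F (\<gamma> b) (\<gamma>' b)) + cell_int F 0 1 (vpath F (\<gamma> a) (\<gamma>' a))"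
      using green_rect[OF R zero_less_one ab(1) Wb Q(2) dc Q(1)] ends[OF a_in(1)] ends[OF a_in(2)]
      by (simp add: line_int_def Fc)
    have fcont: "continuous_on ({0..1} \<times> {a..b}) (\<lambda>(s,t). ?f s t)"
    proof -
      have W: "continuous_on ({0..1} \<times> {a..b}) (\<lambda>x. ?W (fst x) (snd x))" "continuous_on ({0..1::real} \<times> {a..b}) (\<lambda>x. ?z (snd x) - ?y (snd x))"
        "continuous_on ({0..1} \<times> {a..b}) (\<lambda>x. ?Wt (fst x) (snd x))"
        using R unfolding rect_C2_def case_prod_unfold by - (elim conjE, assumption)+
      have "continuous_on ({0..1} \<times> {a..b}) (\<lambda>x. dens c (?W (fst x) (snd x)))"
        by (rule continuous_on_compose2[OF dc W(1)]) (use Wb in auto)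
      from continuous_on_mult_cross2[OF this W(2,3)] show ?thesis unfolding case_prod_unfold .
    qed
    have A: "integral ({0..1} \<times> {a..b}) (\<lambda>(s,t). ?f s t) = integral {a..b} (\<lambda>t. integral {0..1} (\<lambda>s. ?f s t))"
    proof -
      have cb: "cbox (0::real,a) (1,b) = {0..1} \<times> {a..b}" by (simp add: cbox_Pair_eq)
      have "integral ({0..1} \<times> {a..b}) (\<lambda>(s,t). ?f s t) = integral (cbox 0 1) (\<lambda>s. integral (cbox a b) (?f s))"
        using integral_prod_continuous[of 0 a 1 b "\<lambda>(s,t). ?f s t"] fcont unfolding cb by simp
      also have "\<dots> = integral (cbox a b) (\<lambda>t. integral (cbox 0 1) (\<lambda>s. ?f s t))"
        by (rule integral_swap_continuous) (use fcont cb in simp)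
      finally show ?thesis by simp
    qed
    \<comment> \<open>The error at time \<open>t\<close>: the difference of the Hamiltonian on the
      two trajectories minus the area form on the connecting segment and the interpolated
      velocity.\<close>
    define k where "k t = H t (\<gamma>' t) - H t (\<gamma> t) - integral {0..1} (\<lambda>s. ?f s t)" for t
    have kb: "norm (k t) \<le> M * (2 * L) * (e * D) ^ 3" if t: "t \<in> {a..b}" for t
    proof -
      have t1: "t \<in> {0..1}" using t ab(2) by blast
      let ?d = "?z t - ?y t"
      let ?X = "\<lambda>s. vf c H (t, ?W s t)"
      \<comment> \<open>The difference of \<open>H t\<close> is its derivative integrated along the
        segment. By the sign convention for the vector field, that derivative is the area form
        applied to the direction \<open>?d\<close> first and to the true field at
        \<open>?W s t\<close> second.\<close>
      have ft: "((\<lambda>s. dens c (?W s t) * cross2 ?d (?X s)) has_integral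
          ((H t \<circ> coord_inv c) (?W 1 t) - (H t \<circ> coord_inv c) (?W 0 t))) {0..1}"
      proof (rule fundamental_theorem_of_calculus)
        fix s :: real assume s: "s \<in> {0..1}"
        have I: "?W s t \<in> snd c ` fst c" using Wb[OF s t] cell_ball[OF F[unfolded Fc]] by blast
        let ?p = "coord_inv c (?W s t)"
        have p: "?p \<in> fst c" "snd c ?p = ?W s t" using coord_inv_in[OF c(1) I] chart_coord_inv[OF c(1) I] by auto
        have "((\<lambda>s. ?W s t) has_vector_derivative ?d) (at s within {0..1})"
          unfolding has_vector_derivative_def by (auto intro!: derivative_eq_intros simp: algebra_simps)
        from vector_derivative_diff_chain_within[OF this has_derivative_at_withinI[OF smooth_open_has_derivative[OF ham_slice_smooth[OF H t1 c(1)] I]]]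
        have "((\<lambda>s. (H t \<circ> coord_inv c) (?W s t)) has_vector_derivative
           frechet_derivative (H t \<circ> coord_inv c) (at (?W s t)) ?d) (at s within {0..1})" by (simp add: o_def)
        moreover have "frechet_derivative (H t \<circ> coord_inv c) (at (?W s t)) ?d = dens c (?W s t) * cross2 ?d (?X s)"
          using ham_vf_formula(2)[OF H t1 c(1) p(1), of ?d] dens_chart[OF c(1) p(1)] unfolding p(2)
          by (simp add: area_form_cross2 vf_def cross2_def algebra_simps)
        ultimately show "((\<lambda>s. (H t \<circ> coord_inv c) (?W s t)) has_vector_derivative dens c (?W s t) * cross2 ?d (?X s)) (at s within {0..1})" by simp
      qed simp
      have Hv: "(H t \<circ> coord_inv c) (?W 1 t) = H t (\<gamma>' t)" "(H t \<circ> coord_inv c) (?W 0 t) = H t (\<gamma> t)"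
        using coord_inv_chart[OF c(1)] iny[OF t] by auto
      have fi: "(\<lambda>s. ?f s t) integrable_on {0..1}"
        by (rule integrable_continuous_real[OF continuous_on_slices(2)[OF fcont t]])
      have i1: "(\<lambda>s. dens c (?W s t) * cross2 ?d (?X s)) integrable_on {0..1}" using ft by blast
      have k1: "k t = integral {0..1} (\<lambda>s. dens c (?W s t) * cross2 ?d (?X s) - ?f s t)"
        unfolding integral_diff[OF i1 fi] k_def integral_unique[OF ft] Hv ..
      have "norm (k t) \<le> integral {0..1} (\<lambda>s::real. M * (2 * L) * norm ?d ^ 3)"
        unfolding k1
      proof (rule integral_norm_bound_integral)
        show "(\<lambda>s. dens c (?W s t) * cross2 ?d (?X s) - ?f s t) integrable_on {0..1}" by (rule integrable_diff[OF i1 fi])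
        fix s :: real assume s: "s \<in> {0..1}"
        \<comment> \<open>The velocities of the curves are the vector field at their positions, so
          \<open>?Wt\<close> is its linear interpolation and the quadratic interpolation estimate
          applies.\<close>
        have "norm (?X s - ?Wt s t) \<le> L * (norm (?y t - ?z t))\<^sup>2"
          unfolding vy[OF t] vz[OF t] by (rule L(3)[OF t1 iny'(1)[OF t] iny'(2)[OF t] s])
        then have X: "norm (?X s - ?Wt s t) \<le> L * (norm ?d)\<^sup>2" by (simp add: norm_minus_commute)
        have e1: "dens c (?W s t) * cross2 ?d (?X s) - ?f s t = dens c (?W s t) * cross2 ?d (?X s - ?Wt s t)"
          by (simp add: cross2_simps right_diff_distrib)
        have "\<bar>cross2 ?d (?X s - ?Wt s t)\<bar> \<le> 2 * (norm ?d * (L * (norm ?d)\<^sup>2))"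
          using cross2_le[of ?d "?X s - ?Wt s t"] mult_left_mono[OF X norm_ge_zero[of ?d]] by linarith
        then have "norm (dens c (?W s t) * cross2 ?d (?X s - ?Wt s t)) \<le> M * (2 * (norm ?d * (L * (norm ?d)\<^sup>2)))"
          unfolding real_norm_def abs_mult
          by (rule mult_mono[OF M(2)[OF Wb[OF s t], unfolded real_norm_def] _ M(1) abs_ge_zero])
        moreover have "M * (2 * (norm ?d * (L * (norm ?d)\<^sup>2))) = M * (2 * L) * norm ?d ^ 3"
          by (simp add: power2_eq_square power3_eq_cube)
        ultimately show "norm (dens c (?W s t) * cross2 ?d (?X s) - ?f s t) \<le> M * (2 * L) * norm ?d ^ 3"
          unfolding e1 by linarith
      qed auto
      then have "norm (k t) \<le> M * (2 * L) * norm ?d ^ 3" by simp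
      moreover have "M * (2 * L) * norm ?d ^ 3 \<le> M * (2 * L) * (e * D) ^ 3"
        using gr[OF t] M(1) L(1) by (intro mult_left_mono power_mono) auto
      ultimately show ?thesis by (rule order_trans)
    qed
    have H1: "continuous_on {a..b} (\<lambda>t. H t (\<gamma> t))" "continuous_on {a..b} (\<lambda>t. H t (\<gamma>' t))"
      using tr unfolding traj_on_def by (auto intro!: ham_along_continuous[OF H ab(2)])
    have H2: "continuous_on {a..b} (\<lambda>t. integral {0..1} (\<lambda>s. ?f s t))"
    proof -
      have "continuous_on ({a..b} \<times> cbox 0 (1::real)) (\<lambda>x. (snd x, fst x))" "(\<lambda>x. (snd x, fst x)) ` ({a..b} \<times> cbox 0 (1::real)) \<subseteq> {0..1} \<times> {a..b}"
        by (intro continuous_intros) auto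
      from continuous_on_compose2[OF fcont this] have "continuous_on ({a..b} \<times> cbox 0 1) (\<lambda>(t,s). ?f s t)"
        by (simp add: case_prod_unfold)
      from integral_continuous_on_param[OF this] show ?thesis by simp
    qed
    have kc: "continuous_on {a..b} k" unfolding k_def by (intro continuous_on_diff H1 H2)
    have "integral {a..b} k = integral {a..b} (\<lambda>t. H t (\<gamma>' t)) - integral {a..b} (\<lambda>t. H t (\<gamma> t)) - integral {a..b} (\<lambda>t. integral {0..1} (\<lambda>s. ?f s t))"
      unfolding k_def using H1 H2
      by (simp add: integral_diff integrable_continuous_real integrable_diff)
    moreover have "norm (integral {a..b} k) \<le> M * (2 * L) * (e * D) ^ 3 * (b - a)"
      by (rule integral_bound[OF _ kc kb]) (use ab(1) in auto)
    moreover have "M * (2 * L) * (e * D) ^ 3 * (b - a) \<le> M * (2 * L) * (e * D) ^ 3"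
    proof -
      have "b - a \<le> 1" using ab a_in by fastforce
      moreover have "0 \<le> M * (2 * L) * (e * D) ^ 3" using M(1) L(1) e0 by (simp add: D_def)
      ultimately show ?thesis using mult_left_mono[of "b - a" 1 "M * (2 * L) * (e * D) ^ 3"] by simp
    qed
    moreover have "\<bar>cell_int F 0 1 (vpath V1 (\<gamma> a) (\<gamma>' a)) - cell_int F 0 1 (vpath F (\<gamma> a) (\<gamma>' a))\<bar> \<le> C1 * D ^ 3"
      using C1(2)[OF v1] by (simp add: D_def Fc)
    moreover have "\<bar>cell_int F 0 1 (vpath V2 (\<gamma> b) (\<gamma>' b)) - cell_int F 0 1 (vpath F (\<gamma> b) (\<gamma>' b))\<bar> \<le> C2 * (e * D) ^ 3"
    proof -
      have "C2 * norm (?z b - ?y b) ^ 3 \<le> C2 * (e * D) ^ 3" using gr[OF a_in(2)] C2(1) by (intro mult_left_mono power_mono) auto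
      then show ?thesis using C2(2)[OF v2] by (simp add: Fc)
    qed
    ultimately have "\<bar>integral {a..b} (\<lambda>t. H t (\<gamma>' t)) - integral {a..b} (\<lambda>t. H t (\<gamma> t)) -
        loop_int F a b \<gamma> \<gamma>' (vpath V1 (\<gamma> a) (\<gamma>' a)) (vpath V2 (\<gamma> b) (\<gamma>' b))\<bar> \<le> M * (2 * L) * (e * D) ^ 3 + C1 * D ^ 3 + C2 * (e * D) ^ 3"
      using G A unfolding loop_int_def real_norm_def by linarith
    also have "\<dots> \<le> C * D ^ 3"
      using e0 by (simp add: C_def D_def power_mult_distrib algebra_simps)
    finally have 1: "\<bar>integral {a..b} (\<lambda>t. H t (\<gamma>' t)) - integral {a..b} (\<lambda>t. H t (\<gamma> t)) -
        loop_int F a b \<gamma> \<gamma>' (vpath V1 (\<gamma> a) (\<gamma>' a)) (vpath V2 (\<gamma> b) (\<gamma>' b))\<bar> \<le> C * D ^ 3" .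
    have "e * D \<le> C * D" using p0 C1(1) by (intro mult_right_mono) (auto simp: C_def D_def)
    then have 2: "norm (?z b - ?y b) \<le> C * D" using gr[OF a_in(2)] by linarith
    show "\<bar>integral {a..b} (\<lambda>t. H t (\<gamma>' t)) - integral {a..b} (\<lambda>t. H t (\<gamma> t)) -
        loop_int F a b \<gamma> \<gamma>' (vpath V1 (\<gamma> a) (\<gamma>' a)) (vpath V2 (\<gamma> b) (\<gamma>' b))\<bar>
        \<le> C * norm (snd (fst F) (\<gamma>' a) - snd (fst F) (\<gamma> a)) ^ 3 \<and>
      norm (snd (fst F) (\<gamma>' b) - snd (fst F) (\<gamma> b)) \<le> C * norm (snd (fst F) (\<gamma>' a) - snd (fst F) (\<gamma> a))"
      using 1 2 by (simp add: D_def Fc)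
  qed
qed

end

section \<open>The action spectrum is negligible\<close>

context area_surface begin

definition capped :: "(real \<Rightarrow> 'a \<Rightarrow> real) \<Rightarrow> 'a \<Rightarrow> (complex \<Rightarrow> 'a) \<Rightarrow> bool" where
  "capped H x u \<longleftrightarrow> contractible_fixed_point \<Sigma> H x \<and> capping_disk \<Sigma> H x u"

text \<open>Collects what the comparison uses of a cap: the identifications of the polar square, a
  boundary that is a trajectory from and to \<open>x\<close>, and an action expressed through the
  square map alone.\<close>

lemma capped_boundary:
  assumes H: "H \<in> hamiltonians \<Sigma>" and u: "capped H x u"
  shows "square_smooth (polar u)" "area_density (polar u) (pullback_density \<Sigma> u)"
    "polar u (s,1) = polar u (s,0)" "polar u (0,t) = polar u (0,0)"
    "traj_on H 0 1 (\<lambda>t. polar u (1,t))" "polar u (1,0) = x" "polar u (1,1) = x"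
    "action \<Sigma> H x u = integral {0..1} (\<lambda>t. H t (polar u (1,t))) - integral unit_square (pullback_density \<Sigma> u)"
proof -
  have cap: "capping_disk \<Sigma> H x u" using u by (simp add: capped_def)
  show sq: "square_smooth (polar u)" by (rule capping_square_smooth[OF cap])
  show "area_density (polar u) (pullback_density \<Sigma> u)"
    unfolding area_density_def using pullback_density_chart[OF sq] by blast
  show "polar u (s,1) = polar u (s,0)" "polar u (0,t) = polar u (0,0)" by (simp_all add: polar_def)
  have b: "polar u (1,t) = ham_flow \<Sigma> H t x" if "t \<in> {0..1}" for t
    using cap that by (simp add: polar_def capping_disk_def)
  show "traj_on H 0 1 (\<lambda>t. polar u (1,t))"
    by (rule traj_on_cong[OF ham_flow_traj_on(1)[OF H, of x]]) (rule b)
  show x: "polar u (1,0) = x" using b[of 0] ham_flow_traj_on(2)[OF H] by simp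
  show "polar u (1,1) = x" using x by (simp add: polar_def)
  have "integral {0..1} (\<lambda>t. H t (ham_flow \<Sigma> H t x)) = integral {0..1} (\<lambda>t. H t (polar u (1,t)))"
    by (rule integral_cong) (simp add: b)
  then show "action \<Sigma> H x u = integral {0..1} (\<lambda>t. H t (polar u (1,t))) - integral unit_square (pullback_density \<Sigma> u)"
    by (simp add: action_def)
qed

text \<open>By \<open>area_difference\<close> the difference of the areas is a sum of circulations
  over the boundary edges, the very ones appearing in \<open>edge_estimate\<close>. Hence the
  difference of the actions is a sum of edge errors, each cubic in the distance at the start of its
  edge, and these distances are controlled by the distance of the fixed points.\<close>

lemma grid_action_estimate:
  assumes H: "H \<in> hamiltonians \<Sigma>" and G: "grid_cells n B E F V"
  obtains C where "C \<ge> 0" "\<And>x u x' u'. capped H x u \<Longrightarrow> grid_fit n B E F V (polar u) \<Longrightarrow> capped H x' u' \<Longrightarrow> grid_fit n B E F V (polar u') \<Longrightarrow>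
     \<bar>action \<Sigma> H x' u' - action \<Sigma> H x u\<bar> \<le> C * norm (snd (fst (F (n,0))) x' - snd (fst (F (n,0))) x) ^ 3"
proof -
  let ?g = "gridpt n"
  have n: "n > 0"
    and GF: "\<forall>i\<le>n. \<forall>j<n. cell (F (i,j))" and GV: "\<forall>i\<le>n. \<forall>j\<le>n. cell (V (i,j))"
    and GVF: "\<forall>i\<le>n. \<forall>j<n. cell_set (V (i,j)) \<subseteq> cell_set (F (i,j)) \<and> cell_set (V (i,Suc j)) \<subseteq> cell_set (F (i,j))"
    using G unfolding grid_cells_def by - (elim conjE, assumption)+
  note g = gridpt[OF n]
  define fit where "fit x u \<longleftrightarrow> capped H x u \<and> grid_fit n B E F V (polar u)" for x u
  let ?\<kappa> = "\<lambda>j. snd (fst (F (n,j)))"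
  let ?S = "\<lambda>u u' k. vpath (V (n,k)) (polar u (1,?g k)) (polar u' (1,?g k))"
  have fitD: "(\<lambda>t. polar u (1,t)) ` {?g j..?g (Suc j)} \<subseteq> cell_set (F (n,j))" if "fit x u" "j < n" for x u j
    using that(1)[unfolded fit_def grid_fit_def, THEN conjunct2, THEN conjunct2, THEN conjunct2, THEN conjunct1, rule_format, OF order_refl that(2)]
    unfolding g(2) .
  have fitV: "polar u (1,?g j) \<in> cell_set (V (n,j))" if "fit x u" "j \<le> n" for x u j
    using that(1)[unfolded fit_def grid_fit_def, THEN conjunct2, THEN conjunct2, THEN conjunct2, THEN conjunct2, rule_format, OF order_refl that(2)]
    unfolding g(2) .
  define P where "P j C \<longleftrightarrow> C \<ge> 0 \<and> (\<forall>x u x' u'. fit x u \<longrightarrow> fit x' u' \<longrightarrow>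
      \<bar>integral {?g j..?g (Suc j)} (\<lambda>t. H t (polar u' (1,t))) - integral {?g j..?g (Suc j)} (\<lambda>t. H t (polar u (1,t))) -
        loop_int (F (n,j)) (?g j) (?g (Suc j)) (\<lambda>t. polar u (1,t)) (\<lambda>t. polar u' (1,t)) (?S u u' j) (?S u u' (Suc j))\<bar>
        \<le> C * norm (?\<kappa> j (polar u' (1,?g j)) - ?\<kappa> j (polar u (1,?g j))) ^ 3 \<and>
      norm (?\<kappa> j (polar u' (1,?g (Suc j))) - ?\<kappa> j (polar u (1,?g (Suc j)))) \<le> C * norm (?\<kappa> j (polar u' (1,?g j)) - ?\<kappa> j (polar u (1,?g j))))" for j and C :: real
  have ex: "\<exists>C. P j C"
    if j: "j < n" for j
  proof -
    have cF: "cell (F (n,j))" and cV: "cell (V (n,j))" "cell (V (n,Suc j))" using GF GV j by auto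
    have sV: "cell_set (V (n,j)) \<subseteq> cell_set (F (n,j))" "cell_set (V (n,Suc j)) \<subseteq> cell_set (F (n,j))"
      using GVF[rule_format, OF order_refl j] by auto
    obtain C where C: "C \<ge> 0" "\<And>\<gamma> \<gamma>'. traj_on H (?g j) (?g (Suc j)) \<gamma> \<Longrightarrow> traj_on H (?g j) (?g (Suc j)) \<gamma>' \<Longrightarrow>
      curve_C1 (?g j) (?g (Suc j)) \<gamma> \<Longrightarrow> curve_C1 (?g j) (?g (Suc j)) \<gamma>' \<Longrightarrow>
      \<gamma> ` {?g j..?g (Suc j)} \<subseteq> cell_set (F (n,j)) \<Longrightarrow> \<gamma>' ` {?g j..?g (Suc j)} \<subseteq> cell_set (F (n,j)) \<Longrightarrow>
      \<gamma> (?g j) \<in> cell_set (V (n,j)) \<Longrightarrow> \<gamma>' (?g j) \<in> cell_set (V (n,j)) \<Longrightarrow>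
      \<gamma> (?g (Suc j)) \<in> cell_set (V (n,Suc j)) \<Longrightarrow> \<gamma>' (?g (Suc j)) \<in> cell_set (V (n,Suc j)) \<Longrightarrow>
      \<bar>integral {?g j..?g (Suc j)} (\<lambda>t. H t (\<gamma>' t)) - integral {?g j..?g (Suc j)} (\<lambda>t. H t (\<gamma> t)) -
        loop_int (F (n,j)) (?g j) (?g (Suc j)) \<gamma> \<gamma>' (vpath (V (n,j)) (\<gamma> (?g j)) (\<gamma>' (?g j))) (vpath (V (n,Suc j)) (\<gamma> (?g (Suc j))) (\<gamma>' (?g (Suc j))))\<bar>
        \<le> C * norm (?\<kappa> j (\<gamma>' (?g j)) - ?\<kappa> j (\<gamma> (?g j))) ^ 3 \<and>
      norm (?\<kappa> j (\<gamma>' (?g (Suc j))) - ?\<kappa> j (\<gamma> (?g (Suc j)))) \<le> C * norm (?\<kappa> j (\<gamma>' (?g j)) - ?\<kappa> j (\<gamma> (?g j)))"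
      by (rule edge_estimate[OF H cF cV(1) sV(1) cV(2) sV(2) g(3) g(5)[OF j]]) (rule that, assumption+)
    have T: "traj_on H (?g j) (?g (Suc j)) (\<lambda>t. polar u (1,t))" "curve_C1 (?g j) (?g (Suc j)) (\<lambda>t. polar u (1,t))" if "fit x u" for x u
    proof -
      have cu: "capped H x u" using that by (simp add: fit_def)
      show "traj_on H (?g j) (?g (Suc j)) (\<lambda>t. polar u (1,t))" by (rule traj_on_subset[OF capped_boundary(5)[OF H cu] g(5)[OF j]])
      show "curve_C1 (?g j) (?g (Suc j)) (\<lambda>t. polar u (1,t))"
        by (rule square_edge_C1(1)[OF capped_boundary(1)[OF H cu] g(3) g(5)[OF j]]) simp
    qed
    show ?thesis unfolding P_def
    proof (intro exI[of _ C] conjI[OF C(1)] allI impI)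
      fix x u x' u' assume f: "fit x u" "fit x' u'"
      have jn: "j \<le> n" "Suc j \<le> n" using j by auto
      show "\<bar>integral {?g j..?g (Suc j)} (\<lambda>t. H t (polar u' (1,t))) - integral {?g j..?g (Suc j)} (\<lambda>t. H t (polar u (1,t))) -
        loop_int (F (n,j)) (?g j) (?g (Suc j)) (\<lambda>t. polar u (1,t)) (\<lambda>t. polar u' (1,t)) (?S u u' j) (?S u u' (Suc j))\<bar>
        \<le> C * norm (?\<kappa> j (polar u' (1,?g j)) - ?\<kappa> j (polar u (1,?g j))) ^ 3 \<and>
        norm (?\<kappa> j (polar u' (1,?g (Suc j))) - ?\<kappa> j (polar u (1,?g (Suc j)))) \<le> C * norm (?\<kappa> j (polar u' (1,?g j)) - ?\<kappa> j (polar u (1,?g j)))"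
        by (rule C(2)[OF T(1)[OF f(1)] T(1)[OF f(2)] T(2)[OF f(1)] T(2)[OF f(2)] fitD[OF f(1) j] fitD[OF f(2) j]
            fitV[OF f(1) jn(1)] fitV[OF f(2) jn(1)] fitV[OF f(1) jn(2)] fitV[OF f(2) jn(2)]])
    qed
  qed
  \<comment> \<open>The constant depends on the grid and the edge but not on the capped points,
    since \<open>P j\<close> quantifies over all of them.\<close>
  define Cj where "Cj j = (SOME C. P j C)" for j
  have CP: "P j (Cj j)" if "j < n" for j unfolding Cj_def by (rule someI_ex[OF ex[OF that]])
  have Cj: "\<And>j. j < n \<Longrightarrow> Cj j \<ge> 0"
    "\<And>j x u x' u'. j < n \<Longrightarrow> fit x u \<Longrightarrow> fit x' u' \<Longrightarrow>
      \<bar>integral {?g j..?g (Suc j)} (\<lambda>t. H t (polar u' (1,t))) - integral {?g j..?g (Suc j)} (\<lambda>t. H t (polar u (1,t))) -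
        loop_int (F (n,j)) (?g j) (?g (Suc j)) (\<lambda>t. polar u (1,t)) (\<lambda>t. polar u' (1,t)) (?S u u' j) (?S u u' (Suc j))\<bar>
        \<le> Cj j * norm (?\<kappa> j (polar u' (1,?g j)) - ?\<kappa> j (polar u (1,?g j))) ^ 3"
    "\<And>j x u x' u'. j < n \<Longrightarrow> fit x u \<Longrightarrow> fit x' u' \<Longrightarrow>
      norm (?\<kappa> j (polar u' (1,?g (Suc j))) - ?\<kappa> j (polar u (1,?g (Suc j)))) \<le> Cj j * norm (?\<kappa> j (polar u' (1,?g j)) - ?\<kappa> j (polar u (1,?g j)))"
    subgoal by (rule CP[unfolded P_def, THEN conjunct1])
    subgoal by (rule CP[unfolded P_def, THEN conjunct2, rule_format, THEN conjunct1])
    subgoal by (rule CP[unfolded P_def, THEN conjunct2, rule_format, THEN conjunct2])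
    done
  let ?D = "\<lambda>x x'. norm (?\<kappa> 0 x' - ?\<kappa> 0 x)"
  \<comment> \<open>Induction along the boundary: the edge estimate bounds the distance at the end
    of an edge in its own chart, and the Lipschitz bound for the transition at the shared vertex
    passes it to the chart of the next edge.\<close>
  have "\<exists>K\<ge>0. \<forall>x u x' u'. fit x u \<longrightarrow> fit x' u' \<longrightarrow> norm (?\<kappa> j (polar u' (1,?g j)) - ?\<kappa> j (polar u (1,?g j))) \<le> K * ?D x x'"
    if "j < n" for j
    using that
  proof (induction j)
    case 0
    have "polar u (1,0) = x" if "fit x u" for x u using that capped_boundary(6)[OF H] by (simp add: fit_def)
    then show ?case unfolding g(1) by (intro exI[of _ 1]) simp
  next
    case (Suc j)
    then obtain K where K: "K \<ge> 0" "\<And>x u x' u'. fit x u \<Longrightarrow> fit x' u' \<Longrightarrow> norm (?\<kappa> j (polar u' (1,?g j)) - ?\<kappa> j (polar u (1,?g j))) \<le> K * ?D x x'"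
      by (metis Suc_lessD)
    have j: "j < n" "Suc j < n" "Suc j \<le> n" using Suc.prems by auto
    have cV: "cell (V (n,Suc j))" and cF: "cell (F (n,j))" "cell (F (n,Suc j))" using GF GV j by auto
    have s1: "cell_set (V (n,Suc j)) \<subseteq> cell_set (F (n,j))" using GVF[rule_format, OF order_refl j(1)] by blast
    have s2: "cell_set (V (n,Suc j)) \<subseteq> cell_set (F (n,Suc j))" using GVF[rule_format, OF order_refl j(2)] by blast
    obtain L where L: "L \<ge> 0" "\<And>p p'. p \<in> cell_set (V (n,Suc j)) \<Longrightarrow> p' \<in> cell_set (V (n,Suc j)) \<Longrightarrow>
       norm (?\<kappa> (Suc j) p - ?\<kappa> (Suc j) p') \<le> L * norm (?\<kappa> j p - ?\<kappa> j p')"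
      by (rule cell_transition_Lipschitz[OF cV cF s1 s2]) (rule that, assumption+)
    show ?case
    proof (intro exI[of _ "L * (Cj j * K)"] conjI allI impI)
      show "0 \<le> L * (Cj j * K)" using L(1) Cj(1)[OF j(1)] K(1) by simp
      fix x u x' u' assume f: "fit x u" "fit x' u'"
      have "norm (?\<kappa> (Suc j) (polar u' (1,?g (Suc j))) - ?\<kappa> (Suc j) (polar u (1,?g (Suc j))))
        \<le> L * norm (?\<kappa> j (polar u' (1,?g (Suc j))) - ?\<kappa> j (polar u (1,?g (Suc j))))"
        by (rule L(2)[OF fitV[OF f(2) j(3)] fitV[OF f(1) j(3)]])
      also have "\<dots> \<le> L * (Cj j * (K * ?D x x'))"
        by (intro mult_left_mono[OF _ L(1)] order_trans[OF Cj(3)[OF j(1) f]] mult_left_mono[OF K(2)[OF f]] Cj(1) j)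
      finally show "norm (?\<kappa> (Suc j) (polar u' (1,?g (Suc j))) - ?\<kappa> (Suc j) (polar u (1,?g (Suc j)))) \<le> L * (Cj j * K) * ?D x x'"
        by (simp add: mult.assoc)
    qed
  qed
  then have "\<forall>j. \<exists>K. j < n \<longrightarrow> K \<ge> 0 \<and> (\<forall>x u x' u'. fit x u \<longrightarrow> fit x' u' \<longrightarrow> norm (?\<kappa> j (polar u' (1,?g j)) - ?\<kappa> j (polar u (1,?g j))) \<le> K * ?D x x')"
    by (intro allI) (case_tac "j < n", simp_all)
  then have "\<exists>K. \<forall>j. j < n \<longrightarrow> K j \<ge> 0 \<and> (\<forall>x u x' u'. fit x u \<longrightarrow> fit x' u' \<longrightarrow> norm (?\<kappa> j (polar u' (1,?g j)) - ?\<kappa> j (polar u (1,?g j))) \<le> K j * ?D x x')"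
    by (rule choice)
  then obtain K where K: "\<And>j. j < n \<Longrightarrow> K j \<ge> 0"
    "\<And>j x u x' u'. j < n \<Longrightarrow> fit x u \<Longrightarrow> fit x' u' \<Longrightarrow> norm (?\<kappa> j (polar u' (1,?g j)) - ?\<kappa> j (polar u (1,?g j))) \<le> K j * ?D x x'"
    by blast
  define C where "C = (\<Sum>j<n. Cj j * K j ^ 3)"
  show thesis
  proof (rule that[of C])
    show "C \<ge> 0" unfolding C_def using Cj(1) K(1) by (intro sum_nonneg) simp
    fix x u x' u' assume a: "capped H x u" "grid_fit n B E F V (polar u)" "capped H x' u'" "grid_fit n B E F V (polar u')"
    then have f: "fit x u" "fit x' u'" by (auto simp: fit_def)
    let ?h = "\<lambda>u t. H t (polar u (1,t))"
    let ?L = "\<lambda>j. loop_int (F (n,j)) (?g j) (?g (Suc j)) (\<lambda>t. polar u (1,t)) (\<lambda>t. polar u' (1,t)) (?S u u' j) (?S u u' (Suc j))"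
    note b = capped_boundary[OF H a(1)] and b' = capped_boundary[OF H a(3)]
    have hi: "?h u integrable_on {0..1}" if "capped H x u" for x u
      using capped_boundary(5)[OF H that] unfolding traj_on_def
      by (intro integrable_continuous_real ham_along_continuous[OF H]) auto
    have e1: "action \<Sigma> H x' u' - action \<Sigma> H x u = (integral {0..1} (?h u') - integral {0..1} (?h u)) -
       (integral unit_square (pullback_density \<Sigma> u') - integral unit_square (pullback_density \<Sigma> u))"
      unfolding b(8) b'(8) by simp
    have e2: "integral unit_square (pullback_density \<Sigma> u') - integral unit_square (pullback_density \<Sigma> u) = (\<Sum>j<n. ?L j)"
      by (rule area_difference[OF G b(1) a(2) b(2) b(3) b(4) b'(1) a(4) b'(2) b'(3) b'(4)])
    have e3: "(integral {0..1} (?h u') - integral {0..1} (?h u)) - (\<Sum>j<n. ?L j) =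
       (\<Sum>j<n. integral {?g j..?g (Suc j)} (?h u') - integral {?g j..?g (Suc j)} (?h u) - ?L j)"
      unfolding integral_grid[OF hi[OF a(1)] n] integral_grid[OF hi[OF a(3)] n] by (simp add: sum_subtractf)
    have e4: "\<bar>\<Sum>j<n. integral {?g j..?g (Suc j)} (?h u') - integral {?g j..?g (Suc j)} (?h u) - ?L j\<bar> \<le> (\<Sum>j<n. Cj j * K j ^ 3 * ?D x x' ^ 3)"
    proof (rule order_trans[OF sum_abs sum_mono])
      fix j assume "j \<in> {..<n}"
      then have j: "j < n" by simp
      have "\<bar>integral {?g j..?g (Suc j)} (?h u') - integral {?g j..?g (Suc j)} (?h u) - ?L j\<bar>
        \<le> Cj j * norm (?\<kappa> j (polar u' (1,?g j)) - ?\<kappa> j (polar u (1,?g j))) ^ 3" by (rule Cj(2)[OF j f])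
      also have "\<dots> \<le> Cj j * (K j * ?D x x') ^ 3"
        by (intro mult_left_mono power_mono K(2)[OF j f] Cj(1)[OF j]) simp
      finally show "\<bar>integral {?g j..?g (Suc j)} (?h u') - integral {?g j..?g (Suc j)} (?h u) - ?L j\<bar> \<le> Cj j * K j ^ 3 * ?D x x' ^ 3"
        by (simp add: power_mult_distrib mult.assoc)
    qed
    have e5: "(\<Sum>j<n. Cj j * K j ^ 3 * ?D x x' ^ 3) = C * ?D x x' ^ 3" by (simp add: C_def sum_distrib_right)
    show "\<bar>action \<Sigma> H x' u' - action \<Sigma> H x u\<bar> \<le> C * ?D x x' ^ 3"
      using e4 unfolding e1 e2 e3 e5 .
  qed
qed

text \<open>There are countably many patterns, and for each one the chart coordinates of the fixed
  points paired with their actions satisfy the cubic estimate, so each pattern contributes a null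
  set.\<close>

lemma action_spectrum_negligible:
  assumes H: "H \<in> hamiltonians \<Sigma>"
  shows "negligible (action_spectrum \<Sigma> H)"
proof -
  obtain \<B> where \<B>: "countable \<B>" "\<And>b. b \<in> \<B> \<Longrightarrow> cell b"
    "\<And>p O'. open O' \<Longrightarrow> p \<in> O' \<Longrightarrow> \<exists>b\<in>\<B>. p \<in> cell_set b \<and> cell_set b \<subseteq> O'"
    by (rule countable_cell_base) (rule that, assumption+)
  \<comment> \<open>Vertices are indexed from 0 to \<open>n\<close> inclusive. Restricting the
    assignments to this finite set makes the patterns countable; functions on all index pairs would
    not be.\<close>
  define I where "I n = {..n} \<times> {..n::nat}" for n
  define rs where "rs n f = restrict f (I n)" for n and f :: "nat \<times> nat \<Rightarrow> 'a cell"
  let ?P = "\<lambda>n. PiE (I n) (\<lambda>_. \<B>)"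
  define \<D> where "\<D> = (SIGMA n:UNIV. ?P n \<times> ?P n \<times> ?P n \<times> ?P n)"
  have cP: "countable (?P n)" for n using \<B>(1) by (intro countable_PiE) (auto simp: I_def)
  have cD: "countable \<D>" unfolding \<D>_def by (intro countable_SIGMA countable_SIGMA cP) auto
  define S where "S = (\<lambda>(n,B,E,F,V). {action \<Sigma> H x u | x u. capped H x u \<and> grid_cells n B E F V \<and> grid_fit n B E F V (polar u)})"
  have "action_spectrum \<Sigma> H \<subseteq> (\<Union>\<delta>\<in>\<D>. S \<delta>)"
  proof
    fix a assume "a \<in> action_spectrum \<Sigma> H"
    then obtain x u where a: "a = action \<Sigma> H x u" "capped H x u" by (auto simp: action_spectrum_def capped_def)
    then have u: "continuous_on (cball 0 1) u" by (simp add: capped_def capping_disk_def)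
    obtain n B E F V where d: "range B \<subseteq> \<B>" "range E \<subseteq> \<B>" "range F \<subseteq> \<B>" "range V \<subseteq> \<B>"
      "grid_cells n B E F V" "grid_fit n B E F V (polar u)"
    proof (rule grid_cells_exist[OF u \<B>(2,3)])
      fix n B E F V
      assume "range B \<subseteq> \<B>" "range E \<subseteq> \<B>" "range F \<subseteq> \<B>" "range V \<subseteq> \<B>"
        "grid_cells n B E F V" "grid_fit n B E F V (polar u)"
      then show thesis by (rule that)
    qed (assumption+)
    have rs: "rs n f (i,j) = f (i,j)" if "i \<le> n" "j \<le> n" for f i j using that by (simp add: rs_def I_def)
    have "grid_cells n (rs n B) (rs n E) (rs n F) (rs n V)"
      unfolding grid_cells_def
    proof (intro conjI allI impI)
      note d' = d(5)[unfolded grid_cells_def]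
      have n: "n > 0" and GB: "\<forall>i<n. \<forall>j<n. cell (B (i,j))" and GE: "\<forall>i<n. \<forall>j\<le>n. cell (E (i,j))"
        and GF: "\<forall>i\<le>n. \<forall>j<n. cell (F (i,j))" and GV: "\<forall>i\<le>n. \<forall>j\<le>n. cell (V (i,j))"
        and Gs: "\<forall>i<n. \<forall>j<n. cell_set (E (i,j)) \<subseteq> cell_set (B (i,j)) \<and> cell_set (E (i,Suc j)) \<subseteq> cell_set (B (i,j)) \<and>
           cell_set (F (i,j)) \<subseteq> cell_set (B (i,j)) \<and> cell_set (F (Suc i,j)) \<subseteq> cell_set (B (i,j))"
        and GVE: "\<forall>i<n. \<forall>j\<le>n. cell_set (V (i,j)) \<subseteq> cell_set (E (i,j)) \<and> cell_set (V (Suc i,j)) \<subseteq> cell_set (E (i,j))"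
        and GVF: "\<forall>i\<le>n. \<forall>j<n. cell_set (V (i,j)) \<subseteq> cell_set (F (i,j)) \<and> cell_set (V (i,Suc j)) \<subseteq> cell_set (F (i,j))"
        and Ge: "\<forall>i<n. E (i,n) = E (i,0)" "\<forall>i\<le>n. V (i,n) = V (i,0)" "\<forall>j\<le>n. V (0,j) = V (0,0)"
        using d' by - (elim conjE, assumption)+
      show "n > 0" by (rule n)
      fix i j
      show "cell (rs n B (i,j))" if "i < n" "j < n" using GB that by (simp add: rs)
      show "cell (rs n E (i,j))" if "i < n" "j \<le> n" using GE that by (simp add: rs)
      show "cell (rs n F (i,j))" if "i \<le> n" "j < n" using GF that by (simp add: rs)
      show "cell (rs n V (i,j))" if "i \<le> n" "j \<le> n" using GV that by (simp add: rs)
      show "cell_set (rs n E (i,j)) \<subseteq> cell_set (rs n B (i,j))" "cell_set (rs n E (i,Suc j)) \<subseteq> cell_set (rs n B (i,j))"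
        "cell_set (rs n F (i,j)) \<subseteq> cell_set (rs n B (i,j))" "cell_set (rs n F (Suc i,j)) \<subseteq> cell_set (rs n B (i,j))"
        if "i < n" "j < n" using Gs that by (simp_all add: rs)
      show "cell_set (rs n V (i,j)) \<subseteq> cell_set (rs n E (i,j))" "cell_set (rs n V (Suc i,j)) \<subseteq> cell_set (rs n E (i,j))"
        if "i < n" "j \<le> n" using GVE that by (simp_all add: rs)
      show "cell_set (rs n V (i,j)) \<subseteq> cell_set (rs n F (i,j))" "cell_set (rs n V (i,Suc j)) \<subseteq> cell_set (rs n F (i,j))"
        if "i \<le> n" "j < n" using GVF that by (simp_all add: rs)
      show "rs n E (i,n) = rs n E (i,0)" if "i < n" using Ge(1) that by (simp add: rs)
      show "rs n V (i,n) = rs n V (i,0)" if "i \<le> n" using Ge(2) that by (simp add: rs)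
      show "rs n V (0,j) = rs n V (0,0)" if "j \<le> n" using Ge(3)[rule_format, OF that] that by (simp add: rs)
    qed
    moreover have "grid_fit n (rs n B) (rs n E) (rs n F) (rs n V) (polar u)"
      using d(6) unfolding grid_fit_def by (simp add: rs less_imp_le)
    moreover have "(n, rs n B, rs n E, rs n F, rs n V) \<in> \<D>"
      using d(1-4) by (auto simp: \<D>_def rs_def)
    ultimately show "a \<in> (\<Union>\<delta>\<in>\<D>. S \<delta>)"
      using a by (intro UN_I[of "(n, rs n B, rs n E, rs n F, rs n V)"]) (auto simp: S_def)
  qed
  moreover have "negligible (S \<delta>)" for \<delta>
  proof -
    obtain n B E F V where \<delta>: "\<delta> = (n,B,E,F,V)" by (metis surj_pair)
    show ?thesis
    proof (cases "grid_cells n B E F V")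
      case True
      obtain C where C: "C \<ge> 0" "\<And>x u x' u'. capped H x u \<Longrightarrow> grid_fit n B E F V (polar u) \<Longrightarrow> capped H x' u' \<Longrightarrow> grid_fit n B E F V (polar u') \<Longrightarrow>
         \<bar>action \<Sigma> H x' u' - action \<Sigma> H x u\<bar> \<le> C * norm (snd (fst (F (n,0))) x' - snd (fst (F (n,0))) x) ^ 3"
        by (rule grid_action_estimate[OF H True]) (rule that, assumption+)
      obtain c q r where F0: "F (n,0) = (c,q,r)" by (metis surj_pair)
      \<comment> \<open>The fixed point is the boundary point at time 0, so it lies in the cell of
        the first boundary edge, in whose chart it is measured.\<close>
      define R where "R = {(snd c x, action \<Sigma> H x u) | x u. capped H x u \<and> grid_fit n B E F V (polar u)}"
      have n: "n > 0" and cF: "cell (c,q,r)" using True F0 unfolding grid_cells_def by (simp, metis order_refl)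
      have "negligible (snd ` R)"
      proof (rule cubic_image_negligible[OF C(1)])
        show "\<bar>a' - a\<bar> \<le> C * norm (y' - y) ^ 3" if "(y,a) \<in> R" "(y',a') \<in> R" for y a y' a'
          using that C(2) F0 by (auto simp: R_def)
        show "y \<in> ball q r" if "(y,a) \<in> R" for y a
        proof -
          obtain x u where xu: "y = snd c x" "capped H x u" "grid_fit n B E F V (polar u)" using \<open>(y,a) \<in> R\<close> by (auto simp: R_def)
          have "(\<lambda>t. polar u (gridpt n n, t)) ` {gridpt n 0..gridpt n (Suc 0)} \<subseteq> cell_set (F (n,0))"
            using xu(3)[unfolded grid_fit_def, THEN conjunct2, THEN conjunct2, THEN conjunct1, rule_format, OF order_refl n] .
          moreover have "gridpt n 0 \<in> {gridpt n 0..gridpt n (Suc 0)}" using gridpt(3)[OF n, of 0] by simp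
          ultimately have "polar u (gridpt n n, gridpt n 0) \<in> cell_set (F (n,0))" by blast
          then have "x \<in> cell_set (c,q,r)" using capped_boundary(6)[OF H xu(2)] gridpt(1,2)[OF n] by (simp add: F0)
          then show ?thesis using cell_set_iff[OF cF] xu(1) by blast
        qed
      qed
      moreover have "S \<delta> \<subseteq> snd ` R" by (force simp: S_def \<delta> R_def image_iff)
      ultimately show ?thesis by (rule negligible_subset)
    qed (simp add: S_def \<delta>)
  qed
  moreover have "negligible (\<Union>(S ` \<D>))"
    by (rule negligible_countable_Union) (use cD \<open>\<And>\<delta>. negligible (S \<delta>)\<close> in auto)
  ultimately show ?thesis using negligible_subset by blast
qed

lemma continuous_in_negligible_constant:
  fixes f :: "real \<Rightarrow> real"
  assumes "continuous_on {0..1} f" "negligible S" "f ` {0..1} \<subseteq> S"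
  shows "f 0 = f 1"
proof (rule ccontr)
  assume "f 0 \<noteq> f 1"
  have c: "connected (f ` {0..1})" by (intro connected_continuous_image assms(1)) simp
  \<comment> \<open>The image is connected and would contain a nondegenerate interval inside the
    null set.\<close>
  have "{min (f 0) (f 1)..max (f 0) (f 1)} \<subseteq> f ` {0..1}"
    by (rule connected_contains_Icc[OF c]) (auto simp: min_def max_def)
  then have "negligible (cbox (min (f 0) (f 1)) (max (f 0) (f 1)))"
    using assms(2,3) negligible_subset[of S] by (auto simp: subset_iff)
  then have "box (min (f 0) (f 1)) (max (f 0) (f 1)) = {}" unfolding negligible_interval by blast
  then show False using \<open>f 0 \<noteq> f 1\<close> by (auto simp: box_eq_empty inner_real_def min_def max_def split: if_splits)
qed

end

section \<open>Paths of symplectomorphisms\<close>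

text \<open>A converse to \<open>family_C_iter_deriv\<close>: joint continuity of all iterated
  derivatives is what the topology on symplectomorphisms delivers, and families are what composes
  well.\<close>

lemma family_C_of_iter_deriv:
  assumes "\<And>vs. continuous_on A (\<lambda>(s,z). iter_deriv UNIV vs (F s) z)"
    "\<And>vs s z. (s,z) \<in> A \<Longrightarrow> iter_deriv UNIV vs (F s) differentiable (at z)"
  shows "family_C k A (\<lambda>s. iter_deriv UNIV vs (F s))"
proof (induction k arbitrary: vs)
  case (Suc k)
  have "family_C k A (\<lambda>s z. frechet_derivative (iter_deriv UNIV vs (F s)) (at z) v)" for v
    using Suc[of "v # vs"] by simp
  then show ?case using assms(1)[of vs] assms(2)[of _ _ vs] by auto
qed (use assms(1) in simp)

lemma family_C_slice_smooth:
  assumes "slices_open A" "\<And>k. family_C k A F"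
  shows "smooth_open {z. (s,z) \<in> A} (F s)"
  unfolding smooth_open_def
proof (intro conjI allI)
  show "open {z. (s,z) \<in> A}" using assms(1) by (simp add: slices_open_def)
  fix vs
  have "iter_deriv UNIV vs (F s) differentiable (at z)" if "(s,z) \<in> A" for z
    using family_C_differentiable[OF family_C_iter_deriv[OF assms(2)] that] by (auto simp: differentiable_def)
  then show "iter_deriv UNIV vs (F s) differentiable_on {z. (s,z) \<in> A}"
    by (auto simp: differentiable_on_def intro: differentiable_at_withinI)
qed

text \<open>Turns the uniform closeness supplied by the basic neighbourhoods into joint
  continuity.\<close>

lemma continuous_on_uniform_family:
  fixes f :: "'p::metric_space \<Rightarrow> 'e::metric_space \<Rightarrow> 'f::real_normed_vector"
  assumes "\<And>s. s \<in> S \<Longrightarrow> continuous_on B (f s)"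
    "\<And>s \<epsilon>. s \<in> S \<Longrightarrow> \<epsilon> > 0 \<Longrightarrow> \<exists>\<delta>>0. \<forall>s'\<in>S. dist s' s < \<delta> \<longrightarrow> (\<forall>y\<in>B. norm (f s' y - f s y) < \<epsilon>)"
  shows "continuous_on (S \<times> B) (\<lambda>(s,y). f s y)"
  unfolding continuous_on_iff
proof (intro ballI allI impI)
  fix x and \<epsilon> :: real assume x: "x \<in> S \<times> B" and e: "\<epsilon> > 0"
  obtain s y where xs: "x = (s,y)" "s \<in> S" "y \<in> B" using x by auto
  have e2: "\<epsilon>/2 > 0" using e by simp
  obtain d1 where d1: "d1 > 0" "\<And>s' y'. s' \<in> S \<Longrightarrow> dist s' s < d1 \<Longrightarrow> y' \<in> B \<Longrightarrow> norm (f s' y' - f s y') < \<epsilon>/2"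
    using assms(2)[OF xs(2) e2] by blast
  obtain d2 where d2: "d2 > 0" "\<And>y'. y' \<in> B \<Longrightarrow> dist y' y < d2 \<Longrightarrow> dist (f s y') (f s y) < \<epsilon>/2"
    using assms(1)[OF xs(2)] xs(3) e2 unfolding continuous_on_iff by blast
  show "\<exists>d>0. \<forall>x'\<in>S \<times> B. dist x' x < d \<longrightarrow> dist (case x' of (s,y) \<Rightarrow> f s y) (case x of (s,y) \<Rightarrow> f s y) < \<epsilon>"
  proof (intro exI[of _ "min d1 d2"] conjI ballI impI)
    fix x' assume x': "x' \<in> S \<times> B" "dist x' x < min d1 d2"
    obtain s' y' where xs': "x' = (s',y')" "s' \<in> S" "y' \<in> B" using x' by auto
    have "dist s' s < d1" "dist y' y < d2"
      using x'(2) dist_fst_le[of x' x] dist_snd_le[of x' x] by (auto simp: xs xs')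
    then have "norm (f s' y' - f s y') < \<epsilon>/2" "dist (f s y') (f s y) < \<epsilon>/2" using d1(2) d2(2) xs' by auto
    then show "dist (case x' of (s,y) \<Rightarrow> f s y) (case x of (s,y) \<Rightarrow> f s y) < \<epsilon>"
      using dist_triangle[of "f s' y'" "f s y" "f s y'"] by (simp add: xs xs' dist_norm)
  qed (use d1(1) d2(1) in auto)
qed

context area_surface begin

definition symp_path :: "(real \<Rightarrow> 'a \<Rightarrow> 'a) \<Rightarrow> bool" where
  "symp_path g \<longleftrightarrow> pathin (symp_topology \<Sigma>) g"

lemma symp_path_symp: "symp_path g \<Longrightarrow> s \<in> {0..1} \<Longrightarrow> g s \<in> symp \<Sigma>"
  unfolding symp_path_def pathin_def continuous_map_def symp_topology_def
  by (fastforce simp: symp_nbhd_def Pi_iff)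

lemma symp_path_near:
  assumes g: "symp_path g" and s: "s \<in> {0..1}" and c: "c \<in> atlas \<Sigma>" "d \<in> atlas \<Sigma>"
    and L: "compact L" "L \<subseteq> fst c" "g s ` L \<subseteq> fst d" and e: "\<epsilon> > 0"
  shows "\<exists>\<delta>>0. \<forall>s'\<in>{0..1}. dist s' s < \<delta> \<longrightarrow> g s' \<in> symp_nbhd \<Sigma> (g s) c d L vs \<epsilon>"
proof -
  let ?U = "symp_nbhd \<Sigma> (g s) c d L vs \<epsilon>"
  have "openin (symp_topology \<Sigma>) ?U"
    unfolding symp_topology_def
    by (rule topology_generated_by_Basis) (use symp_path_symp[OF g s] c L e in blast)
  from openin_continuous_map_preimage[OF g[unfolded symp_path_def pathin_def] this]
  have op: "openin (top_of_set {0..1}) {s' \<in> {0..1}. g s' \<in> ?U}" by simp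
  have "s \<in> {s' \<in> {0..1}. g s' \<in> ?U}" using symp_path_symp[OF g s] s L(3) e by (simp add: symp_nbhd_def)
  then show ?thesis using op unfolding openin_euclidean_subtopology_iff by blast
qed

lemma symp_path_const: "symp_path (\<lambda>s. id)"
proof -
  obtain c where c: "c \<in> atlas \<Sigma>" by (rule chart_at)
  have id: "id \<in> symp \<Sigma>" using area_map_id by (simp add: symp_def area_map_def)
  \<comment> \<open>With the empty compact set the conditions are vacuous, so this basic
    neighbourhood consists of all symplectomorphisms.\<close>
  then have "id \<in> symp_nbhd \<Sigma> id c c {} [] 1" by (simp add: symp_nbhd_def)
  moreover have "openin (symp_topology \<Sigma>) (symp_nbhd \<Sigma> id c c {} [] 1)"
    unfolding symp_topology_def
    by (rule topology_generated_by_Basis) (use id c in \<open>fastforce intro: exI[of _ id]\<close>)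
  ultimately have "id \<in> topspace (symp_topology \<Sigma>)" using openin_subset by blast
  then show ?thesis unfolding symp_path_def pathin_def by (simp add: continuous_map_const)
qed

text \<open>A closed coordinate ball around \<open>p\<close> is compact and is mapped into the chart
  \<open>d\<close> by \<open>g s0\<close>, hence by all nearby \<open>g s\<close>. On it the basic
  neighbourhoods control every iterated derivative uniformly.\<close>

lemma symp_path_local_rep:
  assumes g: "symp_path g" and s: "s0 \<in> {0..1}" and c: "c \<in> atlas \<Sigma>" "p \<in> fst c" and d: "d \<in> atlas \<Sigma>" "g s0 p \<in> fst d"
  obtains \<delta> r where "\<delta> > 0" "r > 0" "ball (snd c p) r \<subseteq> snd c ` fst c"
    "\<And>s y. s \<in> {0..1} \<inter> ball s0 \<delta> \<Longrightarrow> y \<in> ball (snd c p) r \<Longrightarrow> g s (coord_inv c y) \<in> fst d"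
    "\<And>k. family_C k (({0..1} \<inter> ball s0 \<delta>) \<times> ball (snd c p) r) (\<lambda>s. local_rep c d (g s))"
proof -
  have sm: "smooth_self_map \<Sigma> (g s)" if "s \<in> {0..1}" for s using symp_path_symp[OF g that] by (simp add: symp_def)
  have ct: "continuous_on UNIV (g s)" if "s \<in> {0..1}" for s using sm[OF that] by (simp add: smooth_self_map_def)
  have "open (snd c ` (fst c \<inter> g s0 -` fst d))" by (rule local_dom_open(2)[OF c(1) d(1) ct[OF s]])
  moreover have "snd c p \<in> snd c ` (fst c \<inter> g s0 -` fst d)" using c d by blast
  ultimately obtain r where r: "r > 0" "cball (snd c p) r \<subseteq> snd c ` (fst c \<inter> g s0 -` fst d)"
    using open_contains_cball by blast
  let ?y0 = "snd c p"
  have rc: "cball ?y0 r \<subseteq> snd c ` fst c" using r(2) by blast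
  define L where "L = coord_inv c ` cball ?y0 r"
  have Lc: "compact L" unfolding L_def
    by (rule compact_continuous_image[OF continuous_on_subset[OF continuous_coord_inv[OF c(1)] rc] compact_cball])
  have Lf: "L \<subseteq> fst c" unfolding L_def using coord_inv_in[OF c(1)] rc by blast
  have Ld: "g s0 ` L \<subseteq> fst d" unfolding L_def using r(2) coord_inv_chart[OF c(1)] by fastforce
  obtain \<delta> where \<delta>: "\<delta> > 0" "\<forall>s'\<in>{0..1}. dist s' s0 < \<delta> \<longrightarrow> g s' \<in> symp_nbhd \<Sigma> (g s0) c d L [] 1"
    using symp_path_near[OF g s c(1) d(1) Lc Lf Ld zero_less_one] by blast
  have gL: "g s ` L \<subseteq> fst d" if "s \<in> {0..1} \<inter> ball s0 \<delta>" for s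
    using \<delta>(2) that by (auto simp: symp_nbhd_def dist_commute)
  have dom: "ball ?y0 r \<subseteq> snd c ` (fst c \<inter> g s -` fst d)" if s: "s \<in> {0..1} \<inter> ball s0 \<delta>" for s
  proof
    fix y assume y: "y \<in> ball ?y0 r"
    then have yL: "coord_inv c y \<in> L" by (auto simp: L_def)
    have yi: "y \<in> snd c ` fst c" using rc y ball_subset_cball by blast
    have "snd c (coord_inv c y) = y" by (rule chart_coord_inv[OF c(1) yi])
    then show "y \<in> snd c ` (fst c \<inter> g s -` fst d)" using yL Lf gL[OF s] by (intro image_eqI[of _ _ "coord_inv c y"]) auto
  qed
  have sro: "smooth_open (ball ?y0 r) (local_rep c d (g s))" if s: "s \<in> {0..1} \<inter> ball s0 \<delta>" for s
    by (rule smooth_open_subset[OF local_rep_smooth[OF sm c(1) d(1)] open_ball dom[OF s]]) (use s in blast)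
  have D: "iter_deriv UNIV vs (local_rep c d (g s)) differentiable (at y)"
    if "s \<in> {0..1} \<inter> ball s0 \<delta>" "y \<in> ball ?y0 r" for s y vs
    using smooth_open_differentiable[OF sro[OF that(1)] that(2)] by (auto simp: differentiable_def)
  have C: "continuous_on (({0..1} \<inter> ball s0 \<delta>) \<times> ball ?y0 r) (\<lambda>(s,y). iter_deriv UNIV vs (local_rep c d (g s)) y)" for vs
  proof (rule continuous_on_uniform_family)
    fix s1 assume s1: "s1 \<in> {0..1} \<inter> ball s0 \<delta>"
    show "continuous_on (ball ?y0 r) (iter_deriv UNIV vs (local_rep c d (g s1)))"
      by (intro continuous_at_imp_continuous_on ballI differentiable_imp_continuous_within D[OF s1])
    fix \<epsilon> :: real assume e: "\<epsilon> > 0"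
    have "s1 \<in> {0..1}" using s1 by blast
    then obtain \<delta>' where \<delta>': "\<delta>' > 0" "\<forall>s'\<in>{0..1}. dist s' s1 < \<delta>' \<longrightarrow> g s' \<in> symp_nbhd \<Sigma> (g s1) c d L vs \<epsilon>"
      using symp_path_near[OF g _ c(1) d(1) Lc Lf gL[OF s1] e] by blast
    show "\<exists>\<delta>'>0. \<forall>s'\<in>{0..1} \<inter> ball s0 \<delta>. dist s' s1 < \<delta>' \<longrightarrow>
       (\<forall>y\<in>ball ?y0 r. norm (iter_deriv UNIV vs (local_rep c d (g s')) y - iter_deriv UNIV vs (local_rep c d (g s1)) y) < \<epsilon>)"
    proof (intro exI[of _ \<delta>'] conjI ballI impI \<delta>'(1))
      fix s' y assume s': "s' \<in> {0..1} \<inter> ball s0 \<delta>" "dist s' s1 < \<delta>'" and y: "y \<in> ball ?y0 r"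
      have "g s' \<in> symp_nbhd \<Sigma> (g s1) c d L vs \<epsilon>" using \<delta>'(2) s' by blast
      moreover have "coord_inv c y \<in> L" using y by (auto simp: L_def)
      moreover have "snd c (coord_inv c y) = y" by (rule chart_coord_inv[OF c(1)]) (use rc y ball_subset_cball in blast)
      ultimately show "norm (iter_deriv UNIV vs (local_rep c d (g s')) y - iter_deriv UNIV vs (local_rep c d (g s1)) y) < \<epsilon>"
        unfolding symp_nbhd_def by fastforce
    qed
  qed
  show thesis
  proof (rule that[OF \<delta>(1) r(1)])
    show "ball ?y0 r \<subseteq> snd c ` fst c" using rc ball_subset_cball by blast
    show "g s (coord_inv c y) \<in> fst d" if "s \<in> {0..1} \<inter> ball s0 \<delta>" "y \<in> ball ?y0 r" for s y
      using gL[OF that(1)] that(2) by (auto simp: L_def image_subset_iff)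
    show "family_C k (({0..1} \<inter> ball s0 \<delta>) \<times> ball ?y0 r) (\<lambda>s. local_rep c d (g s))" for k
      using family_C_of_iter_deriv[OF C, of k "[]"] D by auto
  qed
qed

section \<open>Hamiltonians composed with a path of symplectomorphisms\<close>

definition ham_deriv :: "'a chart \<Rightarrow> (real \<times> (real^2)) list \<Rightarrow> (real \<Rightarrow> 'a \<Rightarrow> real) \<Rightarrow> real \<times> (real^2) \<Rightarrow> real" where
  "ham_deriv c vs H = iter_deriv ({0..1} \<times> snd c ` fst c) vs (ham_rep c H)"

text \<open>Near a given parameter, time and point the composed Hamiltonian extends to
  \<open>G (t, local_rep c d (g s) y)\<close> with \<open>G\<close> a smooth extension of
  \<open>H\<close> in the chart \<open>d\<close>. Families are closed under composition, so all
  derivatives of this extension are jointly continuous, and on the domain they are the derivatives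
  in question.\<close>

lemma ham_deriv_path_continuous:
  assumes g: "symp_path g" and H: "H \<in> hamiltonians \<Sigma>" and c: "c \<in> atlas \<Sigma>"
  shows "continuous_on ({0..1} \<times> ({0..1} \<times> snd c ` fst c)) (\<lambda>(s,z). ham_deriv c vs (\<lambda>t x. H t (g s x)) z)"
proof (rule continuous_on_relative)
  let ?S = "{0..1::real} \<times> snd c ` fst c"
  fix x :: "real \<times> (real \<times> (real^2))" assume x: "x \<in> {0..1} \<times> ?S"
  obtain s0 t0 p where xs: "x = (s0,(t0,snd c p))" "s0 \<in> {0..1}" "t0 \<in> {0..1}" "p \<in> fst c" using x by auto
  let ?y0 = "snd c p"
  obtain d where d: "d \<in> atlas \<Sigma>" "g s0 p \<in> fst d" by (rule chart_at)
  obtain \<delta> r where dr: "\<delta> > 0" "r > 0" "ball ?y0 r \<subseteq> snd c ` fst c"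
    "\<And>s y. s \<in> {0..1} \<inter> ball s0 \<delta> \<Longrightarrow> y \<in> ball ?y0 r \<Longrightarrow> g s (coord_inv c y) \<in> fst d"
    "\<And>k. family_C k (({0..1} \<inter> ball s0 \<delta>) \<times> ball ?y0 r) (\<lambda>s. local_rep c d (g s))"
    by (rule symp_path_local_rep[OF g xs(2) c xs(4) d]) (rule that, assumption+)
  let ?J = "{0..1} \<inter> ball s0 \<delta>"
  let ?B = "ball ?y0 r"
  let ?f = "\<lambda>s. local_rep c d (g s)"
  have f0: "?f s0 ?y0 = snd d (g s0 p)" by (rule local_rep_chart[OF c xs(4)])
  have sH: "smooth_on ({0..1} \<times> snd d ` fst d) (ham_rep d H)" using H d(1) by (simp add: hamiltonians_def)
  have "(t0, snd d (g s0 p)) \<in> {0..1} \<times> snd d ` fst d" using xs(3) d(2) by simp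
  from sH[unfolded smooth_on_iff, rule_format, OF this]
  obtain W G where W0: "(t0, snd d (g s0 p)) \<in> W" "smooth_open W G" "\<forall>y\<in>W \<inter> ({0..1} \<times> snd d ` fst d). G y = ham_rep d H y"
    by (elim exE conjE)
  note W = W0(1,2) W0(3)[rule_format, OF IntI]
  have oW: "open W" using W(2) by (simp add: smooth_open_def)
  \<comment> \<open>Time runs over all reals because the extension \<open>G\<close> lives on an open
    set. The parameter stays in \<open>[0,1]\<close>, so only the slices in time and space are
    open.\<close>
  define T where "T = ?J \<times> ((UNIV :: real set) \<times> ?B)"
  let ?F = "\<lambda>s z. (fst z, ?f s (snd z))"
  have fc: "continuous_on T (\<lambda>x. ?f (fst x) (snd (snd x)))"
  proof -
    have "continuous_on T (\<lambda>x. (fst x, snd (snd x)))" by (intro continuous_intros)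
    moreover have "(\<lambda>x. (fst x, snd (snd x))) ` T \<subseteq> ?J \<times> ?B" by (auto simp: T_def)
    ultimately show ?thesis
      using continuous_on_compose2[OF family_C_imp_continuous[OF dr(5), unfolded case_prod_unfold]] by fastforce
  qed
  have Fc: "continuous_on T (\<lambda>x. ?F (fst x) (snd x))"
    by (intro continuous_on_Pair fc continuous_intros)
  obtain Q where Q: "open Q" "Q \<inter> T = (\<lambda>x. ?F (fst x) (snd x)) -` W \<inter> T"
    using Fc oW unfolding continuous_on_open_invariant by meson
  define A where "A = Q \<inter> T"
  have AW: "s \<in> ?J \<and> snd z \<in> ?B \<and> ?F s z \<in> W" if a: "(s,z) \<in> A" for s z
  proof -
    have "(s,z) \<in> (\<lambda>x. ?F (fst x) (snd x)) -` W \<inter> T" using a unfolding A_def Q(2) .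
    then have "?F s z \<in> W" "(s,z) \<in> T" by simp_all
    then show ?thesis by (simp add: T_def mem_Times_iff)
  qed
  have so: "slices_open A"
    unfolding slices_open_def
  proof
    fix s
    have "{z. (s,z) \<in> A} = (if s \<in> ?J then Pair s -` Q \<inter> (UNIV \<times> ?B) else {})"
      by (auto simp: A_def T_def)
    moreover have "open (Pair s -` Q)" by (rule open_vimage[OF Q(1)]) (intro continuous_intros)
    ultimately show "open {z. (s,z) \<in> A}" by (auto intro: open_Int open_Times)
  qed
  have soB: "slices_open (?J \<times> ?B)" "slices_open (?J \<times> (UNIV :: (real^2) set))" "slices_open (?J \<times> W)"
    using oW by (auto intro: slices_open_Times)
  have p1: "family_C k A (\<lambda>s z. ?f s (snd z))" for k
    by (rule family_C_compose[OF so soB(1) _ family_C_linear[OF bounded_linear_snd so] dr(5)]) (use AW in auto)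
  have l0: "bounded_linear (\<lambda>w::real^2. (0::real, w))" "bounded_linear (\<lambda>z::real\<times>(real^2). (fst z, 0::real^2))"
    by (intro bounded_linear_Pair bounded_linear_zero bounded_linear_ident bounded_linear_fst)+
  have p2: "family_C k A (\<lambda>s z. (0::real, ?f s (snd z)))" for k
    by (rule family_C_compose[OF so soB(2) _ p1 family_C_linear[OF l0(1) soB(2)]]) (use AW in auto)
  have "family_C k A (\<lambda>s z. (fst z, 0) + (0::real, ?f s (snd z)))" for k
    by (rule family_C_add[OF so family_C_linear[OF l0(2) so] p2])
  then have p3: "family_C k A ?F" for k by simp
  have p4: "family_C k A (\<lambda>s z. G (?F s z))" for k
    by (rule family_C_compose[OF so soB(3) _ p3 smooth_open_family_C[OF W(2)]]) (use AW in auto)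
  have cont: "continuous_on A (\<lambda>(s,z). iter_deriv UNIV vs (\<lambda>z. G (?F s z)) z)"
    using family_C_imp_continuous[OF family_C_iter_deriv[OF p4]] .
  have eq: "ham_deriv c vs (\<lambda>t x. H t (g s x)) z = iter_deriv UNIV vs (\<lambda>z. G (?F s z)) z" if "(s,z) \<in> A" "z \<in> ?S" for s z
    unfolding ham_deriv_def
  proof (rule iter_deriv_within[OF uniq_deriv_prod[OF open_img[OF c]] family_C_slice_smooth[OF so p4, of s]])
    show "z \<in> ?S \<inter> {z. (s,z) \<in> A}" using that by blast
    fix w assume w: "w \<in> ?S \<inter> {z. (s,z) \<in> A}"
    obtain t y where wt: "w = (t,y)" by (cases w)
    have a: "s \<in> ?J" "y \<in> ?B" "(t, ?f s y) \<in> W" "t \<in> {0..1}" using AW[of s w] w wt by auto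
    let ?q = "g s (coord_inv c y)"
    have q: "?q \<in> fst d" by (rule dr(4)[OF a(1,2)])
    have fy: "?f s y = snd d ?q" by (simp add: local_rep_def)
    have "G (t, ?f s y) = ham_rep d H (t, ?f s y)" by (rule W(3)[OF a(3)]) (use a(4) q fy in auto)
    then show "ham_rep c (\<lambda>t x. H t (g s x)) w = G (?F s w)"
      by (simp add: wt ham_rep_def fy coord_inv_chart[OF d(1) q])
  qed
  let ?U = "Q \<inter> (ball s0 \<delta> \<times> (UNIV \<times> ?B))"
  have TU: "?U \<inter> ({0..1} \<times> ?S) \<subseteq> A" by (auto simp: A_def T_def)
  have xA: "x \<in> A"
  proof -
    have "x \<in> T" using xs dr(1,2) by (auto simp: T_def)
    moreover have "?F (fst x) (snd x) \<in> W" using W(1) f0 by (simp add: xs)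
    ultimately show ?thesis unfolding A_def Q(2) by blast
  qed
  show "\<exists>U. open U \<and> x \<in> U \<and> continuous_on (({0..1} \<times> ?S) \<inter> U) (\<lambda>(s,z). ham_deriv c vs (\<lambda>t x. H t (g s x)) z)"
  proof (intro exI[of _ ?U] conjI)
    show "open ?U" using Q(1) by (intro open_Int open_Times) auto
    show "x \<in> ?U" using xA by (auto simp: A_def T_def)
    have "continuous_on (({0..1} \<times> ?S) \<inter> ?U) (\<lambda>(s,z). iter_deriv UNIV vs (\<lambda>z. G (?F s z)) z)"
      by (rule continuous_on_subset[OF cont]) (use TU in blast)
    then show "continuous_on (({0..1} \<times> ?S) \<inter> ?U) (\<lambda>(s,z). ham_deriv c vs (\<lambda>t x. H t (g s x)) z)"
      by (rule continuous_on_eq) (use eq TU in auto)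
  qed
qed

text \<open>The case of the constant path at the identity, evaluated at parameter 0.\<close>

lemma ham_deriv_continuous:
  assumes H: "H \<in> hamiltonians \<Sigma>" and c: "c \<in> atlas \<Sigma>"
  shows "continuous_on ({0..1} \<times> snd c ` fst c) (ham_deriv c vs H)"
proof -
  have "continuous_on ({0..1} \<times> snd c ` fst c) (\<lambda>z. (0::real, z))" "(\<lambda>z. (0::real, z)) ` ({0..1} \<times> snd c ` fst c) \<subseteq> {0..1} \<times> ({0..1} \<times> snd c ` fst c)"
    by (intro continuous_intros) auto
  from continuous_on_compose2[OF ham_deriv_path_continuous[OF symp_path_const H c, of vs] this]
  show ?thesis by simp
qed

lemma hamiltonian_path_loc_continuous:
  assumes g: "symp_path g" and H: "H \<in> hamiltonians \<Sigma>"
  shows "continuous_map (top_of_set {0..1}) (ham_loc_topology \<Sigma>) (\<lambda>s t x. H t (g s x))"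
  unfolding ham_loc_topology_def
proof (rule continuous_on_generated_topo)
  let ?\<Phi> = "\<lambda>s t x. H t (g s x)"
  have Hs: "?\<Phi> s \<in> hamiltonians \<Sigma>" if "s \<in> {0..1}" for s
    by (rule ham_compose_in_hamiltonians(1)[OF symp_path_symp[OF g that] H])
  fix U assume "U \<in> {ham_nbhd \<Sigma> H c L vs \<epsilon> | H c L vs \<epsilon>. H \<in> hamiltonians \<Sigma> \<and> c \<in> atlas \<Sigma> \<and> compact L \<and> L \<subseteq> fst c \<and> \<epsilon> > 0}"
  then obtain G c L vs \<epsilon> where U: "U = ham_nbhd \<Sigma> G c L vs \<epsilon>" "G \<in> hamiltonians \<Sigma>" "c \<in> atlas \<Sigma>" "compact L" "L \<subseteq> fst c" "\<epsilon> > 0" by blast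
  let ?Q = "{0..1::real} \<times> snd c ` L"
  let ?S = "{0..1::real} \<times> snd c ` fst c"
  have Q: "compact ({0..1::real} \<times> ?Q)" "?Q \<subseteq> ?S"
    using U(4,5) compact_continuous_image[OF continuous_on_subset[OF continuous_chart[OF U(3)] U(5)] U(4)]
    by (auto intro!: compact_Times)
  let ?h = "\<lambda>x. \<bar>ham_deriv c vs (?\<Phi> (fst x)) (snd x) - ham_deriv c vs G (snd x)\<bar>"
  have c1: "continuous_on ({0..1} \<times> ?Q) (\<lambda>x. ham_deriv c vs (?\<Phi> (fst x)) (snd x))"
    using continuous_on_subset[OF ham_deriv_path_continuous[OF g H U(3), of vs], of "{0..1} \<times> ?Q"] Q(2)
    unfolding case_prod_unfold by blast
  have c2: "continuous_on ({0..1::real} \<times> ?Q) (\<lambda>x. ham_deriv c vs G (snd x))"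
    by (rule continuous_on_compose2[OF ham_deriv_continuous[OF U(2,3)]]) (use Q(2) in \<open>auto intro: continuous_intros\<close>)
  have hc: "continuous_on ({0..1} \<times> ?Q) ?h" by (intro continuous_intros c1 c2)
  \<comment> \<open>The tube argument in complementary form: the set where a derivative deviates by
    at least \<open>\<epsilon>\<close> is compact, so its projection to the parameters is closed,
    and the good parameters are the complement.\<close>
  have "closedin (top_of_set ({0..1} \<times> ?Q)) (({0..1} \<times> ?Q) \<inter> ?h -` {\<epsilon>..})"
    by (rule continuous_closedin_preimage[OF hc closed_atLeast])
  then have "compact (({0..1} \<times> ?Q) \<inter> ?h -` {\<epsilon>..})" using closedin_compact[OF Q(1)] by blast
  then have "compact (fst ` (({0..1} \<times> ?Q) \<inter> ?h -` {\<epsilon>..}))"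
    by (rule compact_continuous_image[rotated]) (intro continuous_intros)
  then have "open (- fst ` (({0..1} \<times> ?Q) \<inter> ?h -` {\<epsilon>..}))" using compact_imp_closed by blast
  moreover have "?\<Phi> -` U \<inter> topspace (top_of_set {0..1}) = {0..1} \<inter> - fst ` (({0..1} \<times> ?Q) \<inter> ?h -` {\<epsilon>..})"
  proof (intro set_eqI iffI)
    fix s assume s: "s \<in> ?\<Phi> -` U \<inter> topspace (top_of_set {0..1})"
    then have "?\<Phi> s \<in> ham_nbhd \<Sigma> G c L vs \<epsilon>" by (simp add: U(1))
    then have "\<bar>ham_deriv c vs (?\<Phi> s) (t, snd c p) - ham_deriv c vs G (t, snd c p)\<bar> < \<epsilon>" if "t \<in> {0..1}" "p \<in> L" for t p
      using that unfolding ham_nbhd_def ham_deriv_def by blast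
    then show "s \<in> {0..1} \<inter> - fst ` (({0..1} \<times> ?Q) \<inter> ?h -` {\<epsilon>..})"
      using s by (fastforce simp: not_less[symmetric])
  next
    fix s assume s: "s \<in> {0..1} \<inter> - fst ` (({0..1} \<times> ?Q) \<inter> ?h -` {\<epsilon>..})"
    have "\<bar>ham_deriv c vs (?\<Phi> s) (t, snd c p) - ham_deriv c vs G (t, snd c p)\<bar> < \<epsilon>" if "t \<in> {0..1}" "p \<in> L" for t p
    proof (rule ccontr)
      assume "\<not> ?thesis"
      then have "(s,(t,snd c p)) \<in> ({0..1} \<times> ?Q) \<inter> ?h -` {\<epsilon>..}" using s that by auto
      then have "s \<in> fst ` (({0..1} \<times> ?Q) \<inter> ?h -` {\<epsilon>..})" by (rule image_eqI[rotated]) simp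
      then show False using s by blast
    qed
    then show "s \<in> ?\<Phi> -` U \<inter> topspace (top_of_set {0..1})"
      using s Hs[of s] by (simp add: U(1) ham_nbhd_def ham_deriv_def)
  qed
  ultimately show "openin (top_of_set {0..1}) (?\<Phi> -` U \<inter> topspace (top_of_set {0..1}))"
    by (simp add: openin_open_Int)
next
  obtain c where c: "c \<in> atlas \<Sigma>" by (rule chart_at)
  show "(\<lambda>s t x. H t (g s x)) ` topspace (top_of_set {0..1}) \<subseteq>
     \<Union>{ham_nbhd \<Sigma> H c L vs \<epsilon> | H c L vs \<epsilon>. H \<in> hamiltonians \<Sigma> \<and> c \<in> atlas \<Sigma> \<and> compact L \<and> L \<subseteq> fst c \<and> \<epsilon> > 0}"
  proof (intro image_subsetI)
    fix s assume "s \<in> topspace (top_of_set {0..1::real})"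
    then have h: "(\<lambda>t x. H t (g s x)) \<in> hamiltonians \<Sigma>"
      using ham_compose_in_hamiltonians(1)[OF symp_path_symp[OF g] H] by simp
    show "(\<lambda>t x. H t (g s x)) \<in> \<Union>{ham_nbhd \<Sigma> H c L vs \<epsilon> | H c L vs \<epsilon>. H \<in> hamiltonians \<Sigma> \<and> c \<in> atlas \<Sigma> \<and> compact L \<and> L \<subseteq> fst c \<and> \<epsilon> > 0}"
    proof (rule UnionI)
      show "ham_nbhd \<Sigma> (\<lambda>t x. H t (g s x)) c {} [] 1 \<in> {ham_nbhd \<Sigma> H c L vs \<epsilon> | H c L vs \<epsilon>. H \<in> hamiltonians \<Sigma> \<and> c \<in> atlas \<Sigma> \<and> compact L \<and> L \<subseteq> fst c \<and> \<epsilon> > 0}"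
        using h c by (intro CollectI exI conjI) (rule refl, auto)
      show "(\<lambda>t x. H t (g s x)) \<in> ham_nbhd \<Sigma> (\<lambda>t x. H t (g s x)) c {} [] 1" using h by (simp add: ham_nbhd_def)
    qed
  qed
qed

end

section \<open>Invariance of formal spectral invariants\<close>

context area_surface begin

lemma topspace_ham_topology: "topspace (ham_topology \<Sigma>) = hamiltonians \<Sigma>"
proof
  show "topspace (ham_topology \<Sigma>) \<subseteq> hamiltonians \<Sigma>"
    using openin_topspace[of "ham_topology \<Sigma>"] unfolding openin_ham_topology by blast
  obtain c where c: "c \<in> atlas \<Sigma>" by (rule chart_at)
  have "hamiltonians \<Sigma> \<subseteq> topspace (ham_loc_topology \<Sigma>)"
  proof
    fix H assume H: "H \<in> hamiltonians \<Sigma>"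
    \<comment> \<open>The neighbourhood belonging to the empty compact set is the whole set of
      Hamiltonians.\<close>
    have "openin (ham_loc_topology \<Sigma>) (ham_nbhd \<Sigma> H c {} [] 1)"
      unfolding ham_loc_topology_def
      by (rule topology_generated_by_Basis, intro CollectI exI conjI, rule refl) (use H c in auto)
    moreover have "H \<in> ham_nbhd \<Sigma> H c {} [] 1" using H by (simp add: ham_nbhd_def)
    ultimately show "H \<in> topspace (ham_loc_topology \<Sigma>)" using openin_subset by blast
  qed
  then have "openin (subtopology (ham_loc_topology \<Sigma>) (hamiltonians_in \<Sigma> K)) (hamiltonians \<Sigma> \<inter> hamiltonians_in \<Sigma> K)" for K
    unfolding openin_subtopology
    by (intro exI[of _ "topspace (ham_loc_topology \<Sigma>)"]) (auto simp: hamiltonians_in_def)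
  then have "openin (ham_topology \<Sigma>) (hamiltonians \<Sigma>)" unfolding openin_ham_topology by blast
  then show "hamiltonians \<Sigma> \<subseteq> topspace (ham_topology \<Sigma>)" by (rule openin_subset)
qed

text \<open>A set open in \<open>ham_topology\<close> is known to agree with an open set of the
  local topology only among Hamiltonians supported in a fixed compact set. The hypothesis
  \<open>K\<close> places the Hamiltonians of nearby parameters in one such subspace, where
  continuity of the path in the local topology suffices.\<close>

lemma continuous_along_symp_path:
  assumes c: "continuous_map (ham_topology \<Sigma>) euclideanreal c"
    and g: "symp_path g" and H: "H \<in> hamiltonians \<Sigma>"
    and K: "\<And>s0. s0 \<in> {0..1} \<Longrightarrow> \<exists>K \<delta>. compact K \<and> \<delta> > 0 \<and>
       (\<forall>s\<in>{0..1}. dist s s0 < \<delta> \<longrightarrow> ham_support (\<lambda>t x. H t (g s x)) \<subseteq> K)"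
  shows "continuous_on {0..1} (\<lambda>s. c (\<lambda>t x. H t (g s x)))"
  unfolding continuous_on_iff
proof (intro ballI allI impI)
  let ?\<Phi> = "\<lambda>s t x. H t (g s x)"
  fix s0 \<epsilon> :: real assume s0: "s0 \<in> {0..1}" and e: "\<epsilon> > 0"
  have Hs: "?\<Phi> s \<in> hamiltonians \<Sigma>" if "s \<in> {0..1}" for s
    by (rule ham_compose_in_hamiltonians(1)[OF symp_path_symp[OF g that] H])
  obtain K \<delta>1 where K1: "compact K" "\<delta>1 > 0" "\<And>s. s \<in> {0..1} \<Longrightarrow> dist s s0 < \<delta>1 \<Longrightarrow> ham_support (?\<Phi> s) \<subseteq> K"
    using K[OF s0] by blast
  define V where "V = {G \<in> hamiltonians \<Sigma>. c G \<in> ball (c (?\<Phi> s0)) \<epsilon>}"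
  have "openin (ham_topology \<Sigma>) V"
    using openin_continuous_map_preimage[OF c, of "ball (c (?\<Phi> s0)) \<epsilon>"] by (simp add: V_def topspace_ham_topology)
  then obtain T where T: "openin (ham_loc_topology \<Sigma>) T" "V \<inter> hamiltonians_in \<Sigma> K = T \<inter> hamiltonians_in \<Sigma> K"
    using K1(1) unfolding openin_ham_topology openin_subtopology by blast
  have in_K: "?\<Phi> s \<in> hamiltonians_in \<Sigma> K" if "s \<in> {0..1}" "dist s s0 < \<delta>1" for s
    using Hs[OF that(1)] K1(3)[OF that] by (simp add: hamiltonians_in_def)
  have "?\<Phi> s0 \<in> V" using Hs[OF s0] e by (simp add: V_def)
  then have T0: "?\<Phi> s0 \<in> T" using in_K[OF s0] K1(2) T(2) by auto
  have "openin (top_of_set {0..1}) {s \<in> {0..1}. ?\<Phi> s \<in> T}"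
    using openin_continuous_map_preimage[OF hamiltonian_path_loc_continuous[OF g H] T(1)] by simp
  then obtain \<delta>2 where d2: "\<delta>2 > 0" "\<And>s. s \<in> {0..1} \<Longrightarrow> dist s s0 < \<delta>2 \<Longrightarrow> ?\<Phi> s \<in> T"
    using s0 T0 unfolding openin_euclidean_subtopology_iff by blast
  show "\<exists>d>0. \<forall>s\<in>{0..1}. dist s s0 < d \<longrightarrow> dist (c (?\<Phi> s)) (c (?\<Phi> s0)) < \<epsilon>"
  proof (intro exI[of _ "min \<delta>1 \<delta>2"] conjI ballI impI)
    fix s assume s: "s \<in> {0..1::real}" "dist s s0 < min \<delta>1 \<delta>2"
    then have "?\<Phi> s \<in> T \<inter> hamiltonians_in \<Sigma> K" using d2(2) in_K by simp
    then have "?\<Phi> s \<in> V" using T(2) by blast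
    then show "dist (c (?\<Phi> s)) (c (?\<Phi> s0)) < \<epsilon>" by (simp add: V_def dist_commute)
  qed (use K1(2) d2(1) in auto)
qed

text \<open>Common compact supports are assumed for every path, because the path from the identity
  to \<open>\<psi>\<close> is chosen only inside the proof. The value of \<open>c\<close> at
  composed Hamiltonians moves continuously within one null set.\<close>

lemma spectral_invariant_symp_invariant:
  assumes c: "continuous_map (ham_topology \<Sigma>) euclideanreal c" "\<And>H. H \<in> hamiltonians \<Sigma> \<Longrightarrow> c H \<in> action_spectrum \<Sigma> H"
    and H: "H \<in> hamiltonians \<Sigma>" and \<psi>: "\<psi> \<in> symp0 \<Sigma>"
    and K: "\<And>g s0. symp_path g \<Longrightarrow> s0 \<in> {0..1} \<Longrightarrow> \<exists>K \<delta>. compact K \<and> \<delta> > 0 \<and>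
       (\<forall>s\<in>{0..1}. dist s s0 < \<delta> \<longrightarrow> ham_support (\<lambda>t x. H t (g s x)) \<subseteq> K)"
  shows "c H = c (\<lambda>t x. H t (\<psi> x))"
proof -
  obtain g where g: "symp_path g" "g 0 = id" "g 1 = \<psi>"
    using \<psi> by (auto simp: symp0_def path_component_of_def symp_path_def)
  let ?f = "\<lambda>s. c (\<lambda>t x. H t (g s x))"
  have "?f 0 = ?f 1"
  proof (rule continuous_in_negligible_constant)
    show "continuous_on {0..1} ?f" by (rule continuous_along_symp_path[OF c(1) g(1) H K[OF g(1)]])
    show "negligible (action_spectrum \<Sigma> H)" by (rule action_spectrum_negligible[OF H])
    show "?f ` {0..1} \<subseteq> action_spectrum \<Sigma> H"
    proof (rule image_subsetI)
      fix s :: real assume s: "s \<in> {0..1}"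
      note gs = symp_path_symp[OF g(1) s]
      show "?f s \<in> action_spectrum \<Sigma> H"
        using c(2)[OF ham_compose_in_hamiltonians(1)[OF gs H]] action_spectrum_compose[OF gs H] by blast
    qed
  qed
  then show ?thesis by (simp add: g(2,3))
qed

end

section \<open>Supports along a path on the plane\<close>

lemma plane_coord_inv: "coord_inv (UNIV, id) = (id :: real^2 \<Rightarrow> real^2)"
  by (auto simp: coord_inv_def fun_eq_iff)

lemma symplectic_surface_plane: "symplectic_surface plane"
proof -
  have lr: "local_rep (UNIV, id) (UNIV, id) id = (\<lambda>x::real^2. x)"
    by (auto simp: local_rep_def plane_coord_inv)
  have "smooth_on (UNIV :: (real^2) set) (density plane (UNIV, id) \<circ> coord_inv (UNIV, id))"
    using smooth_on_const[of UNIV "1::real"] by (simp add: plane_def o_def)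
  moreover have "smooth_self_map plane id"
    using smooth_on_linear[OF bounded_linear_ident] by (simp add: smooth_self_map_def plane_def lr)
  moreover have "preserves_area_form plane id"
    by (simp add: preserves_area_form_def plane_def lr area_form_def)
  ultimately show ?thesis
    by (simp add: symplectic_surface_def is_chart_def plane_coord_inv homeomorphism_def plane_def)
qed

interpretation plane: area_surface plane
  by unfold_locales (rule symplectic_surface_plane)

text \<open>On a large sphere \<open>S\<close> around the origin a nearby map \<open>\<phi>\<close> still avoids a disk \<open>B\<close> containing the support of
  \<open>H\<close>. Since \<open>\<phi>\<^sup>-\<^sup>1(B)\<close> is connected, disjoint from \<open>S\<close>, and meets its inside, it stays inside.\<close>

lemma plane_common_support:
  assumes H: "H \<in> hamiltonians plane" and g: "plane.symp_path g" and s0: "s0 \<in> {0..1}"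
  shows "\<exists>K \<delta>. compact K \<and> \<delta> > 0 \<and> (\<forall>s\<in>{0..1}. dist s s0 < \<delta> \<longrightarrow> ham_support (\<lambda>t x. H t (g s x)) \<subseteq> K)"
proof -
  have sy: "bij (g s)" "continuous_on UNIV (g s)" "continuous_on UNIV (inv (g s))" if "s \<in> {0..1}" for s
    using plane.symp_path_symp[OF g that] by (auto simp: symp_def smooth_self_map_def)
  have "bounded (ham_support H)" using H by (auto simp: hamiltonians_def compact_imp_bounded)
  then obtain \<rho> where \<rho>: "\<rho> > 0" "ham_support H \<subseteq> cball 0 \<rho>"
    using bounded_subset_ballD[of "ham_support H" 0] ball_subset_cball by blast
  let ?B = "cball (0::real^2) \<rho>"
  \<comment> \<open>A reference point inside the large sphere. It is sent to the centre of
    \<open>?B\<close> by \<open>g s0\<close>, hence into \<open>?B\<close> by nearby maps, and so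
    lies in the preimage of \<open>?B\<close> under each of them.\<close>
  define x0 where "x0 = inv (g s0) 0"
  have gx0: "g s0 x0 = 0" unfolding x0_def by (rule surj_f_inv_f[OF bij_is_surj[OF sy(1)[OF s0]]])
  have "compact (inv (g s0) ` ?B)"
    by (rule compact_continuous_image[OF continuous_on_subset[OF sy(3)[OF s0]] compact_cball]) simp
  then obtain R where R: "R > 0" "inv (g s0) ` ?B \<subseteq> ball 0 R"
    by (metis bounded_subset_ballD compact_imp_bounded)
  have x0R: "x0 \<in> ball 0 R" unfolding x0_def by (rule subsetD[OF R(2) imageI]) (use \<rho>(1) in simp)
  have dis: "g s0 ` sphere 0 R \<inter> ?B = {}"
  proof (rule ccontr)
    assume "\<not> ?thesis"
    then obtain y where y: "y \<in> sphere 0 R" "g s0 y \<in> ?B" by blast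
    then have "inv (g s0) (g s0 y) \<in> ball 0 R" using R(2) by blast
    then show False using y(1) inv_f_f[OF bij_is_inj[OF sy(1)[OF s0]]] by simp
  qed
  have "compact (g s0 ` sphere 0 R)"
    by (rule compact_continuous_image[OF continuous_on_subset[OF sy(2)[OF s0]] compact_sphere]) simp
  then obtain \<epsilon> where \<epsilon>: "\<epsilon> > 0" "\<And>y z. y \<in> g s0 ` sphere 0 R \<Longrightarrow> z \<in> ?B \<Longrightarrow> \<epsilon> \<le> dist y z"
    using separate_compact_closed[OF _ closed_cball dis] by blast
  let ?c = "(UNIV, id) :: (real^2) chart"
  have c: "?c \<in> atlas plane" by (simp add: plane_def)
  have lr: "local_rep ?c ?c f = f" for f by (simp add: local_rep_def plane_coord_inv)
  \<comment> \<open>Closeness below \<open>\<epsilon>\<close> keeps the image of the sphere off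
    \<open>?B\<close>, and closeness below \<open>\<rho>\<close> keeps the image of
    \<open>x0\<close> in \<open>?B\<close>.\<close>
  have "\<exists>\<delta>>0. \<forall>s'\<in>{0..1}. dist s' s0 < \<delta> \<longrightarrow> g s' \<in> symp_nbhd plane (g s0) ?c ?c (cball 0 R) [] (min \<epsilon> \<rho>)"
    by (rule plane.symp_path_near[OF g s0 c c]) (use \<epsilon>(1) \<rho>(1) in auto)
  then obtain \<delta> where \<delta>: "\<delta> > 0"
    "\<And>s'. s' \<in> {0..1} \<Longrightarrow> dist s' s0 < \<delta> \<Longrightarrow> g s' \<in> symp_nbhd plane (g s0) ?c ?c (cball 0 R) [] (min \<epsilon> \<rho>)" by blast
  show ?thesis
  proof (intro exI[of _ "cball 0 R"] exI[of _ \<delta>] conjI ballI impI)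
    fix s assume s: "s \<in> {0..1::real}" "dist s s0 < \<delta>"
    have near: "norm (g s y - g s0 y) < min \<epsilon> \<rho>" if "y \<in> cball 0 R" for y
      using \<delta>(2)[OF s] that by (simp add: symp_nbhd_def lr)
    let ?C = "inv (g s) ` ?B"
    have cC: "connected ?C"
      by (rule connected_continuous_image[OF continuous_on_subset[OF sy(3)[OF s(1)]]]) auto
    have inC: "y \<in> ?C" if "g s y \<in> ?B" for y
      using that inv_f_f[OF bij_is_inj[OF sy(1)[OF s(1)]], of y] by (metis imageI)
    have Cin: "g s y \<in> ?B" if "y \<in> ?C" for y
      using that surj_f_inv_f[OF bij_is_surj[OF sy(1)[OF s(1)]]] by auto
    have "x0 \<in> ?C" using near[of x0] x0R gx0 by (intro inC) auto
    moreover have "?C \<inter> sphere 0 R = {}"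
    proof (rule ccontr)
      assume "\<not> ?thesis"
      then obtain y where y: "y \<in> ?C" "y \<in> sphere 0 R" by blast
      then have "\<epsilon> \<le> dist (g s0 y) (g s y)" by (intro \<epsilon>(2) Cin) auto
      moreover have "norm (g s y - g s0 y) < \<epsilon>" using near[of y] y(2) by simp
      ultimately show False by (simp add: dist_norm norm_minus_commute)
    qed
    ultimately have "?C \<subseteq> ball 0 R"
      using connected_Int_frontier[OF cC, of "ball 0 R", unfolded frontier_ball[OF R(1)]] x0R by blast
    then have "inv (g s) ` ham_support H \<subseteq> cball 0 R" using \<rho>(2) ball_subset_cball by blast
    then show "ham_support (\<lambda>t x. H t (g s x)) \<subseteq> cball 0 R"
      using plane.ham_compose_in_hamiltonians(2)[OF plane.symp_path_symp[OF g s(1)] H] by blast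
  qed (use \<delta>(1) in auto)
qed

theorem mainTheorem10:
  shows "(\<forall>c. formal_spectral_invariant plane c \<longrightarrow>
            (\<forall>H\<in>hamiltonians plane. \<forall>\<psi>\<in>symp0 plane. c H = c (\<lambda>t x. H t (\<psi> x)))) \<and>
         (\<forall>(\<Sigma> :: 'a::{t2_space, second_countable_topology} surface) c.
            symplectic_surface \<Sigma> \<and> compact (UNIV :: 'a set) \<and> connected (UNIV :: 'a set) \<and>
            \<not> (UNIV :: 'a set) homeomorphic (sphere 0 1 :: (real^3) set) \<and>
            formal_spectral_invariant \<Sigma> c \<longrightarrow>
            (\<forall>H\<in>hamiltonians \<Sigma>. \<forall>\<psi>\<in>symp0 \<Sigma>. c H = c (\<lambda>t x. H t (\<psi> x))))"
proof (intro conjI allI impI ballI)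
  fix c H \<psi> assume c: "formal_spectral_invariant plane c" and H: "H \<in> hamiltonians plane" and \<psi>: "\<psi> \<in> symp0 plane"
  show "c H = c (\<lambda>t x. H t (\<psi> x))"
    by (rule plane.spectral_invariant_symp_invariant[OF _ _ H \<psi> plane_common_support[OF H]])
      (use c in \<open>auto simp: formal_spectral_invariant_def\<close>)
next
  fix \<Sigma> :: "'a surface" and c H \<psi>
  assume S: "symplectic_surface \<Sigma> \<and> compact (UNIV :: 'a set) \<and> connected (UNIV :: 'a set) \<and>
      \<not> (UNIV :: 'a set) homeomorphic (sphere 0 1 :: (real^3) set) \<and> formal_spectral_invariant \<Sigma> c"
    and H: "H \<in> hamiltonians \<Sigma>" and \<psi>: "\<psi> \<in> symp0 \<Sigma>"
  interpret area_surface \<Sigma> using S by unfold_locales simp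
  show "c H = c (\<lambda>t x. H t (\<psi> x))"
  proof (rule spectral_invariant_symp_invariant[OF _ _ H \<psi>])
    show "continuous_map (ham_topology \<Sigma>) euclideanreal c" using S by (simp add: formal_spectral_invariant_def)
    show "c H \<in> action_spectrum \<Sigma> H" if "H \<in> hamiltonians \<Sigma>" for H
      using S that by (simp add: formal_spectral_invariant_def)
    show "\<exists>K \<delta>. compact K \<and> \<delta> > 0 \<and> (\<forall>s\<in>{0..1}. dist s s0 < \<delta> \<longrightarrow> ham_support (\<lambda>t x. H t (g s x)) \<subseteq> K)"
      for g :: "real \<Rightarrow> 'a \<Rightarrow> 'a" and s0 :: real
      \<comment> \<open>On a closed surface the whole space is the common compact set.\<close>
      using S by (intro exI[of _ UNIV] exI[of _ 1]) simp
  qed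
qed

end
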